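(* Let $\Lambda$ be a positive definite rational lattice. A necessary condition for $\Lambda$ to have a norm-doubling map is that $\dim\Lambda$ is even and every prime $p\equiv\pm3\pmod 8$ appears to an even power in $\det\Lambda$ (i.e. the $p$-adic valuation of $\det\Lambda$ is even). If moreover $\Lambda$ is unigeneric and $(r)$-maximal for some rational $r>0$, then this condition is also sufficient.
   Context: A rational lattice is one with $u\cdot v\in\mathbb{Q}$ for all $u,v\in\Lambda$; $\det\Lambda$ is the determinant of its Gram matrix. A norm-doubling map for $\Lambda$ is a linear map $\sigma$ with $\sigma u\cdot\sigma v=2\,u\cdot v$ for all $u,v$ and $\sigma(\Lambda)\subseteq\Lambda$. A lattice $\Lambda$ is $(r)$-maximal if it is maximal (among lattices in $\mathbb{Q}\Lambda$) with respect to the property that $u\cdot u\in r\mathbb{Z}$ for all $u\in\Lambda$. A lattice is unigeneric if it is the only isometry class in its genus. *)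

theory Defs
  imports
    "HOL-Analysis.Euclidean_Space"
    "HOL-Algebra.QuotRing"
    "HOL-Number_Theory.Cong"
    "Jordan_Normal_Form.Determinant"
begin

section \<open>Rational lattices in Euclidean space\<close>

text \<open>A lattice need not have full rank in the ambient space, so the zero lattice (with the empty
  basis) is included. Positive definiteness comes from the inner product of the ambient space.\<close>

definition lattice_basis :: "'a::euclidean_space list \<Rightarrow> 'a set \<Rightarrow> bool" where
  "lattice_basis bs L \<longleftrightarrow>
     distinct bs \<and> independent (set bs) \<and>
     L = {\<Sum>i<length bs. real_of_int (c i) *\<^sub>R bs ! i | c :: nat \<Rightarrow> int. True}"

definition euclidean_lattice :: "'a::euclidean_space set \<Rightarrow> bool" where
  "euclidean_lattice L \<longleftrightarrow> (\<exists>bs. lattice_basis bs L)"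

definition rational_lattice :: "'a::euclidean_space set \<Rightarrow> bool" where
  "rational_lattice L \<longleftrightarrow> euclidean_lattice L \<and> (\<forall>u\<in>L. \<forall>v\<in>L. inner u v \<in> \<rat>)"

text \<open>The Gram matrix is taken with entries in \<^typ>\<open>rat\<close>, because the entries have to be mapped into
  the p-adic numbers. It is meaningful only if all inner products of basis vectors are rational.\<close>

definition gram :: "'a::euclidean_space list \<Rightarrow> rat mat" where
  "gram bs = mat (length bs) (length bs)
     (\<lambda>(i, j). the_inv (of_rat :: rat \<Rightarrow> real) (inner (bs ! i) (bs ! j)))"

text \<open>The value does not depend on the basis that is chosen.\<close>

definition lattice_det :: "'a::euclidean_space set \<Rightarrow> rat" where
  "lattice_det L = Determinant.det (gram (SOME bs. lattice_basis bs L))"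

definition rat_val :: "nat \<Rightarrow> rat \<Rightarrow> int" where
  "rat_val p q = int (multiplicity (int p) (fst (quotient_of q)))
               - int (multiplicity (int p) (snd (quotient_of q)))"

text \<open>Only the restriction of the map to the span of the lattice matters.\<close>

definition norm_doubling_map :: "('a::euclidean_space \<Rightarrow> 'a) \<Rightarrow> 'a set \<Rightarrow> bool" where
  "norm_doubling_map \<sigma> L \<longleftrightarrow>
     linear \<sigma> \<and> (\<forall>u\<in>span L. \<forall>v\<in>span L. inner (\<sigma> u) (\<sigma> v) = 2 * inner u v) \<and> \<sigma> ` L \<subseteq> L"

definition isometric_lattices :: "'a::euclidean_space set \<Rightarrow> 'a set \<Rightarrow> bool" where
  "isometric_lattices L M \<longleftrightarrow>
     (\<exists>f. linear f \<and> (\<forall>u\<in>span L. \<forall>v\<in>span L. inner (f u) (f v) = inner u v) \<and> f ` L = M)"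

definition norms_in :: "rat \<Rightarrow> 'a::euclidean_space set \<Rightarrow> bool" where
  "norms_in r L \<longleftrightarrow> (\<forall>u\<in>L. \<exists>k::int. inner u u = real_of_rat r * real_of_int k)"

definition rat_space :: "'a::euclidean_space set \<Rightarrow> 'a set" where
  "rat_space L = {q *\<^sub>R x | q x. q \<in> \<rat> \<and> x \<in> L}"

definition r_maximal :: "rat \<Rightarrow> 'a::euclidean_space set \<Rightarrow> bool" where
  "r_maximal r L \<longleftrightarrow> euclidean_lattice L \<and> norms_in r L \<and>
     (\<forall>M. euclidean_lattice M \<and> M \<subseteq> rat_space L \<and> norms_in r M \<and> L \<subseteq> M \<longrightarrow> M = L)"


section \<open>The p-adic numbers\<close>

text \<open>The field of p-adic numbers is the completion of the rationals: the ring of p-adic Cauchy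
  sequences modulo the ideal of p-adic null sequences. The p-adic integers are its closed unit
  ball.\<close>

definition padic_norm :: "nat \<Rightarrow> rat \<Rightarrow> real" where
  "padic_norm p q = (if q = 0 then 0 else real p powi (- rat_val p q))"

definition padic_cauchy :: "nat \<Rightarrow> (nat \<Rightarrow> rat) set" where
  "padic_cauchy p = {x. \<forall>e>0. \<exists>N. \<forall>m\<ge>N. \<forall>n\<ge>N. padic_norm p (x m - x n) < e}"

definition padic_null :: "nat \<Rightarrow> (nat \<Rightarrow> rat) set" where
  "padic_null p = {x. (\<lambda>n. padic_norm p (x n)) \<longlonglongrightarrow> 0}"

definition padic_cauchy_ring :: "nat \<Rightarrow> (nat \<Rightarrow> rat) ring" where
  "padic_cauchy_ring p =
     \<lparr>carrier = padic_cauchy p, monoid.mult = (\<lambda>x y n. x n * y n), one = (\<lambda>_. 1),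
      zero = (\<lambda>_. 0), add = (\<lambda>x y n. x n + y n)\<rparr>"

definition Qp :: "nat \<Rightarrow> (nat \<Rightarrow> rat) set ring" where
  "Qp p = padic_cauchy_ring p Quot padic_null p"

definition Qp_of_rat :: "nat \<Rightarrow> rat \<Rightarrow> (nat \<Rightarrow> rat) set" where
  "Qp_of_rat p q = padic_null p +>\<^bsub>padic_cauchy_ring p\<^esub> (\<lambda>_. q)"

definition Zp :: "nat \<Rightarrow> (nat \<Rightarrow> rat) set set" where
  "Zp p = {X \<in> carrier (Qp p). \<exists>x\<in>X. \<forall>n. padic_norm p (x n) \<le> 1}"


section \<open>Genus\<close>

text \<open>Matrices over a ring record are represented by functions on indices below the dimension,
  since multiplication of \<^typ>\<open>'a mat\<close> needs a type class.\<close>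

definition rmat_mult ::
  "('b, 'c) ring_scheme \<Rightarrow> nat \<Rightarrow> (nat \<Rightarrow> nat \<Rightarrow> 'b) \<Rightarrow> (nat \<Rightarrow> nat \<Rightarrow> 'b) \<Rightarrow> nat \<Rightarrow> nat \<Rightarrow> 'b" where
  "rmat_mult R n A B = (\<lambda>i j. \<Oplus>\<^bsub>R\<^esub>k\<in>{..<n}. A i k \<otimes>\<^bsub>R\<^esub> B k j)"

definition rmat_one :: "('b, 'c) ring_scheme \<Rightarrow> nat \<Rightarrow> nat \<Rightarrow> 'b" where
  "rmat_one R = (\<lambda>i j. if i = j then \<one>\<^bsub>R\<^esub> else \<zero>\<^bsub>R\<^esub>)"

definition rmat_eq :: "nat \<Rightarrow> (nat \<Rightarrow> nat \<Rightarrow> 'b) \<Rightarrow> (nat \<Rightarrow> nat \<Rightarrow> 'b) \<Rightarrow> bool" where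
  "rmat_eq n A B \<longleftrightarrow> (\<forall>i<n. \<forall>j<n. A i j = B i j)"

definition Zp_GL :: "nat \<Rightarrow> nat \<Rightarrow> (nat \<Rightarrow> nat \<Rightarrow> (nat \<Rightarrow> rat) set) set" where
  "Zp_GL p n = {U. (\<forall>i<n. \<forall>j<n. U i j \<in> Zp p) \<and>
     (\<exists>V. (\<forall>i<n. \<forall>j<n. V i j \<in> Zp p) \<and>
          rmat_eq n (rmat_mult (Qp p) n U V) (rmat_one (Qp p)) \<and>
          rmat_eq n (rmat_mult (Qp p) n V U) (rmat_one (Qp p)))}"

text \<open>Isometry of the lattices with Gram matrices A and B after extension of scalars to the p-adic
  integers: B is the transpose of U times A times U, for some invertible U.\<close>

definition Zp_equivalent :: "nat \<Rightarrow> nat \<Rightarrow> rat mat \<Rightarrow> rat mat \<Rightarrow> bool" where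
  "Zp_equivalent p n A B \<longleftrightarrow>
     (\<exists>U \<in> Zp_GL p n.
        rmat_eq n
          (rmat_mult (Qp p) n (\<lambda>i j. U j i)
             (rmat_mult (Qp p) n (\<lambda>i j. Qp_of_rat p (A $$ (i, j))) U))
          (\<lambda>i j. Qp_of_rat p (B $$ (i, j))))"

text \<open>The spans are the extensions of scalars to the reals, so the last condition is the one at the
  infinite place.\<close>

definition same_genus :: "'a::euclidean_space set \<Rightarrow> 'a set \<Rightarrow> bool" where
  "same_genus L M \<longleftrightarrow>
     (\<exists>bs cs. lattice_basis bs L \<and> lattice_basis cs M \<and> length bs = length cs \<and>
        (\<forall>p. prime p \<longrightarrow> Zp_equivalent p (length bs) (gram bs) (gram cs))) \<and>
     (\<exists>f. linear f \<and> (\<forall>u\<in>span L. \<forall>v\<in>span L. inner (f u) (f v) = inner u v) \<and>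
          f ` span L = span M)"

text \<open>Lattices in the genus have the same dimension as the given lattice and are positive definite,
  so each of them is isometric to one in the given ambient space.\<close>

definition unigeneric :: "'a::euclidean_space set \<Rightarrow> bool" where
  "unigeneric L \<longleftrightarrow> (\<forall>M. rational_lattice M \<and> same_genus L M \<longrightarrow> isometric_lattices L M)"

end

theory Submission
  imports Defs "HOL-Number_Theory.Number_Theory"
begin

text \<open>Write H for the Gram matrix scaled by 2 / r, an even integral form.

  Necessity. Let S be the rational matrix of a norm-doubling map, x a vector of norm a, and c the inner
  product of x with y = S x. The plane of x and y has determinant \<open>2 * a\<^sup>2 - c\<^sup>2\<close>, whose valuation is even
  at every prime at which 2 is not a square. Composing S with the reflection that carries S y to 2 x
  gives a similarity of the same multiplier that preserves the plane, hence also its orthogonal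
  complement, and one concludes by induction on the dimension.

  Sufficiency. At every prime p the condition on the determinant, together with the fact that maximality
  makes the discriminant form anisotropic, yields p-integral matrices S for which the transformed form
  is as close to 2 H as desired: at primes at which 2 is a square take a scalar, at the others pair up
  diagonal entries, and at 2 split off binary blocks. The determinant of the matrix at 2 is a unit times
  a power of 2, so that matrix is the product of a unimodular matrix over the localization at 2 and an
  integer matrix C. The lattice with basis matrix C\<open>\<^sup>-\<^sup>1\<close>, scaled by the square root of 2,
  contains the multiple of L by that root. It lies in the genus of L, because approximate isometries can be
  corrected by a square root of a matrix near 1. As L is the only class in its genus, an
  isometry carries this lattice back to L, and its composition with the scaling doubles the norms.\<close>

section \<open>The localization of the integers at a prime\<close>

text \<open>A similarity over the p-adic integers seldom has rational entries, while the new lattice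
  needs a rational Gram matrix. So all local work is done with rational matrices modulo high powers
  of p, where \<open>Zid p N\<close> is the N-th power of the maximal ideal of the localization;
  completions appear only when the genus is checked. Three obstacles shape the rest. The hypothesis
  is silent about the prime 2: there it follows from the other primes, because 2, -1, squares and
  primes congruent to 1 or -1 modulo 8 are, up to sign, norms from the 2-adic numbers with the
  square root of 2 adjoined, and -1 is a norm too. One lattice has to serve all primes at once:
  hence C is integral with determinant exactly a power of 2, so that it is unimodular at every odd
  prime. Finally, closeness to 2 H must survive the inversion of H and of C, so the precision is
  fixed beforehand from the valuations of their determinants. The remaining error is written as 1 +
  4 W, since for W divisible by p this has a square root over the p-adic integers uniformly in p,
  the prime 2 included.\<close>

definition Zid :: "nat \<Rightarrow> nat \<Rightarrow> rat set" where
  "Zid p N = {x. \<exists>a b::int. \<not> int p dvd b \<and> x * of_int b = of_int (int p ^ N * a)}"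

lemma ZidI: "\<not> int p dvd b \<Longrightarrow> x * of_int b = of_int (int p ^ N * a) \<Longrightarrow> x \<in> Zid p N"
  unfolding Zid_def by blast

lemma ZidE:
  assumes "x \<in> Zid p N"
  obtains a b :: int where "\<not> int p dvd b" "b \<noteq> 0" "x * of_int b = of_int (int p ^ N * a)"
  using assms unfolding Zid_def by fastforce

lemma Zid_mult:
  assumes "prime p" "x \<in> Zid p M" "y \<in> Zid p N"
  shows "x * y \<in> Zid p (M + N)"
proof -
  obtain a b where 1: "\<not> int p dvd b" "x * of_int b = of_int (int p ^ M * a)"
    using ZidE[OF assms(2)] by blast
  obtain c d where 2: "\<not> int p dvd d" "y * of_int d = of_int (int p ^ N * c)"
    using ZidE[OF assms(3)] by blast
  show ?thesis
  proof (rule ZidI)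
    show "\<not> int p dvd b * d"
      using 1 2 assms(1) by (simp add: prime_dvd_mult_iff)
    have "x * y * of_int (b * d) = (x * of_int b) * (y * of_int d)" by simp
    also have "\<dots> = of_int (int p ^ (M + N) * (a * c))"
      unfolding 1 2 by (simp add: power_add)
    finally show "x * y * of_int (b * d) = of_int (int p ^ (M + N) * (a * c))" .
  qed
qed

lemma Zid_add:
  assumes "prime p" "x \<in> Zid p N" "y \<in> Zid p N"
  shows "x + y \<in> Zid p N"
proof -
  obtain a b where 1: "\<not> int p dvd b" "x * of_int b = of_int (int p ^ N * a)"
    using ZidE[OF assms(2)] by blast
  obtain c d where 2: "\<not> int p dvd d" "y * of_int d = of_int (int p ^ N * c)"
    using ZidE[OF assms(3)] by blast
  show ?thesis
  proof (rule ZidI)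
    show "\<not> int p dvd b * d"
      using 1 2 assms(1) by (simp add: prime_dvd_mult_iff)
    have "(x + y) * of_int (b * d) = (x * of_int b) * of_int d + (y * of_int d) * of_int b"
      by (simp add: algebra_simps)
    also have "\<dots> = of_int (int p ^ N * (a * d + c * b))"
      unfolding 1 2 by (simp add: algebra_simps)
    finally show "(x + y) * of_int (b * d) = of_int (int p ^ N * (a * d + c * b))" .
  qed
qed

lemma Zid_of_int_iff:
  assumes "prime p"
  shows "of_int k \<in> Zid p N \<longleftrightarrow> int p ^ N dvd k"
proof
  assume "of_int k \<in> Zid p N"
  then obtain a b where 1: "\<not> int p dvd b" "(of_int k :: rat) * of_int b = of_int (int p ^ N * a)"
    using ZidE by blast
  then have "k * b = int p ^ N * a" by (metis of_int_eq_iff of_int_mult)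
  moreover have "coprime (int p ^ N) b"
    using 1 assms by (simp add: prime_imp_coprime coprime_power_left_iff)
  ultimately show "int p ^ N dvd k"
    by (metis coprime_dvd_mult_left_iff dvd_triv_left)
next
  assume "int p ^ N dvd k"
  then obtain a where "k = int p ^ N * a" by blast
  then show "of_int k \<in> Zid p N"
    using assms by (intro ZidI[of p 1 _ N a]) (auto simp: prime_nat_iff)
qed

lemma Zid_of_nat_iff: "prime p \<Longrightarrow> of_nat k \<in> Zid p N \<longleftrightarrow> p ^ N dvd k"
  using Zid_of_int_iff[of p "int k" N] by (simp flip: of_nat_power)

lemma Zid_numeral_iff: "prime p \<Longrightarrow> numeral k \<in> Zid p N \<longleftrightarrow> p ^ N dvd numeral k"
  using Zid_of_nat_iff[of p "numeral k" N] by simp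

lemma Zid_zero [simp]: "prime p \<Longrightarrow> 0 \<in> Zid p N"
  using Zid_of_int_iff[of p 0 N] by simp

lemma Zid_one_iff [simp]: "prime p \<Longrightarrow> 1 \<in> Zid p N \<longleftrightarrow> N = 0"
  using Zid_of_nat_iff[of p 1 N] by (auto simp: prime_nat_iff)

lemma Zid_of_int [simp]: "prime p \<Longrightarrow> of_int k \<in> Zid p 0"
  by (simp add: Zid_of_int_iff)

lemma Zid_of_nat [simp]: "prime p \<Longrightarrow> of_nat k \<in> Zid p 0"
  by (simp add: Zid_of_nat_iff)

lemma Zid_numeral [simp]: "prime p \<Longrightarrow> numeral k \<in> Zid p 0"
  by (simp add: Zid_numeral_iff)

lemma Zid_power_self [simp]: "prime p \<Longrightarrow> of_nat p ^ N \<in> Zid p N"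
  using Zid_of_nat_iff[of p "p ^ N" N] by simp

lemma Zid_mult_0: "prime p \<Longrightarrow> x \<in> Zid p 0 \<Longrightarrow> y \<in> Zid p N \<Longrightarrow> x * y \<in> Zid p N"
  using Zid_mult[of p x 0 y N] by simp

lemma Zid_mult_0': "prime p \<Longrightarrow> x \<in> Zid p N \<Longrightarrow> y \<in> Zid p 0 \<Longrightarrow> x * y \<in> Zid p N"
  using Zid_mult[of p x N y 0] by simp

lemma Zid_uminus: "prime p \<Longrightarrow> x \<in> Zid p N \<Longrightarrow> - x \<in> Zid p N"
  using Zid_mult_0[of p "-1" x N] Zid_of_int[of p "-1"] by simp

lemma Zid_uminus_iff: "prime p \<Longrightarrow> - x \<in> Zid p N \<longleftrightarrow> x \<in> Zid p N"
  using Zid_uminus[of p x N] Zid_uminus[of p "-x" N] by auto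

lemma Zid_diff: "prime p \<Longrightarrow> x \<in> Zid p N \<Longrightarrow> y \<in> Zid p N \<Longrightarrow> x - y \<in> Zid p N"
  using Zid_add[of p x N "-y"] Zid_uminus[of p y N] by simp

lemma Zid_sum: "prime p \<Longrightarrow> (\<And>i. i \<in> A \<Longrightarrow> f i \<in> Zid p N) \<Longrightarrow> sum f A \<in> Zid p N"
  by (induction A rule: infinite_finite_induct) (auto intro: Zid_add)

lemma Zid_prod: "prime p \<Longrightarrow> (\<And>i. i \<in> A \<Longrightarrow> f i \<in> Zid p 0) \<Longrightarrow> prod f A \<in> Zid p 0"
  by (induction A rule: infinite_finite_induct) (auto intro: Zid_mult_0)

lemma Zid_power: "prime p \<Longrightarrow> x \<in> Zid p 0 \<Longrightarrow> x ^ k \<in> Zid p 0"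
  by (induction k) (auto intro: Zid_mult_0)

lemma Zid_mono:
  assumes "prime p" "M \<le> N" "x \<in> Zid p N"
  shows "x \<in> Zid p M"
proof -
  obtain a b where 1: "\<not> int p dvd b" "x * of_int b = of_int (int p ^ N * a)"
    using ZidE[OF assms(3)] by blast
  show ?thesis
    using 1 assms(2) by (intro ZidI[of p b _ M "int p ^ (N - M) * a"])
      (auto simp flip: mult.assoc power_add of_int_power)
qed

lemma Zid_shift_iff:
  assumes "prime p"
  shows "of_nat p ^ K * x \<in> Zid p (K + N) \<longleftrightarrow> x \<in> Zid p N"
proof
  assume "of_nat p ^ K * x \<in> Zid p (K + N)"
  then obtain a b where 1: "\<not> int p dvd b" "of_nat p ^ K * x * of_int b = of_int (int p ^ (K + N) * a)"
    using ZidE by blast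
  have "(of_nat p ^ K :: rat) \<noteq> 0" using assms by auto
  moreover have "of_nat p ^ K * (x * of_int b) = (of_nat p ^ K :: rat) * of_int (int p ^ N * a)"
    using 1(2) by (simp only: power_add of_int_mult of_int_power of_int_of_nat_eq mult.assoc)
  ultimately have "x * of_int b = of_int (int p ^ N * a)" by (rule mult_left_cancel[THEN iffD1])
  with 1(1) show "x \<in> Zid p N" by (rule ZidI)
next
  assume "x \<in> Zid p N"
  with Zid_mult[OF assms Zid_power_self[OF assms]] show "of_nat p ^ K * x \<in> Zid p (K + N)" by blast
qed

lemma Zid_shift1_iff: "prime p \<Longrightarrow> of_nat p * x \<in> Zid p (Suc N) \<longleftrightarrow> x \<in> Zid p N"
  using Zid_shift_iff[of p 1 x N] by simp

lemma Zid_inverse: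
  assumes "prime p" "x \<in> Zid p 0" "x \<notin> Zid p 1"
  shows "inverse x \<in> Zid p 0"
proof -
  obtain a b where 1: "\<not> int p dvd b" "b \<noteq> 0" "x * of_int b = of_int (int p ^ 0 * a)"
    using ZidE[OF assms(2)] by blast
  have "\<not> int p dvd a"
  proof
    assume "int p dvd a"
    then obtain c where "a = int p * c" by blast
    then have "x \<in> Zid p 1" using 1 by (intro ZidI[of p b _ 1 c]) auto
    then show False using assms(3) by blast
  qed
  moreover have "x \<noteq> 0" using assms by auto
  then have "inverse x * of_int a = of_int (int p ^ 0 * b)"
    using 1 by (auto simp: field_simps)
  ultimately show ?thesis by (rule ZidI)
qed

section \<open>Units of the localization\<close>

definition Zunit :: "nat \<Rightarrow> rat set" where
  "Zunit p = Zid p 0 - Zid p 1"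

lemma Zunit_nonzero: "prime p \<Longrightarrow> x \<in> Zunit p \<Longrightarrow> x \<noteq> 0"
  by (auto simp: Zunit_def)

lemma Zunit_Zid: "x \<in> Zunit p \<Longrightarrow> x \<in> Zid p 0"
  by (auto simp: Zunit_def)

lemma Zunit_inverse_Zid: "prime p \<Longrightarrow> x \<in> Zunit p \<Longrightarrow> inverse x \<in> Zid p 0"
  by (auto simp: Zunit_def intro: Zid_inverse)

lemma ZunitI:
  assumes "prime p" "x \<in> Zid p 0" "y \<in> Zid p 0" "x * y = 1"
  shows "x \<in> Zunit p"
proof -
  have "x \<notin> Zid p 1"
  proof
    assume "x \<in> Zid p 1"
    then have "1 \<in> Zid p 1" using Zid_mult_0'[OF assms(1) _ assms(3), of x 1] assms(4) by simp
    then show False using assms(1) by simp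
  qed
  then show ?thesis using assms(2) by (simp add: Zunit_def)
qed

lemma Zunit_mult:
  assumes "prime p" "x \<in> Zunit p" "y \<in> Zunit p"
  shows "x * y \<in> Zunit p"
proof (rule ZunitI[OF assms(1)])
  show "x * y \<in> Zid p 0"
    using Zid_mult_0[OF assms(1)] Zunit_Zid assms by blast
  show "inverse x * inverse y \<in> Zid p 0"
    using Zid_mult_0[OF assms(1)] Zunit_inverse_Zid assms by blast
  show "x * y * (inverse x * inverse y) = 1"
    using Zunit_nonzero[OF assms(1,2)] Zunit_nonzero[OF assms(1,3)] by (simp add: field_simps)
qed

lemma Zunit_inverse:
  assumes "prime p" "x \<in> Zunit p"
  shows "inverse x \<in> Zunit p"
proof (rule ZunitI[OF assms(1)])
  show "inverse x * x = 1" using Zunit_nonzero[OF assms] by simp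
qed (use assms Zunit_Zid Zunit_inverse_Zid in blast)+

lemma Zid_mult_unit_iff:
  assumes "prime p" "u \<in> Zunit p"
  shows "u * x \<in> Zid p N \<longleftrightarrow> x \<in> Zid p N"
proof
  assume "u * x \<in> Zid p N"
  then have "inverse u * (u * x) \<in> Zid p N"
    using Zid_mult_0[OF assms(1) Zunit_inverse_Zid[OF assms]] by blast
  then show "x \<in> Zid p N" using Zunit_nonzero[OF assms] by (simp flip: mult.assoc)
qed (use Zid_mult_0[OF assms(1) Zunit_Zid[OF assms(2)]] in blast)

lemma Zid_divide_unit_iff:
  "prime p \<Longrightarrow> u \<in> Zunit p \<Longrightarrow> x / u \<in> Zid p N \<longleftrightarrow> x \<in> Zid p N"
  using Zid_mult_unit_iff[OF _ Zunit_inverse, of p u x N] by (simp add: field_simps)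

lemma Zunit_mult_iff:
  assumes "prime p" "x \<in> Zid p 0" "y \<in> Zid p 0"
  shows "x * y \<in> Zunit p \<longleftrightarrow> x \<in> Zunit p \<and> y \<in> Zunit p"
proof
  assume "x * y \<in> Zunit p"
  then show "x \<in> Zunit p \<and> y \<in> Zunit p"
    using assms Zid_mult_0[of p x y 1] Zid_mult_0'[of p x 1 y]
    by (auto simp: Zunit_def)
qed (use Zunit_mult assms in auto)

lemma Zunit_of_int_iff: "prime p \<Longrightarrow> of_int k \<in> Zunit p \<longleftrightarrow> \<not> int p dvd k"
  by (simp add: Zunit_def Zid_of_int_iff)

lemma Zunit_one [simp]: "prime p \<Longrightarrow> 1 \<in> Zunit p"
  by (simp add: Zunit_def)

lemma Zunit_cong:
  assumes "prime p" "x - y \<in> Zid p 1"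
  shows "x \<in> Zunit p \<longleftrightarrow> y \<in> Zunit p"
proof -
  have *: "v \<in> Zunit p" if "u \<in> Zunit p" "u - v \<in> Zid p 1" for u v
  proof -
    have "v \<in> Zid p 0"
      using Zid_diff[OF assms(1) Zunit_Zid[OF that(1)] Zid_mono[OF assms(1) _ that(2)]] by simp
    moreover have "v \<notin> Zid p 1"
      using Zid_add[OF assms(1) that(2), of v] that(1) by (auto simp: Zunit_def)
    ultimately show ?thesis by (simp add: Zunit_def)
  qed
  have "y - x \<in> Zid p 1" using Zid_uminus[OF assms] by simp
  then show ?thesis using * assms(2) by blast
qed

text \<open>The localization modulo p^N is Z / p^N: k is the numerator times an inverse of the
  denominator modulo p^N. Rational data can thus be replaced by integers whenever only a congruence
  matters.\<close>

lemma Zid_round: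
  assumes "prime p" "x \<in> Zid p 0"
  obtains k :: int where "x - of_int k \<in> Zid p N"
proof -
  obtain a b where 1: "\<not> int p dvd b" "b \<noteq> 0" "x * of_int b = of_int (int p ^ 0 * a)"
    using ZidE[OF assms(2)] by blast
  have "coprime b (int p ^ N)"
    using 1 assms by (metis coprime_commute coprime_power_right_iff prime_imp_coprime prime_nat_int_transfer)
  then obtain c where "[b * c = 1] (mod int p ^ N)"
    using cong_solve_coprime_int by blast
  then obtain d where d: "b * c - 1 = int p ^ N * d"
    by (metis cong_iff_dvd_diff dvd_def)
  have "(x - of_int (a * c)) * of_int b = of_int a - of_int a * of_int (b * c)"
    using 1 by (simp add: algebra_simps)
  also have "\<dots> = of_int (int p ^ N * (- (a * d)))"
    unfolding d[symmetric, THEN arg_cong[where f = "\<lambda>y. a * y"], unfolded] 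
    using arg_cong[OF d, of "\<lambda>y. (of_int (a * y) :: rat)"] by (simp add: algebra_simps)
  finally show ?thesis using 1 that ZidI by blast
qed

section \<open>Valuations of rational numbers\<close>

lemma rat_val_of_int_div:
  assumes "prime p" "a \<noteq> 0" "b \<noteq> 0"
  shows "rat_val p (of_int a / of_int b) = int (multiplicity (int p) a) - int (multiplicity (int p) b)"
proof -
  define q where "q = (of_int a / of_int b :: rat)"
  define c d where "c = fst (quotient_of q)" and "d = snd (quotient_of q)"
  have cd: "q = of_int c / of_int d" "d > 0"
    by (auto simp: c_def d_def quotient_of_div quotient_of_denom_pos prod_eq_iff)
  have "c \<noteq> 0" using cd assms by (auto simp: q_def)
  have "(of_int (a * d) :: rat) = of_int (c * b)"
    using cd assms by (simp add: q_def field_simps)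
  then have eq: "a * d = c * b" by (simp only: of_int_eq_iff)
  have pr: "prime_elem (int p)" using assms by simp
  have "multiplicity (int p) a + multiplicity (int p) d = multiplicity (int p) c + multiplicity (int p) b"
    using prime_elem_multiplicity_mult_distrib[OF pr, of a d]
      prime_elem_multiplicity_mult_distrib[OF pr, of c b] eq cd assms \<open>c \<noteq> 0\<close> by simp
  then show ?thesis
    unfolding rat_val_def q_def[symmetric] c_def[symmetric] d_def[symmetric] by linarith
qed

lemma rat_obtain_ints:
  fixes x :: rat
  obtains a b :: int where "x = of_int a / of_int b" "b > 0"
  using that[of "fst (quotient_of x)" "snd (quotient_of x)"] quotient_of_div[of x]
    quotient_of_denom_pos[of x] by (cases "quotient_of x") auto

lemma rat_val_mult:
  assumes "prime p" "x \<noteq> 0" "y \<noteq> 0"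
  shows "rat_val p (x * y) = rat_val p x + rat_val p y"
proof -
  obtain a b where x: "x = of_int a / of_int b" "b > 0" using rat_obtain_ints .
  obtain c d where y: "y = of_int c / of_int d" "d > 0" using rat_obtain_ints .
  have nz: "a \<noteq> 0" "c \<noteq> 0" using assms x y by auto
  have pr: "prime_elem (int p)" using assms by simp
  have "x * y = of_int (a * c) / of_int (b * d)" by (simp add: x y)
  then show ?thesis
    using rat_val_of_int_div[OF assms(1), of "a * c" "b * d"] rat_val_of_int_div[OF assms(1), of a b]
      rat_val_of_int_div[OF assms(1), of c d] nz x y
      prime_elem_multiplicity_mult_distrib[OF pr, of a c]
      prime_elem_multiplicity_mult_distrib[OF pr, of b d] by simp
qed

lemma rat_val_power:
  assumes "prime p" "x \<noteq> 0"
  shows "rat_val p (x ^ k) = int k * rat_val p x"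
proof (induction k)
  case 0
  show ?case using rat_val_of_int_div[OF assms(1), of 1 1] by simp
next
  case (Suc k)
  then show ?case using rat_val_mult[OF assms(1), of x "x ^ k"] assms by (simp add: algebra_simps)
qed

lemma rat_val_eq:
  assumes "prime p" "x \<noteq> 0"
  shows "\<exists>u\<in>Zunit p. x = of_nat p powi rat_val p x * u"
proof -
  obtain a b where x: "x = of_int a / of_int b" "b > 0" using rat_obtain_ints .
  have a: "a \<noteq> 0" using assms x by auto
  have nu: "\<not> is_unit (int p)" using assms(1) by (auto simp: prime_nat_iff)
  obtain c where c: "a = int p ^ multiplicity (int p) a * c" "\<not> int p dvd c"
    using multiplicity_decompose'[OF a nu] by blast
  obtain d where d: "b = int p ^ multiplicity (int p) b * d" "\<not> int p dvd d"
    using multiplicity_decompose'[of b "int p"] nu x by auto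
  have p0: "(of_nat p :: rat) \<noteq> 0" using assms(1) by auto
  have v: "rat_val p x = int (multiplicity (int p) a) - int (multiplicity (int p) b)"
    using rat_val_of_int_div[OF assms(1) a, of b] x by simp
  have "x = of_nat p powi rat_val p x * (of_int c * inverse (of_int d))"
    unfolding v using p0
    by (subst x(1), subst c(1), subst d(1)) (simp add: power_int_diff field_simps)
  moreover have "of_int c * inverse (of_int d) \<in> Zunit p"
    using c d assms by (intro Zunit_mult Zunit_inverse) (auto simp: Zunit_of_int_iff)
  ultimately show ?thesis by blast
qed

lemma rat_val_unit:
  assumes "prime p" "u \<in> Zunit p"
  shows "rat_val p u = 0"
proof -
  obtain a b where 1: "\<not> int p dvd b" "b \<noteq> 0" "u * of_int b = of_int (int p ^ 0 * a)"
    using ZidE[OF Zunit_Zid[OF assms(2)]] by blast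
  have u: "u = of_int a / of_int b" using 1 by (simp add: field_simps)
  have "a \<noteq> 0" using u Zunit_nonzero[OF assms] by auto
  have "of_int b * u \<in> Zunit p" using 1 assms by (intro Zunit_mult) (auto simp: Zunit_of_int_iff)
  then have "\<not> int p dvd a" using 1 assms by (simp add: mult.commute Zunit_of_int_iff)
  then show ?thesis
    using rat_val_of_int_div[OF assms(1) \<open>a \<noteq> 0\<close> 1(2)] 1(1) u by (simp add: not_dvd_imp_multiplicity_0)
qed

lemma rat_val_prime_powi:
  assumes "prime p"
  shows "rat_val p (of_nat p powi k) = k"
proof -
  have p0: "(of_nat p :: rat) \<noteq> 0" and nu: "\<not> is_unit (int p)"
    using assms(1) by (auto simp: prime_nat_iff)
  have p: "int p \<noteq> 0" using assms by auto
  show ?thesis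
  proof (cases "k \<ge> 0")
    case True
    then show ?thesis
      using rat_val_of_int_div[OF assms, of "int p ^ nat k" 1] p nu
      by (simp add: power_int_def multiplicity_same_power)
  next
    case False
    then show ?thesis
      using rat_val_of_int_div[OF assms, of 1 "int p ^ nat (- k)"] p nu
      by (simp add: power_int_def field_simps multiplicity_same_power)
  qed
qed

lemma rat_val_powi_unit:
  assumes "prime p" "u \<in> Zunit p"
  shows "rat_val p (of_nat p powi k * u) = k"
  using rat_val_mult[OF assms(1), of "of_nat p powi k" u] rat_val_unit[OF assms]
    rat_val_prime_powi[OF assms(1)] Zunit_nonzero[OF assms] assms(1) by auto

text \<open>The bridge between ideals and valuations. Zero is excluded because
  \<open>rat_val\<close> gives it the value 0 and not infinity.\<close>

lemma Zid_iff_rat_val: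
  assumes "prime p" "x \<noteq> 0"
  shows "x \<in> Zid p N \<longleftrightarrow> int N \<le> rat_val p x"
proof -
  obtain u where u: "u \<in> Zunit p" "x = of_nat p powi rat_val p x * u" using rat_val_eq[OF assms] by blast
  have p0: "(of_nat p :: rat) \<noteq> 0" using assms(1) by auto
  show ?thesis
  proof
    assume "int N \<le> rat_val p x"
    then have "of_nat p powi rat_val p x = (of_nat p :: rat) ^ nat (rat_val p x)" "N \<le> nat (rat_val p x)"
      by (auto simp: power_int_def)
    then show "x \<in> Zid p N"
      using u assms(1) by (metis Zid_mono Zid_mult_0' Zid_power_self Zunit_Zid)
  next
    assume x: "x \<in> Zid p N"
    obtain a b where 1: "\<not> int p dvd b" "b \<noteq> 0" "x * of_int b = of_int (int p ^ N * a)"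
      using ZidE[OF x] by blast
    then have x': "x = of_int (int p ^ N * a) / of_int b" by (simp add: field_simps)
    have "a \<noteq> 0" using x' assms(2) by auto
    then have "rat_val p x = int (multiplicity (int p) (int p ^ N * a))"
      using rat_val_of_int_div[OF assms(1), of "int p ^ N * a" b] 1 assms(1) x'
      by (simp add: not_dvd_imp_multiplicity_0 prime_gt_0_nat)
    moreover have "N \<le> multiplicity (int p) (int p ^ N * a)"
      using \<open>a \<noteq> 0\<close> assms(1) by (intro multiplicity_geI) (auto simp: prime_nat_iff)
    ultimately show "int N \<le> rat_val p x" by simp
  qed
qed

section \<open>Matrices over the localization\<close>

text \<open>Conditions on dimensions, rather than membership in a carrier, make the matrix laws
  usable as conditional rewrite rules: the simplifier computes the dimensions of compound terms,
  whereas the carrier form contains size variables that it would have to guess.\<close>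

lemma mat_assoc:
  fixes A B C :: "'b::semiring_0 mat"
  assumes "dim_col A = dim_row B" "dim_col B = dim_row C"
  shows "A * B * C = A * (B * C)"
  using assms by (intro assoc_mult_mat) auto

lemma mat_transpose_mult:
  fixes A B :: "'b::comm_semiring_0 mat"
  assumes "dim_col A = dim_row B"
  shows "(A * B)\<^sup>T = B\<^sup>T * A\<^sup>T"
  using assms by (intro transpose_mult) auto

lemma mat_diff_distrib:
  fixes A B C :: "'b::ring mat"
  assumes "dim_col A = dim_row B" "dim_row B = dim_row C" "dim_col B = dim_col C"
  shows "A * (B - C) = A * B - A * C"
  using assms by (intro mult_minus_distrib_mat) auto

lemma mat_diff_distrib':
  fixes A B C :: "'b::ring mat"
  assumes "dim_col A = dim_row C" "dim_row A = dim_row B" "dim_col A = dim_col B"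
  shows "(A - B) * C = A * C - B * C"
  using assms by (intro minus_mult_distrib_mat) auto

lemma mat_smult_right:
  fixes A B :: "'b::comm_semiring_0 mat"
  assumes "dim_col A = dim_row B"
  shows "A * (k \<cdot>\<^sub>m B) = k \<cdot>\<^sub>m (A * B)"
  using assms by (intro mult_smult_distrib) auto

lemma mat_smult_left:
  fixes A B :: "'b::comm_semiring_0 mat"
  assumes "dim_col A = dim_row B"
  shows "(k \<cdot>\<^sub>m A) * B = k \<cdot>\<^sub>m (A * B)"
  using assms by (intro mult_smult_assoc_mat) auto

lemma mat_one_left:
  fixes A :: "'b::semiring_1 mat"
  shows "dim_row A = n \<Longrightarrow> 1\<^sub>m n * A = A"
  by (intro left_mult_one_mat) auto

lemma mat_one_right:
  fixes A :: "'b::semiring_1 mat"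
  shows "dim_col A = n \<Longrightarrow> A * 1\<^sub>m n = A"
  by (intro right_mult_one_mat) auto

text \<open>Rewriting with \<open>mat_ring\<close> associates products to the right, so an inverse
  pair shows up as the first two factors of a longer product.\<close>

lemma mat_cancel_left:
  fixes A B C :: "'b::semiring_1 mat"
  assumes "A * B = 1\<^sub>m n" "dim_col A = dim_row B" "dim_col B = dim_row C"
  shows "A * (B * C) = C"
proof -
  have "dim_row A = n" "dim_col B = n"
    using arg_cong[OF assms(1), of dim_row] arg_cong[OF assms(1), of dim_col] by auto
  then show ?thesis using mat_assoc[OF assms(2,3)] assms by (simp add: mat_one_left)
qed

lemmas mat_ring = mat_assoc mat_transpose_mult mat_diff_distrib mat_diff_distrib' mat_smult_right
  mat_smult_left mat_one_left mat_one_right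

definition mid :: "nat \<Rightarrow> nat \<Rightarrow> rat mat \<Rightarrow> bool" where
  "mid p N A \<longleftrightarrow> (\<forall>i<dim_row A. \<forall>j<dim_col A. A $$ (i, j) \<in> Zid p N)"

lemma midD: "mid p N A \<Longrightarrow> i < dim_row A \<Longrightarrow> j < dim_col A \<Longrightarrow> A $$ (i, j) \<in> Zid p N"
  by (simp add: mid_def)

lemma mid_mult:
  assumes "prime p" "dim_col A = dim_row B" "mid p M A" "mid p N B"
  shows "mid p (M + N) (A * B)"
  using assms by (auto simp: mid_def scalar_prod_def intro!: Zid_sum Zid_mult)

lemma mid_mult_0: "prime p \<Longrightarrow> dim_col A = dim_row B \<Longrightarrow> mid p 0 A \<Longrightarrow> mid p N B \<Longrightarrow> mid p N (A * B)"
  using mid_mult[of p A B 0 N] by simp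

lemma mid_mult_0': "prime p \<Longrightarrow> dim_col A = dim_row B \<Longrightarrow> mid p N A \<Longrightarrow> mid p 0 B \<Longrightarrow> mid p N (A * B)"
  using mid_mult[of p A B N 0] by simp

lemma mid_add:
  "prime p \<Longrightarrow> dim_row A = dim_row B \<Longrightarrow> dim_col A = dim_col B \<Longrightarrow> mid p N A \<Longrightarrow> mid p N B \<Longrightarrow> mid p N (A + B)"
  by (simp add: mid_def Zid_add)

lemma mid_diff:
  "prime p \<Longrightarrow> dim_row A = dim_row B \<Longrightarrow> dim_col A = dim_col B \<Longrightarrow> mid p N A \<Longrightarrow> mid p N B \<Longrightarrow> mid p N (A - B)"
  by (simp add: mid_def Zid_diff)

lemma mid_uminus: "prime p \<Longrightarrow> mid p N A \<Longrightarrow> mid p N (- A)"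
  by (simp add: mid_def Zid_uminus)

lemma mid_smult: "prime p \<Longrightarrow> c \<in> Zid p M \<Longrightarrow> mid p N A \<Longrightarrow> mid p (M + N) (c \<cdot>\<^sub>m A)"
  by (simp add: mid_def Zid_mult)

lemma mid_smult_0: "prime p \<Longrightarrow> c \<in> Zid p 0 \<Longrightarrow> mid p N A \<Longrightarrow> mid p N (c \<cdot>\<^sub>m A)"
  using mid_smult[of p c 0 N A] by simp

lemma mid_transpose: "mid p N A \<Longrightarrow> mid p N A\<^sup>T"
  by (simp add: mid_def)

lemma mid_mono: "prime p \<Longrightarrow> M \<le> N \<Longrightarrow> mid p N A \<Longrightarrow> mid p M A"
  by (auto simp: mid_def intro: Zid_mono)

lemma mid_one: "prime p \<Longrightarrow> mid p 0 (1\<^sub>m n)"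
  by (simp add: mid_def)

lemma mid_zero: "prime p \<Longrightarrow> mid p N (0\<^sub>m n m)"
  by (simp add: mid_def)

lemma mid_four_block:
  assumes "A \<in> carrier_mat a c" "B \<in> carrier_mat a d" "C \<in> carrier_mat b c" "D \<in> carrier_mat b d"
  shows "mid p N (four_block_mat A B C D) \<longleftrightarrow> mid p N A \<and> mid p N B \<and> mid p N C \<and> mid p N D"
proof
  let ?F = "four_block_mat A B C D"
  assume *: "mid p N ?F"
  have "A $$ (i, j) \<in> Zid p N" if "i < a" "j < c" for i j
    using midD[OF *, of i j] assms that by simp
  moreover have "B $$ (i, j) \<in> Zid p N" if "i < a" "j < d" for i j
    using midD[OF *, of i "c + j"] assms that by simp
  moreover have "C $$ (i, j) \<in> Zid p N" if "i < b" "j < c" for i j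
    using midD[OF *, of "a + i" j] assms that by simp
  moreover have "D $$ (i, j) \<in> Zid p N" if "i < b" "j < d" for i j
    using midD[OF *, of "a + i" "c + j"] assms that by simp
  ultimately show "mid p N A \<and> mid p N B \<and> mid p N C \<and> mid p N D"
    using assms by (auto simp: mid_def)
qed (use assms in \<open>auto simp: mid_def\<close>)

lemma mid_det:
  assumes "prime p" "A \<in> carrier_mat n n" "mid p 0 A"
  shows "det A \<in> Zid p 0"
proof -
  have "signof q \<in> Zid p 0" for q
    using assms(1) Zid_uminus_iff[of p 1 0] by (cases "evenperm q") (auto simp: sign_def)
  moreover have "(\<Prod>i = 0..<n. A $$ (i, q i)) \<in> Zid p 0" if "q permutes {0..<n}" for q
    using assms permutes_in_image[OF that] by (intro Zid_prod) (auto simp: mid_def)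
  ultimately show ?thesis
    using assms unfolding det_def'[OF assms(2)] by (intro Zid_sum Zid_mult_0) auto
qed

lemma mid_adj:
  assumes "prime p" "A \<in> carrier_mat n n" "mid p 0 A"
  shows "mid p 0 (adj_mat A)"
proof -
  have "cofactor A j i \<in> Zid p 0" if "i < n" "j < n" for i j
  proof -
    have "mid p 0 (mat_delete A j i)"
      using assms that by (auto simp: mid_def mat_delete_def)
    moreover have "mat_delete A j i \<in> carrier_mat (n - 1) (n - 1)"
      using assms by (auto simp: mat_delete_def)
    moreover have "(-1) ^ (j + i) \<in> Zid p 0"
      using assms(1) Zid_uminus_iff[of p 1 0] by (intro Zid_power) auto
    ultimately show ?thesis unfolding cofactor_def
      using assms(1) by (intro Zid_mult_0 mid_det) auto
  qed
  then show ?thesis using assms by (auto simp: mid_def adj_mat_def)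
qed

section \<open>The general linear group over the localization\<close>

definition Zgl :: "nat \<Rightarrow> nat \<Rightarrow> rat mat set" where
  "Zgl p n = {U \<in> carrier_mat n n. mid p 0 U \<and> det U \<in> Zunit p}"

lemma det_inverse_mats:
  fixes A B :: "'b::field mat"
  assumes "A \<in> carrier_mat n n" "B \<in> carrier_mat n n" "A * B = 1\<^sub>m n"
  shows "det A * det B = 1"
  using det_mult[OF assms(1,2)] assms(3) by simp

lemma field_mat_inverse:
  fixes A :: "'b::field mat"
  assumes "A \<in> carrier_mat n n" "det A \<noteq> 0"
  obtains B where "B \<in> carrier_mat n n" "A * B = 1\<^sub>m n" "B * A = 1\<^sub>m n" "B = (1 / det A) \<cdot>\<^sub>m adj_mat A"
proof -
  define B where "B = (1 / det A) \<cdot>\<^sub>m adj_mat A"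
  note adj = adj_mat[OF assms(1)]
  have "B \<in> carrier_mat n n" using adj by (simp add: B_def)
  moreover have "A * B = 1\<^sub>m n" "B * A = 1\<^sub>m n"
    unfolding B_def using adj assms carrier_matD[OF assms(1)] by (auto simp: mat_ring intro!: eq_matI)
  ultimately show thesis using that B_def by blast
qed

lemma ZglI:
  assumes "prime p" "U \<in> carrier_mat n n" "V \<in> carrier_mat n n" "mid p 0 U" "mid p 0 V" "U * V = 1\<^sub>m n"
  shows "U \<in> Zgl p n"
  using assms ZunitI[OF assms(1) mid_det mid_det det_inverse_mats[OF assms(2,3,6)]]
  by (simp add: Zgl_def)

lemma Zgl_carrier: "U \<in> Zgl p n \<Longrightarrow> U \<in> carrier_mat n n"
  by (simp add: Zgl_def)

lemma Zgl_mid: "U \<in> Zgl p n \<Longrightarrow> mid p 0 U"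
  by (simp add: Zgl_def)

lemma Zgl_det: "U \<in> Zgl p n \<Longrightarrow> det U \<in> Zunit p"
  by (simp add: Zgl_def)

lemma Zgl_inverse:
  assumes "prime p" "U \<in> Zgl p n"
  obtains V where "V \<in> Zgl p n" "U * V = 1\<^sub>m n" "V * U = 1\<^sub>m n"
proof -
  have U: "U \<in> carrier_mat n n" "mid p 0 U" "det U \<in> Zunit p" using assms by (auto simp: Zgl_def)
  have "det U \<noteq> 0" using Zunit_nonzero[OF assms(1) U(3)] .
  then obtain V where V: "V \<in> carrier_mat n n" "U * V = 1\<^sub>m n" "V * U = 1\<^sub>m n"
    "V = (1 / det U) \<cdot>\<^sub>m adj_mat U" using field_mat_inverse[OF U(1)] by blast
  have "mid p 0 V" unfolding V(4)
    using Zunit_inverse_Zid[OF assms(1) U(3)]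
    by (intro mid_smult_0 mid_adj[OF _ U(1)] assms U) (simp add: inverse_eq_divide)
  then have "V \<in> Zgl p n" using V U assms by (intro ZglI[OF _ V(1) U(1)]) auto
  then show thesis using that V by blast
qed

lemma Zgl_mult:
  assumes "prime p" "U \<in> Zgl p n" "V \<in> Zgl p n"
  shows "U * V \<in> Zgl p n"
  using assms det_mult[of U n V] by (auto simp: Zgl_def intro!: mid_mult_0 Zunit_mult)

lemma Zgl_transpose:
  assumes "U \<in> Zgl p n"
  shows "U\<^sup>T \<in> Zgl p n"
  using assms det_transpose[of U n] by (auto simp: Zgl_def intro!: mid_transpose)

section \<open>Approximate similarities\<close>

text \<open>The rational shadow of a similarity of multiplier 2 over the p-adic integers. An exact
  equation cannot be asked for: at p = 7 in dimension one it would need a rational square root of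
  2.\<close>

definition approx_doubling :: "nat \<Rightarrow> nat \<Rightarrow> nat \<Rightarrow> rat mat \<Rightarrow> bool" where
  "approx_doubling p N n H \<longleftrightarrow>
     (\<exists>S \<in> carrier_mat n n. mid p 0 S \<and> mid p N (S\<^sup>T * H * S - 2 \<cdot>\<^sub>m H))"

lemma approx_doubling_congruent:
  assumes p: "prime p" and H: "H \<in> carrier_mat n n" and U: "U \<in> Zgl p n"
    and D: "approx_doubling p N n (U\<^sup>T * H * U)"
  shows "approx_doubling p N n H"
proof -
  obtain V where V: "V \<in> Zgl p n" "U * V = 1\<^sub>m n" "V * U = 1\<^sub>m n" using Zgl_inverse[OF p U] .
  obtain S where S: "S \<in> carrier_mat n n" "mid p 0 S"
    "mid p N (S\<^sup>T * (U\<^sup>T * H * U) * S - 2 \<cdot>\<^sub>m (U\<^sup>T * H * U))"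
    using D by (auto simp: approx_doubling_def)
  have [simp]: "dim_row H = n" "dim_col H = n" "dim_row U = n" "dim_col U = n"
    "dim_row V = n" "dim_col V = n" "dim_row S = n" "dim_col S = n"
    using H S Zgl_carrier[OF U] Zgl_carrier[OF V(1)] by auto
  have VU: "V\<^sup>T * U\<^sup>T = 1\<^sub>m n"
    using arg_cong[OF V(2), of transpose_mat] by (simp add: mat_transpose_mult)
  let ?S = "U * (S * V)"
  have "?S\<^sup>T * H * ?S - 2 \<cdot>\<^sub>m H =
      V\<^sup>T * ((S\<^sup>T * (U\<^sup>T * H * U) * S - 2 \<cdot>\<^sub>m (U\<^sup>T * H * U)) * V)"
    using V by (simp add: mat_ring mat_cancel_left[OF VU])
  moreover have "mid p N \<dots>"
    using mid_mult_0[OF p _ mid_transpose[OF Zgl_mid[OF V(1)]] mid_mult_0'[OF p _ S(3) Zgl_mid[OF V(1)]]]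
    by simp
  moreover have "mid p 0 ?S"
    using mid_mult_0[OF p _ Zgl_mid[OF U] mid_mult_0[OF p _ S(2) Zgl_mid[OF V(1)]]] by simp
  moreover have "?S \<in> carrier_mat n n" by auto
  ultimately show ?thesis unfolding approx_doubling_def by metis
qed

abbreviation block_sum :: "'b::zero mat \<Rightarrow> 'b mat \<Rightarrow> 'b mat" where
  "block_sum K W \<equiv> four_block_mat K (0\<^sub>m (dim_row K) (dim_col W)) (0\<^sub>m (dim_row W) (dim_col K)) W"

lemma congruent_block_sum:
  fixes K W A B :: "'b::comm_ring_1 mat"
  assumes K: "K \<in> carrier_mat k k" and W: "W \<in> carrier_mat l l"
    and A: "A \<in> carrier_mat k k" and B: "B \<in> carrier_mat l l"
  shows "(block_sum A B)\<^sup>T * block_sum K W * block_sum A B = block_sum (A\<^sup>T * K * A) (B\<^sup>T * W * B)"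
proof -
  have Z: "0\<^sub>m k l \<in> carrier_mat k l" "0\<^sub>m l k \<in> carrier_mat l k" by auto
  have T: "A\<^sup>T \<in> carrier_mat k k" "B\<^sup>T \<in> carrier_mat l l" using A B by auto
  have [simp]: "dim_row A = k" "dim_col A = k" "dim_row B = l" "dim_col B = l"
    "dim_row K = k" "dim_col K = k" "dim_row W = l" "dim_col W = l" using A B K W by auto
  show ?thesis
    using A B K W T Z
    by (simp add: transpose_four_block_mat[OF A Z B] mult_four_block_mat[OF T(1) Z T(2) K Z W]
        mult_four_block_mat[of _ k k _ l _ l _ _ k _ l])
qed

lemma approx_doubling_block_sum:
  assumes p: "prime p" and K: "K \<in> carrier_mat k k" and W: "W \<in> carrier_mat l l"
    and "approx_doubling p N k K" "approx_doubling p N l W"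
  shows "approx_doubling p N (k + l) (block_sum K W)"
proof -
  obtain S where S: "S \<in> carrier_mat k k" "mid p 0 S" "mid p N (S\<^sup>T * K * S - 2 \<cdot>\<^sub>m K)"
    using assms by (auto simp: approx_doubling_def)
  obtain T where T: "T \<in> carrier_mat l l" "mid p 0 T" "mid p N (T\<^sup>T * W * T - 2 \<cdot>\<^sub>m W)"
    using assms by (auto simp: approx_doubling_def)
  have [simp]: "dim_row S = k" "dim_col S = k" "dim_row T = l" "dim_col T = l"
    "dim_row K = k" "dim_col K = k" "dim_row W = l" "dim_col W = l" using S T K W by auto
  have "(block_sum S T)\<^sup>T * block_sum K W * block_sum S T = block_sum (S\<^sup>T * K * S) (T\<^sup>T * W * T)"
    using congruent_block_sum[OF K W S(1) T(1)] by simp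
  then have "(block_sum S T)\<^sup>T * block_sum K W * block_sum S T - 2 \<cdot>\<^sub>m block_sum K W =
      block_sum (S\<^sup>T * K * S - 2 \<cdot>\<^sub>m K) (T\<^sup>T * W * T - 2 \<cdot>\<^sub>m W)"
    by (intro eq_matI) auto
  moreover have "mid p N \<dots>"
    using S T p by (subst mid_four_block[of _ k k _ l _ l]) (auto simp: mid_zero)
  moreover have "mid p 0 (block_sum S T)"
    using S T p by (subst mid_four_block[of _ k k _ l _ l]) (auto simp: mid_zero)
  moreover have "block_sum S T \<in> carrier_mat (k + l) (k + l)" by auto
  ultimately show ?thesis unfolding approx_doubling_def by metis
qed

text \<open>E is the inclusion of the second summand and its transpose the projection onto it. The
  identities let vectors of W be tested inside the sum without index computations.\<close>

lemma block_embedding: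
  fixes K W :: "'b::comm_ring_1 mat"
  assumes K: "K \<in> carrier_mat k k" and W: "W \<in> carrier_mat l l"
  defines "E \<equiv> mat (k + l) l (\<lambda>(i, j). if i = k + j then 1 else 0)"
  shows "block_sum K W * E = E * W" "E\<^sup>T * E = 1\<^sub>m l" "E \<in> carrier_mat (k + l) l"
proof -
  have [simp]: "dim_row K = k" "dim_col K = k" "dim_row W = l" "dim_col W = l"
    "dim_row E = k + l" "dim_col E = l" using K W by (auto simp: E_def)
  show E: "block_sum K W * E = E * W"
  proof (rule eq_matI)
    fix i j assume "i < dim_row (E * W)" "j < dim_col (E * W)"
    then have ij: "i < k + l" "j < l" by auto
    have "(block_sum K W * E) $$ (i, j) = block_sum K W $$ (i, k + j)"
      using ij by (simp add: scalar_prod_def E_def if_distrib[of "\<lambda>x. _ * x"] sum.delta cong: if_cong)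
    also have "\<dots> = (\<Sum>a<l. if a = i - k \<and> k \<le> i then W $$ (a, j) else 0)"
      using ij by (cases "k \<le> i") (auto simp: sum.delta)
    also have "\<dots> = (E * W) $$ (i, j)"
      using ij by (auto simp: scalar_prod_def E_def lessThan_atLeast0 intro!: sum.cong)
    finally show "(block_sum K W * E) $$ (i, j) = (E * W) $$ (i, j)" .
  qed auto
  show "E\<^sup>T * E = 1\<^sub>m l"
  proof (rule eq_matI)
    fix i j assume "i < dim_row (1\<^sub>m l :: 'b mat)" "j < dim_col (1\<^sub>m l :: 'b mat)"
    then have ij: "i < l" "j < l" by auto
    then show "(E\<^sup>T * E) $$ (i, j) = 1\<^sub>m l $$ (i, j)"
      by (simp add: scalar_prod_def E_def if_distrib[of "\<lambda>x. _ * x"] sum.delta cong: if_cong)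
  qed auto
  show "E \<in> carrier_mat (k + l) l" by (auto simp: E_def)
qed

section \<open>Local maximality\<close>

text \<open>Column vectors are one-column matrices.  Anisotropy modulo p of the radical modulo p is what
  maximality of a lattice means at the prime p; the half accounts for the quadratic form of an even
  bilinear form.\<close>

definition locally_maximal :: "nat \<Rightarrow> nat \<Rightarrow> rat mat \<Rightarrow> bool" where
  "locally_maximal p n H \<longleftrightarrow>
     (\<forall>z \<in> carrier_mat n 1. mid p 0 z \<and> mid p 1 (H * z) \<and> mid p 2 ((1/2) \<cdot>\<^sub>m (z\<^sup>T * H * z)) \<longrightarrow> mid p 1 z)"

lemma locally_maximal_congruent:
  assumes p: "prime p" and H: "H \<in> carrier_mat n n" and U: "U \<in> Zgl p n"
    and D: "locally_maximal p n H"
  shows "locally_maximal p n (U\<^sup>T * H * U)"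
  unfolding locally_maximal_def
proof (intro ballI impI, elim conjE)
  fix z :: "rat mat"
  assume z: "z \<in> carrier_mat n 1" "mid p 0 z" "mid p 1 (U\<^sup>T * H * U * z)"
    "mid p 2 ((1/2) \<cdot>\<^sub>m (z\<^sup>T * (U\<^sup>T * H * U) * z))"
  obtain V where V: "V \<in> Zgl p n" "U * V = 1\<^sub>m n" "V * U = 1\<^sub>m n" using Zgl_inverse[OF p U] .
  have [simp]: "dim_row H = n" "dim_col H = n" "dim_row U = n" "dim_col U = n"
    "dim_row V = n" "dim_col V = n" "dim_row z = n" "dim_col z = 1"
    using H z Zgl_carrier[OF U] Zgl_carrier[OF V(1)] by auto
  have VU: "V\<^sup>T * U\<^sup>T = 1\<^sub>m n"
    using arg_cong[OF V(2), of transpose_mat] by (simp add: mat_transpose_mult)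
  have "mid p 1 (V\<^sup>T * (U\<^sup>T * H * U * z))"
    using mid_mult_0[OF p _ mid_transpose[OF Zgl_mid[OF V(1)]] z(3)] by simp
  then have "mid p 1 (H * (U * z))" by (simp add: mat_ring mat_cancel_left[OF VU])
  moreover have "mid p 2 ((1/2) \<cdot>\<^sub>m ((U * z)\<^sup>T * H * (U * z)))"
    using z by (simp add: mat_ring)
  moreover have "mid p 0 (U * z)" using mid_mult_0[OF p _ Zgl_mid[OF U] z(2)] by simp
  moreover have "U * z \<in> carrier_mat n 1" by auto
  ultimately have "mid p 1 (U * z)"
    using D unfolding locally_maximal_def by blast
  then have "mid p 1 (V * (U * z))" using mid_mult_0[OF p _ Zgl_mid[OF V(1)]] by simp
  then show "mid p 1 z" by (simp add: mat_cancel_left[OF V(3)])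
qed

text \<open>A vector of the second summand satisfies the same three conditions inside the sum, and
  the divisibility obtained there projects back to it.\<close>

lemma locally_maximal_block_sum:
  assumes p: "prime p" and K: "K \<in> carrier_mat k k" and W: "W \<in> carrier_mat l l"
    and D: "locally_maximal p (k + l) (block_sum K W)"
  shows "locally_maximal p l W"
  unfolding locally_maximal_def
proof (intro ballI impI, elim conjE)
  fix z :: "rat mat"
  assume z: "z \<in> carrier_mat l 1" "mid p 0 z" "mid p 1 (W * z)" "mid p 2 ((1/2) \<cdot>\<^sub>m (z\<^sup>T * W * z))"
  define E :: "rat mat" where "E = mat (k + l) l (\<lambda>(i, j). if i = k + j then 1 else 0)"
  have [simp]: "dim_row K = k" "dim_col K = k" "dim_row W = l" "dim_col W = l"
    "dim_row z = l" "dim_col z = 1" "dim_row E = k + l" "dim_col E = l" using K W z by (auto simp: E_def)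
  note E = block_embedding(1)[OF K W, folded E_def] and EE = block_embedding(2)[OF K W, folded E_def]
  have mE: "mid p 0 E" using p by (auto simp: mid_def E_def)
  have 1: "mid p 1 (block_sum K W * (E * z))"
  proof -
    have "block_sum K W * (E * z) = E * (W * z)"
      using E by (simp flip: mat_assoc)
    then show ?thesis using mid_mult_0[OF p _ mE z(3)] by simp
  qed
  have "(E * z)\<^sup>T * block_sum K W * (E * z) = z\<^sup>T * W * z"
  proof -
    have "(E * z)\<^sup>T * block_sum K W * (E * z) = z\<^sup>T * (E\<^sup>T * ((block_sum K W * E) * z))"
      by (simp add: mat_ring)
    also have "\<dots> = z\<^sup>T * W * z"
      unfolding E by (simp add: mat_ring mat_cancel_left[OF EE])
    finally show ?thesis .
  qed
  then have 2: "mid p 2 ((1/2) \<cdot>\<^sub>m ((E * z)\<^sup>T * block_sum K W * (E * z)))" using z by simp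
  have "mid p 0 (E * z)" using mid_mult_0[OF p _ mE z(2)] by simp
  moreover have "E * z \<in> carrier_mat (k + l) 1" by auto
  ultimately have "mid p 1 (E * z)"
    using D 1 2 unfolding locally_maximal_def by blast
  then have "mid p 1 (E\<^sup>T * (E * z))" using mid_mult_0[OF p _ mid_transpose[OF mE]] by simp
  then show "mid p 1 z" by (simp add: mat_cancel_left[OF EE])
qed

section \<open>Splitting symmetric matrices\<close>

lemma symmetric_blocks:
  assumes "H \<in> carrier_mat (k + l) (k + l)" "H\<^sup>T = H"
  obtains K X W where "K \<in> carrier_mat k k" "X \<in> carrier_mat k l" "W \<in> carrier_mat l l"
    "K\<^sup>T = K" "W\<^sup>T = W" "H = four_block_mat K X X\<^sup>T W"
proof -
  obtain K X Y W where s: "split_block H k k = (K, X, Y, W)" by (cases "split_block H k k") auto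
  have b: "K \<in> carrier_mat k k" "X \<in> carrier_mat k l" "Y \<in> carrier_mat l k" "W \<in> carrier_mat l l"
    "H = four_block_mat K X Y W"
    using split_block[OF s, of l l] assms by auto
  have sym: "H $$ (i, j) = H $$ (j, i)" if "i < k + l" "j < k + l" for i j
    using arg_cong[OF assms(2), of "\<lambda>A. A $$ (j, i)"] that assms(1) by simp
  have K: "K\<^sup>T = K"
  proof (rule eq_matI)
    fix i j assume "i < dim_row K" "j < dim_col K"
    then show "K\<^sup>T $$ (i, j) = K $$ (i, j)"
      using sym[of i j] b by simp
  qed (use b in auto)
  have W: "W\<^sup>T = W"
  proof (rule eq_matI)
    fix i j assume "i < dim_row W" "j < dim_col W"
    then show "W\<^sup>T $$ (i, j) = W $$ (i, j)"
      using sym[of "k + i" "k + j"] b by simp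
  qed (use b in auto)
  have "Y = X\<^sup>T"
  proof (rule eq_matI)
    fix i j assume "i < dim_row X\<^sup>T" "j < dim_col X\<^sup>T"
    then show "Y $$ (i, j) = X\<^sup>T $$ (i, j)"
      using sym[of "k + i" j] b by simp
  qed (use b in auto)
  then show thesis using that b K W by blast
qed

text \<open>Completing the square: U subtracts from the later basis vectors their projections to the
  span of the first k, which leaves the Schur complement of K. It is stated over a field and serves
  both the rational planes of the necessity part and the p-integral splittings.\<close>

lemma block_elimination:
  fixes K X W J :: "'b::field mat"
  assumes K: "K \<in> carrier_mat k k" "K\<^sup>T = K" and X: "X \<in> carrier_mat k l" and W: "W \<in> carrier_mat l l"
    and J: "J \<in> carrier_mat k k" "K * J = 1\<^sub>m k" "J * K = 1\<^sub>m k"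
  defines "U \<equiv> four_block_mat (1\<^sub>m k) (- (J * X)) (0\<^sub>m l k) (1\<^sub>m l)"
  shows "U\<^sup>T * four_block_mat K X X\<^sup>T W * U = block_sum K (W - X\<^sup>T * (J * X))" "det U = 1"
    "U \<in> carrier_mat (k + l) (k + l)"
proof -
  have [simp]: "dim_row K = k" "dim_col K = k" "dim_row W = l" "dim_col W = l"
    "dim_row X = k" "dim_col X = l" "dim_row J = k" "dim_col J = k" using K W X J by auto
  have JT: "J\<^sup>T = J"
  proof -
    have "J\<^sup>T * K = 1\<^sub>m k"
      using arg_cong[OF J(2), of transpose_mat] K by (simp add: mat_transpose_mult)
    then have "J\<^sup>T * (K * J) = J" by (simp flip: mat_assoc add: mat_one_left)
    then show ?thesis using J by (simp add: mat_one_right)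
  qed
  have JX: "- (J * X) \<in> carrier_mat k l" by (intro carrier_matI) auto
  have KJX: "K * - (J * X) = - X" "J * X \<in> carrier_mat k l"
    using mat_cancel_left[OF J(2), of X] by (auto intro!: carrier_matI)
  have neg: "A * - B = - (A * B)" "- B * C = - (B * C)"
    if "dim_col A = dim_row B" "dim_col B = dim_row C" for A B C :: "'b mat"
    using that by auto
  have c: "1\<^sub>m k \<in> carrier_mat k k" "0\<^sub>m l k \<in> carrier_mat l k" "1\<^sub>m l \<in> carrier_mat l l"
    "X\<^sup>T \<in> carrier_mat l k" "0\<^sub>m k l \<in> carrier_mat k l" using X by auto
  have UT: "U\<^sup>T = four_block_mat (1\<^sub>m k) (0\<^sub>m k l) ((- (J * X))\<^sup>T) (1\<^sub>m l)"
    unfolding U_def using transpose_four_block_mat[OF c(1) JX c(2,3)] by simp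
  have HU: "four_block_mat K X X\<^sup>T W * U = four_block_mat K (0\<^sub>m k l) X\<^sup>T (W - X\<^sup>T * (J * X))"
    unfolding U_def mult_four_block_mat[OF K(1) X c(4) W c(1) JX c(2,3)]
    using KJX by (intro cong_four_block_mat) (auto simp: mat_one_right neg intro!: eq_matI)
  have "(- (J * X))\<^sup>T * K + X\<^sup>T = 0\<^sub>m l k"
  proof -
    have "(- (J * X))\<^sup>T = - (X\<^sup>T * J)" using JT
      by (metis mat_transpose_mult transpose_uminus \<open>dim_row X = k\<close> \<open>dim_col J = k\<close>)
    moreover have "- (X\<^sup>T * J) * K = - X\<^sup>T" using J by (simp add: neg mat_assoc mat_one_right)
    ultimately show ?thesis by (auto intro!: eq_matI)
  qed
  moreover have JXT: "(- (J * X))\<^sup>T \<in> carrier_mat l k" by (intro carrier_matI) auto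
  moreover have W': "W - X\<^sup>T * (J * X) \<in> carrier_mat l l" by (intro carrier_matI) auto
  moreover have "1\<^sub>m k * K + 0\<^sub>m k l * X\<^sup>T = K" "1\<^sub>m l * X\<^sup>T = X\<^sup>T"
    "1\<^sub>m k * 0\<^sub>m k l + 0\<^sub>m k l * (W - X\<^sup>T * (J * X)) = 0\<^sub>m k l"
    "(- (J * X))\<^sup>T * 0\<^sub>m k l + 1\<^sub>m l * (W - X\<^sup>T * (J * X)) = W - X\<^sup>T * (J * X)"
    using K X JXT W' by (auto simp: mat_one_left)
  ultimately have "U\<^sup>T * (four_block_mat K X X\<^sup>T W * U) = block_sum K (W - X\<^sup>T * (J * X))"
    unfolding HU UT mult_four_block_mat[OF c(1,5) JXT c(3) K(1) c(5,4) W'] by simp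
  moreover show U: "U \<in> carrier_mat (k + l) (k + l)" by (auto simp: U_def)
  ultimately show "U\<^sup>T * four_block_mat K X X\<^sup>T W * U = block_sum K (W - X\<^sup>T * (J * X))"
    using carrier_matD[OF U] by (simp add: mat_assoc)
  show "det U = 1" unfolding U_def
    using det_four_block_mat_lower_left_zero[OF c(1) JX refl c(3)] by simp
qed

lemma det_block_sum:
  fixes K W :: "'b::idom mat"
  assumes "K \<in> carrier_mat k k" "W \<in> carrier_mat l l"
  shows "det (block_sum K W) = det K * det W"
  using assms det_four_block_mat_lower_left_zero[OF assms(1) zero_carrier_mat refl assms(2)] by simp

text \<open>A unit determinant makes the inverse of the leading block p-integral, so completing the
  square stays inside the localization: a unimodular sublattice is an orthogonal summand.\<close>

lemma split_unit_block:
  assumes p: "prime p" and H: "H \<in> carrier_mat (k + l) (k + l)" "H\<^sup>T = H" "mid p 0 H"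
    and u: "det (mat k k (\<lambda>ij. H $$ ij)) \<in> Zunit p"
  obtains U W where "U \<in> Zgl p (k + l)" "W \<in> carrier_mat l l" "W\<^sup>T = W" "mid p 0 W"
    "U\<^sup>T * H * U = block_sum (mat k k (\<lambda>ij. H $$ ij)) W" "det H = det (mat k k (\<lambda>ij. H $$ ij)) * det W"
proof -
  obtain K X W where b: "K \<in> carrier_mat k k" "X \<in> carrier_mat k l" "W \<in> carrier_mat l l"
    "K\<^sup>T = K" "W\<^sup>T = W" "H = four_block_mat K X X\<^sup>T W"
    using symmetric_blocks[OF H(1,2)] .
  have [simp]: "dim_row K = k" "dim_col K = k" "dim_row W = l" "dim_col W = l"
    "dim_row X = k" "dim_col X = l" using b by auto
  have K: "mat k k (\<lambda>ij. H $$ ij) = K" using b by (intro eq_matI) auto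
  have m: "mid p 0 K" "mid p 0 X" "mid p 0 W"
    using H(3) b mid_four_block[of K k k X l "X\<^sup>T" l W p 0] by auto
  have "K \<in> Zgl p k" using u K b m by (simp add: Zgl_def)
  then obtain J where J: "J \<in> Zgl p k" "K * J = 1\<^sub>m k" "J * K = 1\<^sub>m k" using Zgl_inverse[OF p] by blast
  have Jc: "J \<in> carrier_mat k k" "mid p 0 J" using J by (auto simp: Zgl_def)
  have [simp]: "dim_row J = k" "dim_col J = k" using Jc by auto
  define U where "U = four_block_mat (1\<^sub>m k) (- (J * X)) (0\<^sub>m l k) (1\<^sub>m l)"
  define W' where "W' = W - X\<^sup>T * (J * X)"
  note be = block_elimination[OF b(1,4,2,3) Jc(1) J(2,3), folded U_def W'_def]
  have mJX: "mid p 0 (J * X)" using mid_mult_0[OF p _ Jc(2) m(2)] by simp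
  have "mid p 0 U" unfolding U_def using mJX p
    by (subst mid_four_block[of _ k k _ l _ l]) (auto simp: mid_one mid_zero mid_uminus)
  then have U: "U \<in> Zgl p (k + l)" using be p by (simp add: Zgl_def)
  have W': "W' \<in> carrier_mat l l" by (auto simp: W'_def)
  have mW: "mid p 0 W'" unfolding W'_def
    using mid_mult_0[OF p _ mid_transpose[OF m(2)] mJX] p m by (intro mid_diff) auto
  have JT: "J\<^sup>T = J"
  proof -
    have "J\<^sup>T * K = 1\<^sub>m k"
      using arg_cong[OF J(2), of transpose_mat] b by (simp add: mat_transpose_mult)
    then have "J\<^sup>T * (K * J) = J" by (simp flip: mat_assoc add: mat_one_left)
    then show ?thesis using J by (simp add: mat_one_right)
  qed
  have WT: "W'\<^sup>T = W'" unfolding W'_def using b(5) JT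
    by (subst transpose_minus[of _ l l]) (auto simp: mat_transpose_mult mat_assoc)
  have "det (U\<^sup>T * H * U) = det H"
    using be(2,3) H(1) det_mult[of "U\<^sup>T * H" "k + l" U] det_mult[of "U\<^sup>T" "k + l" H] det_transpose[OF be(3)]
    by auto
  then have "det H = det K * det W'"
    unfolding b(6) be(1) using det_block_sum[OF b(1) W'] by simp
  then show thesis using that[OF U W' WT mW] be(1) b(6) K by metis
qed

lemma det_congruent:
  fixes H U :: "'b::idom mat"
  assumes "H \<in> carrier_mat n n" "U \<in> carrier_mat n n"
  shows "det (U\<^sup>T * H * U) = (det U)\<^sup>2 * det H"
  using assms det_mult[of "U\<^sup>T * H" n U] det_mult[of "U\<^sup>T" n H] det_transpose[OF assms(2)]
  by (auto simp: power2_eq_square)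

lemma symmetric_congruent:
  fixes H U :: "'b::comm_ring_1 mat"
  assumes "H \<in> carrier_mat n n" "U \<in> carrier_mat n n" "H\<^sup>T = H"
  shows "(U\<^sup>T * H * U)\<^sup>T = U\<^sup>T * H * U"
  using assms carrier_matD[OF assms(1)] carrier_matD[OF assms(2)] by (simp add: mat_ring)

lemma mid_congruent:
  assumes "prime p" "H \<in> carrier_mat n n" "U \<in> carrier_mat n m" "mid p 0 U" "mid p N H"
  shows "mid p N (U\<^sup>T * H * U)"
  using mid_mult_0'[OF assms(1) _ mid_mult_0[OF assms(1) _ mid_transpose[OF assms(4)] assms(5)] assms(4)]
    assms carrier_matD by auto

text \<open>H is thought of as the bilinear form of the quadratic form
  \<open>x\<^sup>T * H * x\<close> / 2; at the prime 2 the condition on the diagonal is what makes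
  that form integral.\<close>

definition even_form :: "nat \<Rightarrow> nat \<Rightarrow> rat mat \<Rightarrow> bool" where
  "even_form p n H \<longleftrightarrow> H \<in> carrier_mat n n \<and> H\<^sup>T = H \<and> mid p 0 H \<and> (\<forall>i<n. H $$ (i, i) / 2 \<in> Zid p 0)"

lemma symmetric_double_sum:
  fixes f :: "nat \<Rightarrow> nat \<Rightarrow> 'b::comm_ring_1"
  assumes "\<And>i j. i < n \<Longrightarrow> j < n \<Longrightarrow> f i j = f j i"
  shows "(\<Sum>i<n. \<Sum>j<n. f i j) = (\<Sum>i<n. f i i) + 2 * (\<Sum>i<n. \<Sum>j<i. f i j)"
  using assms
proof (induction n)
  case (Suc n)
  have "(\<Sum>i<n. f i n) = (\<Sum>i<n. f n i)" using Suc.prems by (intro sum.cong) auto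
  then show ?case using Suc.IH Suc.prems by (simp add: sum.distrib algebra_simps)
qed simp

lemma congruent_entry:
  fixes H U :: "'b::comm_ring_1 mat"
  assumes "H \<in> carrier_mat n n" "U \<in> carrier_mat n m" "i < m" "j < m"
  shows "(U\<^sup>T * H * U) $$ (i, j) = (\<Sum>a<n. \<Sum>b<n. U $$ (a, i) * H $$ (a, b) * U $$ (b, j))"
proof -
  have "(U\<^sup>T * H * U) $$ (i, j) = (\<Sum>a<n. U $$ (a, i) * (\<Sum>b<n. H $$ (a, b) * U $$ (b, j)))"
    using assms by (simp add: scalar_prod_def lessThan_atLeast0)
  then show ?thesis by (simp add: sum_distrib_left mult.assoc)
qed

text \<open>By symmetry the products off the diagonal occur in equal pairs, so halving leaves each
  of them once.\<close>

lemma even_form_diagonal: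
  assumes p: "prime p" and H: "even_form p n H" and U: "U \<in> carrier_mat n m" "mid p 0 U" and i: "i < m"
  shows "(U\<^sup>T * H * U) $$ (i, i) / 2 \<in> Zid p 0"
proof -
  have Hc: "H \<in> carrier_mat n n" "H\<^sup>T = H" "mid p 0 H" and d: "\<And>i. i < n \<Longrightarrow> H $$ (i, i) / 2 \<in> Zid p 0"
    using H by (auto simp: even_form_def)
  have sym: "H $$ (a, b) = H $$ (b, a)" if "a < n" "b < n" for a b
    using arg_cong[OF Hc(2), of "\<lambda>A. A $$ (b, a)"] that Hc(1) by simp
  have "(U\<^sup>T * H * U) $$ (i, i) = (\<Sum>a<n. U $$ (a, i) * H $$ (a, a) * U $$ (a, i)) +
      2 * (\<Sum>a<n. \<Sum>b<a. U $$ (a, i) * H $$ (a, b) * U $$ (b, i))"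
    unfolding congruent_entry[OF Hc(1) U(1) i i]
    using symmetric_double_sum[of n "\<lambda>a b. U $$ (a, i) * H $$ (a, b) * U $$ (b, i)"] sym by (simp add: mult_ac)
  moreover have "(\<Sum>a<n. U $$ (a, i) * H $$ (a, a) * U $$ (a, i)) =
      2 * (\<Sum>a<n. U $$ (a, i) * (H $$ (a, a) / 2) * U $$ (a, i))"
    by (simp add: sum_distrib_left)
  ultimately have "(U\<^sup>T * H * U) $$ (i, i) / 2 = (\<Sum>a<n. U $$ (a, i) * (H $$ (a, a) / 2) * U $$ (a, i)) +
      (\<Sum>a<n. \<Sum>b<a. U $$ (a, i) * H $$ (a, b) * U $$ (b, i))"
    by simp
  moreover have "\<dots> \<in> Zid p 0"
    using p d Hc(1) U i midD[OF U(2)] midD[OF Hc(3)]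
    by (intro Zid_add Zid_sum Zid_mult_0[OF p]) auto
  ultimately show ?thesis by (simp only:)
qed

lemma even_form_congruent:
  assumes "prime p" "even_form p n H" "U \<in> carrier_mat n n" "mid p 0 U"
  shows "even_form p n (U\<^sup>T * H * U)"
  using assms even_form_diagonal[OF assms] symmetric_congruent[of H n U] mid_congruent[of p H n U n 0]
  by (auto simp: even_form_def)

lemma even_form_block_sum:
  assumes "even_form p (k + l) (block_sum K W)" "K \<in> carrier_mat k k" "W \<in> carrier_mat l l"
  shows "even_form p l W"
proof -
  let ?B = "block_sum K W"
  have B: "?B\<^sup>T = ?B" "mid p 0 ?B" and d: "\<And>i. i < k + l \<Longrightarrow> ?B $$ (i, i) / 2 \<in> Zid p 0"
    using assms by (auto simp: even_form_def)
  have "W\<^sup>T = W"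
  proof (rule eq_matI)
    fix i j assume "i < dim_row W" "j < dim_col W"
    then show "W\<^sup>T $$ (i, j) = W $$ (i, j)"
      using arg_cong[OF B(1), of "\<lambda>A. A $$ (k + i, k + j)"] assms by simp
  qed (use assms in auto)
  moreover have "mid p 0 W" using B(2) mid_four_block[of K k k _ l _ l W p 0] assms by auto
  moreover have "W $$ (i, i) / 2 \<in> Zid p 0" if "i < l" for i using d[of "k + i"] that assms by simp
  ultimately show ?thesis using assms by (auto simp: even_form_def)
qed

lemma permute_congruent:
  assumes p: "prime p" and H: "H \<in> carrier_mat n n" and q: "q permutes {0..<n}"
  obtains U where "U \<in> Zgl p n" "\<And>a b. a < n \<Longrightarrow> b < n \<Longrightarrow> (U\<^sup>T * H * U) $$ (a, b) = H $$ (q a, q b)"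
    "(det U)\<^sup>2 = 1"
proof -
  define V :: "rat mat" where "V = mat n n (\<lambda>(i, j). 1\<^sub>m n $$ (q i, j))"
  have qn: "q i < n" if "i < n" for i using permutes_in_image[OF q, of i] that by simp
  have dV: "det V = signof q" using det_permute_rows[OF one_carrier_mat q] by (simp add: V_def)
  then have s: "det V = 1 \<or> det V = -1" by (simp add: sign_def)
  have "V \<in> Zgl p n" unfolding Zgl_def
    using s p qn Zunit_of_int_iff[of p 1] Zunit_of_int_iff[of p "-1"] by (auto simp: V_def mid_def prime_nat_iff)
  then have U: "V\<^sup>T \<in> Zgl p n" by (rule Zgl_transpose)
  have "(V\<^sup>T\<^sup>T * H * V\<^sup>T) $$ (a, b) = H $$ (q a, q b)" if "a < n" "b < n" for a b
  proof -
    have "(V\<^sup>T\<^sup>T * H * V\<^sup>T) $$ (a, b) = (\<Sum>c<n. \<Sum>d<n. V\<^sup>T $$ (c, a) * H $$ (c, d) * V\<^sup>T $$ (d, b))"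
      using congruent_entry[OF H Zgl_carrier[OF U] that] .
    also have "\<dots> = (\<Sum>c<n. if c = q a then H $$ (c, q b) else 0)"
    proof (intro sum.cong refl)
      fix c assume "c \<in> {..<n}"
      then have "(\<Sum>d<n. V\<^sup>T $$ (c, a) * H $$ (c, d) * V\<^sup>T $$ (d, b)) =
          (\<Sum>d<n. if d = q b then (if c = q a then H $$ (c, d) else 0) else 0)"
        using that qn by (intro sum.cong) (auto simp: V_def)
      then show "(\<Sum>d<n. V\<^sup>T $$ (c, a) * H $$ (c, d) * V\<^sup>T $$ (d, b)) = (if c = q a then H $$ (c, q b) else 0)"
        using that qn by simp
    qed
    also have "\<dots> = H $$ (q a, q b)" using qn that by simp
    finally show ?thesis .
  qed
  moreover have "(det V\<^sup>T)\<^sup>2 = 1" using s det_transpose[of V n] by (auto simp: V_def)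
  ultimately show thesis using that U by blast
qed

lemma permutation_moving_two:
  fixes i j n :: nat
  assumes "i < n" "j < n" "i \<noteq> j"
  obtains q where "q permutes {0..<n}" "q 0 = i" "q 1 = j"
proof -
  \<comment> \<open>The swap of 0 and i may move j; m is the place that it sends to j. Since i and j
    differ, m is not 0, so the swap of 1 and m leaves 0 alone.\<close>
  define m where "m = transpose 0 i j"
  define q where "q = transpose 0 i \<circ> transpose 1 m"
  have "0 < n" using assms(1) by (cases n) auto
  moreover have "1 < n" using assms by arith
  moreover have "m < n" "m \<noteq> 0"
    using assms \<open>0 < n\<close> by (auto simp: m_def transpose_def)
  ultimately have n: "0 < n" "1 < n" "m < n" "m \<noteq> 0" by blast+
  then have "q permutes {0..<n}"
    unfolding q_def using assms by (intro permutes_compose permutes_swap_id) auto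
  moreover have "q 0 = i" using n by (simp add: q_def transpose_def)
  moreover have "q 1 = j" by (simp add: q_def m_def)
  ultimately show thesis using that by blast
qed

text \<open>The basis vector e_c is replaced by e_c + t e_k. The purpose is to change the norm of
  one vector by a unimodular step whose effect on every other entry is explicit.\<close>

lemma add_column_congruent:
  assumes p: "prime p" and H: "H \<in> carrier_mat n n" and ck: "c < n" "k < n" "c \<noteq> k" and t: "t \<in> Zid p 0"
  obtains U where "U \<in> Zgl p n" "det U = 1" "\<And>a b. a < n \<Longrightarrow> b < n \<Longrightarrow> (U\<^sup>T * H * U) $$ (a, b) =
     H $$ (a, b) + (if b = c then t * H $$ (a, k) else 0) + (if a = c then t * H $$ (k, b) else 0)
     + (if a = c \<and> b = c then t * t * H $$ (k, k) else 0)"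
proof -
  define V :: "rat mat" where "V = addrow_mat n t c k"
  have V: "V \<in> carrier_mat n n" "det V = 1" using det_addrow_mat[OF ck(3)] by (auto simp: V_def)
  have "mid p 0 V" using p t ck by (auto simp: mid_def V_def)
  then have U: "V\<^sup>T \<in> Zgl p n" using V p by (intro Zgl_transpose) (simp add: Zgl_def)
  have e: "V\<^sup>T $$ (x, a) = (if x = a then 1 else 0) + (if x = k then (if a = c then t else 0) else 0)"
    if "x < n" "a < n" for x a
    using that ck by (auto simp: V_def)
  have row: "(\<Sum>y<n. H $$ (x, y) * V\<^sup>T $$ (y, b)) = H $$ (x, b) + (if b = c then t * H $$ (x, k) else 0)"
    if "x < n" "b < n" for x b
  proof -
    have "(\<Sum>y<n. H $$ (x, y) * V\<^sup>T $$ (y, b)) =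
        (\<Sum>y<n. (if y = b then H $$ (x, y) else 0) + (if y = k then (if b = c then t * H $$ (x, y) else 0) else 0))"
      using that e by (intro sum.cong refl) (auto simp: algebra_simps)
    also have "\<dots> = H $$ (x, b) + (if b = c then t * H $$ (x, k) else 0)"
      using that ck by (simp add: sum.distrib)
    finally show ?thesis .
  qed
  have "(V\<^sup>T\<^sup>T * H * V\<^sup>T) $$ (a, b) =
     H $$ (a, b) + (if b = c then t * H $$ (a, k) else 0) + (if a = c then t * H $$ (k, b) else 0)
     + (if a = c \<and> b = c then t * t * H $$ (k, k) else 0)" if "a < n" "b < n" for a b
  proof -
    have "(V\<^sup>T\<^sup>T * H * V\<^sup>T) $$ (a, b) = (\<Sum>x<n. V\<^sup>T $$ (x, a) * (\<Sum>y<n. H $$ (x, y) * V\<^sup>T $$ (y, b)))"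
      unfolding congruent_entry[OF H Zgl_carrier[OF U] that] by (simp add: sum_distrib_left mult.assoc)
    also have "\<dots> = (\<Sum>x<n. (if x = a then H $$ (x, b) + (if b = c then t * H $$ (x, k) else 0) else 0)
         + (if x = k then (if a = c then t * (H $$ (x, b) + (if b = c then t * H $$ (x, k) else 0)) else 0) else 0))"
      using that row e by (intro sum.cong refl) (auto simp: algebra_simps)
    also have "\<dots> = (H $$ (a, b) + (if b = c then t * H $$ (a, k) else 0)) +
        (if a = c then t * (H $$ (k, b) + (if b = c then t * H $$ (k, k) else 0)) else 0)"
      using that ck by (simp add: sum.distrib)
    finally show ?thesis by (auto simp: algebra_simps)
  qed
  moreover have "det V\<^sup>T = 1" using V det_transpose[OF V(1)] by simp
  ultimately show thesis using that U by blast
qed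

section \<open>Two by two matrices\<close>

definition m2 :: "'b \<Rightarrow> 'b \<Rightarrow> 'b \<Rightarrow> 'b \<Rightarrow> 'b mat" where
  "m2 a b c d = mat 2 2 (\<lambda>(i, j). if i = 0 then if j = 0 then a else b else if j = 0 then c else d)"

lemma m2_carrier [simp]: "m2 a b c d \<in> carrier_mat 2 2"
  by (simp add: m2_def)

lemma m2_dim [simp]: "dim_row (m2 a b c d) = 2" "dim_col (m2 a b c d) = 2"
  by (simp_all add: m2_def)

lemma m2_index [simp]: "m2 a b c d $$ (0, 0) = a" "m2 a b c d $$ (0, 1) = b" "m2 a b c d $$ (1, 0) = c"
  "m2 a b c d $$ (1, 1) = d" "m2 a b c d $$ (0, Suc 0) = b" "m2 a b c d $$ (Suc 0, 0) = c"
  "m2 a b c d $$ (Suc 0, Suc 0) = d"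
  by (simp_all add: m2_def)

lemma less_2_iff: "i < 2 \<longleftrightarrow> i = 0 \<or> i = (1::nat)"
  by auto

lemma m2_eqI:
  assumes "A \<in> carrier_mat 2 2"
  shows "A = m2 (A $$ (0, 0)) (A $$ (0, 1)) (A $$ (1, 0)) (A $$ (1, 1))"
  using assms by (intro eq_matI) (auto simp: m2_def less_2_iff)

lemma m2_mult:
  fixes a :: "'b::semiring_0"
  shows "m2 a b c d * m2 e f g h = m2 (a * e + b * g) (a * f + b * h) (c * e + d * g) (c * f + d * h)"
  by (rule eq_matI) (auto simp: scalar_prod_def numeral_2_eq_2 less_Suc_eq)

lemma m2_transpose: "(m2 a b c d)\<^sup>T = m2 a c b d"
  by (rule eq_matI) (auto simp: less_2_iff)

lemma m2_minus: "m2 a b c d - m2 e f g h = m2 (a - e) (b - f) (c - g) (d - h)"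
  by (rule eq_matI) (auto simp: less_2_iff)

lemma m2_smult: "k \<cdot>\<^sub>m m2 a b c d = m2 (k * a) (k * b) (k * c) (k * d)"
  by (rule eq_matI) (auto simp: less_2_iff)

lemma m2_det: "det (m2 a b c d) = a * d - b * (c :: 'b::comm_ring_1)"
proof -
  have "det (m2 a b c d) = (\<Sum>i<2. m2 a b c d $$ (i, 0) * cofactor (m2 a b c d) i 0)"
    by (rule laplace_expansion_column[OF m2_carrier]) simp
  also have "\<dots> = a * d - b * c"
    by (simp add: eval_nat_numeral cofactor_def det_single mat_delete_def)
  finally show ?thesis .
qed

lemma m2_mid: "mid p N (m2 a b c d) \<longleftrightarrow> a \<in> Zid p N \<and> b \<in> Zid p N \<and> c \<in> Zid p N \<and> d \<in> Zid p N"
  by (auto simp: mid_def less_2_iff)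

lemmas m2_simps = m2_mult m2_transpose m2_minus m2_smult m2_det m2_mid

section \<open>Similarities of anisotropic rational forms\<close>

text \<open>For a prime p this says that p remains prime in Z[sqrt 2]: the norm form, here up to
  sign, has only the trivial zero modulo p. Stated as anisotropy it feeds the descent below
  directly.\<close>

definition two_nonresidue :: "nat \<Rightarrow> bool" where
  "two_nonresidue p \<longleftrightarrow> prime p \<and> (\<forall>x y::int. int p dvd 2 * x\<^sup>2 - y\<^sup>2 \<longrightarrow> int p dvd x \<and> int p dvd y)"

text \<open>Descent: if p divides the value, it divides both arguments, and dividing these by p
  takes exactly p^2 out of the value.\<close>

lemma even_rat_val_norm_int:
  assumes p: "two_nonresidue p" and "2 * x\<^sup>2 - y\<^sup>2 \<noteq> (0::int)"
  shows "even (multiplicity (int p) (2 * x\<^sup>2 - y\<^sup>2))"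
  using assms(2)
proof (induction "nat (\<bar>x\<bar> + \<bar>y\<bar>)" arbitrary: x y rule: less_induct)
  case less
  have pp: "prime p" using p by (simp add: two_nonresidue_def)
  show ?case
  proof (cases "int p dvd 2 * x\<^sup>2 - y\<^sup>2")
    case False
    then show ?thesis by (simp add: not_dvd_imp_multiplicity_0)
  next
    case True
    then have "int p dvd x" "int p dvd y" using p unfolding two_nonresidue_def by blast+
    then obtain u v where uv: "x = int p * u" "y = int p * v" by (auto elim!: dvdE)
    have eq: "2 * x\<^sup>2 - y\<^sup>2 = int p * (int p * (2 * u\<^sup>2 - v\<^sup>2))"
      unfolding uv by (simp add: power2_eq_square algebra_simps)
    then have nz: "2 * u\<^sup>2 - v\<^sup>2 \<noteq> 0" using less.prems by auto
    have p2: "int p \<ge> 2" using prime_ge_2_nat[OF pp] by simp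
    have xy: "\<bar>x\<bar> + \<bar>y\<bar> = int p * (\<bar>u\<bar> + \<bar>v\<bar>)" using p2 by (simp add: uv abs_mult algebra_simps)
    have "\<bar>u\<bar> + \<bar>v\<bar> > 0" using nz by (cases "u = 0"; cases "v = 0") auto
    moreover have "2 * (\<bar>u\<bar> + \<bar>v\<bar>) \<le> \<bar>x\<bar> + \<bar>y\<bar>"
      unfolding xy using p2 by (intro mult_right_mono) auto
    ultimately have "nat (\<bar>u\<bar> + \<bar>v\<bar>) < nat (\<bar>x\<bar> + \<bar>y\<bar>)"
      using nat_mono_iff[of "\<bar>x\<bar> + \<bar>y\<bar>"] by fastforce
    from less.hyps[OF this nz] have "even (multiplicity (int p) (2 * u\<^sup>2 - v\<^sup>2))" .
    moreover have "multiplicity (int p) (int p * (int p * (2 * u\<^sup>2 - v\<^sup>2))) =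
        2 + multiplicity (int p) (2 * u\<^sup>2 - v\<^sup>2)"
      using nz pp p2 by (subst multiplicity_times_same; simp)+
    ultimately show ?thesis unfolding eq by simp
  qed
qed

lemma even_rat_val_norm:
  assumes p: "two_nonresidue p" and nz: "2 * a\<^sup>2 - c\<^sup>2 \<noteq> (0::rat)"
  shows "even (rat_val p (2 * a\<^sup>2 - c\<^sup>2))"
proof -
  have pp: "prime p" using p by (simp add: two_nonresidue_def)
  obtain x d where x: "a = of_int x / of_int d" "d > 0" using rat_obtain_ints .
  obtain y e where y: "c = of_int y / of_int e" "e > 0" using rat_obtain_ints .
  define k where "k = 2 * (x * e)\<^sup>2 - (y * d)\<^sup>2"
  have eq: "2 * a\<^sup>2 - c\<^sup>2 = of_int k / of_int ((d * e) * (d * e))"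
    unfolding k_def x(1) y(1) using x(2) y(2) by (simp add: field_simps power2_eq_square)
  then have "k \<noteq> 0" using nz by auto
  then have "rat_val p (2 * a\<^sup>2 - c\<^sup>2) =
      int (multiplicity (int p) k) - int (multiplicity (int p) (d * e) + multiplicity (int p) (d * e))"
    unfolding eq using x y pp prime_elem_multiplicity_mult_distrib[of "int p" "d * e" "d * e"]
    by (subst rat_val_of_int_div) auto
  moreover have "even (multiplicity (int p) k)"
    using even_rat_val_norm_int[OF p] \<open>k \<noteq> 0\<close> unfolding k_def by blast
  ultimately show ?thesis by simp
qed

lemma rat_two_not_square: "(x::rat)\<^sup>2 \<noteq> 2"
proof
  assume "x\<^sup>2 = 2"
  moreover from this have "x \<noteq> 0" by auto
  ultimately have "2 * rat_val 2 x = rat_val 2 2" using rat_val_power[of 2 x 2] by simp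
  also have "\<dots> = 1" using rat_val_of_int_div[of 2 2 1] by simp
  finally show False by presburger
qed

section \<open>Columns and changes of basis over a field\<close>

definition unit_col :: "nat \<Rightarrow> nat \<Rightarrow> 'b::zero_neq_one mat" where
  "unit_col n k = mat n 1 (\<lambda>(i, j). if i = k then 1 else 0)"

lemma unit_col_dim [simp]: "dim_row (unit_col n k) = n" "dim_col (unit_col n k) = 1"
  by (simp_all add: unit_col_def)

lemma unit_col_index: "i < n \<Longrightarrow> unit_col n k $$ (i, 0) = (if i = k then 1 else 0)"
  by (simp add: unit_col_def)

lemma mult_unit_col:
  fixes A :: "'b::semiring_1 mat"
  assumes "dim_col A = n" "i < dim_row A" "k < n"
  shows "(A * unit_col n k) $$ (i, 0) = A $$ (i, k)"
  using assms by (simp add: scalar_prod_def unit_col_def if_distrib[of "\<lambda>x. _ * x"] sum.delta cong: if_cong)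

lemma mult_unit_col_eqI:
  fixes A c :: "'b::semiring_1 mat"
  assumes "dim_col A = n" "k < n" "dim_row c = dim_row A" "dim_col c = 1"
    and "\<And>i. i < dim_row A \<Longrightarrow> A $$ (i, k) = c $$ (i, 0)"
  shows "A * unit_col n k = c"
proof (rule eq_matI)
  fix i j assume "i < dim_row c" "j < dim_col c"
  then show "(A * unit_col n k) $$ (i, j) = c $$ (i, j)"
    using assms mult_unit_col[of A n i k] by (simp del: index_mult_mat(1))
qed (use assms in auto)

lemma permutation_matrix:
  fixes q :: "nat \<Rightarrow> nat"
  assumes q: "q permutes {0..<n}"
  obtains V :: "'b::comm_ring_1 mat" where "V \<in> carrier_mat n n" "V\<^sup>T * V = 1\<^sub>m n" "(det V)\<^sup>2 = 1"
    "\<And>i k. i < n \<Longrightarrow> k < n \<Longrightarrow> V $$ (i, k) = (if i = q k then 1 else 0)"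
proof -
  define V :: "'b mat" where "V = mat n n (\<lambda>(i, k). if i = q k then 1 else 0)"
  have qn: "q i < n" if "i < n" for i using permutes_in_image[OF q, of i] that by simp
  have V: "V \<in> carrier_mat n n" by (simp add: V_def)
  have VV: "V\<^sup>T * V = 1\<^sub>m n"
  proof (rule eq_matI)
    fix i k assume "i < dim_row (1\<^sub>m n :: 'b mat)" "k < dim_col (1\<^sub>m n :: 'b mat)"
    then have ik: "i < n" "k < n" by auto
    have "(V\<^sup>T * V) $$ (i, k) = (\<Sum>x = 0..<n. V $$ (x, i) * V $$ (x, k))"
      using ik carrier_matD[OF V] by (simp add: scalar_prod_def)
    also have "\<dots> = (\<Sum>x = 0..<n. if x = q k then (if q k = q i then 1 else 0) else 0)"
      using ik by (intro sum.cong refl) (auto simp: V_def)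
    also have "\<dots> = (if q k = q i then 1 else 0)" using qn ik by simp
    finally show "(V\<^sup>T * V) $$ (i, k) = 1\<^sub>m n $$ (i, k)"
      using ik permutes_inj[OF q] by (auto dest: injD)
  qed (auto simp: V_def)
  have "(det V)\<^sup>2 = 1"
    using arg_cong[OF VV, of det] det_mult[of "V\<^sup>T" n V] det_transpose[OF V] V
    by (simp add: power2_eq_square)
  then show thesis using that[OF V VV] by (simp add: V_def)
qed

lemma replace_column_det:
  fixes v :: "'b::comm_ring_1 mat"
  assumes "k < n"
  shows "det (mat n n (\<lambda>(i, j). if j = k then v $$ (i, 0) else if i = j then 1 else 0)) = v $$ (k, 0)"
proof -
  define x where "x = vec n (\<lambda>i. v $$ (i, 0))"
  have "replace_col (1\<^sub>m n) (1\<^sub>m n *\<^sub>v x) k = mat n n (\<lambda>(i, j). if j = k then v $$ (i, 0) else if i = j then 1 else 0)"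
    by (rule eq_matI) (auto simp: replace_col_def x_def)
  then show ?thesis using cramer_lemma_mat[of "1\<^sub>m n" n x k] assms by (simp add: x_def)
qed

text \<open>The nonzero entry of y outside place 0 makes e_0 and y independent. A permutation that
  fixes 0 brings this entry to place 1, and then y can replace the second column of the
  identity.\<close>

lemma extend_to_basis:
  fixes y :: "'b::field mat"
  assumes y: "y \<in> carrier_mat n 1" and j: "j < n" "j \<noteq> 0" "y $$ (j, 0) \<noteq> 0"
  obtains P where "P \<in> carrier_mat n n" "det P \<noteq> 0" "P * unit_col n 0 = unit_col n 0" "P * unit_col n 1 = y"
proof -
  have n: "0 < n" "1 < n" using j by auto
  obtain q where q: "q permutes {0..<n}" "q 0 = 0" "q 1 = j"
    using permutation_moving_two[of 0 n j] j n by auto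
  obtain V :: "'b mat" where V: "V \<in> carrier_mat n n" "V\<^sup>T * V = 1\<^sub>m n" "(det V)\<^sup>2 = 1"
    "\<And>i k. i < n \<Longrightarrow> k < n \<Longrightarrow> V $$ (i, k) = (if i = q k then 1 else 0)"
    using permutation_matrix[OF q(1)] by blast
  have VV: "V * V\<^sup>T = 1\<^sub>m n" using mat_mult_left_right_inverse[of "V\<^sup>T" n V] V by auto
  define v where "v = V\<^sup>T * y"
  define R where "R = mat n n (\<lambda>(i, k). if k = 1 then v $$ (i, 0) else if i = k then 1 else 0)"
  have [simp]: "dim_row V = n" "dim_col V = n" "dim_row y = n" "dim_col y = 1" "dim_row R = n" "dim_col R = n"
    "dim_row v = n" "dim_col v = 1"
    using V y by (auto simp: R_def v_def)
  have "v $$ (1, 0) = (\<Sum>i<n. V $$ (i, 1) * y $$ (i, 0))"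
    using n by (simp add: v_def scalar_prod_def lessThan_atLeast0)
  also have "\<dots> = (\<Sum>i<n. if i = j then y $$ (i, 0) else 0)"
    using n V(4) q by (intro sum.cong refl) auto
  finally have "v $$ (1, 0) = y $$ (j, 0)" using j by simp
  then have "det R \<noteq> 0" using replace_column_det[of 1 n v] n j by (simp add: R_def)
  have R0: "R * unit_col n 0 = unit_col n 0"
    by (rule mult_unit_col_eqI) (use n in \<open>auto simp: unit_col_index R_def\<close>)
  have R1: "R * unit_col n 1 = v"
    by (rule mult_unit_col_eqI) (use n in \<open>auto simp: R_def\<close>)
  have V0: "V * unit_col n 0 = unit_col n 0"
    by (rule mult_unit_col_eqI) (use n V(4) q in \<open>auto simp: unit_col_index\<close>)
  define P where "P = V * R"
  have "P \<in> carrier_mat n n" by (auto simp: P_def)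
  moreover have "det P \<noteq> 0"
    using det_mult[of V n R] V \<open>det R \<noteq> 0\<close> by (auto simp: P_def R_def)
  moreover have "P * unit_col n 0 = unit_col n 0"
    using R0 V0 by (simp add: P_def mat_assoc)
  moreover have "P * unit_col n 1 = y"
    using R1 mat_cancel_left[OF VV] by (simp add: P_def mat_assoc v_def)
  ultimately show thesis using that by blast
qed

section \<open>Anisotropic forms and exact doublings\<close>

definition ent :: "'b mat \<Rightarrow> 'b" where
  "ent A = A $$ (0, 0)"

lemma ent_minus: "dim_row A = 1 \<Longrightarrow> dim_col A = 1 \<Longrightarrow> dim_row B = 1 \<Longrightarrow> dim_col B = 1 \<Longrightarrow> ent (A - B) = ent A - ent B"
  by (simp add: ent_def)

lemma ent_transpose: "dim_row A = 1 \<Longrightarrow> dim_col A = 1 \<Longrightarrow> ent A\<^sup>T = ent A"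
  by (simp add: ent_def)

lemma ent_scalar:
  fixes A :: "'b::semiring_1 mat"
  shows "dim_row A = 1 \<Longrightarrow> dim_col A = 1 \<Longrightarrow> A = ent A \<cdot>\<^sub>m 1\<^sub>m 1"
  by (rule eq_matI) (auto simp: ent_def)

text \<open>This is what the proof uses of positive definiteness: every nonzero vector has a
  reflection, no diagonal entry vanishes, the form is nondegenerate, and all of it is inherited by
  orthogonal complements.\<close>

definition anisotropic :: "nat \<Rightarrow> rat mat \<Rightarrow> bool" where
  "anisotropic n G \<longleftrightarrow> (\<forall>z \<in> carrier_mat n 1. z \<noteq> 0\<^sub>m n 1 \<longrightarrow> ent (z\<^sup>T * G * z) \<noteq> 0)"

lemma anisotropic_congruent:
  assumes G: "G \<in> carrier_mat n n" "anisotropic n G" and P: "P \<in> carrier_mat n m" "Q \<in> carrier_mat m n" "Q * P = 1\<^sub>m m"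
  shows "anisotropic m (P\<^sup>T * G * P)"
  unfolding anisotropic_def
proof (intro ballI impI)
  fix z :: "rat mat" assume z: "z \<in> carrier_mat m 1" "z \<noteq> 0\<^sub>m m 1"
  have d: "dim_row z = m" "dim_col z = 1" "dim_row P = n" "dim_col P = m" "dim_row G = n" "dim_col G = n"
    "dim_row Q = m" "dim_col Q = n" using z P G by auto
  have "P * z \<noteq> 0\<^sub>m n 1"
  proof
    assume "P * z = 0\<^sub>m n 1"
    then have "Q * (P * z) = 0\<^sub>m m 1" using P by simp
    then show False using z mat_cancel_left[OF P(3), of z] d by simp
  qed
  moreover have "P * z \<in> carrier_mat n 1" using d by auto
  ultimately have "ent ((P * z)\<^sup>T * G * (P * z)) \<noteq> 0" using G by (auto simp: anisotropic_def)
  moreover have "(P * z)\<^sup>T * G * (P * z) = z\<^sup>T * (P\<^sup>T * G * P) * z" using d by (simp add: mat_ring)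
  ultimately show "ent (z\<^sup>T * (P\<^sup>T * G * P) * z) \<noteq> 0" by simp
qed

definition doubling :: "nat \<Rightarrow> rat mat \<Rightarrow> rat mat \<Rightarrow> bool" where
  "doubling n G S \<longleftrightarrow> G \<in> carrier_mat n n \<and> G\<^sup>T = G \<and> anisotropic n G \<and> S \<in> carrier_mat n n \<and>
     S\<^sup>T * G * S = 2 \<cdot>\<^sub>m G"

lemma doubling_conjugate:
  assumes D: "doubling n G S" and P: "P \<in> carrier_mat n n" "Q \<in> carrier_mat n n" "P * Q = 1\<^sub>m n" "Q * P = 1\<^sub>m n"
  shows "doubling n (P\<^sup>T * G * P) (Q * S * P)"
proof -
  have G: "G \<in> carrier_mat n n" "G\<^sup>T = G" "anisotropic n G" "S \<in> carrier_mat n n" "S\<^sup>T * G * S = 2 \<cdot>\<^sub>m G"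
    using D by (auto simp: doubling_def)
  have d: "dim_row P = n" "dim_col P = n" "dim_row G = n" "dim_col G = n"
    "dim_row Q = n" "dim_col Q = n" "dim_row S = n" "dim_col S = n" using P G by auto
  have PQ: "Q\<^sup>T * P\<^sup>T = 1\<^sub>m n"
    using arg_cong[OF P(3), of transpose_mat] d by (simp add: mat_transpose_mult)
  have "(Q * S * P)\<^sup>T * (P\<^sup>T * G * P) * (Q * S * P) = P\<^sup>T * (S\<^sup>T * G * S) * P"
    using d by (simp add: mat_ring mat_cancel_left[OF PQ] mat_cancel_left[OF P(3)])
  also have "\<dots> = 2 \<cdot>\<^sub>m (P\<^sup>T * G * P)" unfolding G(5) using d by (simp add: mat_ring)
  finally have "(Q * S * P)\<^sup>T * (P\<^sup>T * G * P) * (Q * S * P) = 2 \<cdot>\<^sub>m (P\<^sup>T * G * P)" .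
  moreover have "Q * S * P \<in> carrier_mat n n" "P\<^sup>T * G * P \<in> carrier_mat n n" using d by auto
  ultimately show ?thesis unfolding doubling_def
    using anisotropic_congruent[OF G(1,3) P(1,2,4)] symmetric_congruent[OF G(1) P(1) G(2)] by blast
qed

text \<open>The reflection in the hyperplane orthogonal to w exchanges two vectors of equal norm that
  differ by w, and fixes every vector orthogonal to w.\<close>

lemma reflection_moving:
  fixes G u v :: "rat mat"
  assumes G: "G \<in> carrier_mat n n" "G\<^sup>T = G" "anisotropic n G"
    and u: "u \<in> carrier_mat n 1" and v: "v \<in> carrier_mat n 1" and uv: "u\<^sup>T * G * u = v\<^sup>T * G * v"
  obtains R where "R \<in> carrier_mat n n" "R\<^sup>T * G * R = G" "R * u = v"
    "\<And>y. y \<in> carrier_mat n 1 \<Longrightarrow> y\<^sup>T * G * u = y\<^sup>T * G * v \<Longrightarrow> R * y = y"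
proof (cases "u = v")
  case True
  then show thesis using that[of "1\<^sub>m n"] G u by simp
next
  case False
  define w where "w = u - v"
  have w: "w \<in> carrier_mat n 1" using u v unfolding w_def by (intro carrier_matI) auto
  have "w \<noteq> 0\<^sub>m n 1"
  proof
    assume w0: "w = 0\<^sub>m n 1"
    have "u = v"
    proof (rule eq_matI)
      fix i j assume "i < dim_row v" "j < dim_col v"
      then show "u $$ (i, j) = v $$ (i, j)"
        using arg_cong[OF w0, of "\<lambda>A. A $$ (i, j)"] u v by (simp add: w_def)
    qed (use u v in auto)
    then show False using False by simp
  qed
  define s where "s = ent (w\<^sup>T * G * w)"
  have s: "s \<noteq> 0" using G w \<open>w \<noteq> 0\<^sub>m n 1\<close> by (auto simp: anisotropic_def s_def)
  have d: "dim_row w = n" "dim_col w = 1" "dim_row G = n" "dim_col G = n" "dim_row u = n" "dim_col u = 1"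
    "dim_row v = n" "dim_col v = 1"
    using w G u v by auto
  have wGw: "w\<^sup>T * G * w = s \<cdot>\<^sub>m 1\<^sub>m 1" unfolding s_def by (rule ent_scalar) (use d in auto)
  \<comment> \<open>T / s is the orthogonal projection onto the line of w, so R, which subtracts it
    twice from the identity, is the reflection.\<close>
  define T where "T = w * (w\<^sup>T * G)"
  define R where "R = 1\<^sub>m n - (2 / s) \<cdot>\<^sub>m T"
  have dT: "dim_row T = n" "dim_col T = n" "dim_row R = n" "dim_col R = n" using d by (auto simp: T_def R_def)
  have TG: "T\<^sup>T * G = G * T" using d G(2) by (simp add: T_def mat_ring)
  have TT: "T * T = s \<cdot>\<^sub>m T"
  proof -
    have "T * T = w * ((w\<^sup>T * G * w) * (w\<^sup>T * G))" using d by (simp add: T_def mat_ring)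
    also have "\<dots> = s \<cdot>\<^sub>m T" unfolding wGw T_def using d by (simp add: mat_ring)
    finally show ?thesis .
  qed
  have RT: "R\<^sup>T = 1\<^sub>m n - (2 / s) \<cdot>\<^sub>m T\<^sup>T"
    using dT by (intro eq_matI) (auto simp: R_def)
  have RTG: "R\<^sup>T * G = G * R"
    unfolding RT using d dT TG by (simp add: mat_ring R_def)
  have RR: "R * R = 1\<^sub>m n"
  proof -
    have "R * R = R - (2 / s) \<cdot>\<^sub>m (T - (2 / s) \<cdot>\<^sub>m (T * T))"
      unfolding R_def using d dT by (simp add: mat_ring)
    also have "\<dots> = 1\<^sub>m n" unfolding TT R_def using d dT s
      by (intro eq_matI) (auto simp: field_simps)
    finally show ?thesis .
  qed
  have "R\<^sup>T * G * R = G" unfolding RTG using d dT RR by (simp add: mat_ring)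
  moreover have Ry: "R * y = y - (2 / s * ent (w\<^sup>T * G * y)) \<cdot>\<^sub>m w" if "y \<in> carrier_mat n 1" for y
  proof -
    have dy: "dim_row y = n" "dim_col y = 1" using that by auto
    have wy: "w\<^sup>T * G * y = (ent (w\<^sup>T * G * y)) \<cdot>\<^sub>m 1\<^sub>m 1" by (rule ent_scalar) (use d dy in auto)
    have "T * y = w * (w\<^sup>T * G * y)" using d dy by (simp add: T_def mat_ring)
    also have "\<dots> = (ent (w\<^sup>T * G * y)) \<cdot>\<^sub>m w" by (subst wy) (use d in \<open>simp add: mat_ring\<close>)
    finally have "T * y = (ent (w\<^sup>T * G * y)) \<cdot>\<^sub>m w" .
    then show ?thesis unfolding R_def using d dy dT by (simp add: mat_ring) (intro eq_matI, auto)
  qed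
  have tr: "ent (a\<^sup>T * G * b) = ent (b\<^sup>T * G * a)"
    if "a \<in> carrier_mat n 1" "b \<in> carrier_mat n 1" for a b
  proof -
    have "(a\<^sup>T * G * b)\<^sup>T = b\<^sup>T * G * a" using that d G(2) by (simp add: mat_ring)
    then have "ent (b\<^sup>T * G * a) = ent ((a\<^sup>T * G * b)\<^sup>T)" by simp
    also have "\<dots> = ent (a\<^sup>T * G * b)" using that by (intro ent_transpose) auto
    finally show ?thesis by simp
  qed
  have lin: "ent (a\<^sup>T * G * w) = ent (a\<^sup>T * G * u) - ent (a\<^sup>T * G * v)"
    if "a \<in> carrier_mat n 1" for a
    unfolding w_def using that d by (simp add: mat_diff_distrib ent_minus)
  have "R * u = v"
  proof -
    \<comment> \<open>As u and v have equal norms, the norm of w is twice the product of w and u, so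
      the reflection subtracts w from u exactly once and reaches v.\<close>
    have "s = 2 * ent (w\<^sup>T * G * u)"
    proof -
      have "s = ent (w\<^sup>T * G * u) - ent (w\<^sup>T * G * v)"
        using lin[OF w] by (simp add: s_def)
      moreover have "ent (w\<^sup>T * G * u) = ent (u\<^sup>T * G * u) - ent (u\<^sup>T * G * v)"
        using lin[OF u] tr[OF w u] by simp
      moreover have "ent (w\<^sup>T * G * v) = ent (v\<^sup>T * G * u) - ent (v\<^sup>T * G * v)"
        using lin[OF v] tr[OF w v] by simp
      ultimately show ?thesis using tr[OF u v] uv by simp
    qed
    then have "2 / s * ent (w\<^sup>T * G * u) = 1" using s by (simp add: field_simps)
    then show ?thesis using Ry[OF u] d by (simp add: w_def) (intro eq_matI, auto)
  qed
  moreover have "R * y = y" if y: "y \<in> carrier_mat n 1" "y\<^sup>T * G * u = y\<^sup>T * G * v" for y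
  proof -
    have "ent (w\<^sup>T * G * y) = 0" using lin[OF y(1)] tr[OF w y(1)] y(2) by simp
    then show ?thesis using Ry[OF y(1)] y d by simp (intro eq_matI, auto)
  qed
  moreover have "R \<in> carrier_mat n n" using dT by auto
  ultimately show thesis using that by blast
qed


text \<open>The first basis vector is not an eigenvector of S: comparing norms, the square of an
  eigenvalue would be 2, which is not a rational square.\<close>

lemma doubling_diagonal:
  assumes "doubling n G S" "0 < n"
  shows "G $$ (0, 0) \<noteq> 0" "\<exists>j<n. j \<noteq> 0 \<and> S $$ (j, 0) \<noteq> 0"
proof -
  have G: "G \<in> carrier_mat n n" "anisotropic n G" "S \<in> carrier_mat n n" "S\<^sup>T * G * S = 2 \<cdot>\<^sub>m G"
    using assms by (auto simp: doubling_def)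
  have qf: "ent ((A * unit_col n 0)\<^sup>T * G * (A * unit_col n 0)) = (A\<^sup>T * G * A) $$ (0, 0)"
    if "A \<in> carrier_mat n n" for A
  proof -
    have "(A * unit_col n 0)\<^sup>T * G * (A * unit_col n 0) = (unit_col n 0)\<^sup>T * ((A\<^sup>T * G * A) * unit_col n 0)"
      using that G by (simp add: mat_ring)
    moreover have "((unit_col n 0)\<^sup>T * B) $$ (0, 0) = B $$ (0, 0)" if "B \<in> carrier_mat n 1" for B :: "rat mat"
      using that assms(2) by (simp add: scalar_prod_def unit_col_def if_distrib[of "\<lambda>x. x * _"] sum.delta cong: if_cong)
    moreover have "(A\<^sup>T * G * A) * unit_col n 0 \<in> carrier_mat n 1" using that by (intro carrier_matI) auto
    moreover have "((A\<^sup>T * G * A) * unit_col n 0) $$ (0, 0) = (A\<^sup>T * G * A) $$ (0, 0)"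
      using that assms(2) by (intro mult_unit_col) auto
    ultimately show ?thesis unfolding ent_def by simp
  qed
  have "unit_col n 0 \<noteq> (0\<^sub>m n 1 :: rat mat)"
  proof
    assume "unit_col n 0 = (0\<^sub>m n 1 :: rat mat)"
    then have "unit_col n 0 $$ (0, 0) = (0\<^sub>m n 1 :: rat mat) $$ (0, 0)" by simp
    then show False using assms(2) by (simp add: unit_col_index)
  qed
  moreover have "(unit_col n 0 :: rat mat) \<in> carrier_mat n 1" by (intro carrier_matI) auto
  ultimately have "ent ((unit_col n 0)\<^sup>T * G * unit_col n 0) \<noteq> 0"
    using G(2) by (simp add: anisotropic_def)
  then show nz: "G $$ (0, 0) \<noteq> 0" using qf[of "1\<^sub>m n"] G(1) by (simp add: mat_ring)
  show "\<exists>j<n. j \<noteq> 0 \<and> S $$ (j, 0) \<noteq> 0"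
  proof (rule ccontr)
    assume "\<not> ?thesis"
    then have *: "S $$ (j, 0) = 0" if "j < n" "j \<noteq> 0" for j using that by blast
    have "(S\<^sup>T * G * S) $$ (0, 0) = (\<Sum>a<n. \<Sum>b<n. S $$ (a, 0) * G $$ (a, b) * S $$ (b, 0))"
      using congruent_entry[OF G(1,3)] assms(2) by blast
    also have "\<dots> = (\<Sum>a<n. if a = 0 then \<Sum>b<n. if b = 0 then S $$ (0, 0) * G $$ (0, 0) * S $$ (0, 0) else 0 else 0)"
    proof (intro sum.cong refl)
      fix a assume "a \<in> {..<n}"
      moreover have "(\<Sum>b<n. S $$ (0, 0) * G $$ (0, b) * S $$ (b, 0)) =
          (\<Sum>b<n. if b = 0 then S $$ (0, 0) * G $$ (0, 0) * S $$ (0, 0) else 0)"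
        using * by (intro sum.cong refl) auto
      ultimately show "(\<Sum>b<n. S $$ (a, 0) * G $$ (a, b) * S $$ (b, 0)) =
          (if a = 0 then \<Sum>b<n. if b = 0 then S $$ (0, 0) * G $$ (0, 0) * S $$ (0, 0) else 0 else 0)"
        using * by (cases "a = 0") auto
    qed
    also have "\<dots> = (S $$ (0, 0))\<^sup>2 * G $$ (0, 0)" using assms(2) by (simp add: power2_eq_square)
    finally have "(S $$ (0, 0))\<^sup>2 * G $$ (0, 0) = 2 * G $$ (0, 0)"
      unfolding G(4) using assms(2) G(1) by simp
    then show False using nz rat_two_not_square[of "S $$ (0, 0)"] by simp
  qed
qed

text \<open>S preserves the first summand and acts there by the invertible A. The off-diagonal block
  of the similarity equation reads \<open>A\<^sup>T * (K * Q) = 0\<^sub>m k l\<close>, which forces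
  Q = 0: a similarity that preserves a nondegenerate subspace preserves its orthogonal
  complement.\<close>

lemma doubling_block_sum:
  assumes D: "doubling (k + l) (block_sum K W) S" and K: "K \<in> carrier_mat k k" and W: "W \<in> carrier_mat l l"
    and J: "J \<in> carrier_mat k k" "J * K = 1\<^sub>m k"
    and A: "A \<in> carrier_mat k k" "det A \<noteq> 0"
    and S: "\<And>i j. i < k + l \<Longrightarrow> j < k \<Longrightarrow> S $$ (i, j) = (if i < k then A $$ (i, j) else 0)"
  shows "\<exists>T. doubling l W T"
proof -
  have G: "block_sum K W \<in> carrier_mat (k + l) (k + l)" "(block_sum K W)\<^sup>T = block_sum K W"
    "anisotropic (k + l) (block_sum K W)" "S \<in> carrier_mat (k + l) (k + l)"
    "S\<^sup>T * block_sum K W * S = 2 \<cdot>\<^sub>m block_sum K W"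
    using D by (auto simp: doubling_def)
  obtain S1 Q S3 T where s: "split_block S k k = (S1, Q, S3, T)" by (cases "split_block S k k") auto
  have b: "S1 \<in> carrier_mat k k" "Q \<in> carrier_mat k l" "S3 \<in> carrier_mat l k" "T \<in> carrier_mat l l"
    "S = four_block_mat S1 Q S3 T"
    using split_block[OF s, of l l] G(4) by auto
  have "S1 = A"
  proof (rule eq_matI)
    fix i j assume "i < dim_row A" "j < dim_col A"
    then show "S1 $$ (i, j) = A $$ (i, j)" using S[of i j] b A by simp
  qed (use A b in auto)
  have "S3 = 0\<^sub>m l k"
  proof (rule eq_matI)
    fix i j assume "i < dim_row (0\<^sub>m l k :: rat mat)" "j < dim_col (0\<^sub>m l k :: rat mat)"
    then show "S3 $$ (i, j) = 0\<^sub>m l k $$ (i, j)" using S[of "k + i" j] b by simp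
  qed (use A b in auto)
  note b = b[unfolded \<open>S1 = A\<close> \<open>S3 = 0\<^sub>m l k\<close>]
  have [simp]: "dim_row K = k" "dim_col K = k" "dim_row W = l" "dim_col W = l" "dim_row A = k" "dim_col A = k"
    "dim_row Q = k" "dim_col Q = l" "dim_row T = l" "dim_col T = l" "dim_row J = k" "dim_col J = k"
    using K W A b J by auto
  have Z: "0\<^sub>m k l \<in> carrier_mat k l" "0\<^sub>m l k \<in> carrier_mat l k" "A\<^sup>T \<in> carrier_mat k k" "Q\<^sup>T \<in> carrier_mat l k"
    "T\<^sup>T \<in> carrier_mat l l" using A b by auto
  have ST: "S\<^sup>T = four_block_mat A\<^sup>T (0\<^sub>m k l) Q\<^sup>T T\<^sup>T"
    unfolding b(5) using transpose_four_block_mat[OF A(1) b(2) Z(2) b(4)] by simp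
  have GS: "block_sum K W * S = four_block_mat (K * A) (K * Q) (0\<^sub>m l k) (W * T)"
    unfolding b(5) using mult_four_block_mat[OF K Z(1,2) W A(1) b(2) Z(2) b(4)] K W A b by simp
  have c: "K * A \<in> carrier_mat k k" "K * Q \<in> carrier_mat k l" "W * T \<in> carrier_mat l l"
    by (auto intro!: carrier_matI)
  have "S\<^sup>T * (block_sum K W * S) =
      four_block_mat (A\<^sup>T * (K * A)) (A\<^sup>T * (K * Q)) (Q\<^sup>T * (K * A)) (Q\<^sup>T * (K * Q) + T\<^sup>T * (W * T))"
    unfolding GS ST using mult_four_block_mat[OF Z(3,1,4,5) c(1,2) Z(2) c(3)] Z c
    by (simp add: right_add_zero_mat[of _ k k] right_add_zero_mat[of _ k l] right_add_zero_mat[of _ l k] carrier_matI)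
  then have E: "four_block_mat (A\<^sup>T * (K * A)) (A\<^sup>T * (K * Q)) (Q\<^sup>T * (K * A)) (Q\<^sup>T * (K * Q) + T\<^sup>T * (W * T)) =
      2 \<cdot>\<^sub>m block_sum K W"
    using G(5) carrier_matD[OF G(4)] by (simp add: mat_assoc)
  have "A\<^sup>T * (K * Q) = 0\<^sub>m k l"
  proof (rule eq_matI)
    fix i j assume "i < dim_row (0\<^sub>m k l :: rat mat)" "j < dim_col (0\<^sub>m k l :: rat mat)"
    then show "(A\<^sup>T * (K * Q)) $$ (i, j) = 0\<^sub>m k l $$ (i, j)"
      using arg_cong[OF E, of "\<lambda>M. M $$ (i, k + j)"] by (simp del: index_mult_mat(1))
  qed auto
  moreover obtain B where B: "B \<in> carrier_mat k k" "A * B = 1\<^sub>m k" using field_mat_inverse[OF A] by blast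
  have "B\<^sup>T * A\<^sup>T = 1\<^sub>m k" using arg_cong[OF B(2), of transpose_mat] carrier_matD[OF B(1)]
    by (simp add: mat_transpose_mult)
  then have "B\<^sup>T * (A\<^sup>T * (K * Q)) = K * Q" using carrier_matD[OF B(1)] by (intro mat_cancel_left) auto
  ultimately have "K * Q = 0\<^sub>m k l" using B by simp
  then have "Q = 0\<^sub>m k l" using mat_cancel_left[OF J(2), of Q] J by simp
  have "T\<^sup>T * W * T = 2 \<cdot>\<^sub>m W"
  proof (rule eq_matI)
    fix i j assume "i < dim_row (2 \<cdot>\<^sub>m W)" "j < dim_col (2 \<cdot>\<^sub>m W)"
    then show "(T\<^sup>T * W * T) $$ (i, j) = (2 \<cdot>\<^sub>m W) $$ (i, j)"
      using arg_cong[OF E, of "\<lambda>M. M $$ (k + i, k + j)"] \<open>Q = 0\<^sub>m k l\<close>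
      by (simp del: index_mult_mat(1) add: mat_assoc)
  qed auto
  moreover have "anisotropic l W" "W\<^sup>T = W"
  proof -
    obtain E where E: "block_sum K W * E = E * W" "E\<^sup>T * E = 1\<^sub>m l" "E \<in> carrier_mat (k + l) l"
      using block_embedding[OF K W] by blast
    have "E\<^sup>T * block_sum K W * E = W"
      using E mat_cancel_left[OF E(2), of W] by (simp add: mat_assoc)
    then show "anisotropic l W" using anisotropic_congruent[OF G(1,3) E(3) _ E(2)] E(3) by simp
    have "(E\<^sup>T * block_sum K W * E)\<^sup>T = E\<^sup>T * block_sum K W * E"
      using carrier_matD[OF E(3)] G(2) by (simp add: mat_ring)
    then show "W\<^sup>T = W" unfolding \<open>E\<^sup>T * block_sum K W * E = W\<close> .
  qed
  ultimately show ?thesis using W b(4) unfolding doubling_def by blast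
qed


theorem doubling_determinant:
  assumes "doubling n G S"
  shows "even n \<and> det G \<noteq> 0 \<and> (\<forall>p. two_nonresidue p \<longrightarrow> even (rat_val p (det G)))"
  using assms
proof (induction n arbitrary: G S rule: less_induct)
  case (less n)
  have G: "G \<in> carrier_mat n n" "G\<^sup>T = G" "S \<in> carrier_mat n n" "S\<^sup>T * G * S = 2 \<cdot>\<^sub>m G"
    using less.prems by (auto simp: doubling_def)
  show ?case
  proof (cases "n = 0")
    case True
    then have "det G = 1" using G by simp
    moreover have "rat_val p 1 = 0" if "two_nonresidue p" for p
      using rat_val_unit[of p 1] that by (simp add: two_nonresidue_def)
    ultimately show ?thesis using True by simp
  next
    case False
    then have n0: "0 < n" by simp
    obtain j where j: "j < n" "j \<noteq> 0" "S $$ (j, 0) \<noteq> 0" using doubling_diagonal(2)[OF less.prems n0] by blast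
    then have n1: "1 < n" by auto
    then obtain l where l: "n = 2 + l" by (metis Suc_1 Suc_leI le_Suc_ex)
    have "(S * unit_col n 0) $$ (j, 0) \<noteq> 0" using mult_unit_col[of S n j 0] j n0 G by simp
    \<comment> \<open>The new basis starts with x = e_0 and y = S x; they are independent because S
      x has a nonzero entry outside place 0.\<close>
    then obtain P where P: "P \<in> carrier_mat n n" "det P \<noteq> 0" "P * unit_col n 0 = unit_col n 0"
      "P * unit_col n 1 = S * unit_col n 0"
      using extend_to_basis[of "S * unit_col n 0" n j] j G by (metis carrier_matI index_mult_mat(2,3) unit_col_dim(2) carrier_matD(1))
    obtain Q where Q: "Q \<in> carrier_mat n n" "P * Q = 1\<^sub>m n" "Q * P = 1\<^sub>m n" using field_mat_inverse[OF P(1,2)] by blast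
    define G1 S1 where "G1 = P\<^sup>T * G * P" and "S1 = Q * S * P"
    have D1: "doubling n G1 S1" using doubling_conjugate[OF less.prems P(1) Q] by (simp add: G1_def S1_def)
    have S1e: "S1 * unit_col n 0 = unit_col n 1"
    proof -
      have "S1 * unit_col n 0 = Q * (S * (P * unit_col n 0))" using carrier_matD[OF Q(1)] carrier_matD[OF P(1)] carrier_matD[OF G(3)]
        by (simp add: S1_def mat_assoc)
      also have "\<dots> = Q * (P * unit_col n 1)" unfolding P(3,4) ..
      also have "\<dots> = unit_col n 1" using carrier_matD[OF Q(1)] carrier_matD[OF P(1)] by (simp add: mat_cancel_left[OF Q(3)])
      finally show ?thesis .
    qed
    have G1: "G1 \<in> carrier_mat n n" "G1\<^sup>T = G1" "S1 \<in> carrier_mat n n" "S1\<^sup>T * G1 * S1 = 2 \<cdot>\<^sub>m G1"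
      using D1 by (auto simp: doubling_def)
    obtain K X W where b: "K \<in> carrier_mat 2 2" "X \<in> carrier_mat 2 l" "W \<in> carrier_mat l l"
      "K\<^sup>T = K" "W\<^sup>T = W" "G1 = four_block_mat K X X\<^sup>T W"
      using symmetric_blocks[of G1 2 l] G1 l by metis
    define a c where "a = K $$ (0, 0)" and "c = K $$ (0, 1)"
    have S1i: "S1 $$ (i, 0) = (if i = 1 then 1 else 0)" if "i < n" for i
    proof -
      have "S1 $$ (i, 0) = (S1 * unit_col n 0) $$ (i, 0)"
        using that G1(3) n0 by (intro mult_unit_col[symmetric]) auto
      then show ?thesis unfolding S1e unit_col_index[OF that] .
    qed
    \<comment> \<open>The norm of y = S x is twice the norm a of x, so the plane of x and y has
      diagonal a, 2 a and off-diagonal entry c.\<close>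
    have "2 * a = G1 $$ (1, 1)"
    proof -
      have "(S1\<^sup>T * G1 * S1) $$ (0, 0) = (\<Sum>x<n. \<Sum>y<n. S1 $$ (x, 0) * G1 $$ (x, y) * S1 $$ (y, 0))"
        using congruent_entry[OF G1(1,3)] n0 by blast
      also have "\<dots> = (\<Sum>x<n. if x = 1 then \<Sum>y<n. if y = 1 then G1 $$ (1, 1) else 0 else 0)"
      proof (intro sum.cong refl)
        fix x assume "x \<in> {..<n}"
        moreover have "(\<Sum>y<n. S1 $$ (1, 0) * G1 $$ (1, y) * S1 $$ (y, 0)) = (\<Sum>y<n. if y = 1 then G1 $$ (1, 1) else 0)"
          using S1i n1 by (intro sum.cong refl) auto
        ultimately show "(\<Sum>y<n. S1 $$ (x, 0) * G1 $$ (x, y) * S1 $$ (y, 0)) =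
            (if x = 1 then \<Sum>y<n. if y = 1 then G1 $$ (1, 1) else 0 else 0)"
          using S1i by (cases "x = 1") auto
      qed
      also have "\<dots> = G1 $$ (1, 1)" using n1 by simp
      finally show ?thesis unfolding G1(4) using n0 b by (simp add: a_def)
    qed
    then have K11: "K $$ (1, 1) = 2 * a" using b by simp
    have K10: "K $$ (1, 0) = c" using arg_cong[OF b(4), of "\<lambda>A. A $$ (0, 1)"] b(1) by (simp add: c_def)
    have K: "K = m2 a c c (2 * a)" using m2_eqI[OF b(1)] K11 K10 by (simp add: a_def c_def)
    have detK: "det K = 2 * a\<^sup>2 - c\<^sup>2" unfolding K m2_det by (simp add: power2_eq_square)
    have "a \<noteq> 0" using doubling_diagonal(1)[OF D1 n0] b by (simp add: a_def)
    then have nz: "2 * a\<^sup>2 - c\<^sup>2 \<noteq> 0"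
      using rat_two_not_square[of "c / a"] by (auto simp: field_simps)
    then obtain J where J: "J \<in> carrier_mat 2 2" "K * J = 1\<^sub>m 2" "J * K = 1\<^sub>m 2"
      using field_mat_inverse[OF b(1)] detK by metis
    define U where "U = four_block_mat (1\<^sub>m 2) (- (J * X)) (0\<^sub>m l 2) (1\<^sub>m l)"
    define W' where "W' = W - X\<^sup>T * (J * X)"
    note be = block_elimination[OF b(1,4,2,3) J, folded U_def W'_def, folded b(6) l]
    have W': "W' \<in> carrier_mat l l" using b J by (auto simp: W'_def)
    obtain V where V: "V \<in> carrier_mat n n" "U * V = 1\<^sub>m n" "V * U = 1\<^sub>m n"
      using field_mat_inverse[OF be(3)] be(2) by (metis zero_neq_one)
    define S2 where "S2 = V * S1 * U"
    define G2 where "G2 = block_sum K W'"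
    have D2: "doubling n G2 S2" using doubling_conjugate[OF D1 be(3) V] be(1) by (simp add: G2_def S2_def)
    have G2: "G2 \<in> carrier_mat n n" "G2\<^sup>T = G2" "S2 \<in> carrier_mat n n" "S2\<^sup>T * G2 * S2 = 2 \<cdot>\<^sub>m G2"
      "anisotropic n G2"
      using D2 by (auto simp: doubling_def)
    have Ue: "U * unit_col n k = unit_col n k" if "k < 2" for k
      by (rule mult_unit_col_eqI) (use that n1 l in \<open>auto simp: unit_col_index U_def\<close>)
    note dims = carrier_matD[OF V(1)] carrier_matD[OF be(3)] carrier_matD[OF G1(3)] carrier_matD[OF G2(1)] carrier_matD[OF G2(3)]
    have S2e: "S2 * unit_col n 0 = unit_col n 1"
    proof -
      have "S2 * unit_col n 0 = V * (S1 * (U * unit_col n 0))" using dims by (simp add: S2_def mat_assoc)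
      also have "\<dots> = V * (U * unit_col n 1)" using Ue S1e by simp
      also have "\<dots> = unit_col n 1" using dims by (simp add: mat_cancel_left[OF V(3)])
      finally show ?thesis .
    qed
    let ?e0 = "unit_col n 0 :: rat mat" and ?e1 = "unit_col n 1 :: rat mat"
    have S2S: "(S2 * x)\<^sup>T * G2 * (S2 * y) = 2 \<cdot>\<^sub>m (x\<^sup>T * G2 * y)" if "x \<in> carrier_mat n 1" "y \<in> carrier_mat n 1" for x y
    proof -
      have "(S2 * x)\<^sup>T * G2 * (S2 * y) = x\<^sup>T * ((S2\<^sup>T * G2 * S2) * y)"
        using that dims by (simp add: mat_ring)
      then show ?thesis unfolding G2(4) using that dims by (simp add: mat_ring)
    qed
    have ec: "?e0 \<in> carrier_mat n 1" "?e1 \<in> carrier_mat n 1" "S2 * ?e1 \<in> carrier_mat n 1" "2 \<cdot>\<^sub>m ?e0 \<in> carrier_mat n 1"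
      using dims by (auto intro!: carrier_matI)
    have t01: "?e1\<^sup>T * G2 * ?e0 = ?e0\<^sup>T * G2 * ?e1"
    proof -
      have "(?e1\<^sup>T * G2 * ?e0)\<^sup>T = ?e0\<^sup>T * G2 * ?e1" using dims G2(2) by (simp add: mat_ring)
      moreover have "A\<^sup>T = A" if "dim_row A = 1" "dim_col A = 1" for A :: "rat mat"
        using that by (intro eq_matI) auto
      ultimately show ?thesis by simp
    qed
    have e11: "?e1\<^sup>T * G2 * ?e1 = 2 \<cdot>\<^sub>m (?e0\<^sup>T * G2 * ?e0)" using S2S[OF ec(1,1)] S2e by simp
    have n1': "(S2 * ?e1)\<^sup>T * G2 * (S2 * ?e1) = (2 \<cdot>\<^sub>m ?e0)\<^sup>T * G2 * (2 \<cdot>\<^sub>m ?e0)"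
    proof -
      have "(2 \<cdot>\<^sub>m ?e0)\<^sup>T = 2 \<cdot>\<^sub>m ?e0\<^sup>T" by (rule eq_matI) auto
      then show ?thesis unfolding S2S[OF ec(2,2)] e11 using dims by (simp add: mat_ring)
    qed
    \<comment> \<open>S y and 2 x both have norm 4 a, so a reflection carries one to the other. It
      fixes y, because the product of y with S y, that is of S x with S y, is twice that of x with
      y.\<close>
    obtain R where R: "R \<in> carrier_mat n n" "R\<^sup>T * G2 * R = G2" "R * (S2 * ?e1) = 2 \<cdot>\<^sub>m ?e0"
      "\<And>y. y \<in> carrier_mat n 1 \<Longrightarrow> y\<^sup>T * G2 * (S2 * ?e1) = y\<^sup>T * G2 * (2 \<cdot>\<^sub>m ?e0) \<Longrightarrow> R * y = y"
      using reflection_moving[OF G2(1,2,5) ec(3,4) n1'] by blast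
    have "?e1\<^sup>T * G2 * (S2 * ?e1) = ?e1\<^sup>T * G2 * (2 \<cdot>\<^sub>m ?e0)"
      using S2S[OF ec(1,2)] dims t01 by (simp add: S2e mat_smult_right)
    then have Re1: "R * ?e1 = ?e1" using R(4) ec by blast
    define S3 where "S3 = R * S2"
    have S3: "S3 \<in> carrier_mat n n" using R G2 by (simp add: S3_def)
    have "S3\<^sup>T * G2 * S3 = S2\<^sup>T * (R\<^sup>T * G2 * R) * S2"
      using dims carrier_matD[OF R(1)] by (simp add: S3_def mat_ring)
    then have D3: "doubling n G2 S3" using D2 S3 unfolding doubling_def R(2) by simp
    have S3e0: "S3 * ?e0 = ?e1" and S3e1: "S3 * ?e1 = 2 \<cdot>\<^sub>m ?e0"
      using dims carrier_matD[OF R(1)] R(3) Re1 S2e by (simp_all add: S3_def mat_assoc)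
    \<comment> \<open>The corrected similarity sends x to y and y to 2 x, so it preserves the
      plane.\<close>
    have S3i: "S3 $$ (i, j) = (if i < 2 then m2 0 2 1 0 $$ (i, j) else 0)" if "i < n" "j < 2" for i j
    proof -
      have "S3 $$ (i, k) = (S3 * unit_col n k) $$ (i, 0)" if "k < n" for k
        using that \<open>i < n\<close> S3 by (intro mult_unit_col[symmetric]) auto
      from this[OF n0] this[OF n1] have "S3 $$ (i, 0) = (if i = 1 then 1 else 0)" "S3 $$ (i, 1) = (if i = 0 then 2 else 0)"
        unfolding S3e0 S3e1 using that by (simp_all add: unit_col_index)
      moreover have "i = 0 \<or> i = 1 \<or> \<not> i < 2" "j = 0 \<or> j = 1" using that by auto
      ultimately show ?thesis by (elim disjE) auto
    qed
    have m: "det (m2 0 2 1 (0::rat)) \<noteq> 0" by (simp add: m2_det)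
    obtain T where T: "doubling l W' T"
      using doubling_block_sum[OF D3[unfolded l G2_def] b(1) W' J(1,3) m2_carrier m S3i[unfolded l]] by blast
    have IH: "even l" "det W' \<noteq> 0" "\<And>p. two_nonresidue p \<Longrightarrow> even (rat_val p (det W'))"
      using less.IH[OF _ T] l by auto
    have dG: "(det P)\<^sup>2 * det G = (2 * a\<^sup>2 - c\<^sup>2) * det W'"
      using det_congruent[OF G(1) P(1)] det_congruent[OF G1(1) be(3)] be(1,2) det_block_sum[OF b(1) W'] detK
      by (simp add: G1_def)
    then have dG0: "det G \<noteq> 0" using nz IH(2) by auto
    have "even (rat_val p (det G))" if p: "two_nonresidue p" for p
    proof -
      have pp: "prime p" using p by (simp add: two_nonresidue_def)
      have "rat_val p ((det P)\<^sup>2) + rat_val p (det G) = rat_val p (2 * a\<^sup>2 - c\<^sup>2) + rat_val p (det W')"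
        using rat_val_mult[OF pp, of "(det P)\<^sup>2" "det G"] rat_val_mult[OF pp nz IH(2)] dG dG0 P(2) by simp
      moreover have "even (rat_val p ((det P)\<^sup>2))" using rat_val_power[OF pp P(2)] by simp
      ultimately show ?thesis using even_rat_val_norm[OF p nz] IH(3)[OF p] by presburger
    qed
    then show ?thesis using IH(1) l dG0 by simp
  qed
qed

section \<open>The number two as a square\<close>

text \<open>Gauss's lemma with h = (p - 1) / 2: the set E collects the doubles 2 x with 1 \<le> x
  \<le> h that exceed h, and no reduction modulo p takes place. These x are the ones above
  \<open>h div 2\<close>.\<close>

lemma Legendre_two:
  assumes "prime p" "2 < p"
  shows "Legendre 2 (int p) = (-1) ^ nat ((int p - 1) div 2 - (int p - 1) div 2 div 2)"
proof -
  have "[2 \<noteq> 0] (mod int p)"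
    using assms by (simp add: cong_iff_dvd_diff zdvd_not_zless)
  then interpret GAUSS p 2
    using assms by unfold_locales auto
  define h where "h = (int p - 1) div 2"
  have h: "int p = 2 * h + 1" using p_eq2 by (simp add: h_def)
  have "E = (\<lambda>x. 2 * x) ` {h div 2 <.. h}"
  proof
    show "E \<subseteq> (\<lambda>x. 2 * x) ` {h div 2 <.. h}"
    proof
      fix y assume "y \<in> E"
      then obtain x where x: "0 < x" "x \<le> h" "y = (x * 2) mod int p" "h < y"
        by (auto simp: E_def C_def B_def A_def h_def)
      then have "y = 2 * x" using h by simp
      with x show "y \<in> (\<lambda>x. 2 * x) ` {h div 2 <.. h}" by (intro image_eqI[of _ _ x]) auto
    qed
    show "(\<lambda>x. 2 * x) ` {h div 2 <.. h} \<subseteq> E"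
    proof
      fix y assume "y \<in> (\<lambda>x. 2 * x) ` {h div 2 <.. h}"
      then obtain x where x: "h div 2 < x" "x \<le> h" "y = 2 * x" by auto
      then have "0 < x" "h < y" using h p_ge_2 by auto
      moreover have "y = (x * 2) mod int p" using x h \<open>0 < x\<close> by simp
      ultimately show "y \<in> E" using x unfolding E_def C_def B_def A_def h_def[symmetric] by auto
    qed
  qed
  then have "card E = nat (h - h div 2)"
    by (simp add: card_image inj_on_def)
  then show ?thesis using gauss_lemma by (simp add: h_def)
qed

lemma two_nonresidue_mod_8:
  assumes p: "prime p" and "[int p = 3] (mod 8) \<or> [int p = -3] (mod 8)"
  shows "two_nonresidue p" "p \<noteq> 2"
proof -
  have m: "int p mod 8 = 3 \<or> int p mod 8 = 5" using assms(2) by (auto simp: cong_def)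
  then show "p \<noteq> 2" by auto
  then have p2: "2 < p" using prime_ge_2_nat[OF p] by simp
  define k where "k = int p div 8"
  have k: "int p = 8 * k + 3 \<or> int p = 8 * k + 5" using m by (auto simp: k_def) presburger+
  then have "(int p - 1) div 2 - (int p - 1) div 2 div 2 = 2 * k + 1" by auto
  moreover have "k \<ge> 0" by (simp add: k_def)
  ultimately have "Legendre 2 (int p) = -1"
    unfolding Legendre_two[OF p p2] by (simp add: nat_add_distrib nat_mult_distrib)
  then have nq: "\<not> QuadRes (int p) 2" by (auto simp: Legendre_def split: if_splits)
  show "two_nonresidue p"
    unfolding two_nonresidue_def
  proof (intro conjI allI impI p)
    fix x y :: int
    assume d: "int p dvd 2 * x\<^sup>2 - y\<^sup>2"
    have pi: "prime (int p)" using p by simp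
    show x: "int p dvd x"
    proof (rule ccontr)
      assume "\<not> int p dvd x"
      then have "coprime x (int p)" using pi by (metis coprime_commute prime_imp_coprime)
      \<comment> \<open>If x were invertible modulo p, then y times its inverse would be a square
        root of 2.\<close>
      then obtain z where z: "[x * z = 1] (mod int p)" using cong_solve_coprime_int by blast
      have "[y\<^sup>2 = 2 * x\<^sup>2] (mod int p)" using d by (simp add: cong_iff_dvd_diff dvd_diff_commute)
      then have "[(y * z)\<^sup>2 = 2 * (x * z)\<^sup>2] (mod int p)"
        using cong_mult[OF _ cong_refl[of "z\<^sup>2"]] by (simp add: power_mult_distrib flip: mult.assoc)
      also have "[2 * (x * z)\<^sup>2 = 2 * 1\<^sup>2] (mod int p)"
        by (intro cong_mult cong_pow z cong_refl)
      finally show False using nq by (auto simp: QuadRes_def)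
    qed
    then have "int p dvd 2 * x\<^sup>2" by (simp add: power2_eq_square)
    then have "int p dvd y\<^sup>2" using d by (metis dvd_diff_right_iff)
    then show "int p dvd y" using pi by (metis prime_dvd_power)
  qed
qed

lemma two_residue_mod_8:
  assumes p: "prime p" "p \<noteq> 2" and "\<not> ([int p = 3] (mod 8) \<or> [int p = -3] (mod 8))"
  obtains s :: int where "int p dvd s\<^sup>2 - 2"
proof -
  have p2: "2 < p" using prime_ge_2_nat[OF p(1)] p(2) by simp
  have "odd p" using prime_odd_nat[OF p(1) p2] .
  then have "int p mod 2 = 1" by presburger
  moreover have "int p mod 8 \<noteq> 3" "int p mod 8 \<noteq> 5" using assms(3) by (auto simp: cong_def)
  ultimately have m: "int p mod 8 = 1 \<or> int p mod 8 = 7" by presburger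
  define k where "k = int p div 8"
  have k: "k \<ge> 0" by (simp add: k_def)
  have "int p = 8 * k + 1 \<or> int p = 8 * k + 7" using m by (auto simp: k_def) presburger+
  then have "(int p - 1) div 2 - (int p - 1) div 2 div 2 = 2 * k \<or>
      (int p - 1) div 2 - (int p - 1) div 2 div 2 = 2 * (k + 1)" by auto
  then obtain j where "(int p - 1) div 2 - (int p - 1) div 2 div 2 = 2 * j" by blast
  moreover have "nat (2 * j) = 2 * nat j" by (simp add: nat_mult_distrib)
  ultimately have "Legendre 2 (int p) = 1" unfolding Legendre_two[OF p(1) p2] by simp
  then have "QuadRes (int p) 2" by (auto simp: Legendre_def split: if_splits)
  then obtain s where "[s\<^sup>2 = 2] (mod int p)" by (auto simp: QuadRes_def)
  then show thesis using that by (simp add: cong_iff_dvd_diff)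
qed

section \<open>Hensel lifting\<close>

text \<open>Newton's step: if t^2 - u = q c, then replacing t by t + q k turns the error into q (c +
  2 t k) modulo q^2. As 2 t is a unit, k can be chosen to make the bracket divisible by p.\<close>

lemma hensel_sqrt_odd_int:
  assumes p: "prime p" "p \<noteq> 2" and u: "\<not> int p dvd u" and s: "int p dvd s\<^sup>2 - u"
  shows "\<exists>t. int p ^ Suc N dvd t\<^sup>2 - u \<and> \<not> int p dvd t"
proof (induction N)
  case 0
  have "\<not> int p dvd s"
  proof
    assume "int p dvd s"
    then have "int p dvd s\<^sup>2" by (simp add: power2_eq_square)
    then show False using u s by (metis dvd_diff_right_iff)
  qed
  then show ?case using s by auto
next
  case (Suc N)
  then obtain t where t: "int p ^ Suc N dvd t\<^sup>2 - u" "\<not> int p dvd t" by blast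
  then obtain c where c: "t\<^sup>2 - u = int p ^ Suc N * c" by blast
  have pi: "prime (int p)" using p by simp
  have "\<not> int p dvd 2" using p by (metis pi primes_dvd_imp_eq two_is_prime_nat prime_nat_int_transfer of_nat_numeral nat_int_comparison(1))
  then have "\<not> int p dvd 2 * t" using t pi by (simp add: prime_dvd_mult_iff)
  then have "coprime (2 * t) (int p)" using pi by (metis coprime_commute prime_imp_coprime)
  then obtain z where z: "[2 * t * z = 1] (mod int p)" using cong_solve_coprime_int by blast
  define k where "k = - c * z"
  have "[c + 2 * t * k = c + - c * 1] (mod int p)"
    unfolding k_def using cong_mult[OF cong_refl[of "-c"] z] by (intro cong_add cong_refl) (simp add: mult_ac)
  then have "int p dvd c + 2 * t * k" by (simp add: cong_0_iff)
  then obtain d where d: "c + 2 * t * k = int p * d" by blast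
  define q where "q = int p ^ Suc N"
  have "(t + q * k)\<^sup>2 - u = q * (c + 2 * t * k) + q * q * k\<^sup>2"
    using c unfolding q_def[symmetric] by (simp add: power2_eq_square algebra_simps)
  also have "\<dots> = int p ^ Suc (Suc N) * (d + int p ^ N * k\<^sup>2)"
    unfolding d by (simp add: q_def algebra_simps)
  finally have "int p ^ Suc (Suc N) dvd (t + q * k)\<^sup>2 - u" by simp
  moreover have "int p dvd q * k" by (simp add: q_def)
  then have "\<not> int p dvd t + q * k" using t(2) by (metis dvd_add_left_iff)
  ultimately show ?case by blast
qed

text \<open>At 2 the derivative 2 t is not a unit, so the correction is taken half as large as the
  error: adding 2^(N+2) to t changes t^2 by 2^(N+3) t modulo 2^(N+4), which flips the next digit
  because t is odd. This is why the start must already be correct modulo 8.\<close>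

lemma hensel_sqrt_two_int:
  assumes u: "8 dvd u - (1::int)"
  shows "\<exists>t. 2 ^ (N + 3) dvd t\<^sup>2 - u \<and> odd t"
proof (induction N)
  case 0
  have "8 dvd 1\<^sup>2 - u" using u by (metis dvd_diff_commute power_one)
  then show ?case by (intro exI[of _ 1]) auto
next
  case (Suc N)
  then obtain t where t: "2 ^ (N + 3) dvd t\<^sup>2 - u" "odd t" by blast
  then obtain c where c: "t\<^sup>2 - u = 2 ^ (N + 3) * c" by blast
  show ?case
  proof (cases "even c")
    case True
    then obtain d where "c = 2 * d" by blast
    then have "t\<^sup>2 - u = 2 ^ (Suc N + 3) * d" using c by (simp add: power_add)
    then show ?thesis using t by (intro exI[of _ t]) simp
  next
    case False
    then have "even (c + t)" using t by simp
    then obtain d where d: "c + t = 2 * d" by blast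
    have "(t + 2 ^ (N + 2))\<^sup>2 - u = 2 ^ (N + 3) * (c + t) + 2 ^ (N + 4) * 2 ^ N"
      using c by (simp add: power2_eq_square algebra_simps power_add)
    also have "\<dots> = 2 ^ (Suc N + 3) * (d + 2 ^ N)" unfolding d by (simp add: algebra_simps power_add)
    finally have "2 ^ (Suc N + 3) dvd (t + 2 ^ (N + 2))\<^sup>2 - u" by simp
    then show ?thesis using t by (intro exI[of _ "t + 2 ^ (N + 2)"]) simp
  qed
qed

lemma hensel_sqrt_odd:
  assumes p: "prime p" "p \<noteq> 2" and u: "u \<in> Zunit p" and s: "s \<in> Zid p 0" "s\<^sup>2 - u \<in> Zid p 1"
  obtains t where "t \<in> Zid p 0" "t\<^sup>2 - u \<in> Zid p N"
proof -
  \<comment> \<open>One digit more than requested, so that u and k agree modulo p even for N =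
    0.\<close>
  obtain k :: int where k: "u - of_int k \<in> Zid p (Suc N)" using Zid_round[OF p(1) Zunit_Zid[OF u]] .
  obtain r :: int where r: "s - of_int r \<in> Zid p 1" using Zid_round[OF p(1) s(1)] .
  have k1: "u - of_int k \<in> Zid p 1" using Zid_mono[OF p(1) _ k, of 1] by simp
  have "\<not> int p dvd k" using Zunit_cong[OF p(1) k1] u Zunit_of_int_iff[OF p(1)] by blast
  moreover have "int p dvd r\<^sup>2 - k"
  proof -
    have "of_int (r\<^sup>2 - k) = (s\<^sup>2 - u) + (u - of_int k) - (s - of_int r) * (s + of_int r)"
      by (simp add: algebra_simps power2_eq_square)
    moreover have "(s - of_int r) * (s + of_int r) \<in> Zid p 1"
      using p s r by (intro Zid_mult_0' Zid_add) auto
    ultimately have "(of_int (r\<^sup>2 - k) :: rat) \<in> Zid p 1"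
      using Zid_diff[OF p(1) Zid_add[OF p(1) s(2) k1]] by metis
    then show ?thesis using Zid_of_int_iff[OF p(1), of "r\<^sup>2 - k" 1] by (simp only: power_one_right)
  qed
  ultimately obtain t where "int p ^ Suc N dvd t\<^sup>2 - k" using hensel_sqrt_odd_int[OF p] by blast
  then have "of_int (t\<^sup>2 - k) \<in> Zid p (Suc N)" using Zid_of_int_iff[OF p(1)] by blast
  then have "of_int (t\<^sup>2 - k) - (u - of_int k) \<in> Zid p (Suc N)" using Zid_diff[OF p(1) _ k] by blast
  then have "(of_int t)\<^sup>2 - u \<in> Zid p (Suc N)" by simp
  then show thesis using that[of "of_int t"] Zid_mono[OF p(1), of N "Suc N"] p(1) by simp
qed

lemma hensel_sqrt_two:
  assumes u: "u - 1 \<in> Zid 2 3"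
  obtains t where "t \<in> Zunit 2" "t\<^sup>2 - u \<in> Zid 2 N"
proof -
  have p: "prime (2::nat)" by simp
  have u0: "u \<in> Zid 2 0" using Zid_add[OF p Zid_mono[OF p _ u, of 0], of 1] by simp
  \<comment> \<open>Three more digits than requested, so that k is congruent to 1 modulo 8 even for
    small N.\<close>
  obtain k :: int where k: "u - of_int k \<in> Zid 2 (N + 3)" using Zid_round[OF p u0] .
  have "(u - 1) - (u - of_int k) \<in> Zid 2 3" using Zid_diff[OF p u Zid_mono[OF p _ k]] by simp
  then have "of_int (k - 1) \<in> Zid 2 3" by simp
  then have "8 dvd k - 1" using Zid_of_int_iff[OF p, of "k - 1" 3] by simp
  then obtain t where t: "2 ^ (N + 3) dvd t\<^sup>2 - k" "odd t" using hensel_sqrt_two_int by blast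
  then have "of_int (t\<^sup>2 - k) \<in> Zid 2 (N + 3)" using Zid_of_int_iff[OF p, of "t\<^sup>2 - k" "N + 3"] by simp
  then have "of_int (t\<^sup>2 - k) - (u - of_int k) \<in> Zid 2 (N + 3)" using Zid_diff[OF p _ k] by blast
  then have "(of_int t)\<^sup>2 - u \<in> Zid 2 N" using Zid_mono[OF p, of N "N + 3"] by simp
  moreover have "of_int t \<in> Zunit 2" using t Zunit_of_int_iff[OF p] by simp
  ultimately show thesis using that by blast
qed

text \<open>The pigeonhole principle makes a square meet a translate of a multiple of the squares, since
  both take (p + 1) / 2 values modulo p.\<close>

lemma represent_mod_odd:
  assumes p: "prime p" "p \<noteq> 2" and d: "\<not> int p dvd d"
  obtains s t :: int where "int p dvd s\<^sup>2 + d * t\<^sup>2 - c"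
proof -
  have "2 < p" using prime_ge_2_nat[OF p(1)] p(2) by simp
  then have odd: "odd p" using prime_odd_nat p by blast
  have pi: "prime (int p)" using p by simp
  define h where "h = (int p - 1) div 2"
  have h: "int p = 2 * h + 1" "0 \<le> h" using odd \<open>2 < p\<close> unfolding h_def by presburger+
  define f g where "f = (\<lambda>s::int. s\<^sup>2 mod int p)" and "g = (\<lambda>t::int. (c - d * t\<^sup>2) mod int p)"
  have sq: "s = t" if "int p dvd s\<^sup>2 - t\<^sup>2" "s \<in> {0..h}" "t \<in> {0..h}" for s t
  proof -
    have "int p dvd (s - t) * (s + t)" using that by (simp add: algebra_simps power2_eq_square)
    then have "int p dvd s - t \<or> int p dvd s + t" using pi by (simp add: prime_dvd_mult_iff)
    then show ?thesis
    proof
      assume "int p dvd s - t"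
      moreover have "\<bar>s - t\<bar> < int p" using that h by auto
      ultimately show ?thesis using zdvd_imp_le[of "int p" "\<bar>s - t\<bar>"] by fastforce
    next
      assume "int p dvd s + t"
      moreover have "0 \<le> s + t" "s + t < int p" using that h by auto
      ultimately have "s + t = 0" using zdvd_not_zless[of "s + t" "int p"] by fastforce
      then show ?thesis using that by auto
    qed
  qed
  have f: "inj_on f {0..h}"
  proof (rule inj_onI)
    fix s t assume "s \<in> {0..h}" "t \<in> {0..h}" "f s = f t"
    then show "s = t" using sq by (simp add: f_def mod_eq_dvd_iff)
  qed
  have g: "inj_on g {0..h}"
  proof (rule inj_onI)
    fix s t assume st: "s \<in> {0..h}" "t \<in> {0..h}" "g s = g t"
    then have "int p dvd (c - d * s\<^sup>2) - (c - d * t\<^sup>2)" unfolding g_def by (simp only: mod_eq_dvd_iff)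
    then have "int p dvd d * (t\<^sup>2 - s\<^sup>2)" by (simp add: algebra_simps)
    then have "int p dvd t\<^sup>2 - s\<^sup>2" using d pi by (simp add: prime_dvd_mult_iff)
    then show "s = t" using sq[of t s] st by simp
  qed
  have "f ` {0..h} \<inter> g ` {0..h} \<noteq> {}"
  proof
    assume "f ` {0..h} \<inter> g ` {0..h} = {}"
    then have "card (f ` {0..h} \<union> g ` {0..h}) = nat (h + 1) + nat (h + 1)"
      using card_image[OF f] card_image[OF g] by (subst card_Un_disjoint) auto
    moreover have "f ` {0..h} \<union> g ` {0..h} \<subseteq> {0..<int p}"
      using prime_gt_0_nat[OF p(1)] by (auto simp: f_def g_def)
    then have "card (f ` {0..h} \<union> g ` {0..h}) \<le> card {0..<int p}" by (intro card_mono) auto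
    ultimately show False using h by simp
  qed
  then obtain s t where "f s = g t" by auto
  then have "int p dvd s\<^sup>2 - (c - d * t\<^sup>2)" unfolding f_def g_def by (simp only: mod_eq_dvd_iff)
  then show thesis using that[of s t] by (simp add: algebra_simps)
qed

text \<open>A solution modulo p exists by counting, and its t is a unit, as otherwise 2 would be a
  square modulo p. So s can be kept while t is refined to a root of (2 - s^2) / d.\<close>

lemma norm_represents_two_odd:
  assumes p: "two_nonresidue p" "p \<noteq> 2" and d: "d \<in> Zunit p"
  obtains s t where "s \<in> Zid p 0" "t \<in> Zid p 0" "s\<^sup>2 + d * t\<^sup>2 - 2 \<in> Zid p N"
proof -
  have pp: "prime p" using p by (simp add: two_nonresidue_def)
  obtain k :: int where k: "d - of_int k \<in> Zid p 1" using Zid_round[OF pp Zunit_Zid[OF d]] .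
  have kn: "\<not> int p dvd k" using Zunit_cong[OF pp k] d Zunit_of_int_iff[OF pp] by blast
  obtain s t :: int where st: "int p dvd s\<^sup>2 + k * t\<^sup>2 - 2" using represent_mod_odd[OF pp p(2) kn] .
  have nt: "\<not> int p dvd t"
  proof
    assume "int p dvd t"
    then have "int p dvd k * t\<^sup>2" by (simp add: power2_eq_square)
    moreover have "2 * 1\<^sup>2 - s\<^sup>2 = k * t\<^sup>2 - (s\<^sup>2 + k * t\<^sup>2 - 2)" by simp
    ultimately have "int p dvd 2 * 1\<^sup>2 - s\<^sup>2" using st by (metis dvd_diff)
    then have "int p dvd 1" using p unfolding two_nonresidue_def by blast
    then show False using pp by (auto simp: prime_nat_iff)
  qed
  define u where "u = (2 - (of_int s)\<^sup>2) / d"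
  have eq: "(of_int t)\<^sup>2 - u = (of_int (s\<^sup>2 + k * t\<^sup>2 - 2) + (d - of_int k) * (of_int t)\<^sup>2) / d"
    using Zunit_nonzero[OF pp d] by (simp add: u_def field_simps)
  have "of_int (s\<^sup>2 + k * t\<^sup>2 - 2) + (d - of_int k) * (of_int t)\<^sup>2 \<in> Zid p 1"
    using st pp k by (intro Zid_add Zid_mult_0' Zid_power) (auto simp del: of_int_diff of_int_add simp: Zid_of_int_iff)
  then have tu: "(of_int t)\<^sup>2 - u \<in> Zid p 1" unfolding eq using Zid_divide_unit_iff[OF pp d] by blast
  have "of_int (t\<^sup>2) \<in> Zunit p" using nt pp Zunit_of_int_iff[OF pp, of "t\<^sup>2"] by (simp add: prime_dvd_power_iff)
  then have u: "u \<in> Zunit p" using Zunit_cong[OF pp tu] by simp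
  obtain w where w: "w \<in> Zid p 0" "w\<^sup>2 - u \<in> Zid p N" using hensel_sqrt_odd[OF pp p(2) u _ tu] pp by auto
  have "(of_int s)\<^sup>2 + d * w\<^sup>2 - 2 = d * (w\<^sup>2 - u)"
    using Zunit_nonzero[OF pp d] by (simp add: u_def field_simps)
  then show thesis using that[of "of_int s" w] w pp Zid_mult_0[OF pp Zunit_Zid[OF d] w(2)] by simp
qed

text \<open>The form is a times the norm form x^2 + d y^2 of the quadratic extension by a root of
  -d. The matrix is multiplication by s + t sqrt(-d), which scales the norm form by s^2 + d t^2,
  approximately 2.\<close>

lemma approx_doubling_norm_form:
  assumes p: "prime p" and a: "a \<in> Zid p 0" and d: "d \<in> Zid p 0" and s: "s \<in> Zid p 0" and t: "t \<in> Zid p 0"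
    and st: "s\<^sup>2 + d * t\<^sup>2 - 2 \<in> Zid p N"
  shows "approx_doubling p N 2 (m2 a 0 0 (a * d))"
proof -
  let ?S = "m2 s (- d * t) t s" and ?H = "m2 a 0 0 (a * d)"
  have "?S\<^sup>T * ?H * ?S - 2 \<cdot>\<^sub>m ?H = m2 (a * (s\<^sup>2 + d * t\<^sup>2 - 2)) 0 0 (a * d * (s\<^sup>2 + d * t\<^sup>2 - 2))"
    by (simp add: m2_simps algebra_simps power2_eq_square)
  moreover have "mid p N \<dots>"
    using assms by (auto simp: m2_mid intro!: Zid_mult_0)
  moreover have "mid p 0 ?S" using assms by (auto simp: m2_mid intro!: Zid_mult_0 Zid_uminus)
  ultimately show ?thesis unfolding approx_doubling_def using m2_carrier by metis
qed

lemma approx_doubling_scalar: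
  assumes p: "prime p" and H: "H \<in> carrier_mat n n" "mid p 0 H" and s: "s \<in> Zid p 0" "s\<^sup>2 - 2 \<in> Zid p N"
  shows "approx_doubling p N n H"
proof -
  have d: "dim_row H = n" "dim_col H = n" using H by auto
  have "(s \<cdot>\<^sub>m 1\<^sub>m n)\<^sup>T = s \<cdot>\<^sub>m 1\<^sub>m n" by (rule eq_matI) auto
  then have "(s \<cdot>\<^sub>m 1\<^sub>m n)\<^sup>T * H * (s \<cdot>\<^sub>m 1\<^sub>m n) - 2 \<cdot>\<^sub>m H = (s\<^sup>2 - 2) \<cdot>\<^sub>m H"
    using d by (simp add: mat_ring) (intro eq_matI, auto simp: algebra_simps power2_eq_square)
  moreover have "mid p N \<dots>" using H s p by (auto simp: mid_def intro!: Zid_mult_0')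
  moreover have "mid p 0 (s \<cdot>\<^sub>m 1\<^sub>m n)" using s p by (intro mid_smult_0 mid_one)
  moreover have "s \<cdot>\<^sub>m 1\<^sub>m n \<in> carrier_mat n n" by simp
  ultimately show ?thesis unfolding approx_doubling_def by metis
qed

lemma approx_doubling_residue:
  assumes p: "prime p" "p \<noteq> 2" and "\<not> ([int p = 3] (mod 8) \<or> [int p = -3] (mod 8))"
    and H: "H \<in> carrier_mat n n" "mid p 0 H"
  shows "approx_doubling p N n H"
proof -
  obtain s :: int where s: "int p dvd s\<^sup>2 - 2" using two_residue_mod_8[OF assms(1-3)] .
  have "(of_int s)\<^sup>2 - 2 = (of_int (s\<^sup>2 - 2) :: rat)" by simp
  moreover have "\<dots> \<in> Zid p 1" using s Zid_of_int_iff[OF p(1), of "s\<^sup>2 - 2" 1] by (simp only: power_one_right)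
  ultimately have s1: "(of_int s)\<^sup>2 - 2 \<in> Zid p 1" by simp
  have "\<not> p dvd 2" using p by (metis primes_dvd_imp_eq two_is_prime_nat)
  then have "2 \<in> Zunit p" using Zunit_of_int_iff[OF p(1), of 2] int_dvd_int_iff[of p 2] by simp
  then obtain t where "t \<in> Zid p 0" "t\<^sup>2 - 2 \<in> Zid p N" using hensel_sqrt_odd[OF p _ _ s1] p(1) by auto
  then show ?thesis using approx_doubling_scalar[OF p(1) H] by blast
qed

section \<open>Determinants modulo a prime\<close>

lemma Zid_prod_cong:
  assumes "prime p"
    and "\<And>i. i \<in> A \<Longrightarrow> f i \<in> Zid p 0" "\<And>i. i \<in> A \<Longrightarrow> g i \<in> Zid p 0" "\<And>i. i \<in> A \<Longrightarrow> f i - g i \<in> Zid p N"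
  shows "prod f A - prod g A \<in> Zid p N"
  using assms
proof (induction A rule: infinite_finite_induct)
  case (insert x A)
  have "prod f (insert x A) - prod g (insert x A) = f x * (prod f A - prod g A) + (f x - g x) * prod g A"
    using insert by (simp add: algebra_simps)
  moreover have "\<dots> \<in> Zid p N"
    using insert assms(1) by (intro Zid_add Zid_mult_0 Zid_mult_0'[OF assms(1) _ Zid_prod]) auto
  ultimately show ?case by simp
qed auto

lemma det_cong_Zid:
  assumes p: "prime p" and A: "A \<in> carrier_mat n n" "mid p 0 A" and B: "B \<in> carrier_mat n n" "mid p 0 B"
    and AB: "mid p N (A - B)"
  shows "det A - det B \<in> Zid p N"
proof -
  have s: "signof q \<in> Zid p 0" for q
    using p Zid_uminus_iff[of p 1 0] by (cases "evenperm q") (auto simp: sign_def)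
  have "det A - det B = (\<Sum>q | q permutes {0..<n}.
      signof q * ((\<Prod>i = 0..<n. A $$ (i, q i)) - (\<Prod>i = 0..<n. B $$ (i, q i))))"
    unfolding det_def'[OF A(1)] det_def'[OF B(1)] by (simp add: sum_subtractf algebra_simps)
  moreover have "(\<Prod>i = 0..<n. A $$ (i, q i)) - (\<Prod>i = 0..<n. B $$ (i, q i)) \<in> Zid p N" if "q permutes {0..<n}" for q
  proof (rule Zid_prod_cong[OF p])
    fix i assume "i \<in> {0..<n}"
    then have "i < n" "q i < n" using permutes_in_image[OF that, of i] by auto
    then show "A $$ (i, q i) \<in> Zid p 0" "B $$ (i, q i) \<in> Zid p 0" "A $$ (i, q i) - B $$ (i, q i) \<in> Zid p N"
      using A B midD[OF AB, of i "q i"] by (auto simp: mid_def)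
  qed
  ultimately show ?thesis using s p by (auto intro!: Zid_sum Zid_mult_0)
qed

lemma mult_mat_entry:
  fixes A B :: "'b::semiring_0 mat"
  assumes "dim_col A = n" "dim_row B = n" "i < dim_row A" "j < dim_col B"
  shows "(A * B) $$ (i, j) = (\<Sum>k<n. A $$ (i, k) * B $$ (k, j))"
  using assms by (simp add: scalar_prod_def lessThan_atLeast0)

text \<open>Linear algebra over the field with p elements, done by counting. On the finite set of
  residue columns an injective map is surjective; preimages of the unit columns form a matrix B with
  A B congruent to 1 modulo p, so det A is a unit.\<close>

lemma unit_det_if_injective_mod:
  assumes p: "prime p" and A: "A \<in> carrier_mat n n" "mid p 0 A"
    and inj: "\<And>z. z \<in> carrier_mat n 1 \<Longrightarrow> mid p 0 z \<Longrightarrow> mid p 1 (A * z) \<Longrightarrow> mid p 1 z"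
  shows "det A \<in> Zunit p"
proof -
  have p0: "0 < int p" "1 < int p" using prime_gt_1_nat[OF p] by auto
  have "\<exists>k\<in>{0..<int p}. x - of_int k \<in> Zid p 1" if x: "x \<in> Zid p 0" for x
  proof -
    obtain k :: int where k: "x - of_int k \<in> Zid p 1" using Zid_round[OF p x] .
    have "of_int (k - k mod int p) \<in> Zid p 1" using Zid_of_int_iff[OF p, of _ 1] by (simp only: power_one_right) simp
    then have "(x - of_int k) + of_int (k - k mod int p) \<in> Zid p 1" using Zid_add[OF p k] by blast
    then have "x - of_int (k mod int p) \<in> Zid p 1" by simp
    then show ?thesis using p0 by (intro bexI[of _ "k mod int p"]) auto
  qed
  then obtain r where r: "\<And>x. x \<in> Zid p 0 \<Longrightarrow> r x \<in> {0..<int p}" "\<And>x. x \<in> Zid p 0 \<Longrightarrow> x - of_int (r x) \<in> Zid p 1"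
    by metis
  define F where "F = ({0..<n} \<rightarrow>\<^sub>E {0..<int p})"
  define c :: "(nat \<Rightarrow> int) \<Rightarrow> rat mat" where "c f = mat n 1 (\<lambda>(i, j). of_int (f i))" for f
  \<comment> \<open>The action of A on columns of residues: multiply the integer column by A and
    reduce entry by entry modulo p.\<close>
  define T where "T f = (\<lambda>i\<in>{0..<n}. r ((A * c f) $$ (i, 0)))" for f
  have cc: "c f \<in> carrier_mat n 1" "mid p 0 (c f)" for f using p by (auto simp: c_def mid_def)
  have Ac: "(A * c f) $$ (i, 0) \<in> Zid p 0" if "i < n" for f i
    using midD[OF mid_mult_0[OF p _ A(2) cc(2)[of f]], of i 0] that A cc(1)[of f] by auto
  have "T ` F \<subseteq> F" using r(1) Ac by (auto simp: T_def F_def PiE_iff simp del: index_mult_mat(1))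
  moreover have "inj_on T F"
  proof (rule inj_onI)
    fix f g assume f: "f \<in> F" and g: "g \<in> F" and eq: "T f = T g"
    have d: "dim_row (c f) = n" "dim_col (c f) = 1" "dim_row (c g) = n" "dim_col (c g) = 1"
      "dim_row A = n" "dim_col A = n" using cc A by (auto simp: c_def)
    have "mid p 1 (A * (c f - c g))"
      unfolding mid_def
    proof (intro allI impI)
      fix i j assume "i < dim_row (A * (c f - c g))" "j < dim_col (A * (c f - c g))"
      then have i: "i < n" "j = 0" using d by auto
      let ?x = "(A * c f) $$ (i, 0)" and ?y = "(A * c g) $$ (i, 0)"
      have "r ?x = r ?y" using fun_cong[OF eq, of i] i by (simp add: T_def del: index_mult_mat(1))
      then have "?x - ?y = (?x - of_int (r ?x)) - (?y - of_int (r ?y))" by simp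
      then have "?x - ?y \<in> Zid p 1" using Zid_diff[OF p r(2)[OF Ac] r(2)[OF Ac]] i by metis
      moreover have "(A * (c f - c g)) $$ (i, 0) = ?x - ?y"
        using i d by (simp add: mat_diff_distrib del: index_mult_mat(1))
      ultimately show "(A * (c f - c g)) $$ (i, j) \<in> Zid p 1" using i by simp
    qed
    then have *: "mid p 1 (c f - c g)"
      using inj[OF minus_carrier_mat[OF cc(1)]] d mid_diff[OF p _ _ cc(2)[of f] cc(2)[of g]] by metis
    have "f i = g i" if i: "i < n" for i
    proof -
      have "(of_int (f i - g i) :: rat) \<in> Zid p 1" using midD[OF *, of i 0] i d by (simp add: c_def)
      then have "int p dvd f i - g i" using Zid_of_int_iff[OF p, of _ 1] by (simp only: power_one_right)
      moreover have "f i \<in> {0..<int p}" "g i \<in> {0..<int p}" using f g i by (auto simp: F_def PiE_iff)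
      then have "\<bar>f i - g i\<bar> < int p" by auto
      ultimately show ?thesis using zdvd_imp_le[of "int p" "\<bar>f i - g i\<bar>"] by fastforce
    qed
    then show "f = g" using f g unfolding F_def by (intro PiE_ext) auto
  qed
  moreover have "finite F" by (simp add: F_def finite_PiE)
  ultimately have surj: "T ` F = F" using endo_inj_surj by blast
  have "\<exists>f\<in>F. T f = (\<lambda>i\<in>{0..<n}. if i = k then 1 else 0)" for k
  proof -
    have "(\<lambda>i\<in>{0..<n}. if i = k then 1 else 0) \<in> F" using p0 by (auto simp: F_def)
    then show ?thesis using surj by (metis (no_types, lifting) imageE)
  qed
  then obtain h where h: "\<And>k. T (h k) = (\<lambda>i\<in>{0..<n}. if i = k then 1 else 0)" by metis
  define B :: "rat mat" where "B = mat n n (\<lambda>(i, k). of_int (h k i))"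
  have B: "B \<in> carrier_mat n n" "mid p 0 B" using p by (auto simp: B_def mid_def)
  have AB: "A * B \<in> carrier_mat n n" "mid p 0 (A * B)" using A B mid_mult_0[OF p _ A(2) B(2)] by auto
  have "mid p 1 (A * B - 1\<^sub>m n)"
    unfolding mid_def
  proof (intro allI impI)
    fix i k assume "i < dim_row (A * B - 1\<^sub>m n)" "k < dim_col (A * B - 1\<^sub>m n)"
    then have ik: "i < n" "k < n" by auto
    have "(A * B) $$ (i, k) = (\<Sum>j<n. A $$ (i, j) * B $$ (j, k))" using ik A B by (intro mult_mat_entry) auto
    also have "\<dots> = (\<Sum>j<n. A $$ (i, j) * c (h k) $$ (j, 0))"
      using ik by (intro sum.cong refl) (auto simp: B_def c_def)
    also have "\<dots> = (A * c (h k)) $$ (i, 0)" using ik A cc[of "h k"] by (intro mult_mat_entry[symmetric]) auto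
    finally have e: "(A * B) $$ (i, k) = (A * c (h k)) $$ (i, 0)" .
    have "r ((A * c (h k)) $$ (i, 0)) = (if i = k then 1 else 0)"
      using fun_cong[OF h[of k], of i] ik by (simp add: T_def del: index_mult_mat(1))
    then have "(A * c (h k)) $$ (i, 0) - (if i = k then 1 else 0) \<in> Zid p 1"
      using r(2)[OF Ac[OF ik(1)], of "h k"] by (auto simp del: index_mult_mat(1) split: if_splits)
    then show "(A * B - 1\<^sub>m n) $$ (i, k) \<in> Zid p 1" using ik e A B by (simp del: index_mult_mat(1))
  qed
  then have "det (A * B) - det (1\<^sub>m n) \<in> Zid p 1"
    using det_cong_Zid[OF p AB one_carrier_mat mid_one[OF p]] by blast
  then have "det A * det B \<in> Zunit p" using Zunit_cong[OF p, of "det A * det B" 1] det_mult[OF A(1) B(1)] p by simp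
  then show ?thesis using Zunit_mult_iff[OF p mid_det[OF p A] mid_det[OF p B]] by blast
qed

section \<open>Doubling at odd primes\<close>

lemma approx_doubling_0:
  assumes "prime p" "H \<in> carrier_mat 0 0"
  shows "approx_doubling p N 0 H"
  unfolding approx_doubling_def using assms by (intro bexI[of _ "1\<^sub>m 0"]) (auto simp: mid_def)

lemma approx_doubling_smult:
  assumes p: "prime p" and H: "H \<in> carrier_mat n n" and c: "c \<in> Zid p 0" and D: "approx_doubling p N n H"
  shows "approx_doubling p N n (c \<cdot>\<^sub>m H)"
proof -
  obtain S where S: "S \<in> carrier_mat n n" "mid p 0 S" "mid p N (S\<^sup>T * H * S - 2 \<cdot>\<^sub>m H)"
    using D by (auto simp: approx_doubling_def)
  have d: "dim_row H = n" "dim_col H = n" "dim_row S = n" "dim_col S = n" using S H by auto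
  have "S\<^sup>T * (c \<cdot>\<^sub>m H) * S - 2 \<cdot>\<^sub>m (c \<cdot>\<^sub>m H) = c \<cdot>\<^sub>m (S\<^sup>T * H * S - 2 \<cdot>\<^sub>m H)"
  proof -
    have "S\<^sup>T * (c \<cdot>\<^sub>m H) * S = c \<cdot>\<^sub>m (S\<^sup>T * H * S)" using d by (simp add: mat_ring)
    then show ?thesis using d by (intro eq_matI) (auto simp: algebra_simps simp del: index_mult_mat(1))
  qed
  then have "mid p N (S\<^sup>T * (c \<cdot>\<^sub>m H) * S - 2 \<cdot>\<^sub>m (c \<cdot>\<^sub>m H))" using mid_smult_0[OF p c S(3)] by simp
  then show ?thesis using S unfolding approx_doubling_def by blast
qed

lemma congruent_compose:
  fixes H U V :: "'b::comm_ring_1 mat"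
  assumes "H \<in> carrier_mat n n" "U \<in> carrier_mat n n" "V \<in> carrier_mat n n"
  shows "(U * V)\<^sup>T * H * (U * V) = V\<^sup>T * (U\<^sup>T * H * U) * V"
  using carrier_matD[OF assms(1)] carrier_matD[OF assms(2)] carrier_matD[OF assms(3)] by (simp add: mat_ring)

lemma symmetric_entry: "H \<in> carrier_mat n n \<Longrightarrow> H\<^sup>T = H \<Longrightarrow> i < n \<Longrightarrow> j < n \<Longrightarrow> H $$ (i, j) = H $$ (j, i)"
  by (metis carrier_matD index_transpose_mat(1))

text \<open>If p divides all norms of basis vectors, the norm of e_i + e_j is congruent to twice the
  unit H_ij, which is again a unit as p is odd.\<close>

lemma unit_diagonal_entry:
  assumes p: "prime p" "p \<noteq> 2" and H: "H \<in> carrier_mat n n" "H\<^sup>T = H" "mid p 0 H"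
    and ij: "i < n" "j < n" "H $$ (i, j) \<in> Zunit p"
  obtains U where "U \<in> Zgl p n" "(U\<^sup>T * H * U) $$ (0, 0) \<in> Zunit p"
proof -
  have n0: "0 < n" using ij by simp
  have diag: "\<exists>U\<in>Zgl p n. (U\<^sup>T * G * U) $$ (0, 0) \<in> Zunit p"
    if G: "G \<in> carrier_mat n n" "k < n" "G $$ (k, k) \<in> Zunit p" for G k
  proof -
    have "transpose 0 k permutes {0..<n}" using G n0 by (intro permutes_swap_id) auto
    then obtain U where "U \<in> Zgl p n" "\<And>a b. a < n \<Longrightarrow> b < n \<Longrightarrow>
        (U\<^sup>T * G * U) $$ (a, b) = G $$ (transpose 0 k a, transpose 0 k b)"
      using permute_congruent[OF p(1) G(1)] by metis
    then show ?thesis using G n0 by (intro bexI[of _ U]) auto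
  qed
  show thesis
  proof (cases "\<exists>k<n. H $$ (k, k) \<in> Zunit p")
    case True
    then show ?thesis using diag[OF H(1)] that by blast
  next
    case False
    have z: "H $$ (k, k) \<in> Zid p 1" if "k < n" for k
      using False that H midD[OF H(3), of k k] by (auto simp: Zunit_def)
    have "i \<noteq> j" using False ij by blast
    then obtain U where U: "U \<in> Zgl p n" "\<And>a b. a < n \<Longrightarrow> b < n \<Longrightarrow> (U\<^sup>T * H * U) $$ (a, b) =
        H $$ (a, b) + (if b = i then 1 * H $$ (a, j) else 0) + (if a = i then 1 * H $$ (j, b) else 0)
        + (if a = i \<and> b = i then 1 * 1 * H $$ (j, j) else 0)"
      using add_column_congruent[OF p(1) H(1) ij(1,2), of 1] p(1) by (metis Zid_one_iff)
    have "\<not> p dvd 2" using p by (metis primes_dvd_imp_eq two_is_prime_nat)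
    then have 2: "2 \<in> Zunit p" using Zunit_of_int_iff[OF p(1), of 2] int_dvd_int_iff[of p 2] by simp
    have "(U\<^sup>T * H * U) $$ (i, i) - 2 * H $$ (i, j) = H $$ (i, i) + H $$ (j, j)"
      using U(2)[OF ij(1,1)] symmetric_entry[OF H(1,2) ij(1,2)] by simp
    then have "(U\<^sup>T * H * U) $$ (i, i) - 2 * H $$ (i, j) \<in> Zid p 1" using z ij Zid_add[OF p(1)] by metis
    then have "(U\<^sup>T * H * U) $$ (i, i) \<in> Zunit p"
      using Zunit_cong[OF p(1)] Zunit_mult[OF p(1) 2 ij(3)] by blast
    moreover have c: "U \<in> carrier_mat n n" using Zgl_carrier[OF U(1)] .
    moreover have "U\<^sup>T * H * U \<in> carrier_mat n n" using c H by auto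
    ultimately obtain V where V: "V \<in> Zgl p n" "(V\<^sup>T * (U\<^sup>T * H * U) * V) $$ (0, 0) \<in> Zunit p"
      using diag ij by blast
    then show ?thesis using that[of "U * V"] Zgl_mult[OF p(1) U(1) V(1)]
        congruent_compose[OF H(1) c Zgl_carrier[OF V(1)]] by simp
  qed
qed

lemma split_unit_entry:
  assumes p: "prime p" "p \<noteq> 2" and H: "H \<in> carrier_mat (1 + l) (1 + l)" "H\<^sup>T = H" "mid p 0 H"
    and ij: "i < 1 + l" "j < 1 + l" "H $$ (i, j) \<in> Zunit p"
  obtains U W u where "U \<in> Zgl p (1 + l)" "W \<in> carrier_mat l l" "W\<^sup>T = W" "mid p 0 W" "u \<in> Zunit p"
    "U\<^sup>T * H * U = block_sum (mat 1 1 (\<lambda>_. u)) W"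
proof -
  obtain U where U: "U \<in> Zgl p (1 + l)" "(U\<^sup>T * H * U) $$ (0, 0) \<in> Zunit p"
    using unit_diagonal_entry[OF p H ij] .
  note Uc = Zgl_carrier[OF U(1)]
  define G where "G = U\<^sup>T * H * U"
  have G: "G \<in> carrier_mat (1 + l) (1 + l)" "G\<^sup>T = G" "mid p 0 G"
    using symmetric_congruent[OF H(1) Uc H(2)] mid_congruent[OF p(1) H(1) Uc Zgl_mid[OF U(1)] H(3)] Uc H
    by (auto simp: G_def)
  have m: "mat 1 1 (\<lambda>ij. G $$ ij) = mat 1 1 (\<lambda>_. G $$ (0, 0))" by (rule eq_matI) auto
  have "det (mat 1 1 (\<lambda>ij. G $$ ij)) = G $$ (0, 0)" by (subst det_single) auto
  then have u: "det (mat 1 1 (\<lambda>ij. G $$ ij)) \<in> Zunit p" using U(2) by (simp only: G_def)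
  obtain V W where V: "V \<in> Zgl p (1 + l)" "W \<in> carrier_mat l l" "W\<^sup>T = W" "mid p 0 W"
    "V\<^sup>T * G * V = block_sum (mat 1 1 (\<lambda>ij. G $$ ij)) W"
    using split_unit_block[OF p(1) G u] by metis
  show thesis
  proof (rule that[OF _ V(2-4)])
    show "U * V \<in> Zgl p (1 + l)" using Zgl_mult[OF p(1) U(1) V(1)] .
    show "G $$ (0, 0) \<in> Zunit p" using U(2) by (simp only: G_def)
    show "(U * V)\<^sup>T * H * (U * V) = block_sum (mat 1 1 (\<lambda>_. G $$ (0, 0))) W"
      using congruent_compose[OF H(1) Uc Zgl_carrier[OF V(1)]] V(5) m unfolding G_def[symmetric] by simp
  qed
qed

lemma rat_val_det_congruent:
  assumes p: "prime p" and H: "H \<in> carrier_mat n n" and U: "U \<in> Zgl p n" and "det H \<noteq> 0"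
  shows "rat_val p (det (U\<^sup>T * H * U)) = rat_val p (det H)" "det (U\<^sup>T * H * U) \<noteq> 0"
proof -
  have u: "(det U)\<^sup>2 \<in> Zunit p" using Zunit_mult[OF p] Zgl_det[OF U] by (simp add: power2_eq_square)
  then show "rat_val p (det (U\<^sup>T * H * U)) = rat_val p (det H)" "det (U\<^sup>T * H * U) \<noteq> 0"
    using det_congruent[OF H Zgl_carrier[OF U]] rat_val_mult[OF p Zunit_nonzero[OF p u] assms(4)]
      rat_val_unit[OF p u] Zunit_nonzero[OF p u] assms(4) by auto
qed

text \<open>If W z vanishes modulo p, then p W z vanishes modulo p^2, so z meets the conditions of
  local maximality for p W and is divisible by p. Hence W is injective modulo p.\<close>

lemma locally_maximal_multiple_unit:
  assumes p: "prime p" "p \<noteq> 2" and W: "W \<in> carrier_mat l l" "mid p 0 W"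
    and M: "locally_maximal p l (of_nat p \<cdot>\<^sub>m W)"
  shows "det W \<in> Zunit p"
proof (rule unit_det_if_injective_mod[OF p(1) W])
  fix z :: "rat mat" assume z: "z \<in> carrier_mat l 1" "mid p 0 z" "mid p 1 (W * z)"
  have d: "dim_row z = l" "dim_col z = 1" "dim_row W = l" "dim_col W = l" using z W by auto
  have pw: "of_nat p \<in> Zid p 1" using Zid_power_self[OF p(1), of 1] by simp
  have 2: "mid p 2 ((of_nat p \<cdot>\<^sub>m W) * z)"
    using mid_smult[OF p(1) pw z(3)] d by (simp add: mat_ring numeral_2_eq_2)
  have "\<not> p dvd 2" using p by (metis primes_dvd_imp_eq two_is_prime_nat)
  then have "2 \<in> Zunit p" using Zunit_of_int_iff[OF p(1), of 2] int_dvd_int_iff[of p 2] by simp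
  then have h: "1 / 2 \<in> Zid p 0" using Zunit_inverse_Zid[OF p(1)] by (simp add: inverse_eq_divide)
  have "mid p 2 (z\<^sup>T * ((of_nat p \<cdot>\<^sub>m W) * z))"
    using mid_mult_0[OF p(1) _ mid_transpose[OF z(2)] 2] d by simp
  then have "mid p 2 ((1/2) \<cdot>\<^sub>m (z\<^sup>T * (of_nat p \<cdot>\<^sub>m W) * z))"
    using mid_smult_0[OF p(1) h] d by (simp add: mat_assoc)
  moreover have "mid p 1 ((of_nat p \<cdot>\<^sub>m W) * z)" using mid_mono[OF p(1) _ 2] by simp
  ultimately show "mid p 1 z" using M z(1,2) unfolding locally_maximal_def by blast
qed

lemma unit_or_multiple:
  assumes p: "prime p" and H: "H \<in> carrier_mat n n" "H\<^sup>T = H" "mid p 0 H"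
  shows "(\<exists>i<n. \<exists>j<n. H $$ (i, j) \<in> Zunit p) \<or> (\<exists>G\<in>carrier_mat n n. G\<^sup>T = G \<and> mid p 0 G \<and> H = of_nat p \<cdot>\<^sub>m G)"
proof (rule disjCI)
  assume "\<not> (\<exists>G\<in>carrier_mat n n. G\<^sup>T = G \<and> mid p 0 G \<and> H = of_nat p \<cdot>\<^sub>m G)"
  then have *: "\<not> (G \<in> carrier_mat n n \<and> G\<^sup>T = G \<and> mid p 0 G \<and> H = of_nat p \<cdot>\<^sub>m G)" for G by blast
  have p0: "(of_nat p :: rat) \<noteq> 0" using p by auto
  define G where "G = (1 / of_nat p) \<cdot>\<^sub>m H"
  have "G \<in> carrier_mat n n" using H by (simp add: G_def)
  moreover have "G\<^sup>T = G"
    using H symmetric_entry[OF H(1,2)] by (intro eq_matI) (auto simp: G_def)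
  moreover have "H = of_nat p \<cdot>\<^sub>m G" using p0 by (intro eq_matI) (auto simp: G_def)
  ultimately have "\<not> mid p 0 G" using * by blast
  then obtain i j where ij: "i < n" "j < n" "G $$ (i, j) \<notin> Zid p 0" using H by (auto simp: mid_def G_def)
  have "H $$ (i, j) \<notin> Zid p 1"
    using Zid_shift1_iff[OF p, of "G $$ (i, j)" 0] ij H p0 by (simp add: G_def)
  then show "\<exists>i<n. \<exists>j<n. H $$ (i, j) \<in> Zunit p" using ij midD[OF H(3)] H by (auto simp: Zunit_def)
qed

text \<open>Unit diagonal entries are split off in pairs u, v, each pair being u times a norm form
  that represents 2. The parity of the valuation of the determinant prevents a lone unit entry from
  being left over beside a part divisible by p. If the whole form is divisible by p, maximality
  makes it p times a unimodular form, whose doubling serves for it as well.\<close>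

theorem approx_doubling_odd:
  assumes p: "two_nonresidue p" "p \<noteq> 2"
    and "H \<in> carrier_mat n n" "H\<^sup>T = H" "mid p 0 H" "det H \<noteq> 0" "even n" "even (rat_val p (det H))"
    "locally_maximal p n H"
  shows "approx_doubling p N n H"
  using assms(3-)
proof (induction n arbitrary: H rule: less_induct)
  case (less n)
  have pp: "prime p" using p by (simp add: two_nonresidue_def)
  have p0: "(of_nat p :: rat) \<noteq> 0" using pp by auto
  \<comment> \<open>Stated for a fresh H: it is applied to the given form and also to the unimodular
    quotient when the given form is divisible by p.\<close>
  have step: "approx_doubling p N n H"
    if H: "H \<in> carrier_mat n n" "H\<^sup>T = H" "mid p 0 H" "det H \<noteq> 0" "even (rat_val p (det H))"
      "locally_maximal p n H" and ij: "i < n" "j < n" "H $$ (i, j) \<in> Zunit p" for H i j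
  proof -
    obtain l where l: "n = 1 + l" using ij by (metis One_nat_def Suc_leI gr_implies_not0 le_Suc_ex not_gr_zero)
    obtain U W u where U: "U \<in> Zgl p n" "W \<in> carrier_mat l l" "W\<^sup>T = W" "mid p 0 W" "u \<in> Zunit p"
      "U\<^sup>T * H * U = block_sum (mat 1 1 (\<lambda>_. u)) W"
      using split_unit_entry[OF pp p(2) H(1-3)[unfolded l] ij[unfolded l]] unfolding l by metis
    let ?u = "mat 1 1 (\<lambda>_. u) :: rat mat"
    have uc: "?u \<in> carrier_mat 1 1" "det ?u = u" by (auto simp: det_single)
    have H1: "det (block_sum ?u W) \<noteq> 0" "even (rat_val p (det (block_sum ?u W)))"
      "locally_maximal p n (block_sum ?u W)" "block_sum ?u W \<in> carrier_mat n n"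
      using rat_val_det_congruent[OF pp H(1) U(1) H(4)] H(5) locally_maximal_congruent[OF pp H(1) U(1) H(6)] U(2) l
      unfolding U(6) by auto
    have dW: "det (block_sum ?u W) = u * det W" using det_block_sum[OF uc(1) U(2)] uc(2) by simp
    have W0: "det W \<noteq> 0" using H1(1) dW by simp
    have vW: "even (rat_val p (det W))"
      using H1(2) rat_val_mult[OF pp Zunit_nonzero[OF pp U(5)] W0] rat_val_unit[OF pp U(5)] dW by simp
    have mW: "locally_maximal p l W" using locally_maximal_block_sum[OF pp uc(1) U(2)] H1(3) l by simp
    have "odd l" using less.prems(5) l by simp
    from unit_or_multiple[OF pp U(2-4)] have "approx_doubling p N n (block_sum ?u W)"
    proof
      assume "\<exists>G\<in>carrier_mat l l. G\<^sup>T = G \<and> mid p 0 G \<and> W = of_nat p \<cdot>\<^sub>m G"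
      then obtain G where G: "G \<in> carrier_mat l l" "mid p 0 G" "W = of_nat p \<cdot>\<^sub>m G" by blast
      have g: "det G \<in> Zunit p" using locally_maximal_multiple_unit[OF pp p(2) G(1,2)] mW G(3) by simp
      \<comment> \<open>This case cannot occur: det W would have valuation l, which is odd because n
        is even, while its valuation is known to be even.\<close>
      have "det W = of_nat p powi (int l) * det G" using G by simp
      then have "rat_val p (det W) = int l" using rat_val_powi_unit[OF pp g] by metis
      then show ?thesis using vW \<open>odd l\<close> by simp
    next
      assume "\<exists>i<l. \<exists>j<l. W $$ (i, j) \<in> Zunit p"
      then obtain i j where ij: "i < l" "j < l" "W $$ (i, j) \<in> Zunit p" by blast
      then obtain k where k: "l = 1 + k" by (metis One_nat_def Suc_leI gr_implies_not0 le_Suc_ex not_gr_zero)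
      obtain V X v where V: "V \<in> Zgl p l" "X \<in> carrier_mat k k" "X\<^sup>T = X" "mid p 0 X" "v \<in> Zunit p"
        "V\<^sup>T * W * V = block_sum (mat 1 1 (\<lambda>_. v)) X"
        using split_unit_entry[OF pp p(2) U(2-4)[unfolded k] ij[unfolded k]] unfolding k by metis
      let ?v = "mat 1 1 (\<lambda>_. v) :: rat mat"
      note Vc = Zgl_carrier[OF V(1)]
      define V1 where "V1 = block_sum (1\<^sub>m 1) V"
      have V1c: "V1 \<in> carrier_mat n n" using Vc l by (auto simp: V1_def)
      have "det V1 = det V" unfolding V1_def using det_block_sum[OF one_carrier_mat Vc, of 1] by simp
      moreover have "mid p 0 V1" unfolding V1_def using Vc Zgl_mid[OF V(1)] pp
        by (subst mid_four_block[of _ 1 1 _ l _ l]) (auto simp: mid_one mid_zero)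
      ultimately have V1: "V1 \<in> Zgl p n" using V1c Zgl_det[OF V(1)] by (simp add: Zgl_def)
      have "V1\<^sup>T * block_sum ?u W * V1 = block_sum ?u (block_sum ?v X)"
        unfolding V1_def using congruent_block_sum[OF uc(1) U(2) one_carrier_mat Vc] V(6) uc(1)
        by simp
      also have "\<dots> = block_sum (m2 u 0 0 v) X"
        using V(2) by (intro eq_matI) (auto simp: m2_def less_2_iff numeral_2_eq_2)
      finally have e: "V1\<^sup>T * block_sum ?u W * V1 = block_sum (m2 u 0 0 v) X" .
      have n2: "n = 2 + k" using l k by simp
      have H2: "det (block_sum (m2 u 0 0 v) X) \<noteq> 0" "even (rat_val p (det (block_sum (m2 u 0 0 v) X)))"
        "locally_maximal p n (block_sum (m2 u 0 0 v) X)"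
        using rat_val_det_congruent[OF pp H1(4) V1 H1(1)] H1(2) locally_maximal_congruent[OF pp H1(4) V1 H1(3)]
        unfolding e by auto
      have uv: "u * v \<in> Zunit p" using Zunit_mult[OF pp U(5) V(5)] .
      have dX: "det (block_sum (m2 u 0 0 v) X) = (u * v) * det X"
        using det_block_sum[OF m2_carrier V(2)] by (simp add: m2_det)
      have X0: "det X \<noteq> 0" using H2(1) dX by simp
      have vX: "even (rat_val p (det X))"
        using H2(2) rat_val_mult[OF pp Zunit_nonzero[OF pp uv] X0] rat_val_unit[OF pp uv] dX by simp
      have mX: "locally_maximal p k X"
        using locally_maximal_block_sum[OF pp m2_carrier V(2)] H2(3) n2 by simp
      have "approx_doubling p N k X"
        using less.IH[OF _ V(2-4) X0 _ vX mX] n2 less.prems(5) by simp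
      moreover have "approx_doubling p N 2 (m2 u 0 0 v)"
      proof -
        define d where "d = v / u"
        have d: "d \<in> Zunit p" using Zunit_mult[OF pp V(5) Zunit_inverse[OF pp U(5)]] by (simp add: d_def divide_inverse)
        obtain s t where "s \<in> Zid p 0" "t \<in> Zid p 0" "s\<^sup>2 + d * t\<^sup>2 - 2 \<in> Zid p N"
          using norm_represents_two_odd[OF p d] .
        then have "approx_doubling p N 2 (m2 u 0 0 (u * d))"
          using approx_doubling_norm_form[OF pp Zunit_Zid[OF U(5)] Zunit_Zid[OF d]] by blast
        then show ?thesis using Zunit_nonzero[OF pp U(5)] by (simp add: d_def)
      qed
      ultimately have "approx_doubling p N n (block_sum (m2 u 0 0 v) X)"
        using approx_doubling_block_sum[OF pp m2_carrier V(2)] n2 by simp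
      then show ?thesis using approx_doubling_congruent[OF pp H1(4) V1] e by simp
    qed
    then show ?thesis using approx_doubling_congruent[OF pp H(1) U(1)] U(6) by simp
  qed
  from unit_or_multiple[OF pp less.prems(1-3)] show ?case
  proof
    assume "\<exists>i<n. \<exists>j<n. H $$ (i, j) \<in> Zunit p"
    then show ?thesis using step less.prems by blast
  next
    assume "\<exists>G\<in>carrier_mat n n. G\<^sup>T = G \<and> mid p 0 G \<and> H = of_nat p \<cdot>\<^sub>m G"
    then obtain G where G: "G \<in> carrier_mat n n" "G\<^sup>T = G" "mid p 0 G" "H = of_nat p \<cdot>\<^sub>m G" by blast
    have g: "det G \<in> Zunit p" using locally_maximal_multiple_unit[OF pp p(2) G(1,3)] less.prems(7) G(4) by simp
    have pn: "of_nat p \<in> Zid p 0" using pp by simp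
    show ?thesis
    proof (cases "n = 0")
      case True
      then show ?thesis using approx_doubling_0[OF pp] less.prems(1) by simp
    next
      case False
      \<comment> \<open>A unimodular form is locally maximal, since G z vanishes modulo p only if z
        does.\<close>
      have mG: "locally_maximal p n G"
        unfolding locally_maximal_def
      proof (intro ballI impI, elim conjE)
        fix z :: "rat mat" assume z: "z \<in> carrier_mat n 1" "mid p 0 z" "mid p 1 (G * z)"
        have "G \<in> Zgl p n" using G g by (simp add: Zgl_def)
        then obtain V where V: "V \<in> Zgl p n" "V * G = 1\<^sub>m n" using Zgl_inverse[OF pp] by blast
        have "mid p 1 (V * (G * z))" using mid_mult_0[OF pp _ Zgl_mid[OF V(1)] z(3)] Zgl_carrier[OF V(1)] G by simp
        then show "mid p 1 z" using mat_cancel_left[OF V(2), of z] Zgl_carrier[OF V(1)] G z by simp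
      qed
      have "\<exists>i<n. \<exists>j<n. G $$ (i, j) \<in> Zunit p"
      proof (rule ccontr)
        assume "\<not> ?thesis"
        then obtain G' where G': "G' \<in> carrier_mat n n" "mid p 0 G'" "G = of_nat p \<cdot>\<^sub>m G'"
          using unit_or_multiple[OF pp G(1-3)] by blast
        have "det G = of_nat p ^ n * det G'" using G' by simp
        moreover have "\<dots> \<in> Zid p n" using Zid_mult_0'[OF pp Zid_power_self[OF pp] mid_det[OF pp G'(1,2)]] .
        ultimately have "det G \<in> Zid p 1" using Zid_mono[OF pp, of 1 n] False by simp
        then show False using g by (simp add: Zunit_def)
      qed
      then have "approx_doubling p N n G"
        using step[OF G(1-3) Zunit_nonzero[OF pp g] _ mG] rat_val_unit[OF pp g] by auto
      then show ?thesis unfolding G(4) using approx_doubling_smult[OF pp G(1) pn] by blast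
    qed
  qed
qed

section \<open>Arithmetic of the localization at two\<close>

lemma prime_two: "prime (2::nat)"
  by simp

lemma Zid_two_numerals [simp]: "2 \<in> Zid 2 1" "4 \<in> Zid 2 2" "8 \<in> Zid 2 3" "2 \<in> Zid 2 (Suc 0)"
  by (simp_all add: Zid_numeral_iff)

lemma Zunit_two_obtain:
  assumes "u \<in> Zunit 2"
  obtains k :: int where "odd k" "u - of_int k \<in> Zid 2 N"
proof -
  obtain k :: int where k: "u - of_int k \<in> Zid 2 (Suc N)" using Zid_round[OF prime_two Zunit_Zid[OF assms]] .
  have "odd k" using Zunit_cong[OF prime_two Zid_mono[OF prime_two _ k]] assms Zunit_of_int_iff[OF prime_two] by simp
  then show thesis using that Zid_mono[OF prime_two _ k, of N] by simp
qed

lemma odd_add_odd: "u \<in> Zunit 2 \<Longrightarrow> v \<in> Zunit 2 \<Longrightarrow> u + v \<in> Zid 2 1"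
proof -
  assume "u \<in> Zunit 2" "v \<in> Zunit 2"
  then obtain k l :: int where k: "odd k" "u - of_int k \<in> Zid 2 1" and l: "odd l" "v - of_int l \<in> Zid 2 1"
    using Zunit_two_obtain by metis
  have "of_int (k + l) \<in> Zid 2 1" using k l Zid_of_int_iff[OF prime_two, of "k + l" 1] by simp
  then have "(u - of_int k) + (v - of_int l) + of_int (k + l) \<in> Zid 2 1"
    using k l by (intro Zid_add prime_two) auto
  then show ?thesis by simp
qed

lemma odd_diff_odd: "u \<in> Zunit 2 \<Longrightarrow> v \<in> Zunit 2 \<Longrightarrow> u - v \<in> Zid 2 1"
  using odd_add_odd[of u "- v"] Zunit_mult[OF prime_two, of "-1" v] Zunit_of_int_iff[OF prime_two, of "-1"] by simp

lemma odd_square: "u \<in> Zunit 2 \<Longrightarrow> u\<^sup>2 - 1 \<in> Zid 2 3"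
proof -
  assume "u \<in> Zunit 2"
  then obtain k :: int where k: "odd k" "u - of_int k \<in> Zid 2 3" using Zunit_two_obtain by metis
  obtain j where j: "k = 2 * j + 1" using k(1) by (elim oddE)
  have "even (j * (j + 1))" by simp
  then obtain m where "j * (j + 1) = 2 * m" by blast
  moreover have "k\<^sup>2 - 1 = 4 * (j * (j + 1))" by (simp add: j power2_eq_square algebra_simps)
  ultimately have "k\<^sup>2 - 1 = 8 * m" by linarith
  then have "8 dvd k\<^sup>2 - 1" by simp
  then have 1: "of_int (k\<^sup>2 - 1) \<in> Zid 2 3" using Zid_of_int_iff[OF prime_two, of "k\<^sup>2 - 1" 3] by simp
  have "u \<in> Zid 2 0" using \<open>u \<in> Zunit 2\<close> by (rule Zunit_Zid)
  then have "(u - of_int k) * (u + of_int k) \<in> Zid 2 3"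
    using k by (intro Zid_mult_0' Zid_add prime_two) auto
  from Zid_add[OF prime_two this 1] show ?thesis by (simp add: algebra_simps power2_eq_square)
qed

lemma four_times: "x \<in> Zid 2 N \<Longrightarrow> 4 * x \<in> Zid 2 (2 + N)"
  using Zid_mult[OF prime_two, of 4 2 x N] by simp

lemma two_times: "x \<in> Zid 2 N \<Longrightarrow> 2 * x \<in> Zid 2 (Suc N)"
  using Zid_mult[OF prime_two, of 2 1 x N] by simp

lemma two_times_iff: "2 * x \<in> Zid 2 (Suc N) \<longleftrightarrow> x \<in> Zid 2 N"
  using Zid_shift1_iff[OF prime_two, of x N] by simp

lemma half_iff: "x / 2 \<in> Zid 2 N \<longleftrightarrow> x \<in> Zid 2 (Suc N)"
  using Zid_shift1_iff[OF prime_two, of "x / 2" N] by simp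

text \<open>Membership in the group below is the norm condition for the quadratic extension of the 2-adic
  numbers by the square root of two.\<close>

definition pm_one :: "rat \<Rightarrow> bool" where
  "pm_one u \<longleftrightarrow> u - 1 \<in> Zid 2 3 \<or> u + 1 \<in> Zid 2 3"

definition two_norm :: "rat \<Rightarrow> bool" where
  "two_norm d \<longleftrightarrow> (\<exists>a u. pm_one u \<and> d = 2 powi a * u)"

lemma pm_one_unit:
  assumes "pm_one u"
  shows "u \<in> Zunit 2"
proof -
  have "u - 1 \<in> Zid 2 1 \<or> u - (- 1) \<in> Zid 2 1"
    using assms Zid_mono[OF prime_two, of 1 3] by (auto simp: pm_one_def)
  moreover have "(-1 :: rat) \<in> Zunit 2" using Zunit_of_int_iff[OF prime_two, of "-1"] by simp
  ultimately show ?thesis using Zunit_cong[OF prime_two] Zunit_one[OF prime_two] by metis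
qed

lemma pm_one_iff: "pm_one u \<longleftrightarrow> (\<exists>e. (e = 1 \<or> e = -1) \<and> u - e \<in> Zid 2 3)"
  by (auto simp: pm_one_def)

lemma pm_one_mult:
  assumes "pm_one u" "pm_one v"
  shows "pm_one (u * v)"
proof -
  obtain e where e: "e = 1 \<or> e = -1" "u - e \<in> Zid 2 3" using assms by (auto simp: pm_one_iff)
  obtain f where f: "f = 1 \<or> f = -1" "v - f \<in> Zid 2 3" using assms by (auto simp: pm_one_iff)
  have "f \<in> Zid 2 0" using f(1) Zid_uminus_iff[OF prime_two, of 1 0] by auto
  then have "u * (v - f) + (u - e) * f \<in> Zid 2 3"
    using e f Zunit_Zid[OF pm_one_unit[OF assms(1)]]
    by (intro Zid_add prime_two Zid_mult_0 Zid_mult_0'[OF prime_two, of "u - e"]) auto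
  then have "u * v - e * f \<in> Zid 2 3" by (simp add: algebra_simps)
  moreover have "e * f = 1 \<or> e * f = -1" using e f by auto
  ultimately show ?thesis by (auto simp: pm_one_iff)
qed

lemma pm_one_inverse:
  assumes "pm_one u"
  shows "pm_one (inverse u)"
proof -
  obtain e where e: "e = 1 \<or> e = -1" "u - e \<in> Zid 2 3" using assms by (auto simp: pm_one_iff)
  note u = pm_one_unit[OF assms]
  have e0: "e \<in> Zid 2 0" using e(1) Zid_uminus_iff[OF prime_two, of 1 0] by auto
  have "inverse u - e = - (inverse u * (e * (u - e)))"
    using Zunit_nonzero[OF prime_two u] e(1) by (auto simp: field_simps)
  moreover have "\<dots> \<in> Zid 2 3"
    using e e0 Zunit_inverse_Zid[OF prime_two u]
    by (intro Zid_uminus prime_two Zid_mult_0[OF prime_two _ Zid_mult_0])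
  ultimately show ?thesis using e(1) by (auto simp: pm_one_iff)
qed

lemma two_norm_mult: "two_norm c \<Longrightarrow> two_norm d \<Longrightarrow> two_norm (c * d)"
proof -
  assume "two_norm c" "two_norm d"
  then obtain a u b v where "pm_one u" "c = 2 powi a * u" "pm_one v" "d = 2 powi b * v"
    by (auto simp: two_norm_def)
  then have "pm_one (u * v)" "c * d = 2 powi (a + b) * (u * v)"
    by (auto simp: power_int_add intro: pm_one_mult)
  then show ?thesis unfolding two_norm_def by blast
qed

lemma two_norm_inverse: "two_norm c \<Longrightarrow> two_norm (inverse c)"
proof -
  assume "two_norm c"
  then obtain a u where "pm_one u" "c = 2 powi a * u" by (auto simp: two_norm_def)
  then have "pm_one (inverse u)" "inverse c = 2 powi (- a) * inverse u"
    by (auto simp: power_int_minus intro: pm_one_inverse)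
  then show ?thesis unfolding two_norm_def by blast
qed

lemma two_norm_nonzero: "two_norm c \<Longrightarrow> c \<noteq> 0"
  using Zunit_nonzero[OF prime_two pm_one_unit] by (auto simp: two_norm_def)

lemma two_norm_pm_one: "pm_one u \<Longrightarrow> two_norm u"
  unfolding two_norm_def by (intro exI[of _ 0] exI[of _ u]) simp

lemma two_norm_unit:
  assumes "two_norm (2 powi k * u)" "u \<in> Zunit 2"
  shows "pm_one u"
proof -
  obtain a v where v: "pm_one v" "2 powi k * u = 2 powi a * v" using assms by (auto simp: two_norm_def)
  have "k = a"
    using rat_val_powi_unit[OF prime_two assms(2), of k] rat_val_powi_unit[OF prime_two pm_one_unit[OF v(1)], of a] v(2)
    by simp
  then show ?thesis using v by simp
qed

lemma two_norm_cancel: "two_norm c \<Longrightarrow> two_norm (c * d) \<Longrightarrow> two_norm d"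
  using two_norm_mult[OF two_norm_inverse, of c "c * d"] two_norm_nonzero[of c] by (simp flip: mult.assoc)

lemma two_norm_unit_square: "u \<in> Zunit 2 \<Longrightarrow> two_norm (u\<^sup>2)"
  by (intro two_norm_pm_one) (simp add: pm_one_def odd_square)

lemma not_pm_one_five: "u - 5 \<in> Zid 2 3 \<Longrightarrow> \<not> pm_one u"
proof
  assume u: "u - 5 \<in> Zid 2 3" and "pm_one u"
  then obtain e where e: "e = 1 \<or> e = -1" "u - e \<in> Zid 2 3" by (auto simp: pm_one_iff)
  have "5 - e \<in> Zid 2 3" using Zid_diff[OF prime_two e(2) u] by simp
  moreover have "5 - e = 4 \<or> 5 - e = 6" using e(1) by auto
  ultimately show False by (auto simp: Zid_numeral_iff)
qed

text \<open>The discriminant separates the two kinds of binary even unimodular forms at 2: it is 5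
  modulo 8 for the anisotropic kind, with a, b, c all odd, and 1 modulo 8 for the hyperbolic plane.
  Only the latter value belongs to the norm group.\<close>

lemma discriminant_odd:
  assumes "a \<in> Zunit 2" "b \<in> Zunit 2" "c \<in> Zunit 2"
  shows "b\<^sup>2 - 4 * a * c - 5 \<in> Zid 2 3"
proof -
  have "4 * (a * c - 1) \<in> Zid 2 3"
    using four_times[OF odd_diff_odd[OF Zunit_mult[OF prime_two assms(1,3)] Zunit_one[OF prime_two]]] by (simp add: numeral_3_eq_3)
  from Zid_diff[OF prime_two Zid_diff[OF prime_two odd_square[OF assms(2)] this], of 8] show ?thesis
    by (simp add: algebra_simps)
qed

lemma discriminant_even:
  assumes "a \<in> Zid 2 1" "b \<in> Zunit 2" "c \<in> Zid 2 0"
  shows "b\<^sup>2 - 4 * a * c - 1 \<in> Zid 2 3"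
proof -
  have "4 * (a * c) \<in> Zid 2 3"
    using four_times[OF Zid_mult_0'[OF prime_two assms(1,3)]] by (simp add: numeral_3_eq_3)
  from Zid_diff[OF prime_two odd_square[OF assms(2)] this] show ?thesis by (simp add: algebra_simps)
qed

section \<open>Binary blocks at two\<close>

text \<open>Newton's iteration with the derivative b + 2 c t replaced by the unit b, which agrees
  with it modulo 2; each step gains at least one digit.\<close>

lemma hensel_quadratic:
  assumes "a \<in> Zid 2 1" "b \<in> Zunit 2" "c \<in> Zid 2 0"
  shows "\<exists>t\<in>Zid 2 0. a + b * t + c * t\<^sup>2 \<in> Zid 2 (Suc N)"
proof (induction N)
  case 0
  then show ?case using assms by (intro bexI[of _ 0]) auto
next
  case (Suc N)
  then obtain t where t: "t \<in> Zid 2 0" "a + b * t + c * t\<^sup>2 \<in> Zid 2 (Suc N)" by blast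
  define e where "e = a + b * t + c * t\<^sup>2"
  have e: "e \<in> Zid 2 (Suc N)" using t by (simp add: e_def)
  have b: "inverse b \<in> Zid 2 0" "b \<noteq> 0" using assms Zunit_inverse_Zid[OF prime_two] Zunit_nonzero[OF prime_two] by auto
  define s where "s = t - e * inverse b"
  have "e \<in> Zid 2 0" "e \<in> Zid 2 1" using Zid_mono[OF prime_two _ e] by auto
  then have s: "s \<in> Zid 2 0" unfolding s_def using t b by (intro Zid_diff Zid_mult_0 prime_two)
  have "a + b * s + c * s\<^sup>2 = e * (c * inverse b * (e * inverse b - 2 * t))"
    using b(2) unfolding s_def by (simp add: e_def field_simps power2_eq_square)
  moreover have "e * inverse b \<in> Zid 2 1" "2 * t \<in> Zid 2 1"
    using Zid_mult_0'[OF prime_two \<open>e \<in> Zid 2 1\<close> b(1)] two_times[OF t(1)] by simp_all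
  then have "c * inverse b * (e * inverse b - 2 * t) \<in> Zid 2 1"
    using Zid_mult_0[OF prime_two Zid_mult_0[OF prime_two assms(3) b(1)]] Zid_diff[OF prime_two] by blast
  then have "e * (c * inverse b * (e * inverse b - 2 * t)) \<in> Zid 2 (Suc (Suc N))"
    using Zid_mult[OF prime_two e] by fastforce
  ultimately show ?case using s by (intro bexI[of _ s]) auto
qed

lemma Zgl_m2: "prime p \<Longrightarrow> mid p 0 (m2 a b c d) \<Longrightarrow> a * d - b * c \<in> Zunit p \<Longrightarrow> m2 a b c d \<in> Zgl p 2"
  by (simp add: Zgl_def m2_det)

text \<open>An approximate root of a + b t + c t^2 supplies a nearly isotropic vector, and a shear
  by a multiple of it nearly removes the other norm. On a hyperbolic plane the diagonal matrix with
  entries 1 and 2 is a similarity of multiplier 2; the tiny norms left over are absorbed by the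
  precision.\<close>

lemma approx_doubling_hyperbolic:
  assumes a: "a \<in> Zid 2 1" and b: "b \<in> Zunit 2" and c: "c \<in> Zid 2 0"
  shows "approx_doubling 2 N 2 (m2 (2 * a) b b (2 * c))"
proof -
  obtain t where t: "t \<in> Zid 2 0" "a + b * t + c * t\<^sup>2 \<in> Zid 2 (Suc N)" using hensel_quadratic[OF a b c] by blast
  define a' b' where "a' = a + b * t + c * t\<^sup>2" and "b' = b + 2 * (c * t)"
  have a': "a' \<in> Zid 2 N" using t Zid_mono[OF prime_two, of N "Suc N"] by (simp add: a'_def)
  have "b' - b \<in> Zid 2 1" unfolding b'_def using two_times[OF Zid_mult_0[OF prime_two c t(1)]] by simp
  then have b': "b' \<in> Zunit 2" using Zunit_cong[OF prime_two] b by blast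
  \<comment> \<open>Chosen so that the cross term 2 b' s cancels the norm 2 c of the second
    vector.\<close>
  define s where "s = - c * inverse b'"
  have s: "s \<in> Zid 2 0" unfolding s_def using c Zunit_inverse_Zid[OF prime_two b'] by (intro Zid_mult_0 Zid_uminus prime_two)
  have bs: "b' * s = - c" using Zunit_nonzero[OF prime_two b'] by (simp add: s_def)
  have 1: "m2 1 0 t 1 \<in> Zgl 2 2" "m2 1 s 0 1 \<in> Zgl 2 2"
    using t s by (intro Zgl_m2 prime_two; simp add: m2_mid)+
  have e1: "(m2 1 0 t 1)\<^sup>T * m2 (2 * a) b b (2 * c) * m2 1 0 t 1 = m2 (2 * a') b' b' (2 * c)"
    by (simp add: m2_simps a'_def b'_def algebra_simps power2_eq_square)
  have "(m2 1 s 0 1)\<^sup>T * m2 (2 * a') b' b' (2 * c) * m2 1 s 0 1 =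
      m2 (2 * a') (2 * a' * s + b') (2 * a' * s + b') (2 * a' * s * s + 2 * (b' * s) + 2 * c)"
    by (simp add: m2_simps algebra_simps)
  then have e2: "(m2 1 s 0 1)\<^sup>T * m2 (2 * a') b' b' (2 * c) * m2 1 s 0 1 =
      m2 (2 * a') (2 * a' * s + b') (2 * a' * s + b') (2 * a' * s * s)"
    unfolding bs by simp
  let ?K = "m2 (2 * a') (2 * a' * s + b') (2 * a' * s + b') (2 * a' * s * s)"
  have "approx_doubling 2 N 2 ?K"
  proof -
    have "(m2 1 0 0 2)\<^sup>T * ?K * m2 1 0 0 2 - 2 \<cdot>\<^sub>m ?K = m2 (- 2 * a') 0 0 (4 * s * s * a')"
      by (simp add: m2_simps algebra_simps)
    moreover have "mid 2 N \<dots>" using a' s prime_two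
      by (auto simp: m2_mid intro!: Zid_mult_0[OF prime_two _ a'] Zid_mult_0[OF prime_two _ s] Zid_uminus)
    moreover have "mid 2 0 (m2 1 0 0 (2::rat))" by (simp add: m2_mid)
    ultimately show ?thesis unfolding approx_doubling_def using m2_carrier by metis
  qed
  then have "approx_doubling 2 N 2 (m2 (2 * a') b' b' (2 * c))"
    using approx_doubling_congruent[OF prime_two m2_carrier 1(2), of N] e2 by simp
  then show ?thesis using approx_doubling_congruent[OF prime_two m2_carrier 1(1), of N] e1 by simp
qed

text \<open>All odd binary forms of this shape are isometric over the 2-adic integers. The first
  form represents 2 d by a primitive vector; the two discriminants are both 5 modulo 8, so their
  quotient is a square l^2, and l rescales the second basis vector.\<close>

lemma odd_binary_equivalent:
  assumes u: "a \<in> Zunit 2" "b \<in> Zunit 2" "c \<in> Zunit 2" "d \<in> Zunit 2" "e \<in> Zunit 2" "f \<in> Zunit 2"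
  obtains T where "T \<in> Zgl 2 2" "mid 2 N (T\<^sup>T * m2 (2 * a) b b (2 * c) * T - m2 (2 * d) e e (2 * f))"
proof -
  have ad: "a - d \<in> Zid 2 1" using odd_diff_odd u by blast
  \<comment> \<open>The two extra digits are spent when 4 a' (q - f) is divided by 4 at the
    end.\<close>
  obtain y where y: "y \<in> Zid 2 0" "(a - d) + b * y + c * y\<^sup>2 \<in> Zid 2 (Suc (N + 2))"
    using hensel_quadratic[OF ad u(2) Zunit_Zid[OF u(3)]] by blast
  define a' b' where "a' = a + b * y + c * y\<^sup>2" and "b' = b + 2 * (c * y)"
  have a'd: "a' - d \<in> Zid 2 (N + 2)" using Zid_mono[OF prime_two _ y(2), of "N + 2"] by (simp add: a'_def algebra_simps)
  have a': "a' \<in> Zunit 2" using Zunit_cong[OF prime_two Zid_mono[OF prime_two _ a'd, of 1]] u(4) by simp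
  have "b' - b \<in> Zid 2 1" unfolding b'_def using two_times[OF Zid_mult_0[OF prime_two Zunit_Zid[OF u(3)] y(1)]] by simp
  then have b': "b' \<in> Zunit 2" using Zunit_cong[OF prime_two] u(2) by blast
  define D E where "D = b'\<^sup>2 - 4 * a' * c" and "E = e\<^sup>2 - 4 * a' * f"
  have D: "D - 5 \<in> Zid 2 3" "E - 5 \<in> Zid 2 3"
    unfolding D_def E_def using discriminant_odd a' b' u by blast+
  have five: "(5::rat) \<in> Zunit 2" using Zunit_of_int_iff[OF prime_two, of 5] by simp
  have Du: "D \<in> Zunit 2" using Zunit_cong[OF prime_two Zid_mono[OF prime_two _ D(1), of 1]] five by simp
  have "E - D \<in> Zid 2 3" using Zid_diff[OF prime_two D(2,1)] by simp
  then have "inverse D * (E - D) \<in> Zid 2 3" by (intro Zid_mult_0 prime_two Zunit_inverse_Zid Du)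
  then have "E / D - 1 \<in> Zid 2 3" using Zunit_nonzero[OF prime_two Du] by (simp add: field_simps)
  then obtain l where l: "l \<in> Zunit 2" "l\<^sup>2 - E / D \<in> Zid 2 (N + 2)" using hensel_sqrt_two by blast
  have lD: "E - l\<^sup>2 * D \<in> Zid 2 (N + 2)"
  proof -
    have "E - l\<^sup>2 * D = - (D * (l\<^sup>2 - E / D))" using Zunit_nonzero[OF prime_two Du] by (simp add: field_simps)
    then show ?thesis using l Zunit_Zid[OF Du] by (simp only:) (intro Zid_uminus Zid_mult_0 prime_two)
  qed
  have a0: "a' \<noteq> 0" using Zunit_nonzero[OF prime_two a'] .
  \<comment> \<open>Chosen so that the new off-diagonal entry 2 a' t + l b' is exactly e. The
    numerator is a difference of odd numbers, so dividing it by 2 keeps t integral.\<close>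
  define t where "t = (e - l * b') / (2 * a')"
  have "(e - l * b') / 2 \<in> Zid 2 0" using odd_diff_odd[OF u(5) Zunit_mult[OF prime_two l(1) b']] by (simp add: half_iff)
  then have "(e - l * b') / 2 * inverse a' \<in> Zid 2 0" using Zunit_inverse_Zid[OF prime_two a'] by (intro Zid_mult_0 prime_two)
  moreover have "t = (e - l * b') / 2 * inverse a'" using a0 by (simp add: t_def field_simps)
  ultimately have t: "t \<in> Zid 2 0" by (simp only:)
  have te: "2 * a' * t + l * b' = e" using a0 by (simp add: t_def)
  define q where "q = a' * t\<^sup>2 + b' * t * l + c * l\<^sup>2"
  \<comment> \<open>The last coefficient is not solved for: once the first coefficient is a' and the
    middle one e, equality of discriminants determines it.\<close>
  have "4 * a' * q = (2 * a' * t + l * b')\<^sup>2 - l\<^sup>2 * D"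
    by (simp add: q_def D_def algebra_simps power2_eq_square)
  then have "4 * a' * (q - f) = E - l\<^sup>2 * D" unfolding te E_def by (simp add: algebra_simps)
  then have "2 * (2 * (a' * (q - f))) \<in> Zid 2 (Suc (Suc N))" using lD by (simp add: mult.assoc)
  then have "a' * (q - f) \<in> Zid 2 N" unfolding two_times_iff .
  then have qf: "q - f \<in> Zid 2 N" using Zid_mult_unit_iff[OF prime_two a'] by blast
  define T where "T = m2 1 0 y 1 * m2 1 t 0 l"
  have "m2 1 0 y 1 \<in> Zgl 2 2" using y by (intro Zgl_m2 prime_two) (auto simp: m2_mid)
  moreover have "m2 1 t 0 l \<in> Zgl 2 2" using t l Zunit_Zid[OF l(1)] by (intro Zgl_m2 prime_two) (auto simp: m2_mid)
  ultimately have TG: "T \<in> Zgl 2 2" unfolding T_def by (intro Zgl_mult prime_two)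
  have "T\<^sup>T * m2 (2 * a) b b (2 * c) * T = (m2 1 t 0 l)\<^sup>T * ((m2 1 0 y 1)\<^sup>T * m2 (2 * a) b b (2 * c) * m2 1 0 y 1) * m2 1 t 0 l"
    unfolding T_def by (rule congruent_compose) auto
  also have "(m2 1 0 y 1)\<^sup>T * m2 (2 * a) b b (2 * c) * m2 1 0 y 1 = m2 (2 * a') b' b' (2 * c)"
    by (simp add: m2_simps a'_def b'_def algebra_simps power2_eq_square)
  also have "(m2 1 t 0 l)\<^sup>T * m2 (2 * a') b' b' (2 * c) * m2 1 t 0 l = m2 (2 * a') (2 * a' * t + l * b') (2 * a' * t + l * b') (2 * q)"
    by (simp add: m2_simps q_def algebra_simps power2_eq_square)
  finally have "T\<^sup>T * m2 (2 * a) b b (2 * c) * T - m2 (2 * d) e e (2 * f) = m2 (2 * (a' - d)) 0 0 (2 * (q - f))"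
    unfolding te by (simp add: m2_simps algebra_simps)
  moreover have "a' - d \<in> Zid 2 N" using Zid_mono[OF prime_two _ a'd] by simp
  then have "mid 2 N (m2 (2 * (a' - d)) 0 0 (2 * (q - f)))"
    using qf Zid_mult_0[OF prime_two, of 2 "a' - d" N] Zid_mult_0[OF prime_two, of 2 "q - f" N]
    by (simp add: m2_mid del: right_diff_distrib_numeral)
  ultimately show thesis using that[OF TG] by simp
qed

text \<open>The similarity sends (x, y) to (2 T y, inverse of T applied to x), where T is an approximate
  isometry between the two odd binary forms.\<close>

lemma approx_doubling_quaternary:
  assumes u: "a \<in> Zunit 2" "b \<in> Zunit 2" "c \<in> Zunit 2" "d \<in> Zunit 2" "e \<in> Zunit 2" "f \<in> Zunit 2"
  shows "approx_doubling 2 N 4 (block_sum (m2 (2 * a) b b (2 * c)) (2 \<cdot>\<^sub>m m2 (2 * d) e e (2 * f)))"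
proof -
  let ?K = "m2 (2 * a) b b (2 * c)" and ?L = "m2 (2 * d) e e (2 * f)"
  obtain T where T: "T \<in> Zgl 2 2" "mid 2 N (T\<^sup>T * ?K * T - ?L)" using odd_binary_equivalent[OF u] .
  obtain V where V: "V \<in> Zgl 2 2" "T * V = 1\<^sub>m 2" "V * T = 1\<^sub>m 2" using Zgl_inverse[OF prime_two T(1)] .
  have Tc: "T \<in> carrier_mat 2 2" "mid 2 0 T" and Vc: "V \<in> carrier_mat 2 2" "mid 2 0 V"
    using T V by (auto simp: Zgl_def)
  define S where "S = four_block_mat (0\<^sub>m 2 2) (2 \<cdot>\<^sub>m T) V (0\<^sub>m 2 2)"
  let ?H = "block_sum ?K (2 \<cdot>\<^sub>m ?L)"
  have c: "0\<^sub>m 2 2 \<in> carrier_mat 2 2" "2 \<cdot>\<^sub>m T \<in> carrier_mat 2 2" "T\<^sup>T \<in> carrier_mat 2 2" "V\<^sup>T \<in> carrier_mat 2 2"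
    "?K \<in> carrier_mat 2 2" "2 \<cdot>\<^sub>m ?L \<in> carrier_mat 2 2" "2 \<cdot>\<^sub>m T\<^sup>T \<in> carrier_mat 2 2"
    using Tc Vc by auto
  note dims = carrier_matD[OF Tc(1)] carrier_matD[OF Vc(1)]
  have Sc: "S \<in> carrier_mat 4 4" using four_block_carrier_mat[OF c(1) c(1), of "2 \<cdot>\<^sub>m T" V] by (simp add: S_def)
  have t2: "(2 \<cdot>\<^sub>m T)\<^sup>T = 2 \<cdot>\<^sub>m T\<^sup>T" by (rule eq_matI) auto
  have ST: "S\<^sup>T = four_block_mat (0\<^sub>m 2 2) V\<^sup>T (2 \<cdot>\<^sub>m T\<^sup>T) (0\<^sub>m 2 2)"
    unfolding S_def using transpose_four_block_mat[OF c(1,2) Vc(1) c(1)] t2 by simp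
  have KT: "?K * (2 \<cdot>\<^sub>m T) \<in> carrier_mat 2 2" "2 \<cdot>\<^sub>m ?L * V \<in> carrier_mat 2 2" using Tc Vc by auto
  have HS: "?H * S = four_block_mat (0\<^sub>m 2 2) (?K * (2 \<cdot>\<^sub>m T)) (2 \<cdot>\<^sub>m ?L * V) (0\<^sub>m 2 2)"
    unfolding S_def using mult_four_block_mat[OF c(5) c(1) c(1) c(6) c(1,2) Vc(1) c(1)] c KT Vc Tc by simp
  have "S\<^sup>T * (?H * S) = block_sum (V\<^sup>T * (2 \<cdot>\<^sub>m ?L * V)) (2 \<cdot>\<^sub>m T\<^sup>T * (?K * (2 \<cdot>\<^sub>m T)))"
    unfolding HS ST using mult_four_block_mat[OF c(1) c(4) c(7) c(1) c(1) KT c(1)] c KT dims by simp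
  moreover have "S\<^sup>T * ?H * S = S\<^sup>T * (?H * S)" using carrier_matD[OF Sc] by (intro mat_assoc) auto
  moreover have "V\<^sup>T * (2 \<cdot>\<^sub>m ?L * V) = 2 \<cdot>\<^sub>m (V\<^sup>T * ?L * V)" using dims by (simp add: mat_ring)
  moreover have "2 \<cdot>\<^sub>m T\<^sup>T * (?K * (2 \<cdot>\<^sub>m T)) = 4 \<cdot>\<^sub>m (T\<^sup>T * ?K * T)"
    using dims by (simp add: mat_ring) (intro eq_matI, auto)
  \<comment> \<open>V approximately carries the second form to the first and T does the converse, so
    the diagonal blocks approximate 2 K and 4 L, where 4 L is the double of the second summand 2
    L.\<close>
  ultimately have SHS: "S\<^sup>T * ?H * S = block_sum (2 \<cdot>\<^sub>m (V\<^sup>T * ?L * V)) (4 \<cdot>\<^sub>m (T\<^sup>T * ?K * T))" by simp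
  define X where "X = T\<^sup>T * ?K * T - ?L"
  have X: "X \<in> carrier_mat 2 2" "mid 2 N X" using T Tc by (auto simp: X_def)
  have VT: "V\<^sup>T * T\<^sup>T = 1\<^sub>m 2" using arg_cong[OF V(2), of transpose_mat] dims by (simp add: mat_transpose_mult)
  have "V\<^sup>T * X * V = ?K - V\<^sup>T * ?L * V"
    unfolding X_def using dims V(2) by (simp add: mat_ring mat_cancel_left[OF VT])
  then have K: "?K = V\<^sup>T * X * V + V\<^sup>T * ?L * V"
    using dims by (intro eq_matI) (auto simp del: index_mult_mat(1))
  have L: "?L = T\<^sup>T * ?K * T - X"
    unfolding X_def using dims by (intro eq_matI) (auto simp del: index_mult_mat(1))
  have "S\<^sup>T * ?H * S - 2 \<cdot>\<^sub>m ?H = block_sum (2 \<cdot>\<^sub>m (V\<^sup>T * ?L * V) - 2 \<cdot>\<^sub>m ?K) (4 \<cdot>\<^sub>m (T\<^sup>T * ?K * T) - 4 \<cdot>\<^sub>m ?L)"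
    unfolding SHS using dims by (intro eq_matI) auto
  moreover have "2 \<cdot>\<^sub>m (V\<^sup>T * ?L * V) - 2 \<cdot>\<^sub>m ?K = - 2 \<cdot>\<^sub>m (V\<^sup>T * X * V)"
    by (subst K) (use dims in \<open>intro eq_matI, auto simp del: index_mult_mat(1)\<close>)
  moreover have "4 \<cdot>\<^sub>m (T\<^sup>T * ?K * T) - 4 \<cdot>\<^sub>m ?L = 4 \<cdot>\<^sub>m X"
    unfolding X_def using dims by (intro eq_matI) (auto simp del: index_mult_mat(1))
  ultimately have "S\<^sup>T * ?H * S - 2 \<cdot>\<^sub>m ?H = block_sum (- 2 \<cdot>\<^sub>m (V\<^sup>T * X * V)) (4 \<cdot>\<^sub>m X)" by simp
  moreover have "mid 2 N \<dots>"
  proof -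
    have "mid 2 N (V\<^sup>T * X * V)" using mid_congruent[OF prime_two X(1) Vc X(2)] .
    then have "mid 2 N (- 2 \<cdot>\<^sub>m (V\<^sup>T * X * V))" by (intro mid_smult_0 prime_two Zid_uminus) auto
    moreover have "mid 2 N (4 \<cdot>\<^sub>m X)" using X(2) by (intro mid_smult_0 prime_two) auto
    ultimately show ?thesis using X Vc prime_two
      by (subst mid_four_block[of _ 2 2 _ 2 _ 2]) (auto simp: mid_zero)
  qed
  moreover have "mid 2 0 S" unfolding S_def using c Vc Tc prime_two
    by (subst mid_four_block[of _ 2 2 _ 2 _ 2]) (auto simp: mid_zero intro!: mid_smult_0)
  ultimately show ?thesis unfolding approx_doubling_def using Sc by metis
qed


section \<open>Doubling at two\<close>

lemma even_form_carrier: "even_form p n H \<Longrightarrow> H \<in> carrier_mat n n"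
  by (simp add: even_form_def)

lemma even_form_entry: "even_form p n H \<Longrightarrow> i < n \<Longrightarrow> j < n \<Longrightarrow> H $$ (i, j) \<in> Zid p 0"
  by (auto simp: even_form_def mid_def)

lemma even_form_sym: "even_form p n H \<Longrightarrow> i < n \<Longrightarrow> j < n \<Longrightarrow> H $$ (i, j) = H $$ (j, i)"
  unfolding even_form_def using symmetric_entry by blast

lemma split_pair_two:
  assumes H: "even_form 2 n H" and ij: "i < n" "j < n" "i \<noteq> j" "H $$ (i, j) \<in> Zunit 2"
  obtains U W l where "n = 2 + l" "U \<in> Zgl 2 n" "even_form 2 l W"
    "U\<^sup>T * H * U = block_sum (m2 (H $$ (i, i)) (H $$ (i, j)) (H $$ (i, j)) (H $$ (j, j))) W"
proof -
  note Hc = even_form_carrier[OF H]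
  obtain q where q: "q permutes {0..<n}" "q 0 = i" "q 1 = j" using permutation_moving_two[OF ij(1-3)] .
  obtain P where P: "P \<in> Zgl 2 n" "\<And>a b. a < n \<Longrightarrow> b < n \<Longrightarrow> (P\<^sup>T * H * P) $$ (a, b) = H $$ (q a, q b)"
    using permute_congruent[OF prime_two Hc q(1)] by metis
  note Pc = Zgl_carrier[OF P(1)]
  define G where "G = P\<^sup>T * H * P"
  have G: "even_form 2 n G" unfolding G_def using even_form_congruent[OF prime_two H Pc Zgl_mid[OF P(1)]] .
  have "2 \<le> n" using ij by arith
  then obtain l where l: "n = 2 + l" by (metis le_Suc_ex)
  let ?K = "m2 (H $$ (i, i)) (H $$ (i, j)) (H $$ (i, j)) (H $$ (j, j))"
  have K: "mat 2 2 (\<lambda>ij. G $$ ij) = ?K"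
    by (rule eq_matI) (use P(2) q l even_form_sym[OF H ij(1,2)] in \<open>auto simp: less_2_iff G_def simp del: index_mult_mat(1)\<close>)
  have h: "H $$ (i, i) / 2 \<in> Zid 2 0" "H $$ (j, j) / 2 \<in> Zid 2 0" using H ij by (auto simp: even_form_def)
  \<comment> \<open>The diagonal entries are even, so modulo 2 the determinant is minus the square
    of the odd entry, a unit.\<close>
  have "det ?K = 4 * (H $$ (i, i) / 2 * (H $$ (j, j) / 2)) - H $$ (i, j) * H $$ (i, j)" by (simp add: m2_det)
  also have "\<dots> - - (H $$ (i, j) * H $$ (i, j)) \<in> Zid 2 1"
    using four_times[OF Zid_mult_0[OF prime_two h]] Zid_mono[OF prime_two, of 1 2] by simp
  finally have "det ?K - - (H $$ (i, j) * H $$ (i, j)) \<in> Zid 2 1" .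
  moreover have "- (H $$ (i, j) * H $$ (i, j)) \<in> Zunit 2"
    using Zunit_mult[OF prime_two _ Zunit_mult[OF prime_two ij(4,4)], of "-1"] Zunit_of_int_iff[OF prime_two, of "-1"] by simp
  ultimately have "det ?K \<in> Zunit 2" using Zunit_cong[OF prime_two] by blast
  then obtain V W where V: "V \<in> Zgl 2 n" "W \<in> carrier_mat l l" "V\<^sup>T * G * V = block_sum ?K W"
    using split_unit_block[OF prime_two, of G 2 l] G l unfolding K even_form_def by metis
  have "even_form 2 n (block_sum ?K W)"
    using even_form_congruent[OF prime_two G Zgl_carrier[OF V(1)] Zgl_mid[OF V(1)]] V(3) by simp
  then have W: "even_form 2 l W" using even_form_block_sum[of 2 2 l ?K W] V(2) l by simp
  have "(P * V)\<^sup>T * H * (P * V) = block_sum ?K W"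
    using congruent_compose[OF Hc Pc Zgl_carrier[OF V(1)]] V(3) by (simp add: G_def)
  then show thesis using that[OF l Zgl_mult[OF prime_two P(1) V(1)] W] by blast
qed

text \<open>With this sign the determinant becomes the discriminant: it is multiplicative on sums of
  even rank, and a binary block contributes b^2 - 4 a c.\<close>

definition doubling_conditions :: "nat \<Rightarrow> rat mat \<Rightarrow> bool" where
  "doubling_conditions n H \<longleftrightarrow> even_form 2 n H \<and> even n \<and> two_norm ((-1) ^ (n div 2) * det H) \<and> locally_maximal 2 n H"

lemma doubling_conditions_congruent:
  assumes "doubling_conditions n H" "U \<in> Zgl 2 n"
  shows "doubling_conditions n (U\<^sup>T * H * U)"
proof -
  have H: "even_form 2 n H" "even n" "two_norm ((-1) ^ (n div 2) * det H)" "locally_maximal 2 n H"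
    using assms by (auto simp: doubling_conditions_def)
  have "two_norm ((det U)\<^sup>2 * ((-1) ^ (n div 2) * det H))"
    using two_norm_mult[OF two_norm_unit_square[OF Zgl_det[OF assms(2)]] H(3)] .
  then have "two_norm ((-1) ^ (n div 2) * det (U\<^sup>T * H * U))"
    unfolding det_congruent[OF even_form_carrier[OF H(1)] Zgl_carrier[OF assms(2)]] by (simp only: mult.left_commute)
  then show ?thesis unfolding doubling_conditions_def
    using even_form_congruent[OF prime_two H(1) Zgl_carrier[OF assms(2)] Zgl_mid[OF assms(2)]] H(2)
      locally_maximal_congruent[OF prime_two even_form_carrier[OF H(1)] assms(2) H(4)] by blast
qed

text \<open>When half the norm of one vector of the odd pair is even, the pair spans a hyperbolic
  plane. Its discriminant is 1 modulo 8, so the complement inherits the norm condition and the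
  induction hypothesis applies to it.\<close>

lemma split_hyperbolic:
  assumes H: "doubling_conditions n H" and ij: "i < n" "j < n" "i \<noteq> j" "H $$ (i, j) \<in> Zunit 2" "H $$ (i, i) / 2 \<in> Zid 2 1"
    and IH: "\<And>l W. l < n \<Longrightarrow> doubling_conditions l W \<Longrightarrow> approx_doubling 2 N l W"
  shows "approx_doubling 2 N n H"
proof -
  have He: "even_form 2 n H" using H by (simp add: doubling_conditions_def)
  obtain U W l where U: "n = 2 + l" "U \<in> Zgl 2 n" "even_form 2 l W"
    "U\<^sup>T * H * U = block_sum (m2 (H $$ (i, i)) (H $$ (i, j)) (H $$ (i, j)) (H $$ (j, j))) W"
    using split_pair_two[OF He ij(1-4)] .
  define a b c where "a = H $$ (i, i) / 2" and "b = H $$ (i, j)" and "c = H $$ (j, j) / 2"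
  let ?K = "m2 (2 * a) b b (2 * c)"
  have e: "U\<^sup>T * H * U = block_sum ?K W" using U(4) by (simp add: a_def b_def c_def)
  have abc: "a \<in> Zid 2 1" "b \<in> Zunit 2" "c \<in> Zid 2 0" using He ij by (auto simp: a_def b_def c_def even_form_def)
  have D: "doubling_conditions n (block_sum ?K W)" using doubling_conditions_congruent[OF H U(2)] e by simp
  note Wc = even_form_carrier[OF U(3)]
  have "doubling_conditions l W"
  proof -
    have "pm_one (b\<^sup>2 - 4 * a * c)" using discriminant_even[OF abc] by (simp add: pm_one_def)
    moreover have "(-1) ^ (n div 2) * det (block_sum ?K W) = (b\<^sup>2 - 4 * a * c) * ((-1) ^ (l div 2) * det W)"
      unfolding det_block_sum[OF m2_carrier Wc] using U(1) by (simp add: m2_det power2_eq_square algebra_simps)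
    ultimately have "two_norm ((-1) ^ (l div 2) * det W)"
      using two_norm_cancel[OF two_norm_pm_one] D unfolding doubling_conditions_def by metis
    moreover have "locally_maximal 2 l W"
      using locally_maximal_block_sum[OF prime_two m2_carrier Wc] D[unfolded U(1)] unfolding doubling_conditions_def by blast
    moreover have "even l" using H U(1) by (simp add: doubling_conditions_def)
    ultimately show ?thesis using U(3) by (simp add: doubling_conditions_def)
  qed
  then have "approx_doubling 2 N l W" using IH U(1) by simp
  then have "approx_doubling 2 N n (block_sum ?K W)"
    using approx_doubling_block_sum[OF prime_two m2_carrier Wc approx_doubling_hyperbolic[OF abc]] U(1) by simp
  then show ?thesis using approx_doubling_congruent[OF prime_two even_form_carrier[OF He] U(2)] e by simp
qed

section \<open>Zeros of forms modulo 2, 4 and 8 and bounds for the rank\<close>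

lemma quadratic_value:
  fixes G :: "'b::comm_ring_1 mat"
  assumes "G \<in> carrier_mat n n" "m \<le> n"
  defines "z \<equiv> \<lambda>f. mat n 1 (\<lambda>(i, j). if i < m then f i else 0)"
  shows "((z f)\<^sup>T * G * z f) $$ (0, 0) = (\<Sum>a<m. \<Sum>b<m. f a * G $$ (a, b) * f b)"
proof -
  have "((z f)\<^sup>T * G * z f) $$ (0, 0) = (\<Sum>a<n. \<Sum>b<n. z f $$ (a, 0) * G $$ (a, b) * z f $$ (b, 0))"
    using assms by (intro congruent_entry) auto
  also have "\<dots> = (\<Sum>a<m. \<Sum>b<n. z f $$ (a, 0) * G $$ (a, b) * z f $$ (b, 0))"
    using assms by (intro sum.mono_neutral_right) auto
  also have "\<dots> = (\<Sum>a<m. \<Sum>b<m. z f $$ (a, 0) * G $$ (a, b) * z f $$ (b, 0))"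
    using assms by (intro sum.cong refl sum.mono_neutral_right) auto
  also have "\<dots> = (\<Sum>a<m. \<Sum>b<m. f a * G $$ (a, b) * f b)"
    using assms by (intro sum.cong refl) auto
  finally show ?thesis .
qed

text \<open>The case of three variables of Chevalley's theorem over the field with two elements: a
  unit vector works if a square coefficient is even, a sum of two if a mixed one is, and the vector
  of ones if all six coefficients are odd.\<close>

lemma ternary_isotropic_mod_2:
  fixes a b c f g h :: int
  shows "\<exists>x y z. \<not> (even x \<and> even y \<and> even z) \<and> even (a * x * x + b * y * y + c * z * z + f * x * y + g * x * z + h * y * z)"
proof -
  consider "even a" | "even b" | "even c" | "odd a" "odd b" "even f" | "odd a" "odd c" "even g" | "odd b" "odd c" "even h"
    | "odd a" "odd b" "odd c" "odd f" "odd g" "odd h" by blast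
  then show ?thesis
  proof cases
    case 1 then show ?thesis by (intro exI[of _ 1] exI[of _ 0]) auto
  next
    case 2 show ?thesis by (rule exI[of _ 0], rule exI[of _ 1], rule exI[of _ 0]) (use 2 in auto)
  next
    case 3 show ?thesis by (rule exI[of _ 0], rule exI[of _ 0], rule exI[of _ 1]) (use 3 in auto)
  next
    case 4 show ?thesis by (rule exI[of _ 1], rule exI[of _ 1], rule exI[of _ 0]) (use 4 in auto)
  next
    case 5 show ?thesis by (rule exI[of _ 1], rule exI[of _ 0], rule exI[of _ 1]) (use 5 in auto)
  next
    case 6 show ?thesis by (rule exI[of _ 0], rule exI[of _ 1], rule exI[of _ 1]) (use 6 in auto)
  next
    case 7 show ?thesis by (rule exI[of _ 1], rule exI[of _ 1], rule exI[of _ 1]) (use 7 in auto)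
  qed
qed

text \<open>Subtracting the odd variable from the others makes the remaining three coefficients even, and
  half of what they represent is a ternary form modulo 2.\<close>

lemma quaternary_isotropic_mod_4_odd:
  fixes a b c d f g h k l m :: int
  assumes "odd d"
  shows "\<exists>x y z w. \<not> (even x \<and> even y \<and> even z \<and> even w) \<and>
    4 dvd a * x * x + b * y * y + c * z * z + d * w * w + 2 * (f * x * y + g * x * z + h * y * z + k * x * w + l * y * w + m * z * w)"
proof -
  \<comment> \<open>Substituting w = s x + t y + u z adds to a, b, c odd multiples of the squares of
    their own residues, up to even terms, and so makes them even.\<close>
  define s t u where "s = a mod 2" and "t = b mod 2" and "u = c mod 2"
  have "even (a + 2 * k * s + d * s * s)" "even (b + 2 * l * t + d * t * t)" "even (c + 2 * m * u + d * u * u)"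
    using assms by (auto simp: s_def t_def u_def mod2_eq_if)
  then obtain a' b' c' where abc: "a + 2 * k * s + d * s * s = 2 * a'" "b + 2 * l * t + d * t * t = 2 * b'"
    "c + 2 * m * u + d * u * u = 2 * c'" by (metis evenE)
  define f' g' h' where "f' = f + k * t + l * s + d * s * t" and "g' = g + k * u + m * s + d * s * u"
    and "h' = h + l * u + m * t + d * t * u"
  obtain x y z where xyz: "\<not> (even x \<and> even y \<and> even z)"
    "even (a' * x * x + b' * y * y + c' * z * z + f' * x * y + g' * x * z + h' * y * z)"
    using ternary_isotropic_mod_2 by blast
  define w where "w = s * x + t * y + u * z"
  have "a * x * x + b * y * y + c * z * z + d * w * w + 2 * (f * x * y + g * x * z + h * y * z + k * x * w + l * y * w + m * z * w)
     = (a + 2 * k * s + d * s * s) * x * x + (b + 2 * l * t + d * t * t) * y * y + (c + 2 * m * u + d * u * u) * z * z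
       + 2 * (f' * x * y + g' * x * z + h' * y * z)"
    by (simp add: w_def f'_def g'_def h'_def algebra_simps)
  also have "\<dots> = 2 * (a' * x * x + b' * y * y + c' * z * z + f' * x * y + g' * x * z + h' * y * z)"
    unfolding abc by (simp add: algebra_simps)
  also obtain q where q: "a' * x * x + b' * y * y + c' * z * z + f' * x * y + g' * x * z + h' * y * z = 2 * q"
    using xyz(2) by (elim evenE)
  finally have "a * x * x + b * y * y + c * z * z + d * w * w + 2 * (f * x * y + g * x * z + h * y * z + k * x * w + l * y * w + m * z * w) = 4 * q"
    unfolding q by simp
  then have "4 dvd a * x * x + b * y * y + c * z * z + d * w * w + 2 * (f * x * y + g * x * z + h * y * z + k * x * w + l * y * w + m * z * w)"
    by simp
  then show ?thesis using xyz(1) by blast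
qed

text \<open>If one of b, c, d is odd, its variable takes the part of w in the odd case. If all three
  are even, then x = 0 leaves twice a ternary form, and that form has a zero modulo 2.\<close>

lemma quaternary_isotropic_mod_4:
  fixes a b c d f g h k l m :: int
  shows "\<exists>x y z w. \<not> (even x \<and> even y \<and> even z \<and> even w) \<and>
    4 dvd a * x * x + b * y * y + c * z * z + d * w * w + 2 * (f * x * y + g * x * z + h * y * z + k * x * w + l * y * w + m * z * w)"
proof -
  consider "odd d" | "odd c" | "odd b" | "even b" "even c" "even d" by blast
  then show ?thesis
  proof cases
    case 1
    then show ?thesis by (rule quaternary_isotropic_mod_4_odd)
  next
    case 2
    obtain x y w z where "\<not> (even x \<and> even y \<and> even w \<and> even z)"
      "4 dvd a * x * x + b * y * y + d * w * w + c * z * z + 2 * (f * x * y + k * x * w + l * y * w + g * x * z + h * y * z + m * w * z)"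
      using quaternary_isotropic_mod_4_odd[OF 2, of a b d f k l g h m] by blast
    then show ?thesis by (intro exI[of _ x] exI[of _ y] exI[of _ z] exI[of _ w]) (auto simp: algebra_simps)
  next
    case 3
    obtain x z w y where "\<not> (even x \<and> even z \<and> even w \<and> even y)"
      "4 dvd a * x * x + c * z * z + d * w * w + b * y * y + 2 * (g * x * z + k * x * w + m * z * w + f * x * y + h * z * y + l * w * y)"
      using quaternary_isotropic_mod_4_odd[OF 3, of a c d g k m f h l] by blast
    then show ?thesis by (intro exI[of _ x] exI[of _ y] exI[of _ z] exI[of _ w]) (auto simp: algebra_simps)
  next
    case 4
    then obtain b' c' d' where e: "b = 2 * b'" "c = 2 * c'" "d = 2 * d'" by (metis evenE)
    obtain y z w where yzw: "\<not> (even y \<and> even z \<and> even w)" "even (b' * y * y + c' * z * z + d' * w * w + h * y * z + l * y * w + m * z * w)"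
      using ternary_isotropic_mod_2 by blast
    obtain q where "b' * y * y + c' * z * z + d' * w * w + h * y * z + l * y * w + m * z * w = 2 * q"
      using yzw(2) by (elim evenE)
    from arg_cong[OF this, of "\<lambda>t. 2 * t"]
    have "b * y * y + c * z * z + d * w * w + 2 * (h * y * z + l * y * w + m * z * w) = 4 * q"
      by (simp add: e algebra_simps)
    then show ?thesis using yzw(1) by (intro exI[of _ 0] exI[of _ y] exI[of _ z] exI[of _ w]) simp
  qed
qed

lemma Zid_not_unit_two: "x \<in> Zid 2 0 \<Longrightarrow> x \<notin> Zunit 2 \<Longrightarrow> x \<in> Zid 2 1"
  by (simp add: Zunit_def)

lemma half_Zid_3: "x \<in> Zid 2 3 \<Longrightarrow> x / 2 \<in> Zid 2 2"
  using half_iff[of x 2] by simp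

lemma half_Zid_2_iff: "x / 2 \<in> Zid 2 1 \<longleftrightarrow> x \<in> Zid 2 2"
  using half_iff[of x 1] by (simp only: Suc_1)

lemma twice_Zid_2: "x \<in> Zid 2 2 \<Longrightarrow> 2 * x \<in> Zid 2 3"
  using two_times[of x 2] by simp

lemma twice_Zid_1: "x \<in> Zid 2 1 \<Longrightarrow> 2 * x \<in> Zid 2 2"
  using two_times[of x 1] by (simp only: Suc_1)

lemma isotropic_vector_entry:
  assumes G: "G \<in> carrier_mat n n" and m: "m \<le> n"
    and aniso: "\<And>z. z \<in> carrier_mat n 1 \<Longrightarrow> mid 2 0 z \<Longrightarrow> (z\<^sup>T * G * z) $$ (0, 0) \<in> Zid 2 N \<Longrightarrow> mid 2 1 z"
    and f: "\<And>a. a < m \<Longrightarrow> f a \<in> Zid 2 0" and val: "(\<Sum>a<m. \<Sum>b<m. f a * G $$ (a, b) * f b) \<in> Zid 2 N"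
    and k: "k < m"
  shows "f k \<in> Zid 2 1"
proof -
  define z where "z = mat n 1 (\<lambda>(i, j). if i < m then f i else 0)"
  have "(z\<^sup>T * G * z) $$ (0, 0) \<in> Zid 2 N" using quadratic_value[OF G m, of f] val unfolding z_def by (simp only:)
  moreover have "mid 2 0 z" using f by (auto simp: mid_def z_def)
  moreover have "z \<in> carrier_mat n 1" by (simp add: z_def)
  ultimately have "mid 2 1 z" using aniso by blast
  from midD[OF this, of k 0] show ?thesis using k m by (simp add: z_def)
qed

lemma rounded_values:
  assumes f: "\<And>a. a < m \<Longrightarrow> f a \<in> Zid 2 0" and G: "\<And>a b. a < m \<Longrightarrow> b < m \<Longrightarrow> G a b - H a b \<in> Zid 2 N"
    and "(\<Sum>a<m. \<Sum>b<m. f a * H a b * f b) \<in> Zid 2 N"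
  shows "(\<Sum>a<m. \<Sum>b<m. f a * G a b * f b) \<in> Zid 2 N"
proof -
  have "(\<Sum>a<m. \<Sum>b<m. f a * (G a b - H a b) * f b) \<in> Zid 2 N"
    using f G by (intro Zid_sum prime_two Zid_mult_0'[OF prime_two Zid_mult_0[OF prime_two]]) auto
  from Zid_add[OF prime_two this assms(3)] show ?thesis
    by (simp add: algebra_simps flip: sum.distrib)
qed

text \<open>An even form that takes values in 4 Z only at even vectors is, after halving, anisotropic
  modulo 2, and has at most two variables.\<close>

lemma anisotropic_mod_2_rank:
  assumes G: "even_form 2 n G"
    and aniso: "\<And>z. z \<in> carrier_mat n 1 \<Longrightarrow> mid 2 0 z \<Longrightarrow> (z\<^sup>T * G * z) $$ (0, 0) \<in> Zid 2 2 \<Longrightarrow> mid 2 1 z"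
  shows "n \<le> 2"
proof (rule ccontr)
  assume "\<not> n \<le> 2"
  then have n: "3 \<le> n" by simp
  have "\<exists>k::int. x - of_int k \<in> Zid 2 2" if "x \<in> Zid 2 0" for x using Zid_round[OF prime_two that] by metis
  then obtain r :: "rat \<Rightarrow> int" where r: "\<And>x. x \<in> Zid 2 0 \<Longrightarrow> x - of_int (r x) \<in> Zid 2 2" by metis
  have d: "G $$ (i, i) / 2 \<in> Zid 2 0" if "i < 3" for i using G n that by (auto simp: even_form_def)
  \<comment> \<open>Rounding at ordered index pairs makes R symmetric by construction; on the
    diagonal the half is rounded and then doubled, so that R remains even.\<close>
  define R where "R i j = (if i = j then 2 * r (G $$ (i, i) / 2) else r (G $$ (min i j, max i j)))" for i j
  have R: "G $$ (i, j) - of_int (R i j) \<in> Zid 2 2" if ij: "i < 3" "j < 3" for i j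
  proof (cases "i = j")
    case True
    have "2 * (G $$ (i, i) / 2 - of_int (r (G $$ (i, i) / 2))) \<in> Zid 2 2"
      using r[OF d[OF ij(1)]] by (intro Zid_mult_0 prime_two) auto
    then show ?thesis using True by (simp add: R_def)
  next
    case False
    have e: "G $$ (min i j, max i j) = G $$ (i, j)"
      using even_form_sym[OF G, of i j] ij n by (auto simp: min_def max_def)
    have "G $$ (i, j) \<in> Zid 2 0" using even_form_entry[OF G] ij n by simp
    from r[OF this] show ?thesis using False e by (simp add: R_def)
  qed
  obtain x y z where xyz: "\<not> (even x \<and> even y \<and> even z)"
    "even (r (G $$ (0, 0) / 2) * x * x + r (G $$ (1, 1) / 2) * y * y + r (G $$ (2, 2) / 2) * z * z +
       R 0 1 * x * y + R 0 2 * x * z + R 1 2 * y * z)"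
    using ternary_isotropic_mod_2[of "r (G $$ (0, 0) / 2)" "r (G $$ (1, 1) / 2)" "r (G $$ (2, 2) / 2)" "R 0 1" "R 0 2" "R 1 2"]
    by blast
  then obtain q where q: "r (G $$ (0, 0) / 2) * x * x + r (G $$ (1, 1) / 2) * y * y + r (G $$ (2, 2) / 2) * z * z +
       R 0 1 * x * y + R 0 2 * x * z + R 1 2 * y * z = 2 * q" by (elim evenE)
  define f where "f = (\<lambda>a::nat. if a = 0 then x else if a = 1 then y else z)"
  define v where "v = (\<Sum>a<3. \<Sum>b<3. f a * R a b * f b)"
  have sym: "R 1 0 = R 0 1" "R 2 0 = R 0 2" "R 2 1 = R 1 2" by (simp_all add: R_def)
  have "v = 2 * (r (G $$ (0, 0) / 2) * x * x + r (G $$ (1, 1) / 2) * y * y + r (G $$ (2, 2) / 2) * z * z +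
       R 0 1 * x * y + R 0 2 * x * z + R 1 2 * y * z)"
    using sym by (simp add: v_def eval_nat_numeral f_def R_def algebra_simps)
  then have "v = 4 * q" unfolding q by simp
  then have "(of_int v :: rat) \<in> Zid 2 2" using Zid_of_int_iff[OF prime_two, of v 2] by simp
  then have "(\<Sum>a<3. \<Sum>b<3. of_int (f a) * of_int (R a b) * of_int (f b)) \<in> Zid 2 2" by (simp add: v_def)
  then have "(\<Sum>a<3. \<Sum>b<3. of_int (f a) * G $$ (a, b) * of_int (f b)) \<in> Zid 2 2"
    by (intro rounded_values[of 3 _ "\<lambda>a b. G $$ (a, b)" "\<lambda>a b. of_int (R a b)"]) (auto simp: prime_two R)
  then have "(of_int (f k) :: rat) \<in> Zid 2 1" if "k < 3" for k
    using isotropic_vector_entry[OF even_form_carrier[OF G] n aniso, where f = "\<lambda>a. of_int (f a)" and k = k] that prime_two by simp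
  then have "even (f k)" if "k < 3" for k using Zid_of_int_iff[OF prime_two, of "f k" 1] that by simp
  from this[of 0] this[of 1] this[of 2] show False using xyz(1) by (simp add: f_def)
qed

text \<open>Half of G is an integral form that takes values in 4 Z only at even vectors, but any
  form in four variables has such a value at a vector with an odd entry.\<close>

lemma anisotropic_mod_4_rank:
  assumes G: "even_form 2 n G" and ev: "\<And>i j. i < n \<Longrightarrow> j < n \<Longrightarrow> G $$ (i, j) \<in> Zid 2 1"
    and aniso: "\<And>z. z \<in> carrier_mat n 1 \<Longrightarrow> mid 2 0 z \<Longrightarrow> (z\<^sup>T * G * z) $$ (0, 0) \<in> Zid 2 3 \<Longrightarrow> mid 2 1 z"
  shows "n \<le> 3"
proof (rule ccontr)
  assume "\<not> n \<le> 3"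
  then have n: "4 \<le> n" by simp
  have "\<exists>k::int. x - of_int k \<in> Zid 2 3" if "x \<in> Zid 2 0" for x using Zid_round[OF prime_two that] by metis
  then obtain r :: "rat \<Rightarrow> int" where r: "\<And>x. x \<in> Zid 2 0 \<Longrightarrow> x - of_int (r x) \<in> Zid 2 3" by metis
  define R where "R i j = r (G $$ (min i j, max i j) / 2)" for i j
  have R: "G $$ (i, j) - 2 * of_int (R i j) \<in> Zid 2 3" if ij: "i < 4" "j < 4" for i j
  proof -
    have e: "G $$ (min i j, max i j) = G $$ (i, j)"
      using even_form_sym[OF G, of i j] ij n by (auto simp: min_def max_def)
    have "G $$ (i, j) / 2 \<in> Zid 2 0" using ev[of i j] ij n by (simp add: half_iff)
    then have "2 * (G $$ (i, j) / 2 - of_int (R i j)) \<in> Zid 2 3"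
      using r e by (intro Zid_mult_0 prime_two) (auto simp: R_def)
    then show ?thesis by simp
  qed
  obtain x y z w where xyzw: "\<not> (even x \<and> even y \<and> even z \<and> even w)"
    "4 dvd R 0 0 * x * x + R 1 1 * y * y + R 2 2 * z * z + R 3 3 * w * w +
      2 * (R 0 1 * x * y + R 0 2 * x * z + R 1 2 * y * z + R 0 3 * x * w + R 1 3 * y * w + R 2 3 * z * w)"
    using quaternary_isotropic_mod_4[of "R 0 0" "R 1 1" "R 2 2" "R 3 3" "R 0 1" "R 0 2" "R 1 2" "R 0 3" "R 1 3" "R 2 3"]
    by blast
  define f where "f = (\<lambda>a::nat. if a = 0 then x else if a = 1 then y else if a = 2 then z else w)"
  define v where "v = (\<Sum>a<4. \<Sum>b<4. f a * (2 * R a b) * f b)"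
  have sym: "R 1 0 = R 0 1" "R 2 0 = R 0 2" "R 2 1 = R 1 2" "R 3 0 = R 0 3" "R 3 1 = R 1 3" "R 3 2 = R 2 3"
    by (simp_all add: R_def)
  obtain q where q: "R 0 0 * x * x + R 1 1 * y * y + R 2 2 * z * z + R 3 3 * w * w +
      2 * (R 0 1 * x * y + R 0 2 * x * z + R 1 2 * y * z + R 0 3 * x * w + R 1 3 * y * w + R 2 3 * z * w) = 4 * q"
    using xyzw(2) by blast
  have "v = 2 * (R 0 0 * x * x + R 1 1 * y * y + R 2 2 * z * z + R 3 3 * w * w +
      2 * (R 0 1 * x * y + R 0 2 * x * z + R 1 2 * y * z + R 0 3 * x * w + R 1 3 * y * w + R 2 3 * z * w))"
    using sym by (simp add: v_def eval_nat_numeral f_def algebra_simps)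
  then have "v = 8 * q" unfolding q by simp
  then have "(of_int v :: rat) \<in> Zid 2 3" using Zid_of_int_iff[OF prime_two, of v 3] by simp
  then have "(\<Sum>a<4. \<Sum>b<4. of_int (f a) * (2 * of_int (R a b)) * of_int (f b)) \<in> Zid 2 3" by (simp add: v_def)
  then have "(\<Sum>a<4. \<Sum>b<4. of_int (f a) * G $$ (a, b) * of_int (f b)) \<in> Zid 2 3"
    by (intro rounded_values[of 4 _ "\<lambda>a b. G $$ (a, b)" "\<lambda>a b. 2 * of_int (R a b)"]) (auto simp: prime_two R)
  then have "(of_int (f k) :: rat) \<in> Zid 2 1" if "k < 4" for k
    using isotropic_vector_entry[OF even_form_carrier[OF G] n aniso, where f = "\<lambda>a. of_int (f a)" and k = k] that prime_two by simp
  then have "even (f k)" if "k < 4" for k using Zid_of_int_iff[OF prime_two, of "f k" 1] that by simp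
  from this[of 0] this[of 1] this[of 2] this[of 3] show False using xyzw(1) by (simp add: f_def)
qed

lemma binary_anisotropic:
  assumes G: "G \<in> carrier_mat 2 2" "G\<^sup>T = G"
    and aniso: "\<And>z. z \<in> carrier_mat 2 1 \<Longrightarrow> mid 2 0 z \<Longrightarrow> (z\<^sup>T * G * z) $$ (0, 0) \<in> Zid 2 N \<Longrightarrow> mid 2 1 z"
    and xy: "x \<in> Zid 2 0" "y \<in> Zid 2 0"
    and val: "G $$ (0, 0) * x\<^sup>2 + 2 * G $$ (0, 1) * x * y + G $$ (1, 1) * y\<^sup>2 \<in> Zid 2 N"
  shows "x \<in> Zid 2 1" "y \<in> Zid 2 1"
proof -
  define f where "f = (\<lambda>a::nat. if a = 0 then x else y)"
  have "(\<Sum>a<2. \<Sum>b<2. f a * G $$ (a, b) * f b) = G $$ (0, 0) * x\<^sup>2 + 2 * G $$ (0, 1) * x * y + G $$ (1, 1) * y\<^sup>2"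
    using symmetric_entry[OF G, of 1 0] by (simp add: eval_nat_numeral f_def algebra_simps)
  then have *: "f k \<in> Zid 2 1" if "k < 2" for k
    using isotropic_vector_entry[OF G(1) order_refl aniso, where f = f and k = k] val xy that by (auto simp: f_def)
  from *[of 0] *[of 1] show "x \<in> Zid 2 1" "y \<in> Zid 2 1" by (auto simp: f_def)
qed

text \<open>For a unit d the norm condition gives d congruent to 1 or -1 modulo 8, and -1 is ruled
  out by 1 + d; then s = 1 and t^2 = 1/d. For d = 2 e the unit -e is congruent to 1 or -1 modulo 8:
  the first case uses s = 2 and t^2 = -1/e, the second s = 0 and t^2 = 1/e.\<close>

lemma norm_represents_two:
  assumes d: "d \<in> Zid 2 0" "d \<notin> Zid 2 2" and n: "two_norm (- d)" and d4: "1 + d \<notin> Zid 2 2"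
  obtains s t where "s \<in> Zid 2 0" "t \<in> Zid 2 0" "s\<^sup>2 + d * t\<^sup>2 - 2 \<in> Zid 2 N"
proof (cases "d \<in> Zunit 2")
  case True
  have mo: "-1 \<in> Zunit 2" using Zunit_of_int_iff[OF prime_two, of "-1"] by simp
  have "- d \<in> Zunit 2" using Zunit_mult[OF prime_two mo True] by simp
  then have "pm_one (- d)" using two_norm_unit[of 0 "- d"] n by simp
  moreover have "- d - 1 \<notin> Zid 2 3"
  proof
    assume "- d - 1 \<in> Zid 2 3"
    then have "- d - 1 \<in> Zid 2 2" using Zid_mono[OF prime_two _ \<open>- d - 1 \<in> Zid 2 3\<close>, of 2] by simp
    moreover have "- d - 1 = - (1 + d)" by simp
    ultimately have "- (1 + d) \<in> Zid 2 2" by (simp only:)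
    then show False using d4 Zid_uminus_iff[OF prime_two, of "1 + d" 2] by simp
  qed
  ultimately have "- d + 1 \<in> Zid 2 3" by (simp add: pm_one_def)
  then have "- (inverse d * (- d + 1)) \<in> Zid 2 3"
    by (intro Zid_uminus Zid_mult_0 prime_two Zunit_inverse_Zid True)
  moreover have "- (inverse d * (- d + 1)) = - inverse d + 1" using Zunit_nonzero[OF prime_two True] by (simp add: field_simps)
  ultimately have "- (- inverse d + 1) \<in> Zid 2 3" using Zid_uminus[OF prime_two] by metis
  then have "inverse d - 1 \<in> Zid 2 3" by simp
  then obtain t where t: "t \<in> Zunit 2" "t\<^sup>2 - inverse d \<in> Zid 2 N" using hensel_sqrt_two by blast
  have "1\<^sup>2 + d * t\<^sup>2 - 2 = d * (t\<^sup>2 - inverse d)" using Zunit_nonzero[OF prime_two True] by (simp add: field_simps)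
  then show thesis using that[of 1 t] Zid_mult_0[OF prime_two d(1) t(2)] Zunit_Zid[OF t(1)] by simp
next
  case False
  then have "d \<in> Zid 2 1" using Zid_not_unit_two d by blast
  define e where "e = d / 2"
  have e0: "e \<in> Zid 2 0" using \<open>d \<in> Zid 2 1\<close> by (simp add: e_def half_iff)
  have "e \<notin> Zid 2 1" using d(2) by (simp only: e_def half_Zid_2_iff not_False_eq_True)
  then have e: "e \<in> Zunit 2" using e0 by (simp add: Zunit_def)
  have mo: "-1 \<in> Zunit 2" using Zunit_of_int_iff[OF prime_two, of "-1"] by simp
  have me: "- e \<in> Zunit 2" using Zunit_mult[OF prime_two mo e] by simp
  have "pm_one (- e)" using two_norm_unit[of 1 "- e"] me n by (simp add: e_def)
  then obtain g where g: "g = 1 \<or> g = -1" "- e - g \<in> Zid 2 3" by (auto simp: pm_one_iff)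
  have g0: "- g \<in> Zid 2 0" using g(1) Zid_uminus_iff[OF prime_two, of 1 0] by auto
  have en: "e \<noteq> 0" using Zunit_nonzero[OF prime_two e] .
  have "inverse e * ((- e - g)) \<in> Zid 2 3" using g by (intro Zid_mult_0 prime_two Zunit_inverse_Zid e)
  then have "- (inverse e * (- e - g)) \<in> Zid 2 3" by (rule Zid_uminus[OF prime_two])
  moreover have "- (inverse e * (- e - g)) = 1 + g * inverse e" using en by (simp add: field_simps)
  ultimately have "- (1 + g * inverse e) \<in> Zid 2 3" using Zid_uminus[OF prime_two] by metis
  moreover have "- (1 + g * inverse e) = - g * inverse e - 1" by simp
  ultimately have "- g * inverse e - 1 \<in> Zid 2 3" by (simp only:)
  then obtain t where t: "t \<in> Zunit 2" "t\<^sup>2 - - g * inverse e \<in> Zid 2 N" using hensel_sqrt_two by blast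
  have dt: "d * (t\<^sup>2 - - g * inverse e) \<in> Zid 2 N" using Zid_mult_0[OF prime_two d(1) t(2)] .
  have dt2: "d * (t\<^sup>2 - - g * inverse e) = d * t\<^sup>2 + 2 * g" using en by (simp add: e_def field_simps)
  have dt3: "d * t\<^sup>2 + 2 * g \<in> Zid 2 N" using dt unfolding dt2 .
  show thesis
  proof (cases "g = 1")
    case True
    have "2\<^sup>2 + d * t\<^sup>2 - 2 \<in> Zid 2 N" using dt3 True by (simp add: add.commute)
    then show thesis using that[of 2 t] Zunit_Zid[OF t(1)] by simp
  next
    case False
    then have "g = -1" using g by blast
    then have "0\<^sup>2 + d * t\<^sup>2 - 2 \<in> Zid 2 N" using dt3 \<open>g = -1\<close> by simp
    then show thesis using that[of 0 t] Zunit_Zid[OF t(1)] by simp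
  qed
qed

text \<open>The binary form is the norm form a (x^2 + d y^2) after completing the square.\<close>

lemma approx_doubling_binary_diagonal:
  assumes H: "even_form 2 2 H" and ev: "H $$ (0, 1) \<in> Zid 2 1" and a: "H $$ (0, 0) / 2 \<in> Zunit 2"
    and aniso: "\<And>z. z \<in> carrier_mat 2 1 \<Longrightarrow> mid 2 0 z \<Longrightarrow> (z\<^sup>T * H * z) $$ (0, 0) \<in> Zid 2 3 \<Longrightarrow> mid 2 1 z"
    and n: "two_norm (- det H)"
  shows "approx_doubling 2 N 2 H"
proof -
  have Hc: "H \<in> carrier_mat 2 2" "H\<^sup>T = H" using H by (auto simp: even_form_def)
  define \<alpha> \<beta> \<gamma> where "\<alpha> = H $$ (0, 0) / 2" and "\<beta> = H $$ (0, 1) / 2" and "\<gamma> = H $$ (1, 1) / 2"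
  have He: "H = m2 (2 * \<alpha>) (2 * \<beta>) (2 * \<beta>) (2 * \<gamma>)"
    using m2_eqI[OF Hc(1)] symmetric_entry[OF Hc, of 1 0] by (simp add: \<alpha>_def \<beta>_def \<gamma>_def)
  have u: "\<alpha> \<in> Zunit 2" using a by (simp add: \<alpha>_def)
  have a0: "\<alpha> \<noteq> 0" and ai: "inverse \<alpha> \<in> Zid 2 0" using Zunit_nonzero[OF prime_two u] Zunit_inverse_Zid[OF prime_two u] by auto
  have b: "\<beta> \<in> Zid 2 0" "\<gamma> \<in> Zid 2 0" using ev H by (auto simp: \<beta>_def \<gamma>_def half_iff even_form_def)
  define t where "t = - (inverse \<alpha> * \<beta>)"
  have t: "t \<in> Zid 2 0" unfolding t_def using ai b by (intro Zid_uminus Zid_mult_0 prime_two)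
  have at: "\<alpha> * t = - \<beta>" using a0 by (simp add: t_def)
  define \<delta> where "\<delta> = inverse \<alpha> * (\<gamma> + \<beta> * t)"
  have \<delta>: "\<delta> \<in> Zid 2 0" unfolding \<delta>_def using ai b t by (intro Zid_add Zid_mult_0 prime_two)
  have a\<delta>: "\<alpha> * \<delta> = \<gamma> + \<beta> * t" using a0 by (simp add: \<delta>_def)
  have disc: "\<alpha> * \<gamma> - \<beta>\<^sup>2 = \<alpha> * (\<alpha> * \<delta>)"
  proof -
    have "\<alpha> * (\<gamma> + \<beta> * t) = \<alpha> * \<gamma> + \<beta> * (\<alpha> * t)" by (simp add: algebra_simps)
    then show ?thesis unfolding a\<delta> at by (simp add: power2_eq_square)
  qed
  have U: "m2 1 t 0 1 \<in> Zgl 2 2" using t by (intro Zgl_m2 prime_two) (auto simp: m2_mid)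
  have "(m2 1 t 0 1)\<^sup>T * H * m2 1 t 0 1 = m2 (2 * \<alpha>) (2 * (\<alpha> * t + \<beta>)) (2 * (\<alpha> * t + \<beta>)) (2 * (t * (\<alpha> * t + \<beta>) + (\<gamma> + \<beta> * t)))"
    unfolding He by (simp add: m2_simps algebra_simps)
  then have e: "(m2 1 t 0 1)\<^sup>T * H * m2 1 t 0 1 = m2 (2 * \<alpha>) 0 0 (2 * \<alpha> * \<delta>)"
    unfolding at a\<delta>[symmetric] by (simp add: mult.assoc)
  \<comment> \<open>Twice \<alpha> times x^2 + \<delta> y^2 is the value of H at (x + t y, y), so it
    is not divisible by 8 when y is odd. The pairs (0, 1) and (1, 1) yield the two restrictions on
    \<delta> under which 2 is represented.\<close>
  have val: "\<not> (2 * (\<alpha> * (x\<^sup>2 + \<delta> * y\<^sup>2)) \<in> Zid 2 3 \<and> x \<in> Zid 2 0 \<and> y \<in> Zid 2 0 \<and> y \<in> Zunit 2)" for x y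
  proof
    assume *: "2 * (\<alpha> * (x\<^sup>2 + \<delta> * y\<^sup>2)) \<in> Zid 2 3 \<and> x \<in> Zid 2 0 \<and> y \<in> Zid 2 0 \<and> y \<in> Zunit 2"
    define X where "X = x + t * y"
    have X: "X \<in> Zid 2 0" unfolding X_def using * t by (intro Zid_add Zid_mult_0 prime_two) auto
    have "\<alpha> * (H $$ (0, 0) * X\<^sup>2 + 2 * H $$ (0, 1) * X * y + H $$ (1, 1) * y\<^sup>2) =
        2 * ((\<alpha> * X + \<beta> * y)\<^sup>2 + (\<alpha> * \<gamma> - \<beta>\<^sup>2) * y\<^sup>2)"
      by (simp add: \<alpha>_def \<beta>_def \<gamma>_def field_simps power2_eq_square)
    also have "\<alpha> * X + \<beta> * y = \<alpha> * x + (\<alpha> * t + \<beta>) * y" by (simp add: X_def algebra_simps)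
    also note disc
    also have "2 * ((\<alpha> * x + (\<alpha> * t + \<beta>) * y)\<^sup>2 + \<alpha> * (\<alpha> * \<delta>) * y\<^sup>2) = \<alpha> * (2 * (\<alpha> * (x\<^sup>2 + \<delta> * y\<^sup>2)))"
      unfolding at by (simp add: algebra_simps power2_eq_square)
    finally have "H $$ (0, 0) * X\<^sup>2 + 2 * H $$ (0, 1) * X * y + H $$ (1, 1) * y\<^sup>2 = 2 * (\<alpha> * (x\<^sup>2 + \<delta> * y\<^sup>2))"
      using a0 by simp
    then have "H $$ (0, 0) * X\<^sup>2 + 2 * H $$ (0, 1) * X * y + H $$ (1, 1) * y\<^sup>2 \<in> Zid 2 3" using * by simp
    moreover have "y \<in> Zid 2 0" using * by blast
    ultimately have "y \<in> Zid 2 1" using binary_anisotropic(2)[where N = 3, OF Hc _ X] aniso by blast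
    then show False using * by (simp add: Zunit_def)
  qed
  have one: "(1::rat) \<in> Zunit 2" by simp
  have d2: "\<delta> \<notin> Zid 2 2"
  proof
    assume "\<delta> \<in> Zid 2 2"
    then have "2 * (\<alpha> * \<delta>) \<in> Zid 2 3" using twice_Zid_2[OF Zid_mult_0[OF prime_two Zunit_Zid[OF u]]] by blast
    then show False using val[of 0 1] by simp
  qed
  have d4: "1 + \<delta> \<notin> Zid 2 2"
  proof
    assume "1 + \<delta> \<in> Zid 2 2"
    then have "2 * (\<alpha> * (1 + \<delta>)) \<in> Zid 2 3" using twice_Zid_2[OF Zid_mult_0[OF prime_two Zunit_Zid[OF u]]] by blast
    then show False using val[of 1 1] by simp
  qed
  have "- det H = (2 * \<alpha>)\<^sup>2 * (- \<delta>)"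
  proof -
    note disc
    moreover have "- det H = - 4 * (\<alpha> * \<gamma> - \<beta>\<^sup>2)" unfolding He by (simp add: m2_det power2_eq_square)
    ultimately show ?thesis by (simp add: power2_eq_square)
  qed
  moreover have "two_norm ((2 * \<alpha>)\<^sup>2)"
  proof -
    have "two_norm (2 powi 2 * \<alpha>\<^sup>2)" using odd_square[OF u] unfolding two_norm_def pm_one_def by blast
    then show ?thesis by (simp add: power_mult_distrib power_int_def)
  qed
  ultimately have nd: "two_norm (- \<delta>)" using n two_norm_cancel by metis
  obtain s w where "s \<in> Zid 2 0" "w \<in> Zid 2 0" "s\<^sup>2 + \<delta> * w\<^sup>2 - 2 \<in> Zid 2 N"
    using norm_represents_two[OF \<delta> d2 nd d4] .
  then have "approx_doubling 2 N 2 (m2 (2 * \<alpha>) 0 0 (2 * \<alpha> * \<delta>))"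
    using approx_doubling_norm_form[OF prime_two Zid_mult_0[OF prime_two _ Zunit_Zid[OF u], of 2] \<delta>] by simp
  then show ?thesis using approx_doubling_congruent[OF prime_two Hc(1) U] e by simp
qed

text \<open>For an even matrix W the vector W z is even for every integral z, so local maximality
  becomes plain anisotropy modulo 8.\<close>

lemma locally_maximal_even:
  assumes W: "W \<in> carrier_mat n n" and ev: "\<And>i j. i < n \<Longrightarrow> j < n \<Longrightarrow> W $$ (i, j) \<in> Zid 2 1"
    and M: "locally_maximal 2 n W"
    and z: "z \<in> carrier_mat n 1" "mid 2 0 z" "(z\<^sup>T * W * z) $$ (0, 0) \<in> Zid 2 3"
  shows "mid 2 1 z"
proof -
  have "mid 2 1 W" using W ev by (auto simp: mid_def)
  then have "mid 2 1 (W * z)" using mid_mult_0'[OF prime_two _ _ z(2)] W z by auto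
  moreover have "mid 2 2 ((1 / 2) \<cdot>\<^sub>m (z\<^sup>T * W * z))"
    using half_Zid_3[OF z(3)] z(1) by (auto simp: mid_def simp del: index_mult_mat(1))
  ultimately show ?thesis using M z(1,2) unfolding locally_maximal_def by blast
qed

text \<open>If one of the halved diagonal entries is odd, the form is a multiple of a norm form,
  possibly after a swap. If both are even, H is twice an even form, which anisotropy makes odd in
  all three coefficients; its discriminant 5 modulo 8 then contradicts the norm condition.\<close>

lemma approx_doubling_binary_even:
  assumes H: "doubling_conditions 2 H" and ev: "\<And>i j. i < 2 \<Longrightarrow> j < 2 \<Longrightarrow> H $$ (i, j) \<in> Zid 2 1"
  shows "approx_doubling 2 N 2 H"
proof -
  have He: "even_form 2 2 H" "two_norm (- det H)" "locally_maximal 2 2 H" using H by (auto simp: doubling_conditions_def)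
  have Hc: "H \<in> carrier_mat 2 2" "H\<^sup>T = H" using He by (auto simp: even_form_def)
  note aniso = locally_maximal_even[OF Hc(1) ev He(3)]
  have h: "H $$ (0, 0) / 2 \<in> Zid 2 0" "H $$ (1, 1) / 2 \<in> Zid 2 0" using He by (auto simp: even_form_def)
  consider "H $$ (0, 0) / 2 \<in> Zunit 2" | "H $$ (1, 1) / 2 \<in> Zunit 2" | "H $$ (0, 0) / 2 \<in> Zid 2 1" "H $$ (1, 1) / 2 \<in> Zid 2 1"
    using h Zid_not_unit_two by blast
  then show ?thesis
  proof cases
    case 1
    then show ?thesis using approx_doubling_binary_diagonal[OF He(1) _ 1 aniso He(2)] ev[of 0 1] by simp
  next
    case 2
    have "Transposition.transpose 0 1 permutes {0..<2::nat}" by (intro permutes_swap_id) auto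
    then obtain U where U: "U \<in> Zgl 2 2"
      "\<And>a b. a < 2 \<Longrightarrow> b < 2 \<Longrightarrow> (U\<^sup>T * H * U) $$ (a, b) = H $$ (Transposition.transpose 0 1 a, Transposition.transpose 0 1 b)"
      using permute_congruent[OF prime_two Hc(1)] by metis
    define G where "G = U\<^sup>T * H * U"
    have Ge: "G $$ (0, 0) = H $$ (1, 1)" "G $$ (0, 1) = H $$ (1, 0)" "G $$ (1, 0) = H $$ (0, 1)" "G $$ (1, 1) = H $$ (0, 0)"
      using U(2) by (auto simp: G_def simp del: index_mult_mat(1))
    have D: "doubling_conditions 2 G" unfolding G_def using doubling_conditions_congruent[OF H U(1)] .
    then have G: "even_form 2 2 G" "two_norm (- det G)" "locally_maximal 2 2 G" by (auto simp: doubling_conditions_def)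
    have Gev: "G $$ (i, j) \<in> Zid 2 1" if "i < 2" "j < 2" for i j
      using that Ge ev[of 0 0] ev[of 0 1] ev[of 1 0] ev[of 1 1] by (auto simp: less_2_iff)
    have "approx_doubling 2 N 2 G"
      using approx_doubling_binary_diagonal[OF G(1) _ _ locally_maximal_even[OF even_form_carrier[OF G(1)] Gev G(3)] G(2)]
        Gev[of 0 1] 2 Ge by simp
    then show ?thesis using approx_doubling_congruent[OF prime_two Hc(1) U(1)] by (simp add: G_def)
  next
    case 3
    define a b c where "a = H $$ (0, 0) / 4" and "b = H $$ (0, 1) / 2" and "c = H $$ (1, 1) / 4"
    have e: "H = m2 (4 * a) (2 * b) (2 * b) (4 * c)"
      using m2_eqI[OF Hc(1)] symmetric_entry[OF Hc, of 1 0] by (simp add: a_def b_def c_def)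
    have q: "x \<in> Zid 2 1 \<and> y \<in> Zid 2 1" if "x \<in> Zid 2 0" "y \<in> Zid 2 0" "a * x\<^sup>2 + b * x * y + c * y\<^sup>2 \<in> Zid 2 1" for x y
    proof -
      have "4 * (a * x\<^sup>2 + b * x * y + c * y\<^sup>2) \<in> Zid 2 3" using four_times[OF that(3)] by (simp add: numeral_3_eq_3)
      then have "H $$ (0, 0) * x\<^sup>2 + 2 * H $$ (0, 1) * x * y + H $$ (1, 1) * y\<^sup>2 \<in> Zid 2 3"
        by (simp add: a_def b_def c_def algebra_simps)
      then show ?thesis using binary_anisotropic[OF Hc aniso that(1,2)] by blast
    qed
    have z: "a \<in> Zid 2 0" "b \<in> Zid 2 0" "c \<in> Zid 2 0"
      using 3 ev[of 0 1] half_iff[of "H $$ (0, 0) / 2" 0] half_iff[of "H $$ (1, 1) / 2" 0] by (auto simp: a_def b_def c_def half_iff)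
    have one: "(1::rat) \<notin> Zid 2 1" by simp
    have a: "a \<in> Zunit 2" using q[of 1 0] z one by (auto simp: Zunit_def)
    have c: "c \<in> Zunit 2" using q[of 0 1] z one by (auto simp: Zunit_def)
    have b: "b \<in> Zunit 2"
    proof (rule ccontr)
      assume "b \<notin> Zunit 2"
      then have "(a + c) + b \<in> Zid 2 1" using Zid_add[OF prime_two odd_add_odd[OF a c]] Zid_not_unit_two z by blast
      then show False using q[of 1 1] one by (auto simp: add_ac)
    qed
    have "- det H = 2 powi 2 * (b\<^sup>2 - 4 * a * c)" unfolding e by (simp add: m2_det power_int_def power2_eq_square algebra_simps)
    moreover have "b\<^sup>2 - 4 * a * c - 5 \<in> Zid 2 3" using discriminant_odd[OF a b c] .
    moreover have "b\<^sup>2 - 4 * a * c \<in> Zunit 2"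
    proof -
      have "(5::rat) \<in> Zunit 2" using Zunit_of_int_iff[OF prime_two, of 5] by simp
      then show ?thesis using Zunit_cong[OF prime_two Zid_mono[OF prime_two _ discriminant_odd[OF a b c], of 1]] by simp
    qed
    ultimately have False using He(2) two_norm_unit not_pm_one_five by metis
    then show ?thesis ..
  qed
qed

text \<open>Hyperbolic planes are split off as long as a unimodular pair with an even half-norm can
  be found or produced. What resists is small by anisotropy: an even matrix of rank 0 or 2, or an
  odd binary block followed by twice another one. A single odd block is excluded by its
  discriminant.\<close>

theorem approx_doubling_two:
  assumes "doubling_conditions n H"
  shows "approx_doubling 2 N n H"
  using assms
proof (induction n arbitrary: H rule: less_induct)
  case (less n)
  have H: "even_form 2 n H" "even n" "locally_maximal 2 n H" using less.prems by (auto simp: doubling_conditions_def)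
  note Hc = even_form_carrier[OF H(1)]
  show ?case
  proof (cases "\<exists>i<n. \<exists>j<n. i \<noteq> j \<and> H $$ (i, j) \<in> Zunit 2")
    case False
    have ev: "H $$ (i, j) \<in> Zid 2 1" if "i < n" "j < n" for i j
    proof (cases "i = j")
      case True
      then have "H $$ (i, j) / 2 \<in> Zid 2 0" using H(1) that by (auto simp: even_form_def)
      then show ?thesis by (simp add: half_iff)
    next
      case False
      then show ?thesis using \<open>\<not> (\<exists>i<n. _ i)\<close> that even_form_entry[OF H(1)] Zid_not_unit_two by blast
    qed
    have "n \<le> 3" using anisotropic_mod_4_rank[OF H(1) ev locally_maximal_even[OF Hc ev H(3)]] .
    then have "n = 0 \<or> n = 2" using H(2) by presburger
    then show ?thesis
      using approx_doubling_0[OF prime_two] Hc approx_doubling_binary_even[of H N] less.prems ev by auto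
  next
    case True
    then obtain i j where ij: "i < n" "j < n" "i \<noteq> j" "H $$ (i, j) \<in> Zunit 2" by blast
    have hyp: "approx_doubling 2 N n G"
      if "doubling_conditions n G" "k < n" "m < n" "k \<noteq> m" "G $$ (k, m) \<in> Zunit 2" "G $$ (k, k) / 2 \<in> Zid 2 1" for G k m
      using split_hyperbolic[OF that] less.IH by blast
    have h: "H $$ (i, i) / 2 \<in> Zid 2 0" "H $$ (j, j) / 2 \<in> Zid 2 0" using H(1) ij by (auto simp: even_form_def)
    obtain U W l where U: "n = 2 + l" "U \<in> Zgl 2 n" "even_form 2 l W"
      "U\<^sup>T * H * U = block_sum (m2 (H $$ (i, i)) (H $$ (i, j)) (H $$ (i, j)) (H $$ (j, j))) W"
      using split_pair_two[OF H(1) ij] .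
    define a b c where "a = H $$ (i, i) / 2" and "b = H $$ (i, j)" and "c = H $$ (j, j) / 2"
    define G where "G = block_sum (m2 (2 * a) b b (2 * c)) W"
    have e: "U\<^sup>T * H * U = G" using U(4) by (simp add: a_def b_def c_def G_def)
    have D: "doubling_conditions n G" using doubling_conditions_congruent[OF less.prems U(2)] e by simp
    then have G: "even_form 2 n G" "locally_maximal 2 n G" "two_norm ((-1) ^ (n div 2) * det G)" by (auto simp: doubling_conditions_def)
    note Wc = even_form_carrier[OF U(3)]
    have Wd: "dim_row W = l" "dim_col W = l" using Wc by auto
    have Wm: "locally_maximal 2 l W"
      using locally_maximal_block_sum[OF prime_two m2_carrier Wc] G(2)[unfolded U(1) G_def] by blast
    have Wh: "W $$ (k, k) / 2 \<in> Zid 2 0" if "k < l" for k using U(3) that by (auto simp: even_form_def)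
    have "approx_doubling 2 N n G"
    proof -
      consider "a \<in> Zid 2 1" | "c \<in> Zid 2 1" | "a \<in> Zunit 2" "c \<in> Zunit 2"
        using h Zid_not_unit_two by (auto simp: a_def c_def)
      then show ?thesis
      proof cases
        case 1
        show ?thesis by (rule hyp[OF D, of 0 1]) (use U(1) ij 1 in \<open>auto simp: G_def b_def\<close>)
      next
        case 2
        show ?thesis by (rule hyp[OF D, of 1 0]) (use U(1) ij 2 in \<open>auto simp: G_def b_def\<close>)
      next
        case 3
        have bu: "b \<in> Zunit 2" using ij by (simp add: b_def)
        show ?thesis
        proof (cases "\<exists>k<l. W $$ (k, k) / 2 \<in> Zunit 2")
          case True
          then obtain k where k: "k < l" "W $$ (k, k) / 2 \<in> Zunit 2" by blast
          \<comment> \<open>Adding a vector of W with odd half-norm to e_0 makes the half-norm of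
            e_0 even while its product with e_1 remains the odd number b.\<close>
          have "0 < n" "2 + k < n" "0 \<noteq> 2 + k" using U(1) k by auto
          then obtain V where V: "V \<in> Zgl 2 n" "\<And>x y. x < n \<Longrightarrow> y < n \<Longrightarrow> (V\<^sup>T * G * V) $$ (x, y) =
              G $$ (x, y) + (if y = 0 then 1 * G $$ (x, 2 + k) else 0) + (if x = 0 then 1 * G $$ (2 + k, y) else 0)
              + (if x = 0 \<and> y = 0 then 1 * 1 * G $$ (2 + k, 2 + k) else 0)"
            using add_column_congruent[OF prime_two even_form_carrier[OF G(1)], of 0 "2 + k" 1] by (metis Zid_one_iff prime_two)
          have "(V\<^sup>T * G * V) $$ (0, 1) = b" "(V\<^sup>T * G * V) $$ (0, 0) = 2 * a + W $$ (k, k)"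
            using V(2)[of 0 1] V(2)[of 0 0] U(1) k Wd by (simp_all add: G_def del: index_mult_mat(1))
          moreover have "(2 * a + W $$ (k, k)) / 2 \<in> Zid 2 1"
            using odd_add_odd[OF 3(1) k(2)] by (simp add: add_divide_distrib)
          ultimately have "approx_doubling 2 N n (V\<^sup>T * G * V)"
            using hyp[OF doubling_conditions_congruent[OF D V(1)], of 0 1] U(1) bu by simp
          then show ?thesis using approx_doubling_congruent[OF prime_two even_form_carrier[OF G(1)] V(1)] by blast
        next
          case False
          then have Wq: "W $$ (k, k) / 2 \<in> Zid 2 1" if "k < l" for k using Wh Zid_not_unit_two that by blast
          show ?thesis
          proof (cases "\<exists>k<l. \<exists>m<l. k \<noteq> m \<and> W $$ (k, m) \<in> Zunit 2")
            case True
            then obtain k m where km: "k < l" "m < l" "k \<noteq> m" "W $$ (k, m) \<in> Zunit 2" by blast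
            show ?thesis
              by (rule hyp[OF D, of "2 + k" "2 + m"]) (use U(1) km Wq[OF km(1)] Wd in \<open>auto simp: G_def\<close>)
          next
            case False
            \<comment> \<open>No odd entries remain in W and its halved diagonal is even, so W is
              twice an even form; local maximality makes that form anisotropic modulo 4.\<close>
            define W1 where "W1 = (1/2) \<cdot>\<^sub>m W"
            have W1: "W = 2 \<cdot>\<^sub>m W1" "W1 \<in> carrier_mat l l" using Wc by (auto simp: W1_def intro!: eq_matI)
            have We: "W $$ (x, y) \<in> Zid 2 1" if "x < l" "y < l" for x y
            proof (cases "x = y")
              case True
              then show ?thesis using Wh[of x] that by (simp add: half_iff)
            next
              case neq: False
              then show ?thesis using False that even_form_entry[OF U(3)] Zid_not_unit_two by blast
            qed
            have W1e: "even_form 2 l W1"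
              unfolding even_form_def
            proof (intro conjI allI impI W1(2))
              show "W1\<^sup>T = W1" using symmetric_entry[OF Wc] U(3) Wd by (intro eq_matI) (auto simp: W1_def even_form_def)
              show "mid 2 0 W1" using We Wd by (auto simp: mid_def W1_def half_iff)
              fix k assume "k < l"
              then show "W1 $$ (k, k) / 2 \<in> Zid 2 0" using Wq[of k] Wd half_iff[of "W $$ (k, k) / 2" 0] by (simp add: W1_def)
            qed
            have an: "mid 2 1 z" if "z \<in> carrier_mat l 1" "mid 2 0 z" "(z\<^sup>T * W1 * z) $$ (0, 0) \<in> Zid 2 2" for z
            proof (rule locally_maximal_even[OF Wc We Wm that(1,2)])
              have "z\<^sup>T * W * z = 2 \<cdot>\<^sub>m (z\<^sup>T * W1 * z)" unfolding W1(1) using that(1) carrier_matD[OF W1(2)] by (simp add: mat_ring)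
              moreover have "2 * (z\<^sup>T * W1 * z) $$ (0, 0) \<in> Zid 2 3" using twice_Zid_2[OF that(3)] .
              ultimately show "(z\<^sup>T * W * z) $$ (0, 0) \<in> Zid 2 3" using that(1) by (simp del: index_mult_mat(1))
            qed
            have "l \<le> 2" using anisotropic_mod_2_rank[OF W1e an] .
            then have "l = 0 \<or> l = 2" using H(2) U(1) by presburger
            then show ?thesis
            proof
              assume "l = 0"
              \<comment> \<open>A lone odd block has discriminant 5 modulo 8, which is not a
                norm.\<close>
              then have "- det G = b\<^sup>2 - 4 * a * c" unfolding G_def det_block_sum[OF m2_carrier Wc]
                using Wc by (simp add: m2_det power2_eq_square)
              then have "two_norm (2 powi 0 * (b\<^sup>2 - 4 * a * c))" using G(3) U(1) \<open>l = 0\<close> by simp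
              moreover have "b\<^sup>2 - 4 * a * c - 5 \<in> Zid 2 3" using discriminant_odd[OF 3(1) bu 3(2)] .
              moreover have "b\<^sup>2 - 4 * a * c \<in> Zunit 2"
              proof -
                have "(5::rat) \<in> Zunit 2" using Zunit_of_int_iff[OF prime_two, of 5] by simp
                then show ?thesis using Zunit_cong[OF prime_two Zid_mono[OF prime_two _ discriminant_odd[OF 3(1) bu 3(2)], of 1]] by simp
              qed
              ultimately have False using two_norm_unit not_pm_one_five by metis
              then show ?thesis ..
            next
              assume l2: "l = 2"
              note W1l = W1(2)[unfolded l2] and W1el = W1e[unfolded l2] and anl = an[unfolded l2]
              have W1s: "W1\<^sup>T = W1" using W1e by (simp add: even_form_def)
              define x y w where "x = W1 $$ (0, 0) / 2" and "y = W1 $$ (0, 1)" and "w = W1 $$ (1, 1) / 2"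
              have We: "W1 = m2 (2 * x) y y (2 * w)"
                using m2_eqI[OF W1l] symmetric_entry[OF W1l W1s, of 1 0] by (simp add: x_def y_def w_def)
              have q: "s \<in> Zid 2 1 \<and> t \<in> Zid 2 1" if "s \<in> Zid 2 0" "t \<in> Zid 2 0" "x * s\<^sup>2 + y * s * t + w * t\<^sup>2 \<in> Zid 2 1" for s t
              proof -
                have "2 * (x * s\<^sup>2 + y * s * t + w * t\<^sup>2) \<in> Zid 2 2" using twice_Zid_1[OF that(3)] .
                then have "W1 $$ (0, 0) * s\<^sup>2 + 2 * W1 $$ (0, 1) * s * t + W1 $$ (1, 1) * t\<^sup>2 \<in> Zid 2 2"
                  by (simp add: x_def y_def w_def algebra_simps)
                then show ?thesis using binary_anisotropic[OF W1l W1s anl that(1,2)] by blast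
              qed
              have z: "x \<in> Zid 2 0" "y \<in> Zid 2 0" "w \<in> Zid 2 0"
                using W1el even_form_entry[OF W1el, of 0 1] by (auto simp: even_form_def x_def y_def w_def)
              have one: "(1::rat) \<notin> Zid 2 1" by simp
              have xu: "x \<in> Zunit 2" using q[of 1 0] z one by (auto simp: Zunit_def)
              have wu: "w \<in> Zunit 2" using q[of 0 1] z one by (auto simp: Zunit_def)
              have yu: "y \<in> Zunit 2"
              proof (rule ccontr)
                assume "y \<notin> Zunit 2"
                then have "(x + w) + y \<in> Zid 2 1" using Zid_add[OF prime_two odd_add_odd[OF xu wu]] Zid_not_unit_two z by blast
                then show False using q[of 1 1] one by (auto simp: add_ac)
              qed
              show ?thesis unfolding G_def W1(1) We U(1) l2
                using approx_doubling_quaternary[OF 3(1) bu 3(2) xu yu wu, of N] by simp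
            qed
          qed
        qed
      qed
    qed
    then show ?thesis using approx_doubling_congruent[OF prime_two Hc U(2)] e by simp
  qed
qed

section \<open>Equivalence over the p-adic integers\<close>

lemma padic_norm_le_iff:
  assumes p: "prime p"
  shows "padic_norm p x \<le> real p powi (- int N) \<longleftrightarrow> x \<in> Zid p N"
proof (cases "x = 0")
  case True
  then show ?thesis using p by (simp add: padic_norm_def)
next
  case False
  have "1 < real p" using prime_gt_1_nat[OF p] by simp
  then have "real p powi (- rat_val p x) \<le> real p powi (- int N) \<longleftrightarrow> int N \<le> rat_val p x"
    using power_int_increasing[of "- rat_val p x" "- int N" "real p"]
      power_int_strict_increasing[of "- int N" "- rat_val p x" "real p"] by linarith
  then show ?thesis using False by (simp add: padic_norm_def Zid_iff_rat_val[OF p False])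
qed

lemma padic_norm_nonneg: "0 \<le> padic_norm p x"
  by (simp add: padic_norm_def)

lemma powi_small:
  assumes "prime p" "0 < (e::real)"
  obtains N where "real p powi (- int N) < e"
proof -
  have "1 < real p" using prime_gt_1_nat[OF assms(1)] by simp
  then have "1 / real p < 1" "0 < 1 / real p" by auto
  then obtain N where "(1 / real p) ^ N < e" using real_arch_pow_inv[OF assms(2)] by blast
  moreover have "real p powi (- int N) = (1 / real p) ^ N" by (simp add: power_int_minus power_one_over inverse_eq_divide)
  ultimately have "real p powi (- int N) < e" by simp
  then show thesis by (rule that)
qed

lemma powi_pos: "prime p \<Longrightarrow> 0 < real p powi (- int N)"
  using prime_gt_0_nat[of p] by simp

text \<open>Real bounds are traded for congruences modulo powers of p, the form in which sums and
  products of sequences are handled.\<close>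

lemma padic_cauchy_iff:
  assumes p: "prime p"
  shows "x \<in> padic_cauchy p \<longleftrightarrow> (\<forall>N. \<exists>K. \<forall>m\<ge>K. \<forall>n\<ge>K. x m - x n \<in> Zid p N)"
proof
  assume x: "x \<in> padic_cauchy p"
  show "\<forall>N. \<exists>K. \<forall>m\<ge>K. \<forall>n\<ge>K. x m - x n \<in> Zid p N"
  proof
    fix N
    obtain K where "\<forall>m\<ge>K. \<forall>n\<ge>K. padic_norm p (x m - x n) < real p powi (- int N)"
      using x powi_pos[OF p] unfolding padic_cauchy_def by blast
    then show "\<exists>K. \<forall>m\<ge>K. \<forall>n\<ge>K. x m - x n \<in> Zid p N"
      unfolding padic_norm_le_iff[OF p, symmetric] by (intro exI[of _ K]) (simp add: less_imp_le)
  qed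
next
  assume x: "\<forall>N. \<exists>K. \<forall>m\<ge>K. \<forall>n\<ge>K. x m - x n \<in> Zid p N"
  show "x \<in> padic_cauchy p"
    unfolding padic_cauchy_def
  proof (intro CollectI allI impI)
    fix e :: real assume "0 < e"
    then obtain N where N: "real p powi (- int N) < e" using powi_small[OF p] by blast
    obtain K where "\<forall>m\<ge>K. \<forall>n\<ge>K. padic_norm p (x m - x n) \<le> real p powi (- int N)"
      using x unfolding padic_norm_le_iff[OF p] by blast
    then show "\<exists>K. \<forall>m\<ge>K. \<forall>n\<ge>K. padic_norm p (x m - x n) < e"
      using N by (intro exI[of _ K]) (meson le_less_trans)
  qed
qed

lemma padic_null_iff:
  assumes p: "prime p"
  shows "x \<in> padic_null p \<longleftrightarrow> (\<forall>N. \<exists>K. \<forall>n\<ge>K. x n \<in> Zid p N)"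
proof
  assume x: "x \<in> padic_null p"
  show "\<forall>N. \<exists>K. \<forall>n\<ge>K. x n \<in> Zid p N"
  proof
    fix N
    obtain K where "\<forall>n\<ge>K. norm (padic_norm p (x n) - 0) < real p powi (- int N)"
      using LIMSEQ_D[OF _ powi_pos[OF p, of N]] x unfolding padic_null_def by blast
    then show "\<exists>K. \<forall>n\<ge>K. x n \<in> Zid p N"
      unfolding padic_norm_le_iff[OF p, symmetric] using padic_norm_nonneg[of p]
      by (intro exI[of _ K]) (simp add: less_imp_le)
  qed
next
  assume x: "\<forall>N. \<exists>K. \<forall>n\<ge>K. x n \<in> Zid p N"
  show "x \<in> padic_null p"
    unfolding padic_null_def
  proof (intro CollectI LIMSEQ_I)
    fix e :: real assume "0 < e"
    then obtain N where N: "real p powi (- int N) < e" using powi_small[OF p] by blast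
    obtain K where "\<forall>n\<ge>K. padic_norm p (x n) \<le> real p powi (- int N)"
      using x unfolding padic_norm_le_iff[OF p] by blast
    then show "\<exists>K. \<forall>n\<ge>K. norm (padic_norm p (x n) - 0) < e"
      using N padic_norm_nonneg[of p] by (intro exI[of _ K]) (auto intro: le_less_trans)
  qed
qed

lemma padic_cauchy_const: "prime p \<Longrightarrow> (\<lambda>_. c) \<in> padic_cauchy p"
  by (simp add: padic_cauchy_iff)

lemma padic_cauchy_add:
  assumes p: "prime p" and "x \<in> padic_cauchy p" "y \<in> padic_cauchy p"
  shows "(\<lambda>n. x n + y n) \<in> padic_cauchy p"
  unfolding padic_cauchy_iff[OF p]
proof
  fix N
  obtain K L where K: "\<forall>m\<ge>K. \<forall>n\<ge>K. x m - x n \<in> Zid p N" and L: "\<forall>m\<ge>L. \<forall>n\<ge>L. y m - y n \<in> Zid p N"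
    using assms(2,3) unfolding padic_cauchy_iff[OF p] by meson
  show "\<exists>K. \<forall>m\<ge>K. \<forall>n\<ge>K. x m + y m - (x n + y n) \<in> Zid p N"
  proof (intro exI[of _ "max K L"] allI impI)
    fix m n assume "max K L \<le> m" "max K L \<le> n"
    then have "(x m - x n) + (y m - y n) \<in> Zid p N" using K L by (intro Zid_add[OF p]) auto
    then show "x m + y m - (x n + y n) \<in> Zid p N" by (simp add: algebra_simps)
  qed
qed

lemma Zid_bounded: "prime p \<Longrightarrow> \<exists>M. of_nat p ^ M * (x::rat) \<in> Zid p 0"
proof (cases "x = 0")
  case False
  assume p: "prime p"
  have p0: "(of_nat p :: rat) \<noteq> 0" using p by auto
  define M where "M = nat (- rat_val p x)"
  have "rat_val p (of_nat p ^ M * x) = int M + rat_val p x"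
    using rat_val_mult[OF p _ False, of "of_nat p ^ M"] rat_val_prime_powi[OF p, of "int M"] p0 by simp
  then have "0 \<le> rat_val p (of_nat p ^ M * x)" by (simp add: M_def)
  then show ?thesis using Zid_iff_rat_val[OF p, of "of_nat p ^ M * x" 0] False p0 by (intro exI[of _ M]) simp
qed simp

lemma Zid_bounded_mono:
  assumes "prime p" "of_nat p ^ M * x \<in> Zid p 0" "M \<le> L"
  shows "of_nat p ^ L * x \<in> Zid p 0"
proof -
  have "of_nat p ^ L * x = of_nat p ^ (L - M) * (of_nat p ^ M * x)"
    using assms(3) by (simp flip: mult.assoc power_add)
  moreover have "of_nat p ^ (L - M) \<in> Zid p 0" using assms(1) by (intro Zid_power) auto
  ultimately show ?thesis using Zid_mult_0[OF assms(1) _ assms(2)] by metis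
qed

text \<open>From K on all terms differ from x K by p-integral numbers, and the finitely many earlier
  ones have a common denominator.\<close>

lemma padic_cauchy_bounded:
  assumes p: "prime p" and x: "x \<in> padic_cauchy p"
  shows "\<exists>M. \<forall>n. of_nat p ^ M * x n \<in> Zid p 0"
proof -
  obtain K where K: "\<forall>m\<ge>K. \<forall>n\<ge>K. x m - x n \<in> Zid p 0" using x unfolding padic_cauchy_iff[OF p] by meson
  have "\<forall>n. \<exists>M. of_nat p ^ M * x n \<in> Zid p 0" using Zid_bounded[OF p] by blast
  then obtain M where M: "\<And>n. of_nat p ^ M n * x n \<in> Zid p 0" by metis
  define L where "L = Max (M ` {..K})"
  have L: "of_nat p ^ L * x n \<in> Zid p 0" if "n \<le> K" for n
    using Zid_bounded_mono[OF p M] that by (simp add: L_def)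
  have "of_nat p ^ L * x n \<in> Zid p 0" for n
  proof (cases "n \<le> K")
    case False
    then have "of_nat p ^ L * (x n - x K) \<in> Zid p 0"
      using K p by (intro Zid_mult_0 Zid_power) auto
    from Zid_add[OF p this L[of K]] show ?thesis by (simp add: algebra_simps)
  qed (rule L)
  then show ?thesis by blast
qed

lemma Zid_bounded_mult:
  assumes p: "prime p" and "of_nat p ^ M * x \<in> Zid p 0" "y \<in> Zid p (M + N)"
  shows "x * y \<in> Zid p N"
proof -
  have "of_nat p ^ M * (x * y) \<in> Zid p (M + N)" using Zid_mult_0[OF assms] by (simp add: mult.assoc)
  then show ?thesis by (simp only: Zid_shift_iff[OF p])
qed

lemma padic_cauchy_mult:
  assumes p: "prime p" and x: "x \<in> padic_cauchy p" and y: "y \<in> padic_cauchy p"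
  shows "(\<lambda>n. x n * y n) \<in> padic_cauchy p"
  unfolding padic_cauchy_iff[OF p]
proof
  fix N
  obtain M where M: "\<And>n. of_nat p ^ M * x n \<in> Zid p 0" using padic_cauchy_bounded[OF p x] by blast
  obtain M' where M': "\<And>n. of_nat p ^ M' * y n \<in> Zid p 0" using padic_cauchy_bounded[OF p y] by blast
  obtain K L where K: "\<forall>m\<ge>K. \<forall>n\<ge>K. x m - x n \<in> Zid p (M' + N)" and L: "\<forall>m\<ge>L. \<forall>n\<ge>L. y m - y n \<in> Zid p (M + N)"
    using x y unfolding padic_cauchy_iff[OF p] by meson
  show "\<exists>K. \<forall>m\<ge>K. \<forall>n\<ge>K. x m * y m - x n * y n \<in> Zid p N"
  proof (intro exI[of _ "max K L"] allI impI)
    fix m n assume "max K L \<le> m" "max K L \<le> n"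
    then have "x m * (y m - y n) + y n * (x m - x n) \<in> Zid p N"
      using K L by (intro Zid_add[OF p] Zid_bounded_mult[OF p M] Zid_bounded_mult[OF p M']) auto
    then show "x m * y m - x n * y n \<in> Zid p N" by (simp add: algebra_simps)
  qed
qed

lemma padic_null_cauchy:
  assumes p: "prime p" and x: "x \<in> padic_null p"
  shows "x \<in> padic_cauchy p"
  unfolding padic_cauchy_iff[OF p]
proof
  fix N
  obtain K where "\<forall>n\<ge>K. x n \<in> Zid p N" using x unfolding padic_null_iff[OF p] by meson
  then show "\<exists>K. \<forall>m\<ge>K. \<forall>n\<ge>K. x m - x n \<in> Zid p N" using Zid_diff[OF p] by (intro exI[of _ K]) auto
qed

lemma padic_cauchy_ring_cring:
  assumes p: "prime p"
  shows "cring (padic_cauchy_ring p)"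
proof (rule cringI)
  show "abelian_group (padic_cauchy_ring p)"
  proof (rule abelian_groupI; simp add: padic_cauchy_ring_def padic_cauchy_const[OF p] padic_cauchy_add[OF p] add_ac fun_eq_iff)
    fix x assume "x \<in> padic_cauchy p"
    then have "(\<lambda>n. - 1 * x n) \<in> padic_cauchy p" by (intro padic_cauchy_mult padic_cauchy_const p)
    then show "\<exists>y\<in>padic_cauchy p. \<forall>n. x n + y n = 0" by (intro bexI[of _ "\<lambda>n. - 1 * x n"]) auto
  qed
  show "comm_monoid (padic_cauchy_ring p)"
    by (rule comm_monoidI; simp add: padic_cauchy_ring_def padic_cauchy_const[OF p] padic_cauchy_mult[OF p] mult_ac)
qed (simp add: padic_cauchy_ring_def algebra_simps)

lemma padic_null_ideal:
  assumes p: "prime p"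
  shows "ideal (padic_null p) (padic_cauchy_ring p)"
proof -
  interpret R: cring "padic_cauchy_ring p" by (rule padic_cauchy_ring_cring[OF p])
  have mult: "(\<lambda>n. x n * a n) \<in> padic_null p" if a: "a \<in> padic_null p" and x: "x \<in> padic_cauchy p" for a x
    unfolding padic_null_iff[OF p]
  proof
    fix N
    obtain M where M: "\<And>n. of_nat p ^ M * x n \<in> Zid p 0" using padic_cauchy_bounded[OF p x] by blast
    obtain K where "\<forall>n\<ge>K. a n \<in> Zid p (M + N)" using a unfolding padic_null_iff[OF p] by meson
    then show "\<exists>K. \<forall>n\<ge>K. x n * a n \<in> Zid p N" using Zid_bounded_mult[OF p M] by blast
  qed
  have add: "(\<lambda>n. a n + b n) \<in> padic_null p" if ab: "a \<in> padic_null p" "b \<in> padic_null p" for a b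
    unfolding padic_null_iff[OF p]
  proof
    fix N
    obtain K L where "\<forall>n\<ge>K. a n \<in> Zid p N" "\<forall>n\<ge>L. b n \<in> Zid p N" using ab unfolding padic_null_iff[OF p] by meson
    then show "\<exists>K. \<forall>n\<ge>K. a n + b n \<in> Zid p N" using Zid_add[OF p] by (intro exI[of _ "max K L"]) auto
  qed
  have zero: "(\<lambda>_. 0) \<in> padic_null p" using p by (simp add: padic_null_iff)
  show ?thesis
  proof (rule idealI[OF R.ring_axioms])
    show "subgroup (padic_null p) (add_monoid (padic_cauchy_ring p))"
    proof (rule group.subgroupI)
      show "group (add_monoid (padic_cauchy_ring p))" by (rule R.a_group)
      show "padic_null p \<subseteq> carrier (add_monoid (padic_cauchy_ring p))"
        using padic_null_cauchy[OF p] by (auto simp: padic_cauchy_ring_def)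
      show "padic_null p \<noteq> {}" using zero by blast
      fix a b assume a: "a \<in> padic_null p" and b: "b \<in> padic_null p"
      show "a \<otimes>\<^bsub>add_monoid (padic_cauchy_ring p)\<^esub> b \<in> padic_null p"
        using add[OF a b] by (simp add: padic_cauchy_ring_def)
      have m: "(\<lambda>n. - 1 * a n) \<in> padic_null p" using mult[OF a padic_cauchy_const[OF p]] .
      have "inv\<^bsub>add_monoid (padic_cauchy_ring p)\<^esub> a = (\<lambda>n. - 1 * a n)"
      proof (rule group.inv_equality[OF R.a_group])
        show "(\<lambda>n. - 1 * a n) \<otimes>\<^bsub>add_monoid (padic_cauchy_ring p)\<^esub> a = \<one>\<^bsub>add_monoid (padic_cauchy_ring p)\<^esub>"
          by (simp add: padic_cauchy_ring_def)
      qed (use padic_null_cauchy[OF p] a m in \<open>auto simp: padic_cauchy_ring_def\<close>)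
      then show "inv\<^bsub>add_monoid (padic_cauchy_ring p)\<^esub> a \<in> padic_null p" using m by simp
    qed
    fix a x assume a: "a \<in> padic_null p" and "x \<in> carrier (padic_cauchy_ring p)"
    then have x: "x \<in> padic_cauchy p" by (simp add: padic_cauchy_ring_def)
    show "x \<otimes>\<^bsub>padic_cauchy_ring p\<^esub> a \<in> padic_null p" using mult[OF a x] by (simp add: padic_cauchy_ring_def)
    show "a \<otimes>\<^bsub>padic_cauchy_ring p\<^esub> x \<in> padic_null p" using mult[OF a x] by (simp add: padic_cauchy_ring_def mult.commute)
  qed
qed

section \<open>Classes of Cauchy sequences as p-adic numbers\<close>

definition padic_class :: "nat \<Rightarrow> (nat \<Rightarrow> rat) \<Rightarrow> (nat \<Rightarrow> rat) set" where
  "padic_class p x = padic_null p +>\<^bsub>padic_cauchy_ring p\<^esub> x"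

lemma padic_class_hom:
  assumes p: "prime p"
  shows "ring_hom_cring (padic_cauchy_ring p) (Qp p) (padic_class p)"
  unfolding padic_class_def Qp_def
  using ideal.rcos_ring_hom_cring[OF padic_null_ideal[OF p] padic_cauchy_ring_cring[OF p]] .

lemma padic_class_eqI:
  assumes p: "prime p" and x: "x \<in> padic_cauchy p" and xy: "(\<lambda>n. x n - y n) \<in> padic_null p"
  shows "padic_class p x = padic_class p y"
proof -
  interpret I: ideal "padic_null p" "padic_cauchy_ring p" by (rule padic_null_ideal[OF p])
  have "(\<lambda>n. x n + (- 1) * (x n - y n)) \<in> padic_cauchy p"
    using padic_null_cauchy[OF p xy] x by (intro padic_cauchy_add padic_cauchy_mult padic_cauchy_const p)
  then have y: "y \<in> padic_cauchy p" by simp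
  have "x \<in> padic_null p +>\<^bsub>padic_cauchy_ring p\<^esub> y"
    unfolding a_r_coset_def r_coset_def
    using xy by (auto simp: padic_cauchy_ring_def intro!: bexI[of _ "\<lambda>n. x n - y n"])
  moreover have "y \<in> carrier (padic_cauchy_ring p)" using y by (simp add: padic_cauchy_ring_def)
  ultimately show ?thesis unfolding padic_class_def
    using I.a_repr_independence[OF _ _ I.a_subgroup] by metis
qed

lemma padic_class_Zp:
  assumes p: "prime p" and x: "x \<in> padic_cauchy p" "\<And>n. x n \<in> Zid p 0"
  shows "padic_class p x \<in> Zp p"
proof -
  interpret H: ring_hom_cring "padic_cauchy_ring p" "Qp p" "padic_class p" by (rule padic_class_hom[OF p])
  have "x \<in> padic_class p x"
    unfolding padic_class_def a_r_coset_def r_coset_def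
    using p by (auto simp: padic_cauchy_ring_def padic_null_iff intro!: bexI[of _ "\<lambda>_. 0"])
  moreover have "padic_norm p (x n) \<le> 1" for n using padic_norm_le_iff[OF p, of "x n" 0] x(2) by simp
  moreover have "padic_class p x \<in> carrier (Qp p)" using x by (intro H.hom_closed) (simp add: padic_cauchy_ring_def)
  ultimately show ?thesis unfolding Zp_def by blast
qed

lemma padic_cauchy_sum:
  assumes p: "prime p" and "\<And>k. k \<in> A \<Longrightarrow> f k \<in> padic_cauchy p"
  shows "(\<lambda>n. \<Sum>k\<in>A. f k n) \<in> padic_cauchy p"
  using assms(2)
  by (induction A rule: infinite_finite_induct) (auto intro!: padic_cauchy_const[OF p] padic_cauchy_add[OF p])

lemma finsum_padic_cauchy_ring:
  assumes p: "prime p" and "finite A" "\<And>k. k \<in> A \<Longrightarrow> f k \<in> padic_cauchy p"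
  shows "finsum (padic_cauchy_ring p) f A = (\<lambda>n. \<Sum>k\<in>A. f k n)"
proof -
  interpret R: cring "padic_cauchy_ring p" by (rule padic_cauchy_ring_cring[OF p])
  show ?thesis
    using assms(2,3)
  proof (induction A rule: finite_induct)
    case empty
    show ?case using R.finsum_empty[of f] by (simp add: padic_cauchy_ring_def)
  next
    case (insert a A)
    have c: "f \<in> A \<rightarrow> carrier (padic_cauchy_ring p)" "f a \<in> carrier (padic_cauchy_ring p)"
      using insert.prems by (auto simp: padic_cauchy_ring_def)
    have "finsum (padic_cauchy_ring p) f (insert a A) = f a \<oplus>\<^bsub>padic_cauchy_ring p\<^esub> finsum (padic_cauchy_ring p) f A"
      using insert c by (intro R.finsum_insert) auto
    also have "finsum (padic_cauchy_ring p) f A = (\<lambda>n. \<Sum>k\<in>A. f k n)" using insert by simp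
    finally show ?case using insert by (simp add: padic_cauchy_ring_def)
  qed
qed

lemma rmat_mult_padic_class:
  assumes p: "prime p" and "i < n" "j < n"
    and a: "\<And>k. k < n \<Longrightarrow> a i k \<in> padic_cauchy p" and b: "\<And>k. k < n \<Longrightarrow> b k j \<in> padic_cauchy p"
    and A: "\<And>k. k < n \<Longrightarrow> A i k = padic_class p (a i k)" and B: "\<And>k. k < n \<Longrightarrow> B k j = padic_class p (b k j)"
  shows "rmat_mult (Qp p) n A B i j = padic_class p (\<lambda>t. \<Sum>k<n. a i k t * b k j t)"
proof -
  interpret H: ring_hom_cring "padic_cauchy_ring p" "Qp p" "padic_class p" by (rule padic_class_hom[OF p])
  define f where "f k = (\<lambda>t. a i k t * b k j t)" for k
  have f: "f k \<in> padic_cauchy p" if "k < n" for k unfolding f_def using padic_cauchy_mult[OF p a b] that by blast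
  have c: "carrier (padic_cauchy_ring p) = padic_cauchy p" by (simp add: padic_cauchy_ring_def)
  have "padic_class p (\<lambda>t. \<Sum>k<n. a i k t * b k j t) = padic_class p (finsum (padic_cauchy_ring p) f {..<n})"
    using finsum_padic_cauchy_ring[OF p, of "{..<n}" f] f by (simp add: f_def)
  also have "\<dots> = finsum (Qp p) (padic_class p \<circ> f) {..<n}"
    using f by (intro H.hom_finsum) (auto simp: c)
  also have "\<dots> = finsum (Qp p) (\<lambda>k. A i k \<otimes>\<^bsub>Qp p\<^esub> B k j) {..<n}"
  proof (rule H.S.finsum_cong')
    fix k assume "k \<in> {..<n}"
    then have k: "k < n" by simp
    have "padic_class p (f k) = padic_class p (a i k \<otimes>\<^bsub>padic_cauchy_ring p\<^esub> b k j)" by (simp add: f_def padic_cauchy_ring_def)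
    also have "\<dots> = padic_class p (a i k) \<otimes>\<^bsub>Qp p\<^esub> padic_class p (b k j)" using a[OF k] b[OF k] by (intro H.hom_mult) (simp_all add: c)
    finally show "(padic_class p \<circ> f) k = A i k \<otimes>\<^bsub>Qp p\<^esub> B k j" using A[OF k] B[OF k] by simp
  next
    show "(\<lambda>k. A i k \<otimes>\<^bsub>Qp p\<^esub> B k j) \<in> {..<n} \<rightarrow> carrier (Qp p)"
      using A B a b by (auto simp: c intro!: H.S.m_closed H.hom_closed)
  qed simp
  finally show ?thesis by (simp add: rmat_mult_def)
qed

text \<open>All identities over the p-adic numbers are computed termwise on representatives. The
  inverses V t are carried along because membership in \<open>Zp_GL\<close> asks for an inverse that
  is itself given by Cauchy sequences; the congruence has to hold only up to a null
  sequence.\<close>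

lemma Zp_equivalent_limit:
  fixes U V :: "nat \<Rightarrow> rat mat"
  assumes p: "prime p" and A: "A \<in> carrier_mat n n"
    and U: "\<And>t. U t \<in> carrier_mat n n" "\<And>t. mid p 0 (U t)" "\<And>i j. i < n \<Longrightarrow> j < n \<Longrightarrow> (\<lambda>t. U t $$ (i, j)) \<in> padic_cauchy p"
    and V: "\<And>t. V t \<in> carrier_mat n n" "\<And>t. mid p 0 (V t)" "\<And>i j. i < n \<Longrightarrow> j < n \<Longrightarrow> (\<lambda>t. V t $$ (i, j)) \<in> padic_cauchy p"
    and UV: "\<And>t. U t * V t = 1\<^sub>m n" "\<And>t. V t * U t = 1\<^sub>m n"
    and lim: "\<And>i j. i < n \<Longrightarrow> j < n \<Longrightarrow> (\<lambda>t. ((U t)\<^sup>T * A * U t) $$ (i, j) - B $$ (i, j)) \<in> padic_null p"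
  shows "Zp_equivalent p n A B"
proof -
  interpret H: ring_hom_cring "padic_cauchy_ring p" "Qp p" "padic_class p" by (rule padic_class_hom[OF p])
  define u v where "u i j = (\<lambda>t. U t $$ (i, j))" and "v i j = (\<lambda>t. V t $$ (i, j))" for i j
  have uc: "u i j \<in> padic_cauchy p" and vc: "v i j \<in> padic_cauchy p" if "i < n" "j < n" for i j
    using U(3) V(3) that by (auto simp: u_def v_def)
  have one: "padic_class p (\<lambda>t. 1\<^sub>m n $$ (i, j)) = rmat_one (Qp p) i j" if "i < n" "j < n" for i j
    using that H.hom_one H.hom_zero by (simp add: rmat_one_def padic_cauchy_ring_def)
  \<comment> \<open>Stated for arbitrary X and Y, since it is needed for U V and for V U.\<close>
  have prod: "rmat_mult (Qp p) n (\<lambda>i j. padic_class p (x i j)) (\<lambda>i j. padic_class p (y i j)) i j = rmat_one (Qp p) i j"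
    if ij: "i < n" "j < n" and x: "\<And>i j. i < n \<Longrightarrow> j < n \<Longrightarrow> x i j \<in> padic_cauchy p"
      and y: "\<And>i j. i < n \<Longrightarrow> j < n \<Longrightarrow> y i j \<in> padic_cauchy p"
      and X: "\<And>t. X t \<in> carrier_mat n n" "\<And>t. Y t \<in> carrier_mat n n" "\<And>t. X t * Y t = 1\<^sub>m n"
      and xX: "\<And>i j t. x i j t = X t $$ (i, j)" "\<And>i j t. y i j t = Y t $$ (i, j)" for i j x y and X Y :: "nat \<Rightarrow> rat mat"
  proof -
    have "rmat_mult (Qp p) n (\<lambda>i j. padic_class p (x i j)) (\<lambda>i j. padic_class p (y i j)) i j =
        padic_class p (\<lambda>t. \<Sum>k<n. x i k t * y k j t)"
      using x y ij by (intro rmat_mult_padic_class[OF p]) auto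
    also have "(\<lambda>t. \<Sum>k<n. x i k t * y k j t) = (\<lambda>t. 1\<^sub>m n $$ (i, j))"
    proof
      fix t
      have "(\<Sum>k<n. x i k t * y k j t) = (X t * Y t) $$ (i, j)"
        using ij X(1,2)[of t] unfolding xX by (intro mult_mat_entry[symmetric]) auto
      then show "(\<Sum>k<n. x i k t * y k j t) = 1\<^sub>m n $$ (i, j)" unfolding X(3) .
    qed
    finally show ?thesis using one[OF ij] by simp
  qed
  have gl: "(\<lambda>i j. padic_class p (u i j)) \<in> Zp_GL p n"
    unfolding Zp_GL_def
  proof (intro CollectI conjI exI[of _ "\<lambda>i j. padic_class p (v i j)"] allI impI)
    fix i j assume ij: "i < n" "j < n"
    show "padic_class p (u i j) \<in> Zp p"
    proof (rule padic_class_Zp[OF p uc[OF ij]])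
      show "u i j t \<in> Zid p 0" for t using midD[OF U(2)[of t], of i j] carrier_matD[OF U(1)[of t]] ij by (simp add: u_def)
    qed
    show "padic_class p (v i j) \<in> Zp p"
    proof (rule padic_class_Zp[OF p vc[OF ij]])
      show "v i j t \<in> Zid p 0" for t using midD[OF V(2)[of t], of i j] carrier_matD[OF V(1)[of t]] ij by (simp add: v_def)
    qed
  next
    show "rmat_eq n (rmat_mult (Qp p) n (\<lambda>i j. padic_class p (u i j)) (\<lambda>i j. padic_class p (v i j))) (rmat_one (Qp p))"
      unfolding rmat_eq_def using prod[where x = u and y = v and X = U and Y = V, OF _ _ uc vc U(1) V(1) UV(1)] by (simp add: u_def v_def)
    show "rmat_eq n (rmat_mult (Qp p) n (\<lambda>i j. padic_class p (v i j)) (\<lambda>i j. padic_class p (u i j))) (rmat_one (Qp p))"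
      unfolding rmat_eq_def using prod[where x = v and y = u and X = V and Y = U, OF _ _ vc uc V(1) U(1) UV(2)] by (simp add: u_def v_def)
  qed
  have Q: "Qp_of_rat p q = padic_class p (\<lambda>_. q)" for q by (simp add: Qp_of_rat_def padic_class_def)
  define w where "w k j = (\<lambda>t. \<Sum>l<n. A $$ (k, l) * u l j t)" for k j
  have wc: "w k j \<in> padic_cauchy p" if "j < n" for k j
    unfolding w_def using uc that by (intro padic_cauchy_sum padic_cauchy_mult padic_cauchy_const p) auto
  have w: "rmat_mult (Qp p) n (\<lambda>i j. Qp_of_rat p (A $$ (i, j))) (\<lambda>i j. padic_class p (u i j)) k j = padic_class p (w k j)"
    if "k < n" "j < n" for k j
    unfolding Q w_def using uc that padic_cauchy_const[OF p]
    by (intro rmat_mult_padic_class[OF p, where a = "\<lambda>i j _. A $$ (i, j)"]) auto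
  have "rmat_eq n (rmat_mult (Qp p) n (\<lambda>i j. padic_class p (u j i))
      (rmat_mult (Qp p) n (\<lambda>i j. Qp_of_rat p (A $$ (i, j))) (\<lambda>i j. padic_class p (u i j))))
    (\<lambda>i j. Qp_of_rat p (B $$ (i, j)))"
    unfolding rmat_eq_def
  proof (intro allI impI)
    fix i j assume ij: "i < n" "j < n"
    have "rmat_mult (Qp p) n (\<lambda>i j. padic_class p (u j i))
      (rmat_mult (Qp p) n (\<lambda>i j. Qp_of_rat p (A $$ (i, j))) (\<lambda>i j. padic_class p (u i j))) i j
      = padic_class p (\<lambda>t. \<Sum>k<n. u k i t * w k j t)"
      using ij uc wc w by (intro rmat_mult_padic_class[OF p, where a = "\<lambda>i k. u k i"]) auto
    also have "(\<lambda>t. \<Sum>k<n. u k i t * w k j t) = (\<lambda>t. ((U t)\<^sup>T * A * U t) $$ (i, j))"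
    proof
      fix t
      show "(\<Sum>k<n. u k i t * w k j t) = ((U t)\<^sup>T * A * U t) $$ (i, j)"
        unfolding congruent_entry[OF A U(1) ij] by (simp add: u_def w_def sum_distrib_left mult.assoc)
    qed
    also have "padic_class p \<dots> = padic_class p (\<lambda>_. B $$ (i, j))"
    proof (rule padic_class_eqI[OF p _ lim[OF ij]])
      have "(\<lambda>t. B $$ (i, j) + (((U t)\<^sup>T * A * U t) $$ (i, j) - B $$ (i, j))) \<in> padic_cauchy p"
        using padic_null_cauchy[OF p lim[OF ij]] by (intro padic_cauchy_add padic_cauchy_const p)
      then show "(\<lambda>t. ((U t)\<^sup>T * A * U t) $$ (i, j)) \<in> padic_cauchy p" by (simp del: index_mult_mat(1))
    qed
    finally show "rmat_mult (Qp p) n (\<lambda>i j. padic_class p (u j i))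
      (rmat_mult (Qp p) n (\<lambda>i j. Qp_of_rat p (A $$ (i, j))) (\<lambda>i j. padic_class p (u i j))) i j = Qp_of_rat p (B $$ (i, j))"
      unfolding Q .
  qed
  then show ?thesis unfolding Zp_equivalent_def by (intro bexI[OF _ gl])
qed

lemma mat_add_distrib:
  fixes A B C :: "'b::semiring_0 mat"
  assumes "dim_col A = dim_row B" "dim_row B = dim_row C" "dim_col B = dim_col C"
  shows "A * (B + C) = A * B + A * C"
  using assms by (intro mult_add_distrib_mat) auto

lemma mat_add_distrib':
  fixes A B C :: "'b::semiring_0 mat"
  assumes "dim_col A = dim_row C" "dim_row A = dim_row B" "dim_col A = dim_col B"
  shows "(A + B) * C = A * C + B * C"
  using assms by (intro add_mult_distrib_mat) auto

lemma mat_smult_add: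
  fixes A B :: "'b::semiring mat"
  assumes "dim_row A = dim_row B" "dim_col A = dim_col B"
  shows "k \<cdot>\<^sub>m (A + B) = k \<cdot>\<^sub>m A + k \<cdot>\<^sub>m B"
  using assms by (intro eq_matI) (auto simp: distrib_left)

lemma mat_add_assoc:
  fixes A B C :: "'b::semigroup_add mat"
  assumes "dim_row A = dim_row B" "dim_col A = dim_col B" "dim_row B = dim_row C" "dim_col B = dim_col C"
  shows "A + B + C = A + (B + C)"
  using assms by (intro eq_matI) (auto simp: add.assoc)

section \<open>Square roots of matrices\<close>

text \<open>The recursion G' = 1 - W G^2 converges p-adically to a solution of G + W G^2 = 1, and then
  1 + 2 W G is a square root of 1 + 4 W.\<close>

fun sqrt_iter :: "nat \<Rightarrow> rat mat \<Rightarrow> nat \<Rightarrow> rat mat" where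
  "sqrt_iter n W 0 = 1\<^sub>m n"
| "sqrt_iter n W (Suc k) = 1\<^sub>m n - W * (sqrt_iter n W k * sqrt_iter n W k)"

lemma sqrt_iter_dim: "W \<in> carrier_mat n n \<Longrightarrow> dim_row (sqrt_iter n W k) = n \<and> dim_col (sqrt_iter n W k) = n"
  by (induction k) auto

lemma sqrt_iter_mid:
  assumes p: "prime p" and W: "W \<in> carrier_mat n n" "mid p 0 W"
  shows "mid p 0 (sqrt_iter n W k)"
proof (induction k)
  case (Suc k)
  have d: "dim_row (sqrt_iter n W k) = n" "dim_col (sqrt_iter n W k) = n" using sqrt_iter_dim[OF W(1)] by auto
  have "mid p 0 (W * (sqrt_iter n W k * sqrt_iter n W k))"
    using mid_mult_0[OF p _ W(2) mid_mult_0[OF p _ Suc Suc]] d W by simp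
  from mid_diff[OF p _ _ mid_one[OF p, of n] this] show ?case using d W by simp
qed (use p in \<open>simp add: mid_one\<close>)

text \<open>Each iterate is a polynomial in W, so it commutes with whatever commutes with W.\<close>

lemma sqrt_iter_commute:
  assumes W: "W \<in> carrier_mat n n" and X: "X \<in> carrier_mat n n" "X * W = W * X"
  shows "X * sqrt_iter n W k = sqrt_iter n W k * X"
proof (induction k)
  case 0
  then show ?case using X by simp
next
  case (Suc k)
  define G where "G = sqrt_iter n W k"
  have d: "dim_row G = n" "dim_col G = n" "dim_row W = n" "dim_col W = n" "dim_row X = n" "dim_col X = n"
    using sqrt_iter_dim[OF W] W X by (auto simp: G_def)
  have XG: "X * G = G * X" using Suc by (simp add: G_def)
  have "X * (W * (G * G)) = (X * W) * (G * G)" using d by (simp add: mat_assoc)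
  also have "\<dots> = W * ((X * G) * G)" unfolding X(2) using d by (simp add: mat_assoc)
  also have "(X * G) * G = G * (X * G)" using d by (simp add: XG mat_assoc)
  also have "G * (X * G) = G * (G * X)" by (simp only: XG)
  also have "W * (G * (G * X)) = W * (G * G) * X" using d by (simp add: mat_assoc)
  finally have "X * (W * (G * G)) = W * (G * G) * X" .
  then show ?case using d by (simp add: mat_ring flip: G_def)
qed

text \<open>The hypothesis says that W is self-adjoint for C, a property that passes to polynomials
  in W.\<close>

lemma sqrt_iter_adjoint:
  assumes W: "W \<in> carrier_mat n n" and C: "C \<in> carrier_mat n n" "C * W = W\<^sup>T * C"
  shows "C * sqrt_iter n W k = (sqrt_iter n W k)\<^sup>T * C"
proof (induction k)
  case 0
  then show ?case using C by simp
next
  case (Suc k)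
  define G where "G = sqrt_iter n W k"
  have d: "dim_row G = n" "dim_col G = n" "dim_row W = n" "dim_col W = n" "dim_row C = n" "dim_col C = n"
    using sqrt_iter_dim[OF W] W C by (auto simp: G_def)
  have CG: "C * G = G\<^sup>T * C" using Suc by (simp add: G_def)
  have WG: "W * G = G * W" using sqrt_iter_commute[OF W W refl] by (simp add: G_def)
  have "C * (W * (G * G)) = C * ((W * G) * G)" using d by (simp add: mat_assoc)
  also have "(W * G) * G = G * (W * G)"
  proof -
    have "(W * G) * G = (G * W) * G" by (simp only: WG)
    then show ?thesis using d by (simp add: mat_assoc)
  qed
  also have "G * (W * G) = G * (G * W)" by (simp only: WG)
  also have "C * (G * (G * W)) = (C * G) * (G * W)" using d by (simp add: mat_assoc)
  also have "(C * G) * (G * W) = (G\<^sup>T * C) * (G * W)" by (simp only: CG)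
  also have "\<dots> = G\<^sup>T * ((C * G) * W)" using d by (simp add: mat_assoc)
  also have "(C * G) * W = G\<^sup>T * (C * W)" unfolding CG using d by (simp add: mat_assoc)
  also have "G\<^sup>T * (G\<^sup>T * (C * W)) = G\<^sup>T * (G\<^sup>T * (W\<^sup>T * C))" unfolding C(2) ..
  also have "\<dots> = (W * (G * G))\<^sup>T * C" using d by (simp add: mat_ring)
  finally have e: "C * (W * (G * G)) = (W * (G * G))\<^sup>T * C" .
  have t: "(1\<^sub>m n - W * (G * G))\<^sup>T = 1\<^sub>m n - (W * (G * G))\<^sup>T"
    using d by (intro eq_matI) (auto simp del: index_mult_mat(1))
  show ?case using d e by (simp add: mat_diff_distrib mat_diff_distrib' mat_one_left mat_one_right t flip: G_def)
qed

text \<open>Consecutive differences satisfy G'' - G' = - W (G' - G) (G' + G), because G and G'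
  commute; the factor W, divisible by p, gains one digit per step.\<close>

lemma sqrt_iter_converges:
  assumes p: "prime p" and W: "W \<in> carrier_mat n n" "mid p 1 W"
  shows "mid p (Suc k) (sqrt_iter n W (Suc k) - sqrt_iter n W k)"
proof (induction k)
  case 0
  have "sqrt_iter n W (Suc 0) - sqrt_iter n W 0 = - W" using W by (intro eq_matI) auto
  then show ?case using mid_uminus[OF p W(2)] by simp
next
  case (Suc k)
  define G G' where "G = sqrt_iter n W k" and "G' = sqrt_iter n W (Suc k)"
  have d: "dim_row G = n" "dim_col G = n" "dim_row W = n" "dim_col W = n" "dim_row G' = n" "dim_col G' = n"
    using sqrt_iter_dim[OF W(1)] W unfolding G_def G'_def by blast+
  have "G * W = W * G" using sqrt_iter_commute[OF W(1) W(1) refl] by (simp add: G_def)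
  moreover have "G \<in> carrier_mat n n" using d by (intro carrier_matI)
  ultimately have GG: "G * G' = G' * G" unfolding G'_def by (intro sqrt_iter_commute[OF W(1)])
  have W0: "mid p 0 W" using mid_mono[OF p _ W(2)] by simp
  have m0: "mid p 0 G" "mid p 0 G'" using sqrt_iter_mid[OF p W(1) W0] unfolding G_def G'_def by blast+
  have "(G' - G) * (G' + G) = G' * G' - G * G"
  proof -
    have "(G' - G) * (G' + G) = (G' * G' - G * G') + (G' * G - G * G)"
      using d by (simp add: mat_diff_distrib' mat_add_distrib)
    then show ?thesis unfolding GG using d by (intro eq_matI) (auto simp del: index_mult_mat(1))
  qed
  then have "W * ((G' - G) * (G' + G)) = W * (G' * G') - W * (G * G)" using d by (simp add: mat_diff_distrib)
  moreover have "sqrt_iter n W (Suc (Suc k)) = 1\<^sub>m n - W * (G' * G')" by (simp only: sqrt_iter.simps G'_def)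
  moreover have "sqrt_iter n W (Suc k) = 1\<^sub>m n - W * (G * G)" by (simp only: sqrt_iter.simps G_def)
  ultimately have e: "sqrt_iter n W (Suc (Suc k)) - sqrt_iter n W (Suc k) = - (W * ((G' - G) * (G' + G)))"
    using d by (intro eq_matI) (auto simp del: index_mult_mat(1))
  have "mid p (Suc k) (G' - G)" using Suc by (simp only: G_def G'_def)
  then have "mid p (Suc k) ((G' - G) * (G' + G))" using mid_mult_0'[OF p] mid_add[OF p _ _ m0(2,1)] d by simp
  then have "mid p (1 + Suc k) (W * ((G' - G) * (G' + G)))" using mid_mult[OF p _ W(2)] d by simp
  then show ?case unfolding e using mid_uminus[OF p] by simp
qed

lemma padic_cauchy_step:
  assumes p: "prime p" and "\<And>k. x (Suc k) - x k \<in> Zid p k"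
  shows "x \<in> padic_cauchy p"
proof -
  have *: "x (K + j) - x K \<in> Zid p K" for K j
  proof (induction j)
    case (Suc j)
    have "x (Suc (K + j)) - x (K + j) \<in> Zid p K" using Zid_mono[OF p _ assms(2)] by simp
    from Zid_add[OF p this Suc] show ?case by simp
  qed (use p in simp)
  show ?thesis unfolding padic_cauchy_iff[OF p]
  proof (intro allI exI impI)
    fix N m n :: nat assume "N \<le> m" "N \<le> n"
    then have "x m - x N \<in> Zid p N" "x n - x N \<in> Zid p N" using *[of N "m - N"] *[of N "n - N"] by simp_all
    from Zid_diff[OF p this] show "x m - x n \<in> Zid p N" by simp
  qed
qed

lemma mat_bounded:
  assumes p: "prime p" and C: "C \<in> carrier_mat n m"
  obtains M where "mid p 0 (of_nat p ^ M \<cdot>\<^sub>m C)"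
proof -
  obtain f where f: "\<And>x. of_nat p ^ f x * (x::rat) \<in> Zid p 0" using Zid_bounded[OF p] by metis
  define M where "M = (\<Sum>i<n. \<Sum>j<m. f (C $$ (i, j)))"
  have "of_nat p ^ M * C $$ (i, j) \<in> Zid p 0" if "i < n" "j < m" for i j
  proof (rule Zid_bounded_mono[OF p f])
    have "f (C $$ (i, j)) \<le> (\<Sum>j<m. f (C $$ (i, j)))" using that by (intro member_le_sum) auto
    also have "\<dots> \<le> M" unfolding M_def using that by (intro member_le_sum[of i "{..<n}" "\<lambda>i. \<Sum>j<m. f (C $$ (i, j))"]) auto
    finally show "f (C $$ (i, j)) \<le> M" .
  qed
  then have "mid p 0 (of_nat p ^ M \<cdot>\<^sub>m C)" using C by (auto simp: mid_def)
  then show thesis using that by blast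
qed

text \<open>Put C = \<open>U0\<^sup>T * A * U0\<close>. Symmetry of B = C (1 + 4 W) makes W
  self-adjoint for C, and so is the square root Y of 1 + 4 W. Hence \<open>Y\<^sup>T * C * Y\<close>
  = C Y^2 = B in the limit, and U0 Y is the required isometry.\<close>

lemma Zp_equivalent_approx:
  assumes p: "prime p" and A: "A \<in> carrier_mat n n" "A\<^sup>T = A" and B: "B\<^sup>T = B"
    and U0: "U0 \<in> Zgl p n" and W: "W \<in> carrier_mat n n" "mid p 1 W"
    and BW: "B = (U0\<^sup>T * A * U0) * (1\<^sub>m n + 4 \<cdot>\<^sub>m W)"
  shows "Zp_equivalent p n A B"
proof -
  note U0c = Zgl_carrier[OF U0] and U0m = Zgl_mid[OF U0]
  define C where "C = U0\<^sup>T * A * U0"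
  have C: "C \<in> carrier_mat n n" "C\<^sup>T = C" using A U0c symmetric_congruent[OF A(1) U0c A(2)] by (auto simp: C_def)
  have dC: "dim_row C = n" "dim_col C = n" "dim_row W = n" "dim_col W = n" "dim_row U0 = n" "dim_col U0 = n"
    "dim_row A = n" "dim_col A = n"
    using C W U0c A by auto
  have B1: "B = C + 4 \<cdot>\<^sub>m (C * W)"
    unfolding BW C_def[symmetric] using dC C W by (simp add: mat_add_distrib mat_smult_right)
  have CW: "C * W = W\<^sup>T * C"
  proof -
    have "4 \<cdot>\<^sub>m (C * W) = B - C" using dC by (intro eq_matI) (auto simp: B1 simp del: index_mult_mat(1))
    moreover have "(B - C)\<^sup>T = B - C"
    proof -
      have "(B - C)\<^sup>T = B\<^sup>T - C\<^sup>T" using dC by (intro eq_matI) (auto simp: B1 simp del: index_mult_mat(1))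
      then show ?thesis using B C by simp
    qed
    ultimately have "(4 \<cdot>\<^sub>m (C * W))\<^sup>T = 4 \<cdot>\<^sub>m (C * W)" by simp
    moreover have "(4 \<cdot>\<^sub>m (C * W))\<^sup>T = 4 \<cdot>\<^sub>m (W\<^sup>T * C)"
    proof -
      have "(4 \<cdot>\<^sub>m (C * W))\<^sup>T = 4 \<cdot>\<^sub>m (C * W)\<^sup>T" using dC by (intro eq_matI) (auto simp del: index_mult_mat(1))
      then show ?thesis using C dC by (simp add: mat_transpose_mult)
    qed
    ultimately have e: "4 \<cdot>\<^sub>m (W\<^sup>T * C) = 4 \<cdot>\<^sub>m (C * W)" by simp
    show ?thesis
    proof (rule eq_matI)
      fix i j assume "i < dim_row (W\<^sup>T * C)" "j < dim_col (W\<^sup>T * C)"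
      then show "(C * W) $$ (i, j) = (W\<^sup>T * C) $$ (i, j)"
        using arg_cong[OF e, of "\<lambda>M. M $$ (i, j)"] dC by (simp del: index_mult_mat(1))
    qed (use dC in auto)
  qed
  define G where "G k = sqrt_iter n W k" for k
  have dG: "dim_row (G k) = n" "dim_col (G k) = n" for k using sqrt_iter_dim[OF W(1)] by (auto simp: G_def)
  have W0: "mid p 0 W" using mid_mono[OF p _ W(2)] by simp
  have G0: "mid p 0 (G k)" for k unfolding G_def using sqrt_iter_mid[OF p W(1) W0] .
  have WG: "W * G k = G k * W" for k unfolding G_def using sqrt_iter_commute[OF W(1) W(1) refl] .
  have CG: "C * G k = (G k)\<^sup>T * C" for k unfolding G_def using sqrt_iter_adjoint[OF W(1) C(1) CW] .
  have conv: "mid p (Suc k) (G (Suc k) - G k)" for k unfolding G_def using sqrt_iter_converges[OF p W] .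
  have GS: "G (Suc k) = 1\<^sub>m n - W * (G k * G k)" for k by (simp add: G_def)
  define Y where "Y k = 1\<^sub>m n + 2 \<cdot>\<^sub>m (W * G k)" for k
  have dY: "dim_row (Y k) = n" "dim_col (Y k) = n" for k using dC dG by (auto simp: Y_def)
  have mWG: "mid p 1 (W * G k)" for k using mid_mult_0'[OF p _ W(2) G0] dC dG by simp
  have mY1: "mid p 1 (2 \<cdot>\<^sub>m (W * G k))" for k using mid_smult_0[OF p _ mWG, of 2] p by simp
  have mY: "mid p 0 (Y k)" for k
    unfolding Y_def using mid_add[OF p _ _ mid_one[OF p] mid_mono[OF p _ mY1]] dC dG by simp
  have YZ: "Y k \<in> Zgl p n" for k
  proof -
    have Yc: "Y k \<in> carrier_mat n n" using dY by (intro carrier_matI) auto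
    have "Y k - 1\<^sub>m n = 2 \<cdot>\<^sub>m (W * G k)" unfolding Y_def using dC dG by (intro eq_matI) (auto simp del: index_mult_mat(1))
    then have "det (Y k) - det (1\<^sub>m n) \<in> Zid p 1"
      using det_cong_Zid[OF p Yc mY one_carrier_mat mid_one[OF p], of 1] mY1 by simp
    then show ?thesis using Zunit_cong[OF p, of "det (Y k)" 1] Yc mY p by (simp add: Zgl_def)
  qed
  define U where "U k = U0 * Y k" for k
  have UZ: "U k \<in> Zgl p n" for k unfolding U_def using Zgl_mult[OF p U0 YZ] .
  have dU: "dim_row (U k) = n" "dim_col (U k) = n" for k using dC dY by (auto simp: U_def)
  have "\<exists>V. V \<in> Zgl p n \<and> U k * V = 1\<^sub>m n \<and> V * U k = 1\<^sub>m n" for k using Zgl_inverse[OF p UZ] by metis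
  then obtain V where V: "\<And>k. V k \<in> Zgl p n" "\<And>k. U k * V k = 1\<^sub>m n" "\<And>k. V k * U k = 1\<^sub>m n" by metis
  have dV: "dim_row (V k) = n" "dim_col (V k) = n" for k using Zgl_carrier[OF V(1)] by auto
  have Ustep: "mid p k (U (Suc k) - U k)" for k
  proof -
    have "U (Suc k) - U k = U0 * (2 \<cdot>\<^sub>m (W * (G (Suc k) - G k)))"
    proof -
      have "U (Suc k) - U k = U0 * (Y (Suc k) - Y k)" unfolding U_def using dC dY by (simp add: mat_diff_distrib)
      moreover have "Y (Suc k) - Y k = 2 \<cdot>\<^sub>m (W * G (Suc k) - W * G k)"
        unfolding Y_def using dC dG by (intro eq_matI) (auto simp: algebra_simps simp del: index_mult_mat(1))
      ultimately show ?thesis using dC dG by (simp add: mat_diff_distrib)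
    qed
    moreover have "mid p (Suc k) (W * (G (Suc k) - G k))" using mid_mult_0[OF p _ W0 conv] dC dG by simp
    then have "mid p (Suc k) (U0 * (2 \<cdot>\<^sub>m (W * (G (Suc k) - G k))))"
      using mid_mult_0[OF p _ U0m mid_smult_0[OF p, of 2]] dC p by simp
    ultimately show ?thesis using mid_mono[OF p, of k "Suc k"] by simp
  qed
  have Vstep: "mid p k (V (Suc k) - V k)" for k
  proof -
    have "V (Suc k) * ((U (Suc k) - U k) * V k) = V k - V (Suc k)"
    proof -
      have "V (Suc k) * ((U (Suc k) - U k) * V k) = V (Suc k) * (U (Suc k) * V k) - V (Suc k) * (U k * V k)"
        using dU dV by (simp add: mat_diff_distrib mat_diff_distrib')
      then show ?thesis using mat_cancel_left[OF V(3)[of "Suc k"], of "V k"] dU dV by (simp add: V(2) mat_one_right)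
    qed
    moreover have "mid p k (V (Suc k) * ((U (Suc k) - U k) * V k))"
      using mid_mult_0[OF p _ Zgl_mid[OF V(1)] mid_mult_0'[OF p _ Ustep Zgl_mid[OF V(1)]]] dU dV by simp
    ultimately have "mid p k (V k - V (Suc k))" by simp
    then have "mid p k (- (V k - V (Suc k)))" by (rule mid_uminus[OF p])
    moreover have "- (V k - V (Suc k)) = V (Suc k) - V k" using dV by (intro eq_matI) auto
    ultimately show ?thesis by simp
  qed
  \<comment> \<open>A, and with it C, may have denominators divisible by p; they cost M digits in
    the estimate of the error.\<close>
  obtain M where M: "mid p 0 (of_nat p ^ M \<cdot>\<^sub>m C)" using mat_bounded[OF p C(1)] .
  \<comment> \<open>The error after k steps is governed by one increment of the iteration.\<close>
  have err: "(U k)\<^sup>T * A * U k - B = 4 \<cdot>\<^sub>m (C * (W * (G k - G (Suc k))))" for k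
  proof -
    have U1: "(U k)\<^sup>T * A * U k = (Y k)\<^sup>T * C * Y k"
      unfolding U_def C_def using congruent_compose[OF A(1) U0c Zgl_carrier[OF YZ]] .
    have YT: "(Y k)\<^sup>T = 1\<^sub>m n + 2 \<cdot>\<^sub>m (W * G k)\<^sup>T" unfolding Y_def using dC dG by (intro eq_matI) (auto simp del: index_mult_mat(1))
    have a: "(W * G k)\<^sup>T * C = C * (W * G k)"
    proof -
      have "(W * G k)\<^sup>T * C = (G k)\<^sup>T * (W\<^sup>T * C)" using dC dG by (simp add: mat_ring)
      also have "\<dots> = ((G k)\<^sup>T * C) * W" unfolding CW[symmetric] using dC dG by (simp add: mat_assoc)
      also have "\<dots> = C * (G k * W)" unfolding CG[symmetric] using dC dG by (simp add: mat_assoc)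
      finally show ?thesis by (simp only: WG)
    qed
    have cc: "C \<in> carrier_mat n n" "W * G k \<in> carrier_mat n n" "2 \<cdot>\<^sub>m (W * G k) \<in> carrier_mat n n" "2 \<cdot>\<^sub>m (W * G k)\<^sup>T \<in> carrier_mat n n"
      using dC dG by (auto intro!: carrier_matI)
    have YC: "(Y k)\<^sup>T * C = C * Y k"
      unfolding YT unfolding Y_def using a dC dG cc
      by (simp add: mat_add_distrib' mat_add_distrib mat_smult_left mat_smult_right mat_one_left mat_one_right)
    \<comment> \<open>With X = W G one has (1 + 2 X)^2 = 1 + 4 (X + X^2) and X + X^2 = W (G + W
      G^2); by the recursion the bracket equals 1 + G - G', where G' is the next iterate.\<close>
    have YY: "Y k * Y k = 1\<^sub>m n + 4 \<cdot>\<^sub>m (W * (1\<^sub>m n + (G k - G (Suc k))))"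
    proof -
      have X: "(1\<^sub>m n + 2 \<cdot>\<^sub>m X) * (1\<^sub>m n + 2 \<cdot>\<^sub>m X) = 1\<^sub>m n + 4 \<cdot>\<^sub>m (X + X * X)" if X: "X \<in> carrier_mat n n" for X :: "rat mat"
      proof -
        have dX: "dim_row X = n" "dim_col X = n" using X by auto
        have "(1\<^sub>m n + 2 \<cdot>\<^sub>m X) * (1\<^sub>m n + 2 \<cdot>\<^sub>m X) = (1\<^sub>m n + 2 \<cdot>\<^sub>m X) + (2 \<cdot>\<^sub>m X + 2 \<cdot>\<^sub>m (2 \<cdot>\<^sub>m (X * X)))"
          using dX X by (simp add: mat_add_distrib' mat_add_distrib mat_smult_left mat_smult_right mat_one_left mat_one_right)
            (intro eq_matI, auto simp: algebra_simps simp del: index_mult_mat(1))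
        also have "\<dots> = 1\<^sub>m n + 4 \<cdot>\<^sub>m (X + X * X)" using dX by (intro eq_matI) (auto simp: algebra_simps simp del: index_mult_mat(1))
        finally show ?thesis .
      qed
      have "(W * G k) * (W * G k) = W * ((G k * W) * G k)" using dC dG by (simp add: mat_assoc)
      also have "\<dots> = W * (W * (G k * G k))" unfolding WG[symmetric] using dC dG by (simp add: mat_assoc)
      finally have "W * G k + (W * G k) * (W * G k) = W * (G k + W * (G k * G k))"
        using dC dG by (simp add: mat_add_distrib)
      also have "G k + W * (G k * G k) = 1\<^sub>m n + (G k - G (Suc k))"
        unfolding GS using dC dG by (intro eq_matI) (auto simp del: index_mult_mat(1))
      finally show ?thesis unfolding Y_def X[OF cc(2)] by simp
    qed
    have "(U k)\<^sup>T * A * U k = C * (Y k * Y k)" unfolding U1 YC using dC dY by (simp add: mat_assoc)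
    also have "\<dots> = C * (1\<^sub>m n + (4 \<cdot>\<^sub>m W + 4 \<cdot>\<^sub>m (W * (G k - G (Suc k)))))"
    proof -
      have "4 \<cdot>\<^sub>m (W * (1\<^sub>m n + (G k - G (Suc k)))) = 4 \<cdot>\<^sub>m W + 4 \<cdot>\<^sub>m (W * (G k - G (Suc k)))"
        using dC dG W by (simp add: mat_add_distrib mat_smult_add mat_one_right)
      then show ?thesis unfolding YY by simp
    qed
    also have "\<dots> = (C + 4 \<cdot>\<^sub>m (C * W)) + 4 \<cdot>\<^sub>m (C * (W * (G k - G (Suc k))))"
      using dC dG by (simp add: mat_add_distrib mat_smult_right mat_one_right mat_add_assoc)
    finally show ?thesis using dC dG by (intro eq_matI) (auto simp: B1 simp del: index_mult_mat(1))
  qed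
  have null: "(\<lambda>k. ((U k)\<^sup>T * A * U k) $$ (i, j) - B $$ (i, j)) \<in> padic_null p" if ij: "i < n" "j < n" for i j
    unfolding padic_null_iff[OF p]
  proof (intro allI exI impI)
    fix N k assume k: "M + N \<le> k"
    have "mid p (Suc k) (- (G (Suc k) - G k))" using mid_uminus[OF p conv] .
    moreover have "- (G (Suc k) - G k) = G k - G (Suc k)" using dG by (intro eq_matI) auto
    ultimately have "mid p (M + N) (G k - G (Suc k))" using mid_mono[OF p, of "M + N" "Suc k"] k by simp
    then have m: "mid p (M + N) (W * (G k - G (Suc k)))" using mid_mult_0[OF p _ W0] dC dG by simp
    have "mid p (M + N) ((of_nat p ^ M \<cdot>\<^sub>m C) * (W * (G k - G (Suc k))))" using mid_mult_0[OF p _ M m] dC by simp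
    moreover have "(of_nat p ^ M \<cdot>\<^sub>m C) * (W * (G k - G (Suc k))) = of_nat p ^ M \<cdot>\<^sub>m (C * (W * (G k - G (Suc k))))"
      using dC by (simp add: mat_smult_left)
    ultimately have "of_nat p ^ M * (C * (W * (G k - G (Suc k)))) $$ (i, j) \<in> Zid p (M + N)"
      using ij dC dG by (auto simp: mid_def simp del: index_mult_mat(1))
    then have "(C * (W * (G k - G (Suc k)))) $$ (i, j) \<in> Zid p N" by (simp only: Zid_shift_iff[OF p])
    then have "4 * (C * (W * (G k - G (Suc k)))) $$ (i, j) \<in> Zid p N" using p by (intro Zid_mult_0) auto
    moreover have "((U k)\<^sup>T * A * U k) $$ (i, j) - B $$ (i, j) = ((U k)\<^sup>T * A * U k - B) $$ (i, j)"
      using ij dC by (simp add: B1 del: index_mult_mat(1))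
    ultimately show "((U k)\<^sup>T * A * U k) $$ (i, j) - B $$ (i, j) \<in> Zid p N"
      unfolding err using ij dC dG by (simp del: index_mult_mat(1))
  qed
  show ?thesis
  proof (rule Zp_equivalent_limit[OF p A(1) Zgl_carrier[OF UZ] Zgl_mid[OF UZ] _ Zgl_carrier[OF V(1)] Zgl_mid[OF V(1)] _ V(2,3) null])
    fix i j assume ij: "i < n" "j < n"
    show "(\<lambda>t. U t $$ (i, j)) \<in> padic_cauchy p"
      using midD[OF Ustep, of i _ j] ij dU by (intro padic_cauchy_step[OF p]) simp
    show "(\<lambda>t. V t $$ (i, j)) \<in> padic_cauchy p"
      using midD[OF Vstep, of i _ j] ij dV by (intro padic_cauchy_step[OF p]) simp
  qed
qed

section \<open>Integer factors of p-integral matrices\<close>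

definition intmat :: "rat mat \<Rightarrow> bool" where
  "intmat A \<longleftrightarrow> (\<forall>i<dim_row A. \<forall>j<dim_col A. A $$ (i, j) \<in> \<int>)"

lemma Ints_Zid: "prime p \<Longrightarrow> x \<in> \<int> \<Longrightarrow> x \<in> Zid p 0"
  by (auto elim!: Ints_cases)

lemma intmat_mid: "prime p \<Longrightarrow> intmat A \<Longrightarrow> mid p 0 A"
  by (simp add: intmat_def mid_def Ints_Zid)

lemma intmat_mult:
  assumes "dim_col A = dim_row B" "intmat A" "intmat B"
  shows "intmat (A * B)"
  using assms by (auto simp: intmat_def scalar_prod_def intro!: Ints_sum Ints_mult)

text \<open>B replaces e_j by w / a, and C expresses e_j in the new basis as a times w / a minus the
  other terms of w. The same pair serves to factor matrices and to enlarge a lattice by one vector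
  divided by p.\<close>

lemma replace_column_inverse:
  fixes w :: "rat mat" and a :: rat
  assumes j: "j < n" and wj: "w $$ (j, 0) = 1" and a: "a \<noteq> 0"
  defines "C \<equiv> mat n n (\<lambda>(i, l). if l = j then (if i = j then a else - w $$ (i, 0)) else if i = l then 1 else 0)"
    and "B \<equiv> mat n n (\<lambda>(i, l). if l = j then w $$ (i, 0) / a else if i = l then 1 else 0)"
  shows "det C = a" "B * C = 1\<^sub>m n" "C * B = 1\<^sub>m n"
proof -
  have C: "C \<in> carrier_mat n n" and B: "B \<in> carrier_mat n n" by (auto simp: C_def B_def)
  define v where "v = mat n 1 (\<lambda>(i, _). if i = j then a else - w $$ (i, 0))"
  have "C = mat n n (\<lambda>(i, l). if l = j then v $$ (i, 0) else if i = l then 1 else 0)"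
    by (rule eq_matI) (auto simp: C_def v_def)
  then show "det C = a" using replace_column_det[OF j, of v] j by (simp add: v_def)
  show BC: "B * C = 1\<^sub>m n"
  proof (rule eq_matI)
    fix i l assume "i < dim_row (1\<^sub>m n :: rat mat)" "l < dim_col (1\<^sub>m n :: rat mat)"
    then have il: "i < n" "l < n" by auto
    have "(B * C) $$ (i, l) = (\<Sum>k<n. B $$ (i, k) * C $$ (k, l))" using il B C by (intro mult_mat_entry) auto
    also have "\<dots> = (\<Sum>k<n. (if k = j then w $$ (i, 0) / a * C $$ (j, l) else 0) + (if k = i then (if i = j then 0 else C $$ (i, l)) else 0))"
      using il by (intro sum.cong refl) (auto simp: B_def)
    also have "\<dots> = w $$ (i, 0) / a * C $$ (j, l) + (if i = j then 0 else C $$ (i, l))"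
      using il j by (simp add: sum.distrib)
    also have "\<dots> = 1\<^sub>m n $$ (i, l)" using il j a wj by (auto simp: C_def)
    finally show "(B * C) $$ (i, l) = 1\<^sub>m n $$ (i, l)" .
  qed (use B C in auto)
  show "C * B = 1\<^sub>m n" using mat_mult_left_right_inverse[OF B C BC] .
qed

text \<open>Each step lowers the valuation of the determinant by one. If det S is not a unit, S
  annihilates some z modulo p that p does not divide; normalized and rounded, z becomes an integer
  column w with an entry 1, and S remains integral after e_j is replaced by w / p. Rounding is what
  makes the split-off factor an integer matrix, of determinant exactly p.\<close>

lemma integral_factor:
  assumes p: "prime p"
  shows "S \<in> carrier_mat n n \<Longrightarrow> mid p 0 S \<Longrightarrow> rat_val p (det S) = int h \<Longrightarrow> det S \<noteq> 0 \<Longrightarrow>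
    \<exists>T C. T \<in> Zgl p n \<and> C \<in> carrier_mat n n \<and> intmat C \<and> det C = of_nat p ^ h \<and> S = T * C"
proof (induction h arbitrary: S)
  case 0
  have "det S \<notin> Zid p 1" using Zid_iff_rat_val[OF p, of "det S" 1] 0 by simp
  then have "S \<in> Zgl p n" using 0 mid_det[OF p 0(1,2)] by (simp add: Zgl_def Zunit_def)
  moreover have "intmat (1\<^sub>m n)" by (simp add: intmat_def)
  ultimately show ?case using 0 by (intro exI[of _ S] exI[of _ "1\<^sub>m n"]) simp
next
  case (Suc h)
  have "det S \<in> Zid p 1" using Zid_iff_rat_val[OF p, of "det S" 1] Suc.prems by simp
  then have "det S \<notin> Zunit p" by (simp add: Zunit_def)
  then obtain z where z: "z \<in> carrier_mat n 1" "mid p 0 z" "mid p 1 (S * z)" "\<not> mid p 1 z"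
    using unit_det_if_injective_mod[OF p Suc.prems(1,2)] by blast
  then obtain j where j: "j < n" "z $$ (j, 0) \<notin> Zid p 1" by (auto simp: mid_def)
  have zj: "z $$ (j, 0) \<in> Zunit p" using j midD[OF z(2), of j 0] z(1) by (simp add: Zunit_def)
  note zi = Zunit_inverse_Zid[OF p zj]
  have "\<exists>k::int. inverse (z $$ (j, 0)) * z $$ (i, 0) - of_int k \<in> Zid p 1" if "i < n" for i
    using Zid_round[OF p Zid_mult_0[OF p zi midD[OF z(2), of i 0]]] that z(1) by (metis carrier_matD less_one)
  then obtain k :: "nat \<Rightarrow> int" where k: "\<And>i. i < n \<Longrightarrow> inverse (z $$ (j, 0)) * z $$ (i, 0) - of_int (k i) \<in> Zid p 1"
    by metis
  \<comment> \<open>The j-th entry is set to 1 outright, which is also what the normalized column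
    has there.\<close>
  define w :: "rat mat" where "w = mat n 1 (\<lambda>(i, _). if i = j then 1 else of_int (k i))"
  have wz: "mid p 1 (inverse (z $$ (j, 0)) \<cdot>\<^sub>m z - w)"
    using k z(1) Zunit_nonzero[OF p zj] p by (auto simp: mid_def w_def)
  have w: "w \<in> carrier_mat n 1" "intmat w" by (auto simp: w_def intmat_def)
  have dims: "dim_row S = n" "dim_col S = n" "dim_row w = n" "dim_col w = 1" "dim_row z = n" "dim_col z = 1"
    using Suc.prems(1) w z(1) by auto
  have Sw: "mid p 1 (S * w)"
  proof -
    have "S * w = inverse (z $$ (j, 0)) \<cdot>\<^sub>m (S * z) - S * (inverse (z $$ (j, 0)) \<cdot>\<^sub>m z - w)"
      using dims by (simp add: mat_diff_distrib mat_smult_right) (intro eq_matI, auto simp del: index_mult_mat(1))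
    moreover have "mid p 1 (inverse (z $$ (j, 0)) \<cdot>\<^sub>m (S * z))" using mid_smult_0[OF p zi z(3)] .
    moreover have "mid p 1 (S * (inverse (z $$ (j, 0)) \<cdot>\<^sub>m z - w))" using mid_mult_0[OF p _ Suc.prems(2) wz] dims by simp
    ultimately show ?thesis using mid_diff[OF p] dims by simp
  qed
  define C where "C = mat n n (\<lambda>(i, l). if l = j then (if i = j then of_nat p else - w $$ (i, 0)) else if i = l then 1 else 0)"
  define B where "B = mat n n (\<lambda>(i, l). if l = j then w $$ (i, 0) / of_nat p else if i = l then 1 else 0)"
  have p0: "(of_nat p :: rat) \<noteq> 0" using p by auto
  have wj: "w $$ (j, 0) = 1" using j(1) by (simp add: w_def)
  have C: "C \<in> carrier_mat n n" and B: "B \<in> carrier_mat n n" by (auto simp: C_def B_def)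
  have detC: "det C = of_nat p" and BC: "B * C = 1\<^sub>m n"
    using replace_column_inverse[OF j(1) wj p0] by (auto simp: C_def B_def)
  define S1 where "S1 = S * B"
  have S1: "S1 \<in> carrier_mat n n" using Suc.prems(1) B by (simp add: S1_def)
  have "S = S1 * C" unfolding S1_def using BC dims B C by (simp add: mat_assoc mat_one_right)
  have mS1: "mid p 0 S1"
    unfolding mid_def
  proof (intro allI impI)
    fix i l assume "i < dim_row S1" "l < dim_col S1"
    then have il: "i < n" "l < n" using S1 by auto
    have e: "S1 $$ (i, l) = (\<Sum>a<n. S $$ (i, a) * B $$ (a, l))" unfolding S1_def using il B dims by (intro mult_mat_entry) auto
    show "S1 $$ (i, l) \<in> Zid p 0"
    proof (cases "l = j")
      case True
      have "S1 $$ (i, l) = (\<Sum>a<n. S $$ (i, a) * w $$ (a, 0)) / of_nat p"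
        unfolding e sum_divide_distrib using True il by (intro sum.cong) (auto simp: B_def)
      also have "(\<Sum>a<n. S $$ (i, a) * w $$ (a, 0)) = (S * w) $$ (i, 0)" using il dims by (intro mult_mat_entry[symmetric]) auto
      finally have "of_nat p * S1 $$ (i, l) = (S * w) $$ (i, 0)" using p0 by simp
      moreover have "(S * w) $$ (i, 0) \<in> Zid p 1" using midD[OF Sw, of i 0] il dims by simp
      ultimately show ?thesis using Zid_shift1_iff[OF p, of "S1 $$ (i, l)" 0] by simp
    next
      case False
      have "S1 $$ (i, l) = (\<Sum>a<n. if a = l then S $$ (i, a) else 0)"
        unfolding e using False il by (intro sum.cong) (auto simp: B_def)
      then show ?thesis using il midD[OF Suc.prems(2), of i l] dims by simp
    qed
  qed
  have dS: "det S = det S1 * of_nat p" using det_mult[OF S1 C] detC \<open>S = S1 * C\<close> by simp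
  then have "det S1 \<noteq> 0" using Suc.prems(4) by auto
  have "rat_val p (of_nat p) = 1" using rat_val_prime_powi[OF p, of 1] by simp
  then have "rat_val p (det S1) = int h"
    using rat_val_mult[OF p \<open>det S1 \<noteq> 0\<close> p0] dS Suc.prems(3) by simp
  then obtain T C' where T: "T \<in> Zgl p n" "C' \<in> carrier_mat n n" "intmat C'" "det C' = of_nat p ^ h" "S1 = T * C'"
    using Suc.IH[OF S1 mS1 _ \<open>det S1 \<noteq> 0\<close>] by blast
  have "intmat C" using w(2) dims by (auto simp: intmat_def C_def)
  then have "intmat (C' * C)" using intmat_mult T C by auto
  moreover have "S = T * (C' * C)" using \<open>S = S1 * C\<close> T(5) Zgl_carrier[OF T(1)] T(2) C by simp
  moreover have "det (C' * C) = of_nat p ^ Suc h" using det_mult[OF T(2) C] T(4) detC by simp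
  moreover have "C' * C \<in> carrier_mat n n" using T C by simp
  ultimately show ?case using T(1) by blast
qed

section \<open>Norms from the quadratic field of the square root of two\<close>

text \<open>An elementary piece of reciprocity: 2 and the primes congruent to 1 or -1 modulo 8 lie
  in the group, and the remaining primes occur to even powers, whose squares are 1 modulo 8. So the
  condition at the odd primes entails the one at 2.\<close>

lemma two_norm_of_nat:
  assumes "0 < k" "\<And>q. prime q \<Longrightarrow> [int q = 3] (mod 8) \<or> [int q = -3] (mod 8) \<Longrightarrow> even (rat_val q (of_nat k))"
  shows "two_norm (of_nat k)"
  using assms
proof (induction k rule: less_induct)
  case (less k)
  show ?case
  proof (cases "k = 1")
    case True
    then show ?thesis using two_norm_pm_one[of 1] by (simp add: pm_one_def)
  next
    case False
    then obtain p where p: "prime p" "p dvd k" using prime_factor_nat by blast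
    then obtain m where m: "k = p * m" by blast
    have m0: "0 < m" "m < k" using less.prems(1) m prime_gt_1_nat[OF p(1)] by auto
    have val: "rat_val q (of_nat k) = rat_val q (of_nat p) + rat_val q (of_nat m)" if "prime q" for q
      using rat_val_mult[OF that, of "of_nat p" "of_nat m"] m m0 p(1) by (auto simp: prime_gt_0_nat)
    have val0: "rat_val q (of_nat p) = 0" if "prime q" "q \<noteq> p" for q
    proof -
      have "\<not> q dvd p" using that p(1) primes_dvd_imp_eq by blast
      then have "of_nat p \<in> Zunit q" using Zunit_of_int_iff[OF that(1), of "int p"] by simp
      then show ?thesis using rat_val_unit[OF that(1)] by blast
    qed
    show ?thesis
    proof (cases "[int p = 3] (mod 8) \<or> [int p = -3] (mod 8)")
      case nonres: False
      have "even (rat_val q (of_nat m))" if "prime q" "[int q = 3] (mod 8) \<or> [int q = -3] (mod 8)" for q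
        using less.prems(2)[OF that] val[OF that(1)] val0[OF that(1)] nonres that(2) by (cases "q = p") auto
      then have "two_norm (of_nat m)" using less.IH m0 by blast
      moreover have "two_norm (of_nat p)"
      proof (cases "p = 2")
        case True
        have "two_norm (2 powi 1 * 1)" unfolding two_norm_def pm_one_def by (intro exI[of _ 1] exI[of _ 1]) simp
        then show ?thesis using True by simp
      next
        case False
        have "odd p" using prime_odd_nat[OF p(1)] False prime_ge_2_nat[OF p(1)] by simp
        then have "int p mod 2 = 1" by presburger
        moreover have "int p mod 8 \<noteq> 3" "int p mod 8 \<noteq> 5" using nonres by (auto simp: cong_def)
        ultimately have "int p mod 8 = 1 \<or> int p mod 8 = 7" by presburger
        then have "8 dvd int p - 1 \<or> 8 dvd int p + 1" by presburger
        then have "of_int (int p - 1) \<in> Zid 2 3 \<or> of_int (int p + 1) \<in> Zid 2 3"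
          using Zid_of_int_iff[OF prime_two, of "int p - 1" 3] Zid_of_int_iff[OF prime_two, of "int p + 1" 3] by simp
        then show ?thesis by (intro two_norm_pm_one) (simp add: pm_one_def)
      qed
      ultimately show ?thesis using two_norm_mult m by simp
    next
      \<comment> \<open>The even exponent of p forces a second factor p, and both are removed at
        once.\<close>
      case nonres: True
      have "rat_val p (of_nat p) = 1" using rat_val_prime_powi[OF p(1), of 1] by simp
      then have "odd (rat_val p (of_nat m))" using less.prems(2)[OF p(1) nonres] val[OF p(1)] by simp
      then have "of_nat m \<notin> Zunit p" using rat_val_unit[OF p(1)] by (metis even_zero)
      then have "p dvd m" using Zunit_of_int_iff[OF p(1), of "int m"] by simp
      then obtain l where l: "m = p * l" by blast
      have "0 < l" "l < m" using m0 l prime_gt_1_nat[OF p(1)] by auto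
      then have l0: "0 < l" "l < k" using m0 by auto
      have val2: "rat_val q (of_nat k) = 2 * rat_val q (of_nat p) + rat_val q (of_nat l)" if "prime q" for q
        using rat_val_mult[OF that, of "of_nat p" "of_nat l"] val[OF that] l l0 p(1) by (auto simp: prime_gt_0_nat)
      have "even (rat_val q (of_nat l))" if "prime q" "[int q = 3] (mod 8) \<or> [int q = -3] (mod 8)" for q
        using less.prems(2)[OF that] val2[OF that(1)] by simp
      then have "two_norm (of_nat l)" using less.IH l0 by blast
      moreover have "two_norm ((of_nat p)\<^sup>2)"
      proof (rule two_norm_unit_square)
        have "\<not> 2 dvd p" using nonres by (auto simp: cong_def elim!: evenE) presburger+
        then show "of_nat p \<in> Zunit 2" using Zunit_of_int_iff[OF prime_two, of "int p"] by simp
      qed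
      moreover have "(of_nat k :: rat) = (of_nat p)\<^sup>2 * of_nat l" by (simp add: m l power2_eq_square)
      ultimately show ?thesis using two_norm_mult by simp
    qed
  qed
qed

lemma two_norm_square: "x \<noteq> 0 \<Longrightarrow> two_norm (x\<^sup>2)"
proof -
  assume "x \<noteq> 0"
  then obtain u where u: "u \<in> Zunit 2" "x = of_nat 2 powi rat_val 2 x * u" using rat_val_eq[OF prime_two] by blast
  define a where "a = rat_val 2 x"
  have two: "(2 :: rat) \<noteq> 0" by simp
  have "x\<^sup>2 = 2 powi (a + a) * u\<^sup>2"
    unfolding power_int_add[OF disjI1[OF two]] by (subst u(2)) (simp add: a_def power2_eq_square algebra_simps)
  then show ?thesis using odd_square[OF u(1)] unfolding two_norm_def pm_one_def by blast
qed

text \<open>A sign and the square of the denominator turn d into a natural number; both belong to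
  the group, -1 because it is 7 modulo 8 up to a multiple of 8.\<close>

lemma two_norm_if_even_valuations:
  assumes "d \<noteq> 0" "\<And>q. prime q \<Longrightarrow> [int q = 3] (mod 8) \<or> [int q = -3] (mod 8) \<Longrightarrow> even (rat_val q d)"
  shows "two_norm d"
proof -
  obtain a b where ab: "d = of_int a / of_int b" "b > 0" using rat_obtain_ints .
  define k where "k = nat \<bar>a * b\<bar>"
  have a0: "a \<noteq> 0" using assms(1) ab by auto
  have k0: "0 < k" using a0 ab by (simp add: k_def)
  define e :: rat where "e = (if a > 0 then 1 else -1)"
  have dk: "e * d * (of_int b)\<^sup>2 = of_nat k"
    using ab a0 by (auto simp: e_def k_def power2_eq_square abs_mult field_simps)
  have ee: "e = 1 \<or> e = -1" by (simp add: e_def)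
  have b0: "(of_int b :: rat) \<noteq> 0" using ab by simp
  have "even (rat_val q (of_nat k))" if q: "prime q" "[int q = 3] (mod 8) \<or> [int q = -3] (mod 8)" for q
  proof -
    have eu: "e \<in> Zunit q" using ee Zunit_of_int_iff[OF q(1), of 1] Zunit_of_int_iff[OF q(1), of "-1"] q(1) by (auto simp: prime_nat_iff)
    have "rat_val q (of_nat k) = rat_val q e + rat_val q d + 2 * rat_val q (of_int b)"
      unfolding dk[symmetric] using rat_val_mult[OF q(1), of "e * d" "(of_int b)\<^sup>2"] rat_val_mult[OF q(1), of e d]
        rat_val_power[OF q(1) b0, of 2] Zunit_nonzero[OF q(1) eu] assms(1) b0 by simp
    then show ?thesis using rat_val_unit[OF q(1) eu] assms(2)[OF q] by simp
  qed
  then have "two_norm (of_nat k)" using two_norm_of_nat[OF k0] by blast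
  then have "two_norm ((of_int b)\<^sup>2 * (e * d))" unfolding dk[symmetric] by (simp add: mult.commute)
  then have "two_norm (e * d)" using two_norm_cancel[OF two_norm_square[OF b0]] by blast
  moreover have "two_norm e" using ee by (intro two_norm_pm_one) (auto simp: pm_one_def)
  ultimately show ?thesis using two_norm_cancel by blast
qed

section \<open>Bases of lattices\<close>

definition comb :: "'a::euclidean_space list \<Rightarrow> (nat \<Rightarrow> real) \<Rightarrow> 'a" where
  "comb bs c = (\<Sum>i<length bs. c i *\<^sub>R bs ! i)"

lemma comb_cong: "(\<And>i. i < length bs \<Longrightarrow> c i = d i) \<Longrightarrow> comb bs c = comb bs d"
  unfolding comb_def by (intro sum.cong) auto

lemma comb_add: "comb bs c + comb bs d = comb bs (\<lambda>i. c i + d i)"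
  by (simp add: comb_def scaleR_add_left sum.distrib)

lemma comb_scale: "a *\<^sub>R comb bs c = comb bs (\<lambda>i. a * c i)"
  by (simp add: comb_def scaleR_sum_right)

lemma comb_unit: "j < length bs \<Longrightarrow> comb bs (\<lambda>i. if i = j then 1 else 0) = bs ! j"
  by (simp add: comb_def if_distrib[of "\<lambda>x. x *\<^sub>R _"] cong: if_cong)

lemma inner_comb:
  assumes "\<And>i j. i < length bs \<Longrightarrow> j < length bs \<Longrightarrow> inner (bs ! i) (bs ! j) = g i j"
  shows "inner (comb bs c) (comb bs d) = (\<Sum>i<length bs. \<Sum>j<length bs. c i * g i j * d j)"
  unfolding comb_def inner_sum_left unfolding inner_sum_right using assms
  by (intro sum.cong refl) (auto simp: algebra_simps)

definition zspan :: "'a::euclidean_space list \<Rightarrow> 'a set" where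
  "zspan bs = {comb bs (\<lambda>i. real_of_int (c i)) | c :: nat \<Rightarrow> int. True}"

lemma independent_list_iff:
  "distinct bs \<and> independent (set bs) \<longleftrightarrow> (\<forall>c. comb bs c = 0 \<longrightarrow> (\<forall>i<length bs. c i = 0))"
proof
  assume *: "distinct bs \<and> independent (set bs)"
  show "\<forall>c. comb bs c = 0 \<longrightarrow> (\<forall>i<length bs. c i = 0)"
  proof (intro allI impI)
    fix c i assume c: "comb bs c = 0" and i: "i < length bs"
    have bij: "bij_betw ((!) bs) {..<length bs} (set bs)" using * by (simp add: bij_betw_nth)
    define u where "u v = c (inv_into {..<length bs} ((!) bs) v)" for v
    have u: "u (bs ! k) = c k" if "k < length bs" for k
      unfolding u_def using bij_betw_inv_into_left[OF bij] that by simp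
    have "(\<Sum>v\<in>set bs. u v *\<^sub>R v) = (\<Sum>k<length bs. u (bs ! k) *\<^sub>R bs ! k)"
      by (rule sum.reindex_bij_betw[OF bij, symmetric])
    also have "\<dots> = comb bs c" unfolding comb_def using u by (intro sum.cong) auto
    finally have "(\<Sum>v\<in>set bs. u v *\<^sub>R v) = 0" using c by simp
    then have "u (bs ! i) = 0"
      using independentD[of "set bs" "set bs" u "bs ! i"] * i by simp
    then show "c i = 0" using u i by simp
  qed
next
  assume *: "\<forall>c. comb bs c = 0 \<longrightarrow> (\<forall>i<length bs. c i = 0)"
  have d: "distinct bs"
    unfolding distinct_conv_nth
  proof (intro allI impI notI)
    fix i j assume ij: "i < length bs" "j < length bs" "i \<noteq> j" "bs ! i = bs ! j"
    define c :: "nat \<Rightarrow> real" where "c k = (if k = i then 1 else 0) + (-1) * (if k = j then 1 else 0)" for k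
    have "comb bs c = bs ! i + (-1) *\<^sub>R bs ! j"
      unfolding c_def comb_add[symmetric] comb_scale[symmetric] using comb_unit ij by metis
    then have "comb bs c = 0" using ij by simp
    then have "c i = 0" using * ij by blast
    then show False using ij by (simp add: c_def)
  qed
  moreover have "independent (set bs)"
  proof (rule independent_if_scalars_zero)
    fix f x assume f: "(\<Sum>x\<in>set bs. f x *\<^sub>R x) = 0" and x: "x \<in> set bs"
    have bij: "bij_betw ((!) bs) {..<length bs} (set bs)" using d by (simp add: bij_betw_nth)
    have "comb bs (\<lambda>k. f (bs ! k)) = 0"
      using f unfolding comb_def sum.reindex_bij_betw[OF bij, symmetric] by simp
    then show "f x = 0" using * x by (metis in_set_conv_nth)
  qed simp
  ultimately show "distinct bs \<and> independent (set bs)" by blast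
qed

lemma lattice_basis_iff:
  "lattice_basis bs L \<longleftrightarrow> (\<forall>c. comb bs c = 0 \<longrightarrow> (\<forall>i<length bs. c i = 0)) \<and> L = zspan bs"
  unfolding lattice_basis_def zspan_def comb_def[symmetric] independent_list_iff[symmetric] by blast

lemma lattice_basis_unique:
  assumes "lattice_basis bs L" "comb bs c = comb bs d" "i < length bs"
  shows "c i = d i"
proof -
  have "comb bs (\<lambda>i. c i + (-1) * d i) = 0"
    unfolding comb_add[symmetric] comb_scale[symmetric] using assms(2) by simp
  then have "c i + (-1) * d i = 0" using assms(1,3) unfolding lattice_basis_iff by blast
  then show ?thesis by simp
qed

lemma zspanI: "(\<And>i. i < length bs \<Longrightarrow> c i \<in> \<int>) \<Longrightarrow> comb bs c \<in> zspan bs"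
proof -
  assume "\<And>i. i < length bs \<Longrightarrow> c i \<in> \<int>"
  then have "\<forall>i. \<exists>k::int. i < length bs \<longrightarrow> c i = of_int k" by (metis Ints_cases)
  then obtain k :: "nat \<Rightarrow> int" where "\<And>i. i < length bs \<Longrightarrow> c i = of_int (k i)" by metis
  then have "comb bs c = comb bs (\<lambda>i. of_int (k i))" by (intro comb_cong)
  then show ?thesis unfolding zspan_def by blast
qed

lemma nth_zspan: "j < length bs \<Longrightarrow> bs ! j \<in> zspan bs"
  using zspanI[of bs "\<lambda>i. if i = j then 1 else 0"] comb_unit[of j bs] by simp

lemma comb_in_span: "comb bs c \<in> span (set bs)"
  unfolding comb_def by (intro span_sum span_scale span_base) simp

lemma span_zspan: "span (zspan bs) = span (set bs)"
proof
  show "span (zspan bs) \<subseteq> span (set bs)"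
    using comb_in_span by (intro span_minimal) (auto simp: zspan_def)
  have "set bs \<subseteq> zspan bs" using nth_zspan by (auto simp: in_set_conv_nth)
  then show "span (set bs) \<subseteq> span (zspan bs)" by (rule span_mono)
qed

lemma lattice_basis_span: "lattice_basis bs L \<Longrightarrow> span L = span (set bs)"
  using span_zspan by (simp add: lattice_basis_iff)

lemma lattice_basis_dim:
  assumes "lattice_basis bs L"
  shows "dim L = length bs"
proof -
  have d: "distinct bs" "independent (set bs)" using assms by (auto simp: lattice_basis_def)
  have "dim L = dim (set bs)" using lattice_basis_span[OF assms] by (metis dim_span)
  then show ?thesis using d by (simp add: dim_eq_card_independent distinct_card)
qed

definition change_basis :: "'a::euclidean_space list \<Rightarrow> rat mat \<Rightarrow> 'a list" where
  "change_basis bs B = map (\<lambda>k. comb bs (\<lambda>i. of_rat (B $$ (i, k)))) [0..<length bs]"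

lemma length_change_basis [simp]: "length (change_basis bs B) = length bs"
  by (simp add: change_basis_def)

lemma nth_change_basis: "k < length bs \<Longrightarrow> change_basis bs B ! k = comb bs (\<lambda>i. of_rat (B $$ (i, k)))"
  by (simp add: change_basis_def)

lemma comb_change_basis:
  "comb (change_basis bs B) c = comb bs (\<lambda>i. \<Sum>k<length bs. of_rat (B $$ (i, k)) * c k)"
proof -
  have "comb (change_basis bs B) c = (\<Sum>k<length bs. \<Sum>i<length bs. (of_rat (B $$ (i, k)) * c k) *\<^sub>R bs ! i)"
    unfolding comb_def[of "change_basis bs B"]
    by (auto simp: nth_change_basis comb_def scaleR_sum_right mult.commute intro!: sum.cong)
  also have "\<dots> = comb bs (\<lambda>i. \<Sum>k<length bs. of_rat (B $$ (i, k)) * c k)"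
    unfolding comb_def scaleR_sum_left by (rule sum.swap)
  finally show ?thesis .
qed

lemma change_basis_inverse:
  assumes B: "B \<in> carrier_mat (length bs) (length bs)" "C \<in> carrier_mat (length bs) (length bs)" "B * C = 1\<^sub>m (length bs)"
  shows "comb (change_basis bs B) (\<lambda>k. \<Sum>l<length bs. of_rat (C $$ (k, l)) * c l) = comb bs c"
  unfolding comb_change_basis
proof (rule comb_cong)
  fix i assume i: "i < length bs"
  have "(\<Sum>k<length bs. of_rat (B $$ (i, k)) * (\<Sum>l<length bs. of_rat (C $$ (k, l)) * c l)) =
      (\<Sum>k<length bs. \<Sum>l<length bs. of_rat (B $$ (i, k) * C $$ (k, l)) * c l)"
    by (simp add: sum_distrib_left mult.assoc of_rat_mult)
  also have "\<dots> = (\<Sum>l<length bs. \<Sum>k<length bs. of_rat (B $$ (i, k) * C $$ (k, l)) * c l)" by (rule sum.swap)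
  also have "\<dots> = (\<Sum>l<length bs. of_rat (\<Sum>k<length bs. B $$ (i, k) * C $$ (k, l)) * c l)"
    by (simp add: sum_distrib_right of_rat_sum)
  also have "\<dots> = (\<Sum>l<length bs. if l = i then c l else 0)"
  proof (intro sum.cong refl)
    fix l assume "l \<in> {..<length bs}"
    then have "(\<Sum>k<length bs. B $$ (i, k) * C $$ (k, l)) = (B * C) $$ (i, l)"
      using i B by (intro mult_mat_entry[symmetric]) auto
    then show "of_rat (\<Sum>k<length bs. B $$ (i, k) * C $$ (k, l)) * c l = (if l = i then c l else 0)"
      unfolding B(3) using i \<open>l \<in> {..<length bs}\<close> by simp
  qed
  also have "\<dots> = c i" using i by simp
  finally show "(\<Sum>k<length bs. of_rat (B $$ (i, k)) * (\<Sum>l<length bs. of_rat (C $$ (k, l)) * c l)) = c i" .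
qed

text \<open>The columns of B are the new basis vectors in old coordinates, and the columns of C the
  old ones in new coordinates; so an integral C means that the old lattice is contained in the new
  one.\<close>

lemma change_basis_lattice:
  assumes L: "lattice_basis bs L"
    and B: "B \<in> carrier_mat (length bs) (length bs)" "C \<in> carrier_mat (length bs) (length bs)"
      "B * C = 1\<^sub>m (length bs)" "C * B = 1\<^sub>m (length bs)"
  shows "lattice_basis (change_basis bs B) (zspan (change_basis bs B))"
    "span (set (change_basis bs B)) = span (set bs)" "intmat C \<Longrightarrow> L \<subseteq> zspan (change_basis bs B)"
proof -
  let ?cs = "change_basis bs B" and ?n = "length bs"
  have inv: "change_basis ?cs C ! k = bs ! k" if "k < ?n" for k
  proof -
    have "comb ?cs (\<lambda>i. \<Sum>l<?n. of_rat (C $$ (i, l)) * (if l = k then 1 else 0)) = bs ! k"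
      using change_basis_inverse[OF B(1-3), of "\<lambda>l. if l = k then 1 else 0"] comb_unit[OF that] by simp
    moreover have "comb ?cs (\<lambda>i. \<Sum>l<?n. of_rat (C $$ (i, l)) * (if l = k then 1 else 0)) = comb ?cs (\<lambda>i. of_rat (C $$ (i, k)))"
      using that by (intro comb_cong) (simp add: if_distrib[of "\<lambda>x. _ * x"] cong: if_cong)
    ultimately show ?thesis using that by (simp add: nth_change_basis)
  qed
  have "\<forall>c. comb ?cs c = 0 \<longrightarrow> (\<forall>i<length ?cs. c i = 0)"
  proof (intro allI impI)
    fix c i assume c: "comb ?cs c = 0" and i: "i < length ?cs"
    have "comb (change_basis ?cs C) (\<lambda>k. \<Sum>l<length ?cs. of_rat (B $$ (k, l)) * c l) = comb ?cs c"
      using B by (intro change_basis_inverse) auto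
    moreover have "comb (change_basis ?cs C) d = comb bs d" for d
      using inv by (auto simp: comb_def intro!: sum.cong)
    ultimately have "comb bs (\<lambda>k. \<Sum>l<?n. of_rat (B $$ (k, l)) * c l) = 0" using c by simp
    then have z: "(\<Sum>l<?n. of_rat (B $$ (k, l)) * c l) = 0" if "k < ?n" for k
      using L that unfolding lattice_basis_iff by blast
    have "c i = (\<Sum>l<?n. of_rat ((C * B) $$ (i, l)) * c l)"
    proof -
      have "(\<Sum>l<?n. of_rat ((C * B) $$ (i, l)) * c l) = (\<Sum>l<?n. if l = i then c l else 0)"
        unfolding B(4) using i by (intro sum.cong) auto
      then show ?thesis using i by simp
    qed
    also have "\<dots> = (\<Sum>l<?n. \<Sum>k<?n. of_rat (C $$ (i, k)) * (of_rat (B $$ (k, l)) * c l))"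
    proof (intro sum.cong refl)
      fix l assume "l \<in> {..<?n}"
      then have "(C * B) $$ (i, l) = (\<Sum>k<?n. C $$ (i, k) * B $$ (k, l))" using i B by (intro mult_mat_entry) auto
      then show "of_rat ((C * B) $$ (i, l)) * c l = (\<Sum>k<?n. of_rat (C $$ (i, k)) * (of_rat (B $$ (k, l)) * c l))"
        by (simp add: of_rat_sum of_rat_mult sum_distrib_right mult.assoc del: index_mult_mat(1))
    qed
    also have "\<dots> = (\<Sum>k<?n. \<Sum>l<?n. of_rat (C $$ (i, k)) * (of_rat (B $$ (k, l)) * c l))" by (rule sum.swap)
    also have "\<dots> = (\<Sum>k<?n. of_rat (C $$ (i, k)) * (\<Sum>l<?n. of_rat (B $$ (k, l)) * c l))" by (simp add: sum_distrib_left)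
    also have "\<dots> = 0" using z by simp
    finally show "c i = 0" .
  qed
  then show "lattice_basis ?cs (zspan ?cs)" by (simp add: lattice_basis_iff)
  show "span (set ?cs) = span (set bs)"
  proof (intro equalityI span_minimal subspace_span subsetI)
    fix x assume "x \<in> set ?cs"
    then show "x \<in> span (set bs)" using comb_in_span by (auto simp: change_basis_def)
  next
    fix x assume "x \<in> set bs"
    then obtain k where k: "k < ?n" "x = bs ! k" by (auto simp: in_set_conv_nth)
    then have "x = comb ?cs (\<lambda>i. of_rat (C $$ (i, k)))" using inv[of k] nth_change_basis[of k ?cs C] by simp
    then show "x \<in> span (set ?cs)" by (simp only: comb_in_span)
  qed
  assume C: "intmat C"
  show "L \<subseteq> zspan ?cs"
  proof
    fix x assume "x \<in> L"
    then obtain c :: "nat \<Rightarrow> int" where "x = comb bs (\<lambda>i. of_int (c i))" using L unfolding lattice_basis_iff zspan_def by blast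
    then have "x = comb ?cs (\<lambda>k. \<Sum>l<?n. of_rat (C $$ (k, l)) * of_int (c l))" using change_basis_inverse[OF B(1-3)] by simp
    moreover have "(\<Sum>l<?n. of_rat (C $$ (k, l)) * real_of_int (c l)) \<in> \<int>" if "k < ?n" for k
    proof (intro Ints_sum Ints_mult Ints_of_int)
      fix l assume "l \<in> {..<?n}"
      then have "C $$ (k, l) \<in> \<int>" using C B(2) that by (auto simp: intmat_def)
      then show "real_of_rat (C $$ (k, l)) \<in> \<int>" by (auto elim!: Ints_cases)
    qed
    ultimately show "x \<in> zspan ?cs" using zspanI by (metis (no_types, lifting) length_change_basis)
  qed
qed

lemma scale_lattice_basis:
  assumes "lattice_basis bs L" "a \<noteq> 0"
  shows "lattice_basis (map ((*\<^sub>R) a) bs) ((*\<^sub>R) a ` L)" "span ((*\<^sub>R) a ` L) = span L"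
proof -
  have c: "comb (map ((*\<^sub>R) a) bs) c = a *\<^sub>R comb bs c" for c
    by (simp add: comb_def scaleR_sum_right mult.commute)
  show "lattice_basis (map ((*\<^sub>R) a) bs) ((*\<^sub>R) a ` L)"
    using assms unfolding lattice_basis_iff zspan_def c by (auto simp: image_def)
  show "span ((*\<^sub>R) a ` L) = span L"
  proof (intro equalityI span_minimal subspace_span subsetI)
    fix x assume "x \<in> (*\<^sub>R) a ` L"
    then show "x \<in> span L" by (auto intro: span_scale span_base)
  next
    fix x assume "x \<in> L"
    then have "(1 / a) *\<^sub>R (a *\<^sub>R x) \<in> span ((*\<^sub>R) a ` L)" by (intro span_scale span_base) auto
    then show "x \<in> span ((*\<^sub>R) a ` L)" using assms(2) by simp
  qed
qed

lemma gram_eqI: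
  assumes "X \<in> carrier_mat (length bs) (length bs)"
    "\<And>i j. i < length bs \<Longrightarrow> j < length bs \<Longrightarrow> inner (bs ! i) (bs ! j) = of_rat (X $$ (i, j))"
  shows "gram bs = X"
proof (rule eq_matI)
  fix i j assume "i < dim_row X" "j < dim_col X"
  then have "i < length bs" "j < length bs" using assms(1) by auto
  moreover have "inj (of_rat :: rat \<Rightarrow> real)" by (simp add: inj_def)
  ultimately show "gram bs $$ (i, j) = X $$ (i, j)"
    using assms(2) by (simp add: gram_def the_inv_f_f)
qed (use assms in \<open>auto simp: gram_def\<close>)

section \<open>Overlattices from local doublings\<close>

lemma rat_val_diff:
  assumes p: "prime p" and x: "x \<noteq> 0" and xy: "x - y \<in> Zid p N" and N: "rat_val p x < int N"
  shows "y \<noteq> 0" "rat_val p y = rat_val p x"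
proof -
  have y0: "y \<noteq> 0"
  proof
    assume "y = 0"
    then show False using xy N Zid_iff_rat_val[OF p x, of N] by simp
  qed
  then show "y \<noteq> 0" .
  define u where "u = y / x"
  have u0: "u \<noteq> 0" and yu: "y = x * u" using x y0 by (auto simp: u_def)
  have "1 - u \<in> Zid p 1"
  proof (cases "1 - u = 0")
    case False
    have "x - y = x * (1 - u)" by (simp add: yu algebra_simps)
    then have "x - y \<noteq> 0" "rat_val p (x - y) = rat_val p x + rat_val p (1 - u)"
      using False x rat_val_mult[OF p x False] by auto
    then have "int N \<le> rat_val p x + rat_val p (1 - u)" using Zid_iff_rat_val[OF p] xy by metis
    then have "int 1 \<le> rat_val p (1 - u)" using N by simp
    then show ?thesis using Zid_iff_rat_val[OF p False] by blast
  qed (use p in simp)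
  then have "u \<in> Zunit p" using Zunit_cong[OF p] Zunit_one[OF p] by blast
  then have "rat_val p u = 0" by (rule rat_val_unit[OF p])
  then show "rat_val p y = rat_val p x" using rat_val_mult[OF p x u0] yu by simp
qed

lemma Zid_scale:
  assumes p: "prime p" and c: "c \<noteq> 0" "int M \<le> rat_val p c + int N" and x: "x \<in> Zid p N"
  shows "c * x \<in> Zid p M"
proof (cases "x = 0")
  case False
  then have "int N \<le> rat_val p x" using Zid_iff_rat_val[OF p] x by blast
  then have "int M \<le> rat_val p (c * x)" using rat_val_mult[OF p c(1) False] c(2) by simp
  then show ?thesis using Zid_iff_rat_val[OF p] c(1) False by simp
qed (use p in simp)

lemma rat_val_two:
  assumes p: "prime p"
  shows "rat_val p 2 = (if p = 2 then 1 else 0)"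
proof (cases "p = 2")
  case True
  then show ?thesis using rat_val_prime_powi[OF p, of 1] by simp
next
  case False
  have "\<not> p dvd 2" using False p primes_dvd_imp_eq two_is_prime_nat by blast
  then have "\<not> int p dvd 2" by presburger
  then show ?thesis using rat_val_unit[OF p] Zunit_of_int_iff[OF p, of 2] False by simp
qed

lemma rat_val_inverse:
  assumes p: "prime p" and x: "x \<noteq> 0"
  shows "rat_val p (1 / x) = - rat_val p x"
proof -
  have "rat_val p (x * (1 / x)) = rat_val p x + rat_val p (1 / x)" using x by (intro rat_val_mult[OF p]) auto
  moreover have "rat_val p 1 = 0" by (rule rat_val_unit[OF p Zunit_one[OF p]])
  ultimately show ?thesis using x by simp
qed

lemma mat_smult_smult:
  fixes A :: "'b::semigroup_mult mat"
  shows "a \<cdot>\<^sub>m (b \<cdot>\<^sub>m A) = (a * b) \<cdot>\<^sub>m A"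
  by (intro eq_matI) (auto simp: mult.assoc)

text \<open>Beyond the valuation of det (2 H) the approximation no longer affects the valuation of
  the determinant. Thus det S squared has the same valuation as 2^n: S is unimodular at odd p and
  has valuation n / 2 at p = 2.\<close>

lemma doubling_perturbation:
  assumes p: "prime p" and H: "H \<in> carrier_mat n n" "mid p 0 H" "det H \<noteq> 0"
    and S: "S \<in> carrier_mat n n" "mid p 0 S" "mid p N (S\<^sup>T * H * S - 2 \<cdot>\<^sub>m H)"
    and N: "rat_val p (2 ^ n * det H) < int N"
  shows "det S \<noteq> 0" "2 * rat_val p (det S) = int n * rat_val p 2"
    "det (S\<^sup>T * H * S) \<noteq> 0" "rat_val p (det (S\<^sup>T * H * S)) = rat_val p (2 ^ n * det H)"
proof -
  let ?F = "S\<^sup>T * H * S"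
  have d: "dim_row H = n" "dim_col H = n" "dim_row S = n" "dim_col S = n" using H S by auto
  have F: "?F \<in> carrier_mat n n" "mid p 0 ?F" using H S mid_congruent[OF p H(1) S(1,2) H(2)] by auto
  have two: "2 \<in> Zid p 0" using p by (simp add: Zid_numeral_iff)
  have dd: "det ?F - det (2 \<cdot>\<^sub>m H) \<in> Zid p N"
    using H mid_smult_0[OF p two H(2)] by (intro det_cong_Zid[OF p F _ _ S(3)]) auto
  have d2: "det (2 \<cdot>\<^sub>m H) = 2 ^ n * det H" using H(1) by simp
  have nz: "2 ^ n * det H \<noteq> 0" using H(3) by simp
  have "2 ^ n * det H - det ?F \<in> Zid p N" using dd Zid_uminus_iff[OF p, of "det ?F - det (2 \<cdot>\<^sub>m H)" N] by (simp add: d)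
  from rat_val_diff[OF p nz this N]
  show dF: "det ?F \<noteq> 0" "rat_val p (det ?F) = rat_val p (2 ^ n * det H)" by auto
  have e: "det ?F = (det S)\<^sup>2 * det H"
    using det_congruent[OF H(1) S(1)] by (simp add: power2_eq_square mult.commute)
  then show s0: "det S \<noteq> 0" using dF by auto
  show "2 * rat_val p (det S) = int n * rat_val p 2"
    using dF(2) e rat_val_mult[OF p _ H(3), of "(det S)\<^sup>2"] rat_val_mult[OF p _ H(3), of "2 ^ n"]
      rat_val_power[OF p s0, of 2] rat_val_power[OF p, of 2 n] s0 by simp
qed

text \<open>With F = \<open>S\<^sup>T * H * S\<close> and E = F - 2 H the identity expands
  \<open>B\<^sup>T * (F - E) * B\<close>; the inverse C of B and the inverse F' of F are inserted so
  that the error becomes a right factor close to 1.\<close>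

lemma transported_doubling:
  fixes H S B C F' :: "rat mat"
  assumes c: "H \<in> carrier_mat n n" "S \<in> carrier_mat n n" "B \<in> carrier_mat n n" "C \<in> carrier_mat n n" "F' \<in> carrier_mat n n"
    and BC: "B * C = 1\<^sub>m n" and F': "(S\<^sup>T * H * S) * F' = 1\<^sub>m n"
  shows "2 \<cdot>\<^sub>m (B\<^sup>T * H * B) = ((S * B)\<^sup>T * H * (S * B)) * (1\<^sub>m n - C * F' * (S\<^sup>T * H * S - 2 \<cdot>\<^sub>m H) * B)"
proof -
  note d = c[THEN carrier_matD(1)] c[THEN carrier_matD(2)]
  define F where "F = S\<^sup>T * H * S"
  have dF: "dim_row F = n" "dim_col F = n" using d by (auto simp: F_def)
  have 1: "(S * B)\<^sup>T * H * (S * B) = B\<^sup>T * (F * B)" unfolding F_def using d by (simp add: mat_ring)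
  have "B\<^sup>T * (F * B) * (C * F' * (F - 2 \<cdot>\<^sub>m H) * B) = B\<^sup>T * (F * (B * (C * (F' * ((F - 2 \<cdot>\<^sub>m H) * B)))))"
    using d dF by (simp add: mat_assoc)
  also have "B * (C * (F' * ((F - 2 \<cdot>\<^sub>m H) * B))) = F' * ((F - 2 \<cdot>\<^sub>m H) * B)"
    using d dF by (intro mat_cancel_left[OF BC]) auto
  also have "F * \<dots> = (F - 2 \<cdot>\<^sub>m H) * B"
    using d dF by (intro mat_cancel_left[OF F'[folded F_def]]) auto
  finally have 2: "B\<^sup>T * (F * B) * (C * F' * (F - 2 \<cdot>\<^sub>m H) * B) = B\<^sup>T * (F * B) - 2 \<cdot>\<^sub>m (B\<^sup>T * (H * B))"
    using d dF by (simp add: mat_diff_distrib mat_diff_distrib' mat_smult_left mat_smult_right)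
  have "B\<^sup>T * (F * B) * (1\<^sub>m n - C * F' * (F - 2 \<cdot>\<^sub>m H) * B) = B\<^sup>T * (F * B) - B\<^sup>T * (F * B) * (C * F' * (F - 2 \<cdot>\<^sub>m H) * B)"
    using d dF by (subst mat_diff_distrib) (auto simp: mat_one_right)
  also have "\<dots> = 2 \<cdot>\<^sub>m (B\<^sup>T * (H * B))" unfolding 2 using d dF by (intro eq_matI) (auto simp del: index_mult_mat(1))
  finally show ?thesis unfolding 1 F_def[symmetric] using d by (simp add: mat_assoc)
qed

text \<open>The index of the overlattice is a power of 2: at the other primes the doublings are already
  unimodular, so the matrix built at the prime 2 does no harm there.\<close>

lemma overlattice_matrix:
  assumes H: "H \<in> carrier_mat n n" "\<And>p. prime p \<Longrightarrow> mid p 0 H" "det H \<noteq> 0" and n: "even n"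
    and D: "\<And>p N. prime p \<Longrightarrow> approx_doubling p N n H"
  obtains B C where "B \<in> carrier_mat n n" "C \<in> carrier_mat n n" "B * C = 1\<^sub>m n" "C * B = 1\<^sub>m n" "intmat C"
    "\<And>p. prime p \<Longrightarrow> \<exists>U W. U \<in> Zgl p n \<and> W \<in> carrier_mat n n \<and> mid p 1 W \<and>
       2 \<cdot>\<^sub>m (B\<^sup>T * H * B) = (U\<^sup>T * H * U) * (1\<^sub>m n + 4 \<cdot>\<^sub>m W)"
proof -
  define h where "h = n div 2"
  \<comment> \<open>The digits lost when the error is divided by 4, det F and det C: at most 2, the
    valuation of 2^n det H, and at most h. One more must remain for W to be divisible by p.\<close>
  define K where "K p = nat (rat_val p (2 ^ n * det H)) + h + 4" for p
  have "\<exists>S. S \<in> carrier_mat n n \<and> mid p 0 S \<and> mid p (K p) (S\<^sup>T * H * S - 2 \<cdot>\<^sub>m H)" if "prime p" for p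
    using D[OF that, of "K p"] by (auto simp: approx_doubling_def)
  then obtain S where S: "\<And>p. prime p \<Longrightarrow> S p \<in> carrier_mat n n" "\<And>p. prime p \<Longrightarrow> mid p 0 (S p)"
    "\<And>p. prime p \<Longrightarrow> mid p (K p) ((S p)\<^sup>T * H * S p - 2 \<cdot>\<^sub>m H)" by metis
  have K: "rat_val p (2 ^ n * det H) < int (K p)" for p by (simp add: K_def)
  note P = doubling_perturbation[OF _ H(1) H(2) H(3) S K]
  have "2 * rat_val 2 (det (S 2)) = int n" using P(2)[of 2] rat_val_two[of 2] by simp
  \<comment> \<open>Evenness of the dimension makes h equal to exactly half of n.\<close>
  then have "rat_val 2 (det (S 2)) = int h" using n by (auto simp: h_def elim!: evenE)
  then obtain T C where TC: "T \<in> Zgl 2 n" "C \<in> carrier_mat n n" "intmat C" "det C = of_nat 2 ^ h" "S 2 = T * C"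
    using integral_factor[OF prime_two S(1)[OF prime_two] S(2)[OF prime_two]] P(1)[of 2] by (metis prime_two)
  have dC: "det C = 2 ^ h" "det C \<noteq> 0" using TC(4) by auto
  obtain B where B: "B \<in> carrier_mat n n" "C * B = 1\<^sub>m n" "B * C = 1\<^sub>m n" "B = (1 / det C) \<cdot>\<^sub>m adj_mat C"
    using field_mat_inverse[OF TC(2) dC(2)] by blast
  have "\<exists>U W. U \<in> Zgl p n \<and> W \<in> carrier_mat n n \<and> mid p 1 W \<and>
       2 \<cdot>\<^sub>m (B\<^sup>T * H * B) = (U\<^sup>T * H * U) * (1\<^sub>m n + 4 \<cdot>\<^sub>m W)" if p: "prime p" for p
  proof -
    note Sp = S[OF p]
    define F where "F = (S p)\<^sup>T * H * S p"
    define E where "E = F - 2 \<cdot>\<^sub>m H"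
    have F: "F \<in> carrier_mat n n" "mid p 0 F" using H(1) Sp(1) mid_congruent[OF p H(1) Sp(1,2) H(2)[OF p]] by (auto simp: F_def)
    have E: "E \<in> carrier_mat n n" "mid p (K p) E" using H(1) F(1) Sp(3) by (auto simp: E_def F_def)
    have F0: "det F \<noteq> 0" "rat_val p (det F) = rat_val p (2 ^ n * det H)" using P(3,4)[OF p p p p p] by (auto simp: F_def)
    obtain F' where F': "F' \<in> carrier_mat n n" "F * F' = 1\<^sub>m n" "F' = (1 / det F) \<cdot>\<^sub>m adj_mat F"
      using field_mat_inverse[OF F(1) F0(1)] by blast
    have adj: "adj_mat F \<in> carrier_mat n n" "adj_mat C \<in> carrier_mat n n" using adj_mat F(1) TC(2) by auto
    note cs = F(1) E(1) F'(1) adj TC(2) B(1) H(1) Sp(1)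
    note d = cs[THEN carrier_matD(1)] cs[THEN carrier_matD(2)]
    define c where "c = - (1 / (4 * (det F * det C)))"
    define X where "X = C * adj_mat F * E * adj_mat C"
    define W where "W = c \<cdot>\<^sub>m X"
    have mC: "mid p 0 C" using intmat_mid[OF p TC(3)] .
    have X: "X \<in> carrier_mat n n" "mid p (K p) X"
    proof -
      have "mid p 0 (C * adj_mat F)" using mid_mult_0[OF p _ mC mid_adj[OF p F]] d by simp
      then have "mid p (K p) (C * adj_mat F * E)" using mid_mult_0[OF p _ _ E(2)] d by simp
      then show "mid p (K p) X" unfolding X_def using mid_mult_0'[OF p _ _ mid_adj[OF p TC(2) mC]] d by simp
    qed (use d in \<open>auto simp: X_def\<close>)
    have "rat_val p c \<ge> 1 - int (K p)"
    proof -
      have 1: "rat_val p (det C) \<le> int h" unfolding dC(1) using rat_val_power[OF p, of 2 h] rat_val_two[OF p] by simp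
      have "rat_val p ((2 ^ 2) :: rat) \<le> 2" using rat_val_power[OF p, of 2 2] rat_val_two[OF p] by (simp del: power2_eq_square)
      then have 2: "rat_val p 4 \<le> 2" by simp
      have 3: "rat_val p (4 * (det F * det C)) = rat_val p 4 + (rat_val p (det F) + rat_val p (det C))"
        using rat_val_mult[OF p, of 4 "det F * det C"] rat_val_mult[OF p F0(1) dC(2)] F0(1) dC(2) by simp
      have "rat_val p c = - rat_val p (- (4 * (det F * det C)))"
        using rat_val_inverse[OF p, of "- (4 * (det F * det C))"] F0(1) dC(2) by (simp add: c_def)
      also have "rat_val p (- (4 * (det F * det C))) = rat_val p (4 * (det F * det C))"
      proof -
        have "-1 \<in> Zunit p" using Zunit_of_int_iff[OF p, of "-1"] p by (auto simp: prime_nat_iff)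
        then show ?thesis using rat_val_mult[OF p, of "-1" "4 * (det F * det C)"] rat_val_unit[OF p] F0(1) dC(2) by simp
      qed
      finally show ?thesis using 1 2 3 F0(2) by (simp add: K_def)
    qed
    then have W: "W \<in> carrier_mat n n" "mid p 1 W"
      using X Zid_scale[OF p, of c 1 "K p"] F0(1) dC(2) by (auto simp: W_def mid_def c_def)
    have W4: "1\<^sub>m n - C * F' * E * B = 1\<^sub>m n + 4 \<cdot>\<^sub>m W"
    proof -
      have "C * F' * E * B = (1 / det F * (1 / det C)) \<cdot>\<^sub>m X"
        unfolding X_def F'(3) B(4) using d by (simp add: mat_smult_left mat_smult_right mat_smult_smult mult.commute)
      moreover have "4 * c = - (1 / det F * (1 / det C))" using F0(1) dC(2) by (simp add: c_def field_simps)
      ultimately show ?thesis using X(1) d unfolding W_def mat_smult_smult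
        by (intro eq_matI) (auto simp del: index_mult_mat(1))
    qed
    \<comment> \<open>At 2 the factor C of S 2 cancels and T is left. At the other primes both det S
      and the power of 2 that is det C are units.\<close>
    have U: "S p * B \<in> Zgl p n"
    proof (cases "p = 2")
      case True
      have "S p * B = T" using True TC Zgl_carrier[OF TC(1)] B(1,2) by (simp add: mat_ring)
      then show ?thesis using TC(1) True by simp
    next
      case False
      have "2 * rat_val p (det (S p)) = 0" using P(2)[OF p p p p p] rat_val_two[OF p] False by simp
      then have "det (S p) \<notin> Zid p 1" using Zid_iff_rat_val[OF p P(1)[OF p p p p p], of 1] by simp
      then have s: "S p \<in> Zgl p n" using Sp mid_det[OF p Sp(1,2)] by (simp add: Zgl_def Zunit_def)
      have "\<not> p dvd 2" using False p primes_dvd_imp_eq two_is_prime_nat by blast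
      then have "\<not> p dvd 2 ^ h" using p prime_dvd_power by blast
      then have "\<not> int p dvd 2 ^ h" by (metis int_dvd_int_iff of_nat_numeral of_nat_power)
      then have "det C \<in> Zunit p" unfolding dC(1) using Zunit_of_int_iff[OF p, of "2 ^ h"] by simp
      then have "C \<in> Zgl p n" using TC(2) mC by (simp add: Zgl_def)
      then obtain V where V: "V \<in> Zgl p n" "C * V = 1\<^sub>m n" using Zgl_inverse[OF p] by blast
      have "B * (C * V) = V" using mat_cancel_left[OF B(3), of V] B(1) TC(2) Zgl_carrier[OF V(1)] by simp
      then have "B = V" using V(2) d by (simp add: mat_one_right)
      then show ?thesis using Zgl_mult[OF p s] V(1) by simp
    qed
    have "2 \<cdot>\<^sub>m (B\<^sup>T * H * B) = ((S p * B)\<^sup>T * H * (S p * B)) * (1\<^sub>m n + 4 \<cdot>\<^sub>m W)"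
      using transported_doubling[OF H(1) Sp(1) B(1) TC(2) F'(1) B(3) F'(2)[unfolded F_def]]
      unfolding W4[symmetric] E_def F_def .
    then show ?thesis using U W by blast
  qed
  then show thesis using that[OF B(1) TC(2) B(3,2) TC(3)] by blast
qed

section \<open>Gram matrices\<close>

lemma gram_carrier: "gram bs \<in> carrier_mat (length bs) (length bs)"
  by (simp add: gram_def)

lemma gram_symmetric: "(gram bs)\<^sup>T = gram bs"
  by (rule eq_matI) (auto simp: gram_def inner_commute)

lemma transpose_smult:
  fixes A :: "'b::times mat"
  shows "(k \<cdot>\<^sub>m A)\<^sup>T = k \<cdot>\<^sub>m A\<^sup>T"
  by (intro eq_matI) auto

lemma gram_inner:
  assumes L: "rational_lattice L" "lattice_basis bs L" and ij: "i < length bs" "j < length bs"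
  shows "inner (bs ! i) (bs ! j) = of_rat (gram bs $$ (i, j))"
proof -
  have "bs ! i \<in> L" "bs ! j \<in> L" using L(2) ij nth_zspan by (auto simp: lattice_basis_iff)
  then have "inner (bs ! i) (bs ! j) \<in> \<rat>" using L(1) by (auto simp: rational_lattice_def)
  then obtain q where q: "inner (bs ! i) (bs ! j) = of_rat q" by (auto elim: Rats_cases)
  have "inj (of_rat :: rat \<Rightarrow> real)" by (simp add: inj_def)
  then show ?thesis using ij by (simp add: gram_def q the_inv_f_f)
qed

lemma inner_comb_gram:
  assumes "rational_lattice L" "lattice_basis bs L"
  shows "inner (comb bs c) (comb bs d) = (\<Sum>i<length bs. \<Sum>j<length bs. c i * of_rat (gram bs $$ (i, j)) * d j)"
  by (rule inner_comb) (rule gram_inner[OF assms])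

definition qcomb :: "'a::euclidean_space list \<Rightarrow> rat mat \<Rightarrow> 'a" where
  "qcomb bs x = comb bs (\<lambda>i. of_rat (x $$ (i, 0)))"

lemma inner_qcomb:
  assumes L: "rational_lattice L" "lattice_basis bs L"
    and x: "x \<in> carrier_mat (length bs) 1" "y \<in> carrier_mat (length bs) 1"
  shows "inner (qcomb bs x) (qcomb bs y) = of_rat (ent (x\<^sup>T * gram bs * y))"
proof -
  let ?n = "length bs"
  note d = carrier_matD[OF gram_carrier[of bs]] carrier_matD[OF x(1)] carrier_matD[OF x(2)]
  have "ent (x\<^sup>T * gram bs * y) = ent (x\<^sup>T * (gram bs * y))" using d by (simp add: mat_assoc)
  also have "\<dots> = (\<Sum>i<?n. x\<^sup>T $$ (0, i) * (gram bs * y) $$ (i, 0))"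
    unfolding ent_def using d by (intro mult_mat_entry) auto
  also have "\<dots> = (\<Sum>i<?n. \<Sum>j<?n. x $$ (i, 0) * gram bs $$ (i, j) * y $$ (j, 0))"
  proof (intro sum.cong refl)
    fix i assume i: "i \<in> {..<?n}"
    have "(gram bs * y) $$ (i, 0) = (\<Sum>j<?n. gram bs $$ (i, j) * y $$ (j, 0))"
      using d i by (intro mult_mat_entry) auto
    then show "x\<^sup>T $$ (0, i) * (gram bs * y) $$ (i, 0) = (\<Sum>j<?n. x $$ (i, 0) * gram bs $$ (i, j) * y $$ (j, 0))"
      using d i by (simp add: sum_distrib_left mult.assoc del: index_mult_mat(1))
  qed
  finally have e: "ent (x\<^sup>T * gram bs * y) = (\<Sum>i<?n. \<Sum>j<?n. x $$ (i, 0) * gram bs $$ (i, j) * y $$ (j, 0))" .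
  show ?thesis
    unfolding qcomb_def inner_comb_gram[OF L] e by (simp add: of_rat_sum of_rat_mult)
qed

text \<open>Here the positive definite inner product enters: a combination of norm zero is the zero
  vector, and independence makes its coefficients vanish.\<close>

lemma gram_anisotropic:
  assumes L: "rational_lattice L" "lattice_basis bs L"
  shows "anisotropic (length bs) (gram bs)"
  unfolding anisotropic_def
proof (intro ballI impI notI)
  fix z :: "rat mat" assume z: "z \<in> carrier_mat (length bs) 1" "z \<noteq> 0\<^sub>m (length bs) 1"
    "ent (z\<^sup>T * gram bs * z) = 0"
  have "inner (qcomb bs z) (qcomb bs z) = 0" using inner_qcomb[OF L z(1,1)] z(3) by simp
  then have "comb bs (\<lambda>i. of_rat (z $$ (i, 0))) = 0" by (simp add: qcomb_def)
  then have "\<forall>i<length bs. z $$ (i, 0) = 0" using L(2) by (auto simp: lattice_basis_iff)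
  then have "z = 0\<^sub>m (length bs) 1" using z(1) by (intro eq_matI) auto
  then show False using z(2) by blast
qed

lemma inner_change_basis:
  assumes L: "rational_lattice L" "lattice_basis bs L" and B: "B \<in> carrier_mat (length bs) (length bs)"
    and kl: "k < length bs" "l < length bs"
  shows "inner (change_basis bs B ! k) (change_basis bs B ! l) = of_rat ((B\<^sup>T * gram bs * B) $$ (k, l))"
  unfolding nth_change_basis[OF kl(1)] nth_change_basis[OF kl(2)] inner_comb_gram[OF L]
    congruent_entry[OF gram_carrier B kl] by (simp add: of_rat_sum of_rat_mult)

lemma rational_latticeI:
  assumes bs: "lattice_basis bs M"
    and g: "\<And>i j. i < length bs \<Longrightarrow> j < length bs \<Longrightarrow> inner (bs ! i) (bs ! j) \<in> \<rat>"
  shows "rational_lattice M"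
  unfolding rational_lattice_def
proof (intro conjI ballI)
  show "euclidean_lattice M" using bs by (auto simp: euclidean_lattice_def)
  fix u v assume "u \<in> M" "v \<in> M"
  then obtain c d :: "nat \<Rightarrow> int" where uv: "u = comb bs (\<lambda>i. of_int (c i))" "v = comb bs (\<lambda>i. of_int (d i))"
    using bs unfolding lattice_basis_iff zspan_def by blast
  have "inner u v = (\<Sum>i<length bs. \<Sum>j<length bs. real_of_int (c i) * inner (bs ! i) (bs ! j) * real_of_int (d j))"
    unfolding uv by (rule inner_comb) (rule refl)
  also have "\<dots> \<in> \<rat>" using g by (intro Rats_sum Rats_mult Rats_of_int) auto
  finally show "inner u v \<in> \<rat>" .
qed

lemma norm_doubling_map_doubling:
  assumes L: "rational_lattice L" "lattice_basis bs L" and \<sigma>: "norm_doubling_map \<sigma> L"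
  shows "\<exists>S. doubling (length bs) (gram bs) S"
proof -
  let ?n = "length bs"
  have bL: "bs ! k \<in> L" if "k < ?n" for k using L(2) that nth_zspan by (auto simp: lattice_basis_iff)
  have "\<exists>c :: nat \<Rightarrow> int. k < ?n \<longrightarrow> \<sigma> (bs ! k) = comb bs (\<lambda>i. of_int (c i))" for k
  proof (cases "k < ?n")
    case True
    then have "\<sigma> (bs ! k) \<in> zspan bs" using \<sigma> bL L(2) unfolding norm_doubling_map_def lattice_basis_iff by blast
    then show ?thesis unfolding zspan_def by blast
  qed simp
  then obtain c :: "nat \<Rightarrow> nat \<Rightarrow> int" where c: "\<And>k. k < ?n \<Longrightarrow> \<sigma> (bs ! k) = comb bs (\<lambda>i. of_int (c k i))" by metis
  define S :: "rat mat" where "S = mat ?n ?n (\<lambda>(i, k). of_int (c k i))"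
  have S: "S \<in> carrier_mat ?n ?n" by (simp add: S_def)
  have Sk: "change_basis bs S ! k = \<sigma> (bs ! k)" if "k < ?n" for k
    unfolding nth_change_basis[OF that] c[OF that] using that by (intro comb_cong) (simp add: S_def)
  have "S\<^sup>T * gram bs * S = 2 \<cdot>\<^sub>m gram bs"
  proof (rule eq_matI)
    fix k l assume "k < dim_row (2 \<cdot>\<^sub>m gram bs)" "l < dim_col (2 \<cdot>\<^sub>m gram bs)"
    then have kl: "k < ?n" "l < ?n" using gram_carrier[of bs] by auto
    have "(of_rat ((S\<^sup>T * gram bs * S) $$ (k, l)) :: real) = inner (\<sigma> (bs ! k)) (\<sigma> (bs ! l))"
      using inner_change_basis[OF L S kl] Sk kl by simp
    also have "\<dots> = 2 * inner (bs ! k) (bs ! l)"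
      using \<sigma> bL[OF kl(1)] bL[OF kl(2)] by (auto simp: norm_doubling_map_def span_base)
    also have "\<dots> = of_rat (2 * gram bs $$ (k, l))" using gram_inner[OF L kl] by (simp add: of_rat_mult)
    finally have "(S\<^sup>T * gram bs * S) $$ (k, l) = 2 * gram bs $$ (k, l)" by (simp only: of_rat_eq_iff)
    then show "(S\<^sup>T * gram bs * S) $$ (k, l) = (2 \<cdot>\<^sub>m gram bs) $$ (k, l)"
      using kl gram_carrier[of bs] by (simp del: index_mult_mat(1))
  qed (use S gram_carrier[of bs] in auto)
  then show ?thesis using S gram_carrier[of bs] gram_symmetric[of bs] gram_anisotropic[OF L] unfolding doubling_def by blast
qed

section \<open>Maximal lattices\<close>

lemma lattice_add:
  assumes "lattice_basis bs L" "u \<in> L" "v \<in> L"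
  shows "u + v \<in> L"
proof -
  obtain c d :: "nat \<Rightarrow> int" where "u = comb bs (\<lambda>i. of_int (c i))" "v = comb bs (\<lambda>i. of_int (d i))"
    using assms unfolding lattice_basis_iff zspan_def by blast
  then have "u + v = comb bs (\<lambda>i. of_int (c i) + of_int (d i))" by (simp add: comb_add)
  then show ?thesis using assms(1) zspanI[of bs "\<lambda>i. of_int (c i) + of_int (d i)"] by (simp add: lattice_basis_iff)
qed

lemma lattice_scale:
  assumes "lattice_basis bs L" "u \<in> L"
  shows "of_int k *\<^sub>R u \<in> L"
proof -
  obtain c :: "nat \<Rightarrow> int" where "u = comb bs (\<lambda>i. of_int (c i))"
    using assms unfolding lattice_basis_iff zspan_def by blast
  then have "of_int k *\<^sub>R u = comb bs (\<lambda>i. of_int k * of_int (c i))" by (simp add: comb_scale)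
  then show ?thesis using assms(1) zspanI[of bs "\<lambda>i. of_int k * of_int (c i)"] by (simp add: lattice_basis_iff)
qed

lemma norms_in_inner:
  assumes "lattice_basis bs L" "norms_in r L" "u \<in> L" "v \<in> L"
  obtains k :: int where "2 * inner u v = of_rat r * of_int k"
proof -
  obtain a b c :: int where "inner u u = of_rat r * of_int a" "inner v v = of_rat r * of_int b"
    "inner (u + v) (u + v) = of_rat r * of_int c"
    using assms(2-4) lattice_add[OF assms(1,3,4)] unfolding norms_in_def by blast
  moreover have "2 * inner u v = inner (u + v) (u + v) - inner u u - inner v v"
    by (simp add: inner_add_left inner_add_right inner_commute)
  ultimately have "2 * inner u v = of_rat r * of_int (c - a - b)" by (simp add: algebra_simps)
  then show thesis by (rule that)
qed

text \<open>Norms in r Z give products in (r / 2) Z by polarization. Scaling by 2 / r therefore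
  makes all products integral and all norms even.\<close>

lemma even_form_gram:
  assumes p: "prime p" and L: "rational_lattice L" "lattice_basis bs L" and r: "r \<noteq> 0" "norms_in r L"
  shows "even_form p (length bs) ((2 / r) \<cdot>\<^sub>m gram bs)"
proof -
  let ?n = "length bs"
  note d = carrier_matD[OF gram_carrier[of bs]]
  have bL: "bs ! k \<in> L" if "k < ?n" for k using L(2) that nth_zspan by (auto simp: lattice_basis_iff)
  have "2 / r * gram bs $$ (i, j) \<in> \<int>" if ij: "i < ?n" "j < ?n" for i j
  proof -
    obtain k :: int where k: "2 * inner (bs ! i) (bs ! j) = of_rat r * of_int k"
      using norms_in_inner[OF L(2) r(2) bL[OF ij(1)] bL[OF ij(2)]] .
    then have "of_rat (2 * gram bs $$ (i, j)) = (of_rat (r * of_int k) :: real)"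
      unfolding gram_inner[OF L ij] by (simp add: of_rat_mult)
    then have "2 * gram bs $$ (i, j) = r * of_int k" by (simp only: of_rat_eq_iff)
    then have "2 / r * gram bs $$ (i, j) = of_int k" using r by (simp add: field_simps)
    then show ?thesis by simp
  qed
  moreover have "2 / r * gram bs $$ (i, i) / 2 \<in> \<int>" if i: "i < ?n" for i
  proof -
    obtain k :: int where "inner (bs ! i) (bs ! i) = of_rat r * of_int k" using r(2) bL[OF i] unfolding norms_in_def by blast
    then have "of_rat (gram bs $$ (i, i)) = (of_rat (r * of_int k) :: real)"
      unfolding gram_inner[OF L i i] by (simp add: of_rat_mult)
    then have "gram bs $$ (i, i) = r * of_int k" by (simp only: of_rat_eq_iff)
    then have "2 / r * gram bs $$ (i, i) / 2 = of_int k" using r by (simp add: field_simps)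
    then show ?thesis by simp
  qed
  ultimately show ?thesis
    unfolding even_form_def using d gram_symmetric[of bs] gram_carrier[of bs]
    by (auto simp: mid_def transpose_smult intro!: Ints_Zid[OF p])
qed

lemma Zid_half:
  assumes p: "prime p" and x: "x \<in> Zid p (Suc N)"
  shows "1 / 2 * x \<in> Zid p N"
  using Zid_scale[OF p, of "1 / 2" N "Suc N" x] rat_val_inverse[OF p, of 2] rat_val_two[OF p] x by simp

text \<open>A violating z, normalized and rounded to an integer column, is a vector v of L whose
  norm lies in p^2 r Z and whose doubled products with L lie in p r Z. Then L together with v / p
  generates a strictly larger lattice in the same rational space with norms still in r Z.\<close>

lemma locally_maximal_if_r_maximal:
  assumes p: "prime p" and L: "rational_lattice L" "lattice_basis bs L" and r: "r \<noteq> 0" "r_maximal r L"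
  shows "locally_maximal p (length bs) ((2 / r) \<cdot>\<^sub>m gram bs)"
  unfolding locally_maximal_def
proof (intro ballI impI, rule ccontr)
  let ?n = "length bs" and ?H = "(2 / r) \<cdot>\<^sub>m gram bs"
  fix z :: "rat mat"
  assume z: "z \<in> carrier_mat ?n 1" and "mid p 0 z \<and> mid p 1 (?H * z) \<and> mid p 2 ((1 / 2) \<cdot>\<^sub>m (z\<^sup>T * ?H * z))"
    and nz: "\<not> mid p 1 z"
  then have z': "mid p 0 z" "mid p 1 (?H * z)" "mid p 2 ((1 / 2) \<cdot>\<^sub>m (z\<^sup>T * ?H * z))" by auto
  have nr: "norms_in r L" using r(2) by (simp add: r_maximal_def)
  have H: "?H \<in> carrier_mat ?n ?n" "?H\<^sup>T = ?H" "mid p 0 ?H"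
    using even_form_gram[OF p L r(1) nr] by (auto simp: even_form_def)
  define H where "H = ?H"
  obtain j where j: "j < ?n" "z $$ (j, 0) \<notin> Zid p 1" using nz z by (auto simp: mid_def)
  have zj: "z $$ (j, 0) \<in> Zunit p" using j midD[OF z'(1), of j 0] z by (simp add: Zunit_def)
  define a where "a = inverse (z $$ (j, 0))"
  have ai: "a \<in> Zid p 0" unfolding a_def by (rule Zunit_inverse_Zid[OF p zj])
  \<comment> \<open>The norm condition is modulo p^2 for half of the form; the third digit pays for
    the halving at p = 2.\<close>
  have "\<exists>k::int. a * z $$ (i, 0) - of_int k \<in> Zid p 3" if "i < ?n" for i
    using Zid_round[OF p Zid_mult_0[OF p ai midD[OF z'(1), of i 0]]] that z by (metis carrier_matD less_one)
  then obtain k :: "nat \<Rightarrow> int" where k: "\<And>i. i < ?n \<Longrightarrow> a * z $$ (i, 0) - of_int (k i) \<in> Zid p 3" by metis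
  define w :: "rat mat" where "w = mat ?n 1 (\<lambda>(i, _). if i = j then 1 else of_int (k i))"
  define y where "y = a \<cdot>\<^sub>m z"
  define e where "e = y - w"
  have w: "w \<in> carrier_mat ?n 1" "intmat w" by (auto simp: w_def intmat_def)
  note HH = H[folded H_def]
  have d: "dim_row H = ?n" "dim_col H = ?n" "dim_row w = ?n" "dim_col w = 1" "dim_row y = ?n" "dim_col y = 1"
    "dim_row e = ?n" "dim_col e = 1"
    using HH(1) w z by (auto simp: e_def y_def)
  have me: "mid p 3 e"
    using k z Zunit_nonzero[OF p zj] p by (auto simp: mid_def w_def e_def y_def a_def)
  have mw: "mid p 0 w" using intmat_mid[OF p w(2)] .
  have my: "mid p 0 y" using mid_smult_0[OF p ai z'(1)] by (simp add: y_def)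
  have we: "w = y - e" using d by (intro eq_matI) (auto simp: e_def)
  have "mid p 1 (H * y)" using mid_smult_0[OF p ai z'(2)] z d unfolding y_def H_def[symmetric] by (simp add: mat_smult_right)
  moreover have "mid p 1 (H * e)" using mid_mult_0[OF p _ HH(3) mid_mono[OF p _ me, of 1]] d by simp
  ultimately have Hw: "mid p 1 (H * w)" unfolding we using mid_diff[OF p] d by (simp add: mat_diff_distrib)
  have Hww: "1 / 2 * ent (w\<^sup>T * H * w) \<in> Zid p 2"
  proof -
    have "w\<^sup>T * H * w = w\<^sup>T * H * y - w\<^sup>T * (H * e)" using d by (subst (2) we) (simp add: mat_ring)
    also have "w\<^sup>T * H * y = y\<^sup>T * H * y - e\<^sup>T * (H * y)"
    proof -
      have "w\<^sup>T = y\<^sup>T - e\<^sup>T" using d by (subst we) (intro eq_matI, auto)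
      then show ?thesis using d by (simp add: mat_ring)
    qed
    finally have "ent (w\<^sup>T * H * w) = ent (y\<^sup>T * H * y) - ent (e\<^sup>T * (H * y)) - ent (w\<^sup>T * (H * e))"
      using d by (simp add: ent_def del: index_mult_mat(1))
    moreover have "1 / 2 * ent (y\<^sup>T * H * y) \<in> Zid p 2"
    proof -
      have "y\<^sup>T * H * y = (a * a) \<cdot>\<^sub>m (z\<^sup>T * H * z)"
        unfolding y_def using d z by (simp add: transpose_smult mat_smult_left mat_smult_right mat_smult_smult)
      then have "1 / 2 * ent (y\<^sup>T * H * y) = a * a * ((1 / 2) \<cdot>\<^sub>m (z\<^sup>T * H * z)) $$ (0, 0)"
        using z by (simp add: ent_def del: index_mult_mat(1))
      moreover have "((1 / 2) \<cdot>\<^sub>m (z\<^sup>T * H * z)) $$ (0, 0) \<in> Zid p 2"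
        using midD[OF z'(3), of 0 0] z by (simp add: H_def del: index_mult_mat(1))
      ultimately show ?thesis using Zid_mult_0[OF p Zid_mult_0[OF p ai ai]] by simp
    qed
    moreover have "1 / 2 * ent (e\<^sup>T * (H * y)) \<in> Zid p 2"
    proof -
      have "mid p 3 (e\<^sup>T * (H * y))"
        using mid_mult_0'[OF p _ mid_transpose[OF me] mid_mult_0[OF p _ HH(3) my]] d by simp
      then have "ent (e\<^sup>T * (H * y)) \<in> Zid p (Suc 2)" using midD[of p 3 _ 0 0] d by (simp add: ent_def eval_nat_numeral del: index_mult_mat(1))
      then show ?thesis by (rule Zid_half[OF p])
    qed
    moreover have "1 / 2 * ent (w\<^sup>T * (H * e)) \<in> Zid p 2"
    proof -
      have "mid p 3 (w\<^sup>T * (H * e))"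
        using mid_mult_0[OF p _ mid_transpose[OF mw] mid_mult_0[OF p _ HH(3) me]] d by simp
      then have "ent (w\<^sup>T * (H * e)) \<in> Zid p (Suc 2)" using midD[of p 3 _ 0 0] d by (simp add: ent_def eval_nat_numeral del: index_mult_mat(1))
      then show ?thesis by (rule Zid_half[OF p])
    qed
    ultimately show ?thesis using Zid_diff[OF p] by (simp add: right_diff_distrib)
  qed
  define v where "v = qcomb bs w"
  have vL: "v \<in> L"
    using L(2) zspanI[of bs "\<lambda>i. of_rat (w $$ (i, 0))"] w d
    by (auto simp: lattice_basis_iff v_def qcomb_def w_def)
  have inner_H: "2 * inner (qcomb bs x) v = of_rat (r * ent (x\<^sup>T * (H * w)))" if x: "x \<in> carrier_mat ?n 1" for x
  proof -
    have "ent (x\<^sup>T * (H * w)) = 2 / r * ent (x\<^sup>T * gram bs * w)"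
      unfolding H_def using x w gram_carrier[of bs] carrier_matD[OF gram_carrier[of bs]]
      by (simp add: mat_assoc mat_smult_left mat_smult_right ent_def del: index_mult_mat(1))
    then have "r * ent (x\<^sup>T * (H * w)) = 2 * ent (x\<^sup>T * gram bs * w)" using r(1) by simp
    then show ?thesis unfolding v_def inner_qcomb[OF L x w(1)] by (simp add: of_rat_mult)
  qed
  have rr: "(of_rat r :: real) \<noteq> 0" using r(1) by simp
  have p0: "real p \<noteq> 0" "(of_nat p :: rat) \<noteq> 0" using p by auto
  have vv: "\<exists>m::int. inner v v = of_rat r * (real p ^ 2 * of_int m)"
  proof -
    obtain m :: int where m: "inner v v = of_rat r * of_int m" using nr vL unfolding norms_in_def by blast
    have "of_rat (r * ent (w\<^sup>T * (H * w))) = (of_rat (r * (2 * of_int m)) :: real)"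
      using inner_H[OF w(1), symmetric] m unfolding v_def[symmetric] by (simp add: of_rat_mult)
    then have "r * ent (w\<^sup>T * (H * w)) = r * (2 * of_int m)" by (simp only: of_rat_eq_iff)
    then have "1 / 2 * ent (w\<^sup>T * H * w) = of_int m" using r(1) d by (simp add: mat_assoc)
    then have "int p ^ 2 dvd m" using Hww Zid_of_int_iff[OF p] by metis
    then show ?thesis using m by auto
  qed
  then obtain m0 :: int where m0: "inner v v = of_rat r * (real p ^ 2 * of_int m0)" by blast
  have uv: "\<exists>m::int. 2 * inner u v = of_rat r * (real p * of_int m)" if u: "u \<in> L" for u
  proof -
    obtain c :: "nat \<Rightarrow> int" where c: "u = comb bs (\<lambda>i. of_int (c i))" using u L(2) unfolding lattice_basis_iff zspan_def by blast
    define x :: "rat mat" where "x = mat ?n 1 (\<lambda>(i, _). of_int (c i))"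
    have x: "x \<in> carrier_mat ?n 1" "intmat x" by (auto simp: x_def intmat_def)
    have ux: "u = qcomb bs x" unfolding c qcomb_def by (intro comb_cong) (simp add: x_def)
    obtain m :: int where m: "2 * inner u v = of_rat r * of_int m" using norms_in_inner[OF L(2) nr u vL] .
    have "of_rat (r * ent (x\<^sup>T * (H * w))) = (of_rat (r * of_int m) :: real)"
      using inner_H[OF x(1), symmetric] m unfolding ux by (simp add: of_rat_mult)
    then have "r * ent (x\<^sup>T * (H * w)) = r * of_int m" by (simp only: of_rat_eq_iff)
    then have e: "ent (x\<^sup>T * (H * w)) = of_int m" using r(1) by simp
    have "mid p 1 (x\<^sup>T * (H * w))" using mid_mult_0[OF p _ mid_transpose[OF intmat_mid[OF p x(2)]] Hw] x(1) d by simp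
    then have "ent (x\<^sup>T * (H * w)) \<in> Zid p 1" using midD[of p 1 _ 0 0] d x(1) by (simp add: ent_def del: index_mult_mat(1))
    then have "int p ^ 1 dvd m" unfolding e using Zid_of_int_iff[OF p] by blast
    then show ?thesis using m by auto
  qed
  define B :: "rat mat" where "B = mat ?n ?n (\<lambda>(i, l). if l = j then w $$ (i, 0) / of_nat p else if i = l then 1 else 0)"
  define C :: "rat mat" where "C = mat ?n ?n (\<lambda>(i, l). if l = j then (if i = j then of_nat p else - w $$ (i, 0)) else if i = l then 1 else 0)"
  have wj: "w $$ (j, 0) = 1" using j(1) by (simp add: w_def)
  have BC: "B \<in> carrier_mat ?n ?n" "C \<in> carrier_mat ?n ?n" "B * C = 1\<^sub>m ?n" "C * B = 1\<^sub>m ?n"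
    using replace_column_inverse(2,3)[OF j(1) wj p0(2)] by (auto simp: B_def C_def)
  have "intmat C" using w d by (auto simp: intmat_def C_def)
  define M where "M = zspan (change_basis bs B)"
  have M: "lattice_basis (change_basis bs B) M" "L \<subseteq> M"
    using change_basis_lattice[OF L(2) BC] \<open>intmat C\<close> by (auto simp: M_def)
  \<comment> \<open>M consists of vectors u + (s / p) v with u in L. The expansion of such a norm
    uses the two divisibilities for v term by term.\<close>
  have Mx: "\<exists>u s. u \<in> L \<and> x = u + (of_int s / real p) *\<^sub>R v" if x: "x \<in> M" for x
  proof -
    obtain c :: "nat \<Rightarrow> int" where c: "x = comb (change_basis bs B) (\<lambda>i. of_int (c i))"
      using x unfolding M_def zspan_def by blast
    have "x = comb bs (\<lambda>i. (if i = j then 0 else of_int (c i)) + (of_int (c j) / real p) * of_rat (w $$ (i, 0)))"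
      unfolding c comb_change_basis
    proof (rule comb_cong)
      fix i assume i: "i < ?n"
      have "(\<Sum>k<?n. of_rat (B $$ (i, k)) * real_of_int (c k)) =
          (\<Sum>k<?n. (if k = j then of_rat (w $$ (i, 0) / of_nat p) * real_of_int (c j) else 0) + (if k = i then (if i = j then 0 else of_int (c i)) else 0))"
        using i by (intro sum.cong refl) (auto simp: B_def)
      then show "(\<Sum>k<?n. of_rat (B $$ (i, k)) * real_of_int (c k)) = (if i = j then 0 else of_int (c i)) + (of_int (c j) / real p) * of_rat (w $$ (i, 0))"
        using i j(1) by (simp add: sum.distrib of_rat_divide)
    qed
    then have "x = comb bs (\<lambda>i. if i = j then 0 else of_int (c i)) + (of_int (c j) / real p) *\<^sub>R v"
      unfolding v_def qcomb_def comb_scale comb_add .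
    moreover have "comb bs (\<lambda>i. if i = j then 0 else of_int (c i)) \<in> L"
      using L(2) zspanI[of bs "\<lambda>i. if i = j then 0 else of_int (c i)"] by (auto simp: lattice_basis_iff)
    ultimately show ?thesis by blast
  qed
  have "M \<subseteq> rat_space L"
  proof
    fix x assume "x \<in> M"
    then obtain u s where us: "u \<in> L" "x = u + (of_int s / real p) *\<^sub>R v" using Mx by blast
    have "of_int (int p) *\<^sub>R u + of_int s *\<^sub>R v \<in> L"
      by (intro lattice_add[OF L(2)] lattice_scale[OF L(2)] us(1) vL)
    moreover have "x = (1 / real p) *\<^sub>R (of_int (int p) *\<^sub>R u + of_int s *\<^sub>R v)"
      using p0(1) unfolding us(2) by (simp add: scaleR_add_right)
    moreover have "1 / real p \<in> \<rat>" by simp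
    ultimately show "x \<in> rat_space L" unfolding rat_space_def by blast
  qed
  moreover have "norms_in r M"
    unfolding norms_in_def
  proof
    fix x assume "x \<in> M"
    then obtain u s where us: "u \<in> L" "x = u + (of_int s / real p) *\<^sub>R v" using Mx by blast
    obtain a :: int where a: "inner u u = of_rat r * of_int a" using nr us(1) unfolding norms_in_def by blast
    obtain b :: int where b: "2 * inner u v = of_rat r * (real p * of_int b)" using uv[OF us(1)] by blast
    have "inner x x = inner u u + (of_int s / real p) * (2 * inner u v) + (of_int s / real p)\<^sup>2 * inner v v"
      unfolding us(2) by (simp add: inner_add_left inner_add_right inner_commute power2_eq_square algebra_simps)
    also have "\<dots> = of_rat r * of_int (a + s * b + s\<^sup>2 * m0)"
      unfolding a b m0 using p0(1) by (simp add: power2_eq_square field_simps)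
    finally show "\<exists>k::int. inner x x = of_rat r * of_int k" by blast
  qed
  moreover have "euclidean_lattice M" using M(1) by (auto simp: euclidean_lattice_def)
  ultimately have "M = L" using r(2) M(2) unfolding r_maximal_def by blast
  have "change_basis bs B ! j \<in> M" unfolding M_def using j(1) nth_zspan[of j "change_basis bs B"] by simp
  then obtain c :: "nat \<Rightarrow> int" where c: "comb bs (\<lambda>i. of_rat (B $$ (i, j))) = comb bs (\<lambda>i. of_int (c i))"
    using L(2) \<open>M = L\<close> unfolding lattice_basis_iff zspan_def nth_change_basis[OF j(1)] by blast
  have "of_rat (B $$ (j, j)) = real_of_int (c j)" using lattice_basis_unique[OF L(2) c j(1)] .
  \<comment> \<open>The contradiction: if M were L, the coordinate 1 / p of v / p at place j would
    be an integer.\<close>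
  then have "1 / real p = of_int (c j)" using j(1) wj by (simp add: B_def of_rat_divide)
  then have "real_of_int (int p * c j) = real_of_int 1" using p0(1) by (simp add: field_simps)
  then have "int p * c j = 1" by (simp only: of_int_eq_iff)
  then show False using p by (metis dvd_triv_left int_dvd_int_iff not_prime_unit of_nat_1)
qed

section \<open>Norm-doubling maps\<close>

lemma anisotropic_det:
  assumes G: "G \<in> carrier_mat n n" and a: "anisotropic n G"
  shows "det G \<noteq> 0"
proof
  assume "det G = 0"
  then obtain v where v: "v \<in> carrier_vec n" "v \<noteq> 0\<^sub>v n" "G *\<^sub>v v = 0\<^sub>v n"
    using det_0_iff_vec_prod_zero_field[OF G] by blast
  define z where "z = mat n 1 (\<lambda>(i, _). v $ i)"
  have z: "z \<in> carrier_mat n 1" by (simp add: z_def)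
  note d = carrier_matD[OF G] carrier_matD[OF z]
  have "G * z = 0\<^sub>m n 1"
  proof (rule eq_matI)
    fix i j assume "i < dim_row (0\<^sub>m n 1 :: rat mat)" "j < dim_col (0\<^sub>m n 1 :: rat mat)"
    then have ij: "i < n" "j = 0" by auto
    have "col z 0 = v" using v(1) by (intro eq_vecI) (auto simp: z_def)
    then have "(G * z) $$ (i, 0) = (G *\<^sub>v v) $ i" using ij d by simp
    then show "(G * z) $$ (i, j) = 0\<^sub>m n 1 $$ (i, j)" using ij v(3) by simp
  qed (use d in auto)
  then have "ent (z\<^sup>T * G * z) = 0" using d by (simp add: mat_assoc ent_def)
  moreover have "z \<noteq> 0\<^sub>m n 1"
  proof
    assume "z = 0\<^sub>m n 1"
    then have "z $$ (i, 0) = 0" if "i < n" for i using that by simp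
    then have "v = 0\<^sub>v n" using v(1) by (intro eq_vecI) (auto simp: z_def)
    then show False using v(2) by blast
  qed
  ultimately show False using a z by (auto simp: anisotropic_def)
qed

lemma approx_doubling_gram:
  fixes L :: "'a::euclidean_space set"
  assumes L: "rational_lattice L" "lattice_basis bs L" and r: "r \<noteq> 0" "r_maximal r L" and n: "even (length bs)"
    and dG: "det (gram bs) \<noteq> 0"
    and v: "\<And>q. prime q \<Longrightarrow> [int q = 3] (mod 8) \<or> [int q = -3] (mod 8) \<Longrightarrow> even (rat_val q (det (gram bs)))"
    and p: "prime p"
  shows "approx_doubling p N (length bs) ((2 / r) \<cdot>\<^sub>m gram bs)"
proof -
  let ?n = "length bs"
  define H where "H = (2 / r) \<cdot>\<^sub>m gram bs"
  have nr: "norms_in r L" using r(2) by (simp add: r_maximal_def)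
  have ef: "even_form q ?n H" if "prime q" for q using even_form_gram[OF that L r(1) nr] by (simp add: H_def)
  have lm: "locally_maximal q ?n H" if "prime q" for q using locally_maximal_if_r_maximal[OF that L r] by (simp add: H_def)
  have H: "H \<in> carrier_mat ?n ?n" "H\<^sup>T = H" "mid p 0 H" using ef[OF p] by (auto simp: even_form_def)
  have r2: "2 / r \<noteq> 0" using r(1) by simp
  have dH: "det H = (2 / r) ^ ?n * det (gram bs)"
    using carrier_matD[OF gram_carrier[of bs]] by (simp add: H_def)
  then have dH0: "det H \<noteq> 0" using dG r2 by simp
  \<comment> \<open>As n is even, (2 / r)^n is a square, so scaling preserves the parity of the
    valuations.\<close>
  have ev: "even (rat_val q (det H))" if q: "prime q" "[int q = 3] (mod 8) \<or> [int q = -3] (mod 8)" for q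
    unfolding dH using rat_val_mult[OF q(1), of "(2 / r) ^ ?n" "det (gram bs)"] rat_val_power[OF q(1) r2] r2 dG n v[OF q] by simp
  consider "p = 2" | "p \<noteq> 2" "[int p = 3] (mod 8) \<or> [int p = -3] (mod 8)"
    | "p \<noteq> 2" "\<not> ([int p = 3] (mod 8) \<or> [int p = -3] (mod 8))" by blast
  then have "approx_doubling p N ?n H"
  proof cases
    case 1
    \<comment> \<open>The sign in the discriminant is harmless because -1 is itself a norm.\<close>
    have "two_norm (-1)" by (intro two_norm_pm_one) (simp add: pm_one_def)
    then have "two_norm ((-1) ^ k)" for k
      using two_norm_mult[of "-1"] two_norm_pm_one[of 1] by (induction k) (auto simp: pm_one_def)
    then have "two_norm ((-1) ^ (?n div 2) * det H)"
      using two_norm_mult two_norm_if_even_valuations[OF dH0 ev] by blast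
    then have "doubling_conditions ?n H" using ef[of 2] lm[of 2] n by (simp add: doubling_conditions_def)
    then show ?thesis using approx_doubling_two 1 by blast
  next
    case 2
    show ?thesis using approx_doubling_odd[OF two_nonresidue_mod_8[OF p 2(2)] H dH0 n ev[OF p 2(2)] lm[OF p]] .
  next
    case 3
    show ?thesis using approx_doubling_residue[OF p 3 H(1,3)] .
  qed
  then show ?thesis by (simp add: H_def)
qed

text \<open>The Gram matrix of the scaled overlattice is
  \<open>2 \<cdot>\<^sub>m (B\<^sup>T * gram bs * B)\<close>: the irrational factor enters every
  product twice, so the lattice is rational although it need not lie in the rational space of L. The
  factor c cancels from the local congruences.\<close>

lemma doubled_lattice_in_genus:
  fixes L :: "'a::euclidean_space set"
  assumes L: "rational_lattice L" "lattice_basis bs L" and n: "even (length bs)" and c: "c \<noteq> 0"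
    and H: "\<And>p. prime p \<Longrightarrow> mid p 0 (c \<cdot>\<^sub>m gram bs)" "det (gram bs) \<noteq> 0"
    and D: "\<And>p N. prime p \<Longrightarrow> approx_doubling p N (length bs) (c \<cdot>\<^sub>m gram bs)"
  obtains M where "rational_lattice M" "same_genus L M" "\<And>u. u \<in> L \<Longrightarrow> sqrt 2 *\<^sub>R u \<in> M"
proof -
  let ?n = "length bs" and ?G = "gram bs"
  have dH: "det (c \<cdot>\<^sub>m ?G) \<noteq> 0" using H(2) c by simp
  have Hc: "c \<cdot>\<^sub>m ?G \<in> carrier_mat ?n ?n" using gram_carrier[of bs] by simp
  obtain B C where BC: "B \<in> carrier_mat ?n ?n" "C \<in> carrier_mat ?n ?n" "B * C = 1\<^sub>m ?n" "C * B = 1\<^sub>m ?n" "intmat C"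
    and loc: "\<And>p. prime p \<Longrightarrow> \<exists>U W. U \<in> Zgl p ?n \<and> W \<in> carrier_mat ?n ?n \<and> mid p 1 W \<and>
       2 \<cdot>\<^sub>m (B\<^sup>T * (c \<cdot>\<^sub>m ?G) * B) = (U\<^sup>T * (c \<cdot>\<^sub>m ?G) * U) * (1\<^sub>m ?n + 4 \<cdot>\<^sub>m W)"
    using overlattice_matrix[OF Hc H(1) dH n D] by blast
  define M where "M = (*\<^sub>R) (sqrt 2) ` zspan (change_basis bs B)"
  define cs where "cs = map ((*\<^sub>R) (sqrt 2)) (change_basis bs B)"
  note cb = change_basis_lattice[OF L(2) BC(1-4)]
  have cs: "lattice_basis cs M" "span M = span L" "length cs = ?n"
    using scale_lattice_basis[OF cb(1), of "sqrt 2"] cb(2) span_zspan[of "change_basis bs B"] lattice_basis_span[OF L(2)]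
    by (auto simp: M_def cs_def)
  define X where "X = 2 \<cdot>\<^sub>m (B\<^sup>T * ?G * B)"
  have X: "X \<in> carrier_mat ?n ?n" "X\<^sup>T = X"
    using BC(1) gram_carrier[of bs] symmetric_congruent[OF gram_carrier BC(1) gram_symmetric]
    by (auto simp: X_def transpose_smult)
  have inn: "inner (cs ! i) (cs ! j) = of_rat (X $$ (i, j))" if ij: "i < ?n" "j < ?n" for i j
  proof -
    have "inner (cs ! i) (cs ! j) = 2 * inner (change_basis bs B ! i) (change_basis bs B ! j)"
      using ij by (simp add: cs_def)
    also have "\<dots> = of_rat (2 * (B\<^sup>T * ?G * B) $$ (i, j))"
      unfolding inner_change_basis[OF L BC(1) ij] by (simp add: of_rat_mult del: index_mult_mat(1))
    also have "2 * (B\<^sup>T * ?G * B) $$ (i, j) = X $$ (i, j)"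
      using ij BC(1) by (simp add: X_def del: index_mult_mat(1))
    finally show ?thesis .
  qed
  have gX: "gram cs = X" using X(1) inn cs(3) by (intro gram_eqI) auto
  have "rational_lattice M" using inn cs(3) by (intro rational_latticeI[OF cs(1)]) auto
  moreover have "same_genus L M"
  proof -
    have "Zp_equivalent p ?n ?G X" if p: "prime p" for p
    proof -
      obtain U W where UW: "U \<in> Zgl p ?n" "W \<in> carrier_mat ?n ?n" "mid p 1 W"
        "2 \<cdot>\<^sub>m (B\<^sup>T * (c \<cdot>\<^sub>m ?G) * B) = (U\<^sup>T * (c \<cdot>\<^sub>m ?G) * U) * (1\<^sub>m ?n + 4 \<cdot>\<^sub>m W)"
        using loc[OF p] by blast
      note d = carrier_matD[OF gram_carrier[of bs]] carrier_matD[OF BC(1)] carrier_matD[OF Zgl_carrier[OF UW(1)]] carrier_matD[OF UW(2)]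
      have one: "1 \<cdot>\<^sub>m A = A" for A :: "rat mat" by (rule eq_matI) auto
      have "c \<cdot>\<^sub>m X = c \<cdot>\<^sub>m ((U\<^sup>T * ?G * U) * (1\<^sub>m ?n + 4 \<cdot>\<^sub>m W))"
        using UW(4) d by (simp add: X_def mat_smult_left mat_smult_right mat_smult_smult mult.commute)
      then have "(1 / c) \<cdot>\<^sub>m (c \<cdot>\<^sub>m X) = (1 / c) \<cdot>\<^sub>m (c \<cdot>\<^sub>m ((U\<^sup>T * ?G * U) * (1\<^sub>m ?n + 4 \<cdot>\<^sub>m W)))" by simp
      then have "X = (U\<^sup>T * ?G * U) * (1\<^sub>m ?n + 4 \<cdot>\<^sub>m W)" using c one by (simp add: mat_smult_smult)
      then show ?thesis using Zp_equivalent_approx[OF p gram_carrier gram_symmetric X(2) UW(1-3)] by blast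
    qed
    \<comment> \<open>Scaling and a change of basis leave the real span unchanged, so the identity
      settles the infinite place.\<close>
    moreover have "\<exists>f. linear f \<and> (\<forall>u\<in>span L. \<forall>v\<in>span L. inner (f u) (f v) = inner u v) \<and> f ` span L = span M"
      using cs(2) linear_id by (intro exI[of _ id]) auto
    ultimately show ?thesis using L(2) cs(1,3) gX unfolding same_genus_def by metis
  qed
  moreover have "sqrt 2 *\<^sub>R u \<in> M" if "u \<in> L" for u using cb(3)[OF BC(5)] that by (auto simp: M_def)
  ultimately show thesis using that by blast
qed

text \<open>The map is multiplication by the square root of 2 followed by the inverse of the
  isometry f. On the span f is injective because it preserves norms; a linear left inverse g,
  defined on the whole ambient space, keeps the composition linear everywhere.\<close>

lemma norm_doubling_map_if_isometric:
  fixes L M :: "'a::euclidean_space set"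
  assumes "isometric_lattices L M" and LM: "\<And>u. u \<in> L \<Longrightarrow> sqrt 2 *\<^sub>R u \<in> M"
  shows "\<exists>\<sigma>. norm_doubling_map \<sigma> L"
proof -
  obtain f where f: "linear f" "\<And>u v. u \<in> span L \<Longrightarrow> v \<in> span L \<Longrightarrow> inner (f u) (f v) = inner u v" "f ` L = M"
    using assms(1) unfolding isometric_lattices_def by blast
  have "inj_on f (span L)"
  proof (rule inj_onI)
    fix x y assume xy: "x \<in> span L" "y \<in> span L" "f x = f y"
    have "x - y \<in> span L" using xy by (intro span_diff)
    moreover have "f (x - y) = 0" using linear_diff[OF f(1)] xy(3) by simp
    ultimately have "inner (x - y) (x - y) = 0" using f(2)[of "x - y" "x - y"] by simp
    then show "x = y" by simp
  qed
  then obtain g where g: "linear g" "\<And>x. x \<in> span L \<Longrightarrow> g (f x) = x"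
    using linear_inj_on_left_inverse[OF f(1)] by blast
  define \<sigma> where "\<sigma> = g \<circ> (\<lambda>u. sqrt 2 *\<^sub>R u)"
  have "linear \<sigma>" unfolding \<sigma>_def by (intro linear_compose g(1) linear_scale_self)
  \<comment> \<open>g inverts f only on the image of the span of L, so the scaled vectors must be
    shown to lie in that image.\<close>
  have pre: "\<exists>x. x \<in> span L \<and> sqrt 2 *\<^sub>R u = f x \<and> \<sigma> u = x" if "u \<in> span L" for u
  proof -
    have "(1 / sqrt 2) *\<^sub>R (sqrt 2 *\<^sub>R x) \<in> f ` span L" if "x \<in> L" for x
      unfolding linear_span_image[OF f(1), symmetric] f(3) using LM[OF that] by (intro span_scale span_base)
    then have "L \<subseteq> f ` span L" by auto
    then have "span L \<subseteq> f ` span L" by (intro span_minimal linear_subspace_image f(1) subspace_span)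
    moreover have "sqrt 2 *\<^sub>R u \<in> span L" using that by (rule span_scale)
    ultimately obtain x where "x \<in> span L" "sqrt 2 *\<^sub>R u = f x" by blast
    then show ?thesis using g(2) by (auto simp: \<sigma>_def)
  qed
  have "inner (\<sigma> u) (\<sigma> v) = 2 * inner u v" if uv: "u \<in> span L" "v \<in> span L" for u v
  proof -
    obtain x where x: "x \<in> span L" "sqrt 2 *\<^sub>R u = f x" "\<sigma> u = x" using pre[OF uv(1)] by blast
    obtain y where y: "y \<in> span L" "sqrt 2 *\<^sub>R v = f y" "\<sigma> v = y" using pre[OF uv(2)] by blast
    have "inner x y = inner (sqrt 2 *\<^sub>R u) (sqrt 2 *\<^sub>R v)" unfolding x(2) y(2) using f(2)[OF x(1) y(1)] by simp
    then show ?thesis by (simp add: x(3) y(3))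
  qed
  moreover have "\<sigma> u \<in> L" if u: "u \<in> L" for u
  proof -
    obtain x where "x \<in> L" "sqrt 2 *\<^sub>R u = f x" using LM[OF u] f(3) by blast
    then show ?thesis using g(2)[OF span_base] by (simp add: \<sigma>_def)
  qed
  ultimately show ?thesis using \<open>linear \<sigma>\<close> unfolding norm_doubling_map_def by blast
qed

theorem theorem4:
  fixes L :: "'a::euclidean_space set"
  assumes "rational_lattice L"
  shows "((\<exists>\<sigma>. norm_doubling_map \<sigma> L) \<longrightarrow>
            even (dim L) \<and>
            (\<forall>p::nat. prime p \<and> ([int p = 3] (mod 8) \<or> [int p = -3] (mod 8)) \<longrightarrow>
               even (rat_val p (lattice_det L)))) \<and>
         (unigeneric L \<and> (\<exists>r::rat. r > 0 \<and> r_maximal r L) \<longrightarrow>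
            even (dim L) \<and>
            (\<forall>p::nat. prime p \<and> ([int p = 3] (mod 8) \<or> [int p = -3] (mod 8)) \<longrightarrow>
               even (rat_val p (lattice_det L))) \<longrightarrow>
            (\<exists>\<sigma>. norm_doubling_map \<sigma> L))"
proof -
  \<comment> \<open>The same choice of basis as in \<open>lattice_det\<close>, so no independence of
    the basis has to be proved.\<close>
  define bs where "bs = (SOME bs. lattice_basis bs L)"
  have "\<exists>bs. lattice_basis bs L" using assms by (simp add: rational_lattice_def euclidean_lattice_def)
  then have bs: "lattice_basis bs L" unfolding bs_def by (rule someI_ex)
  have dim: "dim L = length bs" by (rule lattice_basis_dim[OF bs])
  have det: "lattice_det L = det (gram bs)" by (simp add: lattice_det_def bs_def)
  note L = assms bs
  show ?thesis
    unfolding dim det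
  proof (intro conjI impI)
    assume "\<exists>\<sigma>. norm_doubling_map \<sigma> L"
    then obtain S where "doubling (length bs) (gram bs) S" using norm_doubling_map_doubling[OF L] by blast
    note D = doubling_determinant[OF this]
    show "even (length bs)" using D by blast
    show "\<forall>p::nat. prime p \<and> ([int p = 3] (mod 8) \<or> [int p = -3] (mod 8)) \<longrightarrow> even (rat_val p (det (gram bs)))"
      using D two_nonresidue_mod_8(1) by blast
  next
    assume U: "unigeneric L \<and> (\<exists>r::rat. r > 0 \<and> r_maximal r L)"
      and E: "even (length bs) \<and>
        (\<forall>p::nat. prime p \<and> ([int p = 3] (mod 8) \<or> [int p = -3] (mod 8)) \<longrightarrow> even (rat_val p (det (gram bs))))"
    then obtain r :: rat where r: "r \<noteq> 0" "r_maximal r L" by (metis less_irrefl)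
    have dG: "det (gram bs) \<noteq> 0" by (rule anisotropic_det[OF gram_carrier gram_anisotropic[OF L]])
    have nr: "norms_in r L" using r(2) by (simp add: r_maximal_def)
    have c: "2 / r \<noteq> 0" using r(1) by simp
    have m: "mid p 0 ((2 / r) \<cdot>\<^sub>m gram bs)" if "prime p" for p
      using even_form_gram[OF that L r(1) nr] by (simp add: even_form_def)
    have D: "approx_doubling p N (length bs) ((2 / r) \<cdot>\<^sub>m gram bs)" if "prime p" for p N
      using approx_doubling_gram[OF L r _ dG _ that] E by blast
    obtain M where M: "rational_lattice M" "same_genus L M" "\<And>u. u \<in> L \<Longrightarrow> sqrt 2 *\<^sub>R u \<in> M"
      using doubled_lattice_in_genus[OF L _ c m dG D] E by blast
    have "isometric_lattices L M" using U M(1,2) unfolding unigeneric_def by blast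
    then show "\<exists>\<sigma>. norm_doubling_map \<sigma> L" using norm_doubling_map_if_isometric M(3) by blast
  qed
qed

end
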